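(* Let $\alpha\in(1,2]$, $\beta\in(0,1)$, and let $(Z_n)_{n\ge1}$ be the random walk in random scenery described in the context, where the characteristic function of $\xi_0$ is equal to $\phi(u)=e^{-|u|^\beta(A_1+iA_2\,\mathrm{sgn}(u))}$, $u\in\mathbb R$. Let $\mathcal H_1$ denote the set of all complex-valued Lebesgue-integrable functions $h$ on $\mathbb R$ whose Fourier transform $\hat h$ is continuously differentiable on $\mathbb R$ with $\hat h$ and $(\hat h)'$ Lebesgue-integrable. Then, for all $h\in\mathcal H_1$, $$\lim_{a\to+\infty}a^{1-\frac1\delta}\sum_{n\ge1}\mathbb E[h(Z_n-a)]=C_0\,I[h],$$ with $$C_0:=\frac{\Gamma(\frac1{\delta\beta})\,\Gamma(2-\frac1\delta)\,\mathbb E\big[|L|_\beta^{-1/\delta}\big]}{\pi\beta(\delta-1)(A_1^2+A_2^2)^{1/(2\delta\beta)}}\,\sin\left(\frac1\delta\left(\frac\pi2-\frac1\beta\arctan\Big(\frac{A_2}{A_1}\Big)\right)\right).$$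
   Context: $(X_k)_{k\ge1}$ is a sequence of i.i.d. $\mathbb Z$-valued random variables and $(\xi_y)_{y\in\mathbb Z}$ is a sequence of i.i.d. real random variables; the two sequences are independent. $S_0:=0$, $S_n:=\sum_{k=1}^nX_k$, and $Z_n:=\sum_{k=1}^n\xi_{S_k}$, $n\ge1$. The constants satisfy $0<A_1<\infty$ and $|A_1^{-1}A_2|\le|\tan(\pi\beta/2)|$. The distribution of $X_1$ belongs to the normal domain of attraction of a strictly stable law $\mathcal S'_\alpha$ of index $\alpha$, i.e. $n^{-1/\alpha}S_n$ converges in distribution to $\mathcal S'_\alpha$. $U$ is the Lévy process with $U(0)=0$, $U(1)\sim\mathcal S'_\alpha$; $(L_t(x))_{t\ge0,x\in\mathbb R}$ is a continuous version, with compact support, of its local time, and $|L|_\beta:=\left(\int_{\mathbb R}L_1(x)^\beta\,dx\right)^{1/\beta}$. $\delta:=1-\frac1\alpha+\frac1{\alpha\beta}$ (so $\delta>1$ here). $I[h]:=\int_{\mathbb R}h(x)\,dx$ and $\hat h(x):=\int_{\mathbb R}h(y)e^{ixy}\,dy$.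
   Formalization: It is additionally assumed that the support of X_1 generates the group Z; without this the formula fails, since replacing X_k by 2X_k leaves the law of Z_n unchanged but multiplies |L|_β by 2^{1/β-1} and so changes C_0. *)

theory Defs
  imports "HOL-Probability.Probability"
begin

section \<open>Random walks in random scenery\<close>

definition random_walk :: "(nat \<Rightarrow> 'a \<Rightarrow> int) \<Rightarrow> nat \<Rightarrow> 'a \<Rightarrow> int" where
  "random_walk X n \<omega> = (\<Sum>k=1..n. X k \<omega>)"

definition rwrs :: "(nat \<Rightarrow> 'a \<Rightarrow> int) \<Rightarrow> (int \<Rightarrow> 'a \<Rightarrow> real) \<Rightarrow> nat \<Rightarrow> 'a \<Rightarrow> real" where
  "rwrs X \<xi> n \<omega> = (\<Sum>k=1..n. \<xi> (random_walk X k \<omega>) \<omega>)"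

definition iid_on :: "'a measure \<Rightarrow> 'b measure \<Rightarrow> ('i \<Rightarrow> 'a \<Rightarrow> 'b) \<Rightarrow> 'i set \<Rightarrow> bool" where
  "iid_on M B Y I \<longleftrightarrow>
     prob_space.indep_vars M (\<lambda>_. B) Y I \<and>
     (\<forall>i\<in>I. \<forall>j\<in>I. distr M B (Y i) = distr M B (Y j))"

text \<open>Independence of the two sequences means independence of the \<open>\<sigma>\<close>-algebras they generate.
  (The constant \<^const>\<open>prob_space.indep_var\<close> only covers two variables of the same type.)\<close>

definition walk_indep_of_scenery ::
  "'a measure \<Rightarrow> (nat \<Rightarrow> 'a \<Rightarrow> int) \<Rightarrow> (int \<Rightarrow> 'a \<Rightarrow> real) \<Rightarrow> bool" where
  "walk_indep_of_scenery M X \<xi> \<longleftrightarrow>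
     prob_space.indep_set M
       (sigma_sets (space M) {X k -` A \<inter> space M | k A. 1 \<le> k})
       (sigma_sets (space M) {\<xi> y -` A \<inter> space M | y A. A \<in> sets borel})"

text \<open>The support of the integer-valued variable \<open>Y\<close> generates the group of all integers.\<close>

definition support_generates_int :: "'a measure \<Rightarrow> ('a \<Rightarrow> int) \<Rightarrow> bool" where
  "support_generates_int M Y \<longleftrightarrow> Gcd {x. measure M {\<omega> \<in> space M. Y \<omega> = x} > 0} = 1"

section \<open>Stable laws\<close>

text \<open>A non-degenerate law is strictly stable of index \<open>\<alpha>\<close> if, for independent \<open>V\<close>, \<open>V'\<close> with this
  law and \<open>a, b > 0\<close>, the variable \<open>a V + b V'\<close> is distributed as
  \<open>(a\<^sup>\<alpha> + b\<^sup>\<alpha>)\<^bsup>1/\<alpha>\<^esup> V\<close>.\<close>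

definition strictly_stable :: "real \<Rightarrow> real measure \<Rightarrow> bool" where
  "strictly_stable \<alpha> \<mu> \<longleftrightarrow>
     real_distribution \<mu> \<and>
     (\<forall>c. \<mu> \<noteq> return borel c) \<and>
     (\<forall>a>0. \<forall>b>0.
        (distr \<mu> borel (\<lambda>x. a * x) \<star> distr \<mu> borel (\<lambda>x. b * x)) =
        distr \<mu> borel (\<lambda>x. (a powr \<alpha> + b powr \<alpha>) powr (1 / \<alpha>) * x))"

definition scenery_char :: "real \<Rightarrow> real \<Rightarrow> real \<Rightarrow> real \<Rightarrow> complex" where
  "scenery_char \<beta> A1 A2 u =
     exp (- (complex_of_real (\<bar>u\<bar> powr \<beta>) * (complex_of_real A1 + \<i> * complex_of_real (A2 * sgn u))))"

section \<open>Levy processes and local times\<close>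

definition cadlag :: "(real \<Rightarrow> real) \<Rightarrow> bool" where
  "cadlag f \<longleftrightarrow>
     (\<forall>t\<ge>0. (f \<longlongrightarrow> f t) (at_right t)) \<and> (\<forall>t>0. \<exists>l. (f \<longlongrightarrow> l) (at_left t))"

text \<open>Only the values at times \<open>t \<ge> 0\<close> matter.\<close>

definition levy_process :: "'b measure \<Rightarrow> (real \<Rightarrow> 'b \<Rightarrow> real) \<Rightarrow> bool" where
  "levy_process N U \<longleftrightarrow>
     prob_space N \<and>
     (\<forall>t\<ge>0. U t \<in> borel_measurable N) \<and>
     (AE \<omega> in N. U 0 \<omega> = 0) \<and>
     (\<forall>(t::nat \<Rightarrow> real) n. 0 \<le> t 0 \<and> mono t \<longrightarrow>
        prob_space.indep_vars N (\<lambda>_. borel) (\<lambda>i \<omega>. U (t (Suc i)) \<omega> - U (t i) \<omega>) {..<n}) \<and>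
     (\<forall>s\<ge>0. \<forall>t\<ge>0. distr N borel (\<lambda>\<omega>. U (s + t) \<omega> - U s \<omega>) = distr N borel (U t)) \<and>
     (AE \<omega> in N. cadlag (\<lambda>t. U t \<omega>))"

text \<open>\<open>L t x \<omega>\<close> is the density at \<open>x\<close> of the occupation measure of the path up to time \<open>t\<close>; it is
  jointly continuous in \<open>(t, x)\<close>, and compactly supported in \<open>x\<close> for each \<open>t\<close>.\<close>

definition continuous_local_time ::
  "'b measure \<Rightarrow> (real \<Rightarrow> 'b \<Rightarrow> real) \<Rightarrow> (real \<Rightarrow> real \<Rightarrow> 'b \<Rightarrow> real) \<Rightarrow> bool" where
  "continuous_local_time N U L \<longleftrightarrow>
     (\<forall>t\<ge>0. \<forall>x. L t x \<in> borel_measurable N) \<and>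
     (AE \<omega> in N.
        (\<forall>t\<ge>0. \<forall>x. 0 \<le> L t x \<omega>) \<and>
        (\<forall>t\<ge>0. \<forall>A\<in>sets borel.
           emeasure lborel {s \<in> {0..t}. U s \<omega> \<in> A} = (\<integral>\<^sup>+x\<in>A. ennreal (L t x \<omega>) \<partial>lborel)) \<and>
        continuous_on ({0..} \<times> UNIV) (\<lambda>(t, x). L t x \<omega>) \<and>
        (\<forall>t\<ge>0. compact (closure {x. L t x \<omega> \<noteq> 0})))"

definition local_time_norm :: "real \<Rightarrow> (real \<Rightarrow> real \<Rightarrow> 'b \<Rightarrow> real) \<Rightarrow> 'b \<Rightarrow> real" where
  "local_time_norm \<beta> L \<omega> = (\<integral>x. L 1 x \<omega> powr \<beta> \<partial>lborel) powr (1 / \<beta>)"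

section \<open>The class of test functions\<close>

definition fourier_transform :: "(real \<Rightarrow> complex) \<Rightarrow> real \<Rightarrow> complex" where
  "fourier_transform h x = (\<integral>y. h y * iexp (x * y) \<partial>lebesgue)"

definition H1 :: "(real \<Rightarrow> complex) set" where
  "H1 = {h. integrable lebesgue h \<and>
            fourier_transform h C1_differentiable_on UNIV \<and>
            integrable lebesgue (fourier_transform h) \<and>
            integrable lebesgue (\<lambda>x. vector_derivative (fourier_transform h) (at x))}"

section \<open>Expectations and the constants\<close>

text \<open>Members of \<^const>\<open>H1\<close> are merely Lebesgue measurable, so \<open>h (Z\<^sub>n - a)\<close> need only be measurable
  for the completed probability measure. The same holds for \<^const>\<open>local_time_norm\<close>, because the
  local time is continuous only almost surely. Hence expectations are taken in the completion; for
  variables that are measurable before completion this changes nothing.\<close>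

abbreviation (input) expect ::
  "'a measure \<Rightarrow> ('a \<Rightarrow> 'c::{banach, second_countable_topology}) \<Rightarrow> 'c" where
  "expect M f \<equiv> integral\<^sup>L (completion M) f"

definition rwrs_delta :: "real \<Rightarrow> real \<Rightarrow> real" where
  "rwrs_delta \<alpha> \<beta> = 1 - 1 / \<alpha> + 1 / (\<alpha> * \<beta>)"

definition rwrs_C0 ::
  "real \<Rightarrow> real \<Rightarrow> real \<Rightarrow> real \<Rightarrow> 'b measure \<Rightarrow> (real \<Rightarrow> real \<Rightarrow> 'b \<Rightarrow> real) \<Rightarrow> real" where
  "rwrs_C0 \<alpha> \<beta> A1 A2 N L =
     (let \<delta> = rwrs_delta \<alpha> \<beta> in
        Gamma (1 / (\<delta> * \<beta>)) * Gamma (2 - 1 / \<delta>) *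
          expect N (\<lambda>\<omega>. local_time_norm \<beta> L \<omega> powr (- 1 / \<delta>)) /
        (pi * \<beta> * (\<delta> - 1) * (A1\<^sup>2 + A2\<^sup>2) powr (1 / (2 * \<delta> * \<beta>))) *
        sin (1 / \<delta> * (pi / 2 - 1 / \<beta> * arctan (A2 / A1))))"

end

theory Submission
 imports Defs
begin

text \<open>Let \<open>V\<^sub>n\<close> be the sum over all sites of the \<open>\<beta>\<close>-th powers of the occupation numbers of the walk.
 Given the walk, \<open>Z\<^sub>n\<close> has characteristic function \<open>exp (- |t|\<^sup>\<beta> (A1 + i A2 sgn t) V\<^sub>n)\<close>, so Fourier inversion
 turns the potential into oscillatory integrals over half-lines, and an integration by parts leaves the sums of
 \<open>E f (t\<^sup>\<beta> V\<^sub>n)\<close> with \<open>f v = c v exp (- c v)\<close>. As \<open>n powr (- \<beta> \<delta>) V\<^sub>n\<close> converges in law to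
 \<open>W = \<integral> L\<^sub>1(x)\<^sup>\<beta> dx\<close> and its moment of order \<open>- 2 / (1 - \<beta>)\<close> is bounded, these sums are Riemann sums, and
 behave like \<open>t powr (- 1 / \<delta>)\<close> at \<open>0\<close>. For the convergence in law the rescaled occupation field is averaged
 over windows of fixed width \<open>e\<close>, at a cost in mean square bounded by the potential kernel of the walk; the
 averaged field depends continuously on finitely many increments, up to a small error.\<close>

text \<open>The delicate point is t = 0. There the sum over n of the characteristic functions blows
  up like |t| powr (- 1 / \<delta>), which is integrable as \<delta> > 1, but the sum of their
  derivatives blows up like |t| powr (- 1 - 1 / \<delta>), which is not. So the integration by parts
  uses the primitive of exp (i a t) that vanishes at 0: the factor exp (i a t) - 1 restores
  integrability, and rescaling by a leaves the integral of s powr (- 1 - 1 / \<delta>) times exp (i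
  s) - 1, a Gamma value with a phase. The two half-lines contribute conjugate constants; twice the
  real part gives the sine of the theorem.

  The walk may be periodic, so the characteristic function \<phi> of its step can have modulus 1
  away from 0. Estimates therefore go through geometric sums and 1 - \<phi> instead of powers of
  |\<phi>|.

  The order - 2 / (1 - \<beta>) comes from comparing the power mean of exponent \<beta> - 1 of the
  occupation numbers with their mean square, so that a second moment controls it; \<alpha> <= 2
  makes the resulting decay in n summable.\<close>

notation (input) LIMSEQ (infix "---->" 60)
notation (input) tendsto (infixr "--->" 55)

text \<open>Unqualified, some of these names denote facts about the Henstock-Kurzweil integral.\<close>

lemmas integrable_add = Bochner_Integration.integrable_add
lemmas integrable_bound = Bochner_Integration.integrable_bound
lemmas integrable_cong = Bochner_Integration.integrable_cong
lemmas integrable_diff = Bochner_Integration.integrable_diff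
lemmas integrable_sum = Bochner_Integration.integrable_sum
lemmas integral_add = Bochner_Integration.integral_add
lemmas integral_cnj = Bochner_Integration.integral_cnj
lemmas integral_cong = Bochner_Integration.integral_cong
lemmas integral_diff = Bochner_Integration.integral_diff
lemmas integral_nonneg = Bochner_Integration.integral_nonneg
lemmas integral_norm_bound_integral = Bochner_Integration.integral_norm_bound_integral
lemmas integral_sum = Bochner_Integration.integral_sum

section \<open>Gamma integrals with complex rate\<close>

lemma integral_FTC_Ioi:
 fixes f F :: "real => complex"
 assumes F: "!!x. 0 < x ==> (F has_vector_derivative f x) (at x)"
  and f: "!!x. 0 < x ==> isCont f x"
  and int: "set_integrable lborel {0<..} f"
  and A: "(F ---> A) (at_right 0)" and B: "(F ---> B) at_top"
 shows "(LBINT x:{0<..}. f x) = B - A"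
proof -
 have "(LBINT x=ereal 0..\<infinity>. f x) = B - A"
  by (rule interval_integral_FTC_integrable[where F=F])
   (use assms in \<open>auto simp: ereal_tendsto_simps einterval_eq simp del: zero_ereal_def[symmetric] ereal_eq_0\<close>)
 then show ?thesis
  by (simp add: interval_lebesgue_integral_def einterval_eq)
qed

lemma set_integrable_powr_exp:
 fixes z a :: real
 assumes "0 < z" "0 < a"
 shows "set_integrable lborel {0<..} (%v. v powr (z - 1) * exp (- (a * v)))"
proof -
 have "(%t. norm (complex_of_real t powr (complex_of_real z - 1) / of_real (exp (a * t))))
   absolutely_integrable_on {0<..}"
  using absolutely_integrable_Gamma_integral[of "complex_of_real z" a] assms
  by (intro absolutely_integrable_norm[unfolded o_def]) auto
 then have "(%v. v powr (z - 1) * exp (- (a * v))) absolutely_integrable_on {0<..}"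
  unfolding set_integrable_def
  by (rule integrable_cong[THEN iffD1, rotated 2])
   (auto simp: indicator_def norm_divide norm_powr_real_powr exp_minus field_simps)
 then show ?thesis
  unfolding set_integrable_def
  by (subst integrable_completion[symmetric]) auto
qed

text \<open>The Gamma integral of order \<open>z\<close> with complex rate \<open>c\<close>. Viewed
  as a function of \<open>c\<close>, it satisfies a differential equation along vertical lines,
  which does the work of a contour rotation.\<close>

definition cGam :: "real => complex => complex" where
 "cGam z c = (LBINT v:{0<..}. complex_of_real (v powr (z - 1)) * exp (- (c * of_real v)))"

lemma set_integrable_cGam:
 assumes "0 < z" "0 < Re c"
 shows "set_integrable lborel {0<..} (%v. complex_of_real (v powr (z - 1)) * exp (- (c * of_real v)))"
 using set_integrable_powr_exp[OF assms]
 unfolding set_integrable_def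
 by (rule integrable_bound)
  (auto simp: norm_mult indicator_def norm_powr_real_powr)

lemma powr_exp_tendsto_0:
 assumes "0 < (a::real)"
 shows "((%v. v powr z * exp (- (a * v))) ---> 0) at_top"
proof -
 have "((%x. z * (ln x / x)) ---> z * 0) at_top"
  by (intro tendsto_intros ln_x_over_x_tendsto_0)
 then have "\<forall>\<^sub>F x in at_top. z * (ln x / x) < a / 2"
  using assms by (intro order_tendstoD(2)) auto
 then have ev: "\<forall>\<^sub>F x in at_top. x powr z * exp (- (a * x)) <= exp (- (a/2) * x)"
  using eventually_gt_at_top[of 0]
 proof eventually_elim
  case (elim x)
  then have "z * ln x <= a / 2 * x" by (simp add: field_simps)
  then have "x powr z <= exp (a / 2 * x)" using elim by (simp add: powr_def)
  then have "x powr z * exp (- (a * x)) <= exp (a / 2 * x) * exp (- (a * x))"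
   by (intro mult_right_mono) auto
  then show ?case by (simp add: exp_add[symmetric] algebra_simps)
 qed
 have "((%x. exp (- (a/2) * x)) ---> 0) at_top"
  using assms by (intro exp_at_bot[THEN filterlim_compose] filterlim_tendsto_neg_mult_at_bot[OF tendsto_const _ filterlim_ident]) auto
 then show ?thesis
  by (rule Lim_null_comparison[rotated]) (use ev in \<open>auto elim: eventually_mono\<close>)
qed

text \<open>Integrate the derivative of \<open>v powr z * exp (- (c * v))\<close> over the
  half-line: both boundary values vanish. The relation closes the differential equation in
  \<open>cGam_eq\<close>.\<close>

lemma cGam_plus1:
 assumes "0 < z" "0 < Re c"
 shows "c * cGam (z + 1) c = of_real z * cGam z c"
proof -
 let ?F = "%v. complex_of_real (v powr z) * exp (- (c * of_real v))"
 let ?f = "%v. of_real z * (complex_of_real (v powr (z - 1)) * exp (- (c * of_real v)))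
   - c * (complex_of_real (v powr z) * exp (- (c * of_real v)))"
 have i1: "set_integrable lborel {0<..} (%v. complex_of_real (v powr (z - 1)) * exp (- (c * of_real v)))"
  using set_integrable_cGam assms by simp
 have i2: "set_integrable lborel {0<..} (%v. complex_of_real (v powr z) * exp (- (c * of_real v)))"
  using set_integrable_cGam[of "z + 1" c] assms by simp
 have "(LBINT v:{0<..}. ?f v) = 0 - 0"
 proof (rule integral_FTC_Ioi[where F="?F"])
  fix x :: real assume x: "0 < x"
  have "((%v. complex_of_real (v powr z)) has_vector_derivative of_real (z * x powr (z - 1))) (at x)"
   using x by (intro has_vector_derivative_of_real)
    (auto intro!: derivative_eq_intros simp: has_real_derivative_iff_has_vector_derivative[symmetric])
  moreover have "((%v. exp (- (c * of_real v))) has_vector_derivative (- c * exp (- (c * of_real x)))) (at x)"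
   by (rule has_vector_derivative_real_field) (auto intro!: derivative_eq_intros)
  ultimately have "(?F has_vector_derivative complex_of_real (x powr z) * (- c * exp (- (c * of_real x)))
    + of_real (z * x powr (z - 1)) * exp (- (c * of_real x))) (at x)"
   by (rule has_vector_derivative_mult)
  then show "(?F has_vector_derivative ?f x) (at x)"
   by (simp add: algebra_simps)
  show "isCont ?f x" using x by (intro continuous_intros) auto
 next
  show "set_integrable lborel {0<..} ?f" using i1 i2 by (intro set_integral_diff set_integrable_mult_right) auto
  have "((%v. v powr z) ---> 0 powr z) (at_right 0)"
   using assms by (intro tendsto_powr' tendsto_const tendsto_ident_at) (auto simp: eventually_at_filter)
  then have "(?F ---> of_real (0 powr z) * exp (- (c * of_real 0))) (at_right 0)"
   by (intro tendsto_mult tendsto_of_real tendsto_exp tendsto_minus tendsto_const tendsto_ident_at)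
  then show "(?F ---> 0) (at_right 0)" by simp
  show "(?F ---> 0) at_top"
   by (rule tendsto_norm_zero_cancel)
    (use powr_exp_tendsto_0[OF assms(2), of z] in \<open>simp add: norm_mult\<close>)
 qed
 then show ?thesis
  using i1 i2 by (simp add: set_integral_diff cGam_def set_integral_mult_right)
qed

lemma cGam_real:
 assumes "0 < z" "0 < a"
 shows "cGam z (of_real a) = of_real (Gamma z * a powr (- z))"
proof -
 have "((%t. t powr (z - 1) / exp t) has_integral Gamma z) {0<..}"
  by (subst has_integral_spike_set_eq[of _ "{0..}"])
   (auto intro: negligible_subset[of "{0}"] Gamma_integral_real[OF assms(1)])
 then have "(LBINT v:{0<..}. v powr (z - 1) * exp (- (1 * v))) = Gamma z"
  using set_borel_integral_eq_integral(2)[OF set_integrable_powr_exp[of z 1]] assms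
  by (simp add: exp_minus field_simps integral_unique)
 then have 1: "(LBINT v. indicator {0<..} v * (v powr (z - 1) * exp (- v))) = Gamma z"
  by (simp add: set_lebesgue_integral_def)
 have "(LBINT v. indicator {0<..} v * (v powr (z - 1) * exp (- v)))
  = \<bar>a\<bar> *\<^sub>R (LBINT v. indicator {0<..} (0 + a * v) * ((0 + a * v) powr (z - 1) * exp (- (0 + a * v))))"
  using assms by (intro lborel_integral_real_affine) auto
 also have "... = a * (LBINT v. indicator {0<..} v * (a powr (z - 1) * (v powr (z - 1)) * exp (- (a * v))))"
  using assms by (auto simp: indicator_def powr_mult zero_less_mult_iff intro!: integral_cong)
 also have "... = a powr z * (LBINT v. indicator {0<..} v * ((v powr (z - 1)) * exp (- (a * v))))"
  using assms by (subst integral_mult_right_zero[symmetric])+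
   (auto intro!: integral_cong simp: powr_diff)
 finally have "(LBINT v. indicator {0<..} v * ((v powr (z - 1)) * exp (- (a * v)))) = Gamma z * a powr (- z)"
  using 1 assms by (simp add: powr_minus field_simps)
 moreover have "cGam z (of_real a) = (LBINT v. complex_of_real (indicator {0<..} v * ((v powr (z - 1)) * exp (- (a * v)))))"
  unfolding cGam_def set_lebesgue_integral_def
  by (intro integral_cong) (auto simp: indicator_def exp_of_real[symmetric])
 ultimately show ?thesis by (simp only: integral_complex_of_real)
qed

text \<open>Only the factor \<open>iexp (- (h * v))\<close> changes with the imaginary part, and its
  second-order Taylor remainder is at most (h v)^2 / 2. The integral \<open>K\<close>, of order
  \<open>z + 2\<close>, then bounds the error by a multiple of h^2.\<close>

lemma cGam_has_derivative:
 assumes "0 < z" "0 < a"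
 shows "((%y. cGam z (Complex a y)) has_vector_derivative - \<i> * cGam (z + 1) (Complex a y)) (at y)"
proof -
 let ?d = "%h. cGam z (Complex a (y + h)) - cGam z (Complex a y) - h *\<^sub>R (- \<i> * cGam (z + 1) (Complex a y))"
 define K where "K = (LBINT v:{0<..}. v powr (z + 1) * exp (- (a * v)))"
 have bound: "norm (?d h) <= h^2 / 2 * K" for h
 proof -
  let ?A = "%v. complex_of_real (v powr (z - 1)) * exp (- (Complex a (y + h) * of_real v))"
  let ?B = "%v. complex_of_real (v powr (z - 1)) * exp (- (Complex a y * of_real v))"
  let ?C = "%v. complex_of_real (v powr z) * exp (- (Complex a y * of_real v))"
  have iA: "set_integrable lborel {0<..} ?A" and iB: "set_integrable lborel {0<..} ?B"
   and iC: "set_integrable lborel {0<..} ?C"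
   using assms set_integrable_cGam[of z] set_integrable_cGam[of "z + 1"] by auto
  have eq: "cGam z (Complex a (y + h)) - cGam z (Complex a y) - h *\<^sub>R (- \<i> * cGam (z + 1) (Complex a y))
   = (LBINT v:{0<..}. ?A v - ?B v - (- \<i> * of_real h) * ?C v)"
   using iA iB iC by (simp add: cGam_def set_integral_diff set_integral_mult_right scaleR_conv_of_real)
  have "norm (LBINT v:{0<..}. ?A v - ?B v - (- \<i> * of_real h) * ?C v) <= (LBINT v:{0<..}. h^2 / 2 * (v powr (z + 1) * exp (- (a * v))))"
   unfolding set_lebesgue_integral_def
  proof (rule integral_norm_bound_integral)
   show "integrable lborel (%v. indicat_real {0<..} v *\<^sub>R (?A v - ?B v - (- \<i> * of_real h) * ?C v))"
    using iA iB iC unfolding set_integrable_def[symmetric]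
    by (intro set_integral_diff set_integrable_mult_right) auto
   show "integrable lborel (%v. indicat_real {0<..} v *\<^sub>R (h^2 / 2 * (v powr (z + 1) * exp (- (a * v)))))"
    using set_integrable_powr_exp[of "z + 2" a] assms
    unfolding set_integrable_def[symmetric] by (intro set_integrable_mult_right) (auto simp: add.commute)
   fix v :: real
   show "norm (indicat_real {0<..} v *\<^sub>R (?A v - ?B v - (- \<i> * of_real h) * ?C v)) \<le>
    indicat_real {0<..} v *\<^sub>R (h^2 / 2 * (v powr (z + 1) * exp (- (a * v))))"
   proof (cases "0 < v")
    case True
    have e1: "exp (- (Complex a (y + h) * of_real v)) = exp (- (Complex a y * of_real v)) * iexp (- (h * v))"
     unfolding mult_exp_exp by (intro arg_cong[where f=exp]) (simp add: complex_eq_iff algebra_simps)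
    have vz: "v powr z = v powr (z - 1) * v" "v powr (z + 1) = v powr (z - 1) * v^2"
     using True by (auto simp: powr_diff powr_add power2_eq_square)
    have "?A v - ?B v - (- \<i> * of_real h) * ?C v = ?B v * (iexp (- (h * v)) - (1 + \<i> * (- (h * v))))"
     unfolding e1 vz by (simp add: algebra_simps)
    moreover have "norm (iexp (- (h * v)) - (1 + \<i> * (- (h * v)))) <= (h * v)^2 / 2"
     using iexp_approx1[of "- (h * v)" 1] by (simp add: eval_nat_numeral)
    moreover have "norm (?B v) = v powr (z - 1) * exp (- (a * v))"
     by (simp add: norm_mult)
    ultimately have "norm (?A v - ?B v - (- \<i> * of_real h) * ?C v) <= v powr (z - 1) * exp (- (a * v)) * ((h * v)^2 / 2)"
     by (simp only: norm_mult) (intro mult_left_mono, auto)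
    also have "... = h^2 / 2 * (v powr (z + 1) * exp (- (a * v)))"
     unfolding vz by (simp add: power_mult_distrib)
    finally show ?thesis using True by simp
   qed (auto)
  qed
  also have "... = h^2 / 2 * K" unfolding K_def by (rule set_integral_mult_right)
  finally show ?thesis unfolding eq .
 qed
 show ?thesis
  unfolding has_vector_derivative_def has_derivative_at
 proof (intro conjI bounded_linear_scaleR_left)
  show "(%h. norm (?d h) / norm h) \<midarrow>0\<rightarrow> 0"
  proof (rule Lim_null_comparison)
   show "((%h. \<bar>h\<bar> / 2 * K) ---> 0) (at 0)"
    by (intro tendsto_mult_left_zero tendsto_divide_zero tendsto_rabs_zero tendsto_ident_at)
   show "\<forall>\<^sub>F h in at 0. norm (norm (?d h) / norm h) <= \<bar>h\<bar> / 2 * K"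
    unfolding eventually_at_filter
   proof (intro always_eventually allI impI)
    fix h :: real assume "h ~= 0"
    have "h^2 / 2 * K = \<bar>h\<bar>^2 / 2 * K" by simp
    also have "... = (\<bar>h\<bar> / 2 * K) * \<bar>h\<bar>"
     by (simp only: power2_eq_square mult_ac times_divide_eq_left times_divide_eq_right)
    finally have e: "h^2 / 2 * K = (\<bar>h\<bar> / 2 * K) * \<bar>h\<bar>" .
    have "norm (?d h) / \<bar>h\<bar> <= \<bar>h\<bar> / 2 * K"
     using bound[of h, unfolded e] \<open>h ~= 0\<close> by (subst pos_divide_le_eq) (simp, assumption)
    then show "norm (norm (?d h) / norm h) <= \<bar>h\<bar> / 2 * K"
     by (simp only: real_norm_def abs_divide abs_norm_cancel abs_abs)
   qed
  qed
 qed
qed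

text \<open>Multiplied by c^z, the integral has derivative 0 along the line \<open>Re c = a\<close>:
  \<open>cGam_has_derivative\<close> raises the order by one and \<open>cGam_plus1\<close> lowers it
  again. The constant is read off where the line meets the real axis.\<close>

lemma cGam_eq:
 assumes z: "0 < z" and c: "0 < Re c"
 shows "cGam z c = of_real (Gamma z) * c powr (- of_real z)"
proof -
 define a where "a = Re c"
 have a: "0 < a" using c by (simp add: a_def)
 let ?g = "%y. cGam z (Complex a y) * (Complex a y) powr (of_real z)"
 have nz: "Complex a y \<notin> \<real>\<^sub>\<le>\<^sub>0" for y
  using a by (auto simp: complex_nonpos_Reals_iff)
 have der: "(?g has_vector_derivative 0) (at y)" for y
 proof -
  have "((%y. complex_of_real a + \<i> * of_real y) has_vector_derivative \<i>) (at y)"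
   by (auto intro!: derivative_eq_intros)
  then have "((%y. Complex a y) has_vector_derivative \<i>) (at y)"
   by (simp add: Complex_eq)
  moreover have "((%w. w powr (of_real z)) has_field_derivative (of_real z * (Complex a y) powr (of_real z - 1))) (at (Complex a y))"
   by (rule has_field_derivative_powr[OF nz])
  ultimately have 1: "((%y. (Complex a y) powr (of_real z)) has_vector_derivative
    \<i> * (of_real z * (Complex a y) powr (of_real z - 1))) (at y)"
   using field_vector_diff_chain_at[of "Complex a" \<i> y "%w. w powr (of_real z)"] by (simp add: o_def)
  have "Complex a y ~= 0" using a by (auto simp: complex_eq_iff)
  then have T: "(Complex a y) powr (of_real z) = Complex a y * (Complex a y) powr (of_real z - 1)"
   by (simp add: powr_diff)
  have G: "of_real z * cGam z (Complex a y) - cGam (z + 1) (Complex a y) * Complex a y = 0"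
   using cGam_plus1[of z "Complex a y"] z a by (simp add: mult.commute)
  have "cGam z (Complex a y) * (\<i> * (of_real z * (Complex a y) powr (of_real z - 1)))
   + (- \<i> * cGam (z + 1) (Complex a y)) * (Complex a y) powr (of_real z)
   = \<i> * (Complex a y) powr (of_real z - 1) * (of_real z * cGam z (Complex a y) - cGam (z + 1) (Complex a y) * Complex a y)"
   unfolding T by (simp add: algebra_simps)
  then have "cGam z (Complex a y) * (\<i> * (of_real z * (Complex a y) powr (of_real z - 1)))
   + (- \<i> * cGam (z + 1) (Complex a y)) * (Complex a y) powr (of_real z) = 0"
   unfolding G by simp
  then show ?thesis
   using has_vector_derivative_mult[OF cGam_has_derivative[OF z a, of y] 1] by (simp only:)
 qed
 obtain k where "!!y. ?g y = k"
  by (rule has_vector_derivative_zero_constant[of UNIV ?g]) (use der in auto)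
 then have "?g (Im c) = ?g 0" by simp
 moreover have "Complex a (Im c) = c" by (simp add: a_def complex_eq_iff)
 moreover have "Complex a 0 = of_real a" by (simp add: complex_eq_iff)
 ultimately have "cGam z c * c powr (of_real z) = of_real (Gamma z * a powr (- z)) * of_real a powr (of_real z)"
  using cGam_real[OF z a] by simp
 also have "... = of_real (Gamma z)"
  using a powr_of_real[of a z] by (simp add: powr_minus)
 finally have "cGam z c * c powr (of_real z) = of_real (Gamma z)" .
 moreover have "c powr (of_real z) ~= 0" using c by auto
 ultimately show ?thesis by (simp add: powr_minus field_simps)
qed

section \<open>Gamma integrals of negative order\<close>

lemma norm_exp_minus_1_le:
 fixes w :: complex
 assumes "0 <= Re w"
 shows "norm (exp (- w) - 1) <= norm w"
proof -
 have "norm (exp (- w) - exp (- 0)) <= 1 * norm (w - 0)"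
 proof (rule field_differentiable_bound[where S="{w. 0 <= Re w}" and f="%w. exp (- w)" and f'="%w. - exp (- w)"])
  show "convex {w. 0 <= Re w}" by (simp add: convex_halfspace_Re_ge)
  show "((%w. exp (- w)) has_field_derivative - exp (- z)) (at z within {w. 0 <= Re w})" for z :: complex
   by (auto intro!: derivative_eq_intros)
 qed (use assms in auto)
 then show ?thesis by simp
qed

text \<open>The two hypotheses handle the two ends: \<open>g > 1\<close> gives decay at infinity,
  and near 0 the exponent \<open>k - g\<close> exceeds -1. This is the standard source of dominating
  functions in what follows.\<close>

lemma set_integrable_powr_min:
 fixes g k :: real
 assumes "1 < g" "g < 1 + k"
 shows "set_integrable lborel {0<..} (%s. s powr (- g) * min 1 (s powr k))"
proof -
 have 1: "set_integrable lborel {0<..1} (%s. s powr (k - g))"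
 proof -
  have "(%s. s powr (k - g)) absolutely_integrable_on {0<..1}"
   using assms by (intro nonnegative_absolutely_integrable_1 integrable_on_powr_from_0') auto
  then show ?thesis
   unfolding set_integrable_def by (subst integrable_completion[symmetric]) auto
 qed
 have 2: "set_integrable lborel {1..} (%s. s powr (- g))"
 proof -
  have "(%s. s powr (- g)) absolutely_integrable_on {1..}"
   using assms has_integral_powr_to_inf[of "- g" 1]
   by (intro nonnegative_absolutely_integrable_1) (auto simp: integrable_on_def)
  then show ?thesis
   unfolding set_integrable_def by (subst integrable_completion[symmetric]) auto
 qed
 have "integrable lborel (%s. indicator {0<..1} s *\<^sub>R s powr (k - g) + indicator {1..} s *\<^sub>R s powr (- g))"
  using 1 2 unfolding set_integrable_def by (rule integrable_add)
 then show ?thesis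
  unfolding set_integrable_def
 proof (rule integrable_bound)
  show "AE s in lborel. norm (indicat_real {0<..} s *\<^sub>R (s powr - g * min 1 (s powr k)))
    <= norm (indicat_real {0<..1} s *\<^sub>R s powr (k - g) + indicat_real {1..} s *\<^sub>R s powr - g)"
  proof (rule AE_I2)
   fix s :: real
   have "s powr - g * min 1 (s powr k) <= s powr (k - g)" if "0 < s"
    using that mult_left_mono[of "min 1 (s powr k)" "s powr k" "s powr - g"]
    by (simp add: powr_diff powr_minus field_simps)
   moreover have "s powr - g * min 1 (s powr k) <= s powr - g"
    using mult_left_mono[of "min 1 (s powr k)" "1" "s powr - g"] by simp
   ultimately show "norm (indicat_real {0<..} s *\<^sub>R (s powr - g * min 1 (s powr k)))
    <= norm (indicat_real {0<..1} s *\<^sub>R s powr (k - g) + indicat_real {1..} s *\<^sub>R s powr - g)"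
    by (auto simp: indicator_def abs_mult min_def)
  qed
 qed auto
qed

lemma norm_exp_minus_1_le_min:
 fixes w :: complex
 assumes "0 <= Re w"
 shows "norm (exp (- w) - 1) <= min 2 (norm w)"
proof -
 have "norm (exp (- w) - 1) <= norm (exp (- w)) + norm (1::complex)" by (rule norm_triangle_ineq4)
 also have "... <= 2" using assms by simp
 finally show ?thesis using norm_exp_minus_1_le[OF assms] by simp
qed

lemma powr_int_tilde:
 fixes c :: complex
 assumes p: "0 < p" "p < 1" and c: "0 <= Re c" "norm c <= C"
 shows "s > 0 ==> norm (complex_of_real (s powr (- (1 + p))) * (exp (- (c * of_real s)) - 1))
   <= 2 * max 1 C * (s powr (- (1 + p)) * min 1 (s powr 1))"
proof -
 assume s: "s > 0"
 have "norm (exp (- (c * of_real s)) - 1) <= min 2 (norm (c * of_real s))"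
  using s c by (intro norm_exp_minus_1_le_min) auto
 also have "norm (c * of_real s) <= C * s"
  unfolding norm_mult using s c(2) by (simp add: mult_right_mono)
 then have "min 2 (norm (c * of_real s)) <= min 2 (C * s)" by (auto simp: min_def)
 also have "... <= 2 * max 1 C * min 1 s"
 proof -
  have "C * s <= max 1 C * s" using s by (intro mult_right_mono) auto
  moreover have "0 <= max 1 C * s" using s by auto
  ultimately have "C * s <= 2 * max 1 C * s" by linarith
  moreover have "2 <= 2 * max 1 C" by auto
  ultimately show ?thesis by (auto simp: min_def)
 qed
 finally have "s powr (- (1 + p)) * norm (exp (- (c * of_real s)) - 1) <= s powr (- (1 + p)) * (2 * max 1 C * min 1 s)"
  by (rule mult_left_mono) auto
 then show ?thesis using s by (simp add: norm_mult mult_ac)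
qed

lemma set_integrable_powr_exp_minus_1:
 fixes c :: complex
 assumes p: "0 < p" "p < 1" and c: "0 <= Re c"
 shows "set_integrable lborel {0<..} (%s. complex_of_real (s powr (- (1 + p))) * (exp (- (c * of_real s)) - 1))"
proof -
 have "set_integrable lborel {0<..} (%s. 2 * max 1 (norm c) * (s powr (- (1 + p)) * min 1 (s powr 1)))"
  using set_integrable_powr_min[of "1 + p" 1] p by (intro set_integrable_mult_right) auto
 then show ?thesis
  unfolding set_integrable_def
 proof (rule integrable_bound)
  show "AE s in lborel. norm (indicat_real {0<..} s *\<^sub>R (complex_of_real (s powr - (1 + p)) * (exp (- (c * complex_of_real s)) - 1)))
    <= norm (indicat_real {0<..} s *\<^sub>R (2 * max 1 (cmod c) * (s powr - (1 + p) * min 1 (s powr 1))))"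
  proof (rule AE_I2)
   fix s :: real
   show "norm (indicat_real {0<..} s *\<^sub>R (complex_of_real (s powr - (1 + p)) * (exp (- (c * complex_of_real s)) - 1)))
    <= norm (indicat_real {0<..} s *\<^sub>R (2 * max 1 (cmod c) * (s powr - (1 + p) * min 1 (s powr 1))))"
    using powr_int_tilde[OF p c order_refl, of s]
    by (cases "0 < s") (auto intro: order_trans[OF _ abs_ge_self])
  qed
 qed auto
qed

text \<open>This is the Gamma integral at the negative argument - p, made convergent at 0 by
  subtracting 1. Integrating the derivative of \<open>s powr (- p) * (exp (- (c * s)) - 1)\<close>
  raises the order to \<open>1 - p\<close>, where \<open>cGam_eq\<close> applies.\<close>

lemma integral_powr_exp_minus_1_pos:
 fixes c :: complex
 assumes p: "0 < p" "p < 1" and c: "0 < Re c"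
 shows "(LBINT s:{0<..}. complex_of_real (s powr (- (1 + p))) * (exp (- (c * of_real s)) - 1))
  = - of_real (Gamma (1 - p) / p) * c powr (of_real p)"
proof -
 let ?G = "%s. complex_of_real (s powr (- (1 + p))) * (exp (- (c * of_real s)) - 1)"
 let ?H = "%s. complex_of_real (s powr (- p)) * exp (- (c * of_real s))"
 let ?F = "%s. complex_of_real (s powr (- p)) * (exp (- (c * of_real s)) - 1)"
 let ?f = "%s. (- of_real p) * ?G s - c * ?H s"
 have iG: "set_integrable lborel {0<..} ?G" using p c by (intro set_integrable_powr_exp_minus_1) auto
 have iH: "set_integrable lborel {0<..} ?H" using set_integrable_cGam[of "1 - p" c] p c by simp
 have bF: "norm (?F s) <= s powr (- p) * min 2 (norm c * s)" if "s > 0" for s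
  using that norm_exp_minus_1_le_min[of "c * of_real s"] c
  by (auto simp: norm_mult intro!: mult_left_mono)
 have E0: "(LBINT s:{0<..}. ?f s) = 0 - 0"
 proof (rule integral_FTC_Ioi[where F="?F"])
  fix x :: real assume x: "0 < x"
  have "((%v. complex_of_real (v powr (- p))) has_vector_derivative of_real (- p * x powr (- p - 1))) (at x)"
   using x by (intro has_vector_derivative_of_real)
    (auto intro!: derivative_eq_intros simp: has_real_derivative_iff_has_vector_derivative[symmetric])
  moreover have "((%v. exp (- (c * of_real v)) - 1) has_vector_derivative (- c * exp (- (c * of_real x)))) (at x)"
   by (rule has_vector_derivative_real_field) (auto intro!: derivative_eq_intros)
  ultimately have "(?F has_vector_derivative complex_of_real (x powr (- p)) * (- c * exp (- (c * of_real x)))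
    + of_real (- p * x powr (- p - 1)) * (exp (- (c * of_real x)) - 1)) (at x)"
   by (rule has_vector_derivative_mult)
  moreover have "- p - 1 = - (1 + p)" by simp
  ultimately show "(?F has_vector_derivative ?f x) (at x)"
   by (simp add: algebra_simps)
  show "isCont ?f x" using x by (intro continuous_intros) auto
 next
  show "set_integrable lborel {0<..} ?f"
   using iG iH by (intro set_integral_diff set_integrable_mult_right) auto
  show "(?F ---> 0) (at_right 0)"
  proof (rule Lim_null_comparison)
   have "((%s. s powr (1 - p)) ---> 0 powr (1 - p)) (at_right 0)"
    using p by (intro tendsto_powr' tendsto_const tendsto_ident_at) (auto simp: eventually_at_filter)
   then show "((%s. norm c * s powr (1 - p)) ---> 0) (at_right 0)"
    using tendsto_mult_right_zero by force
   show "\<forall>\<^sub>F s in at_right 0. norm (?F s) <= norm c * s powr (1 - p)"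
    using eventually_at_right_less[of 0]
   proof eventually_elim
    case (elim s)
    have "s powr (- p) * min 2 (norm c * s) <= s powr (- p) * (norm c * s)"
     by (intro mult_left_mono) auto
    also have "... = norm c * s powr (1 - p)"
     using elim by (simp add: powr_diff powr_minus field_simps)
    finally show ?case using bF[OF elim] by simp
   qed
  qed
  show "(?F ---> 0) at_top"
  proof (rule Lim_null_comparison)
   have "((%s. s powr (- p)) ---> 0) at_top"
    using p by (intro tendsto_neg_powr filterlim_ident) auto
   then show "((%s. 2 * s powr (- p)) ---> 0) at_top"
    by (rule tendsto_mult_right_zero)
   show "\<forall>\<^sub>F s in at_top. norm (?F s) <= 2 * s powr (- p)"
    using eventually_gt_at_top[of 0]
   proof eventually_elim
    case (elim s)
    have "s powr (- p) * min 2 (norm c * s) <= s powr (- p) * 2"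
     by (intro mult_left_mono) auto
    then show ?case using bF[OF elim] by simp
   qed
  qed
 qed
 have E1: "(LBINT s:{0<..}. ?f s) = (LBINT s:{0<..}. (- of_real p) * ?G s) - (LBINT s:{0<..}. c * ?H s)"
  by (intro set_integral_diff(2) set_integrable_mult_right iG iH)
 have E2: "(LBINT s:{0<..}. (- of_real p) * ?G s) = (- of_real p) * (LBINT s:{0<..}. ?G s)"
  by (rule set_integral_mult_right)
 have E3: "(LBINT s:{0<..}. c * ?H s) = c * cGam (1 - p) c"
  unfolding set_integral_mult_right cGam_def by simp
 have aux: "!!a x c y :: complex. (- a) * x - c * y = 0 ==> a * x = - c * y" by algebra
 have "(- of_real p) * (LBINT s:{0<..}. ?G s) - c * cGam (1 - p) c = 0"
  by (rule trans[OF trans[OF E1 arg_cong2[where f="(-)", OF E2 E3], symmetric] trans[OF E0 diff_self]])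
 then have F1: "of_real p * (LBINT s:{0<..}. ?G s) = - c * cGam (1 - p) c"
  by (rule aux)
 have F2: "c * c powr (- of_real (1 - p)) = c powr (of_real p)"
 proof -
  have e: "- complex_of_real (1 - p) = of_real p - 1" by simp
  show ?thesis using c unfolding e powr_diff by auto
 qed
 have "- c * cGam (1 - p) c = - of_real (Gamma (1 - p)) * (c * c powr (- of_real (1 - p)))"
  using cGam_eq[of "1 - p" c] p c by (simp add: mult.left_commute)
 then have "of_real p * (LBINT s:{0<..}. ?G s) = - of_real (Gamma (1 - p)) * c powr (of_real p)"
  unfolding F1 F2 .
 then have "(LBINT s:{0<..}. ?G s) = (- of_real (Gamma (1 - p)) * c powr (of_real p)) / of_real p"
  using p by (subst eq_divide_eq) (simp add: mult.commute)
 then show ?thesis by simp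
qed

text \<open>The boundary case \<open>c = - \<i>\<close>, reached through rates of positive real part
  under one dominating function because their norms stay below 2. The phase is the principal value
  of \<open>(- \<i>) powr p\<close>.\<close>

lemma integral_powr_iexp_minus_1:
 assumes p: "0 < p" "p < 1"
 shows "(LBINT s:{0<..}. complex_of_real (s powr (- (1 + p))) * (iexp s - 1))
  = - of_real (Gamma (1 - p) / p) * exp (- (\<i> * of_real (pi * p / 2)))"
proof -
 define c where "c n = complex_of_real (inverse (Suc n)) - \<i>" for n
 have c: "c ----> complex_of_real 0 - \<i>"
  unfolding c_def by (intro tendsto_intros tendsto_of_real) (rule LIMSEQ_inverse_real_of_nat)
 have nc: "norm (c n) <= 2" for n
 proof -
  have "norm (c n) <= norm (complex_of_real (inverse (Suc n))) + norm \<i>"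
   unfolding c_def by (rule norm_triangle_ineq4)
  also have "norm (complex_of_real (inverse (Suc n))) = inverse (Suc n)" by (simp only: norm_of_real) simp
  also have "inverse (real (Suc n)) + norm \<i> <= 1 + 1"
   by (intro add_mono) (auto simp: field_simps)
  finally show ?thesis by simp
 qed
 have Rc: "0 < Re (c n)" for n by (simp add: c_def del: of_nat_Suc of_real_inverse)
 have L1: "(%n. LBINT s:{0<..}. complex_of_real (s powr (- (1 + p))) * (exp (- (c n * of_real s)) - 1))
  ----> (LBINT s:{0<..}. complex_of_real (s powr (- (1 + p))) * (iexp s - 1))"
  unfolding set_lebesgue_integral_def
 proof (rule integral_dominated_convergence[where w="%s. indicator {0<..} s *\<^sub>R (2 * max 1 2 * (s powr (- (1 + p)) * min 1 (s powr 1)))"])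
  show "integrable lborel (%s. indicat_real {0<..} s *\<^sub>R (2 * max 1 2 * (s powr - (1 + p) * min 1 (s powr 1))))"
   using set_integrable_powr_min[of "1 + p" 1] p unfolding set_integrable_def[symmetric]
   by (intro set_integrable_mult_right) auto
  show "AE s in lborel. (%i. indicat_real {0<..} s *\<^sub>R (complex_of_real (s powr - (1 + p)) * (exp (- (c i * complex_of_real s)) - 1)))
   ----> indicat_real {0<..} s *\<^sub>R (complex_of_real (s powr - (1 + p)) * (iexp s - 1))"
  proof (rule AE_I2)
   fix s :: real
   have "(%i. exp (- (c i * of_real s))) ----> exp (- ((complex_of_real 0 - \<i>) * of_real s))"
    by (intro tendsto_intros c)
   then have "(%i. exp (- (c i * of_real s))) ----> iexp s" by simp
   then show "(%i. indicat_real {0<..} s *\<^sub>R (complex_of_real (s powr - (1 + p)) * (exp (- (c i * complex_of_real s)) - 1)))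
   ----> indicat_real {0<..} s *\<^sub>R (complex_of_real (s powr - (1 + p)) * (iexp s - 1))"
    by (intro tendsto_scaleR tendsto_mult tendsto_diff tendsto_const)
  qed
  show "AE s in lborel. norm (indicat_real {0<..} s *\<^sub>R (complex_of_real (s powr - (1 + p)) * (exp (- (c i * complex_of_real s)) - 1)))
    <= indicat_real {0<..} s *\<^sub>R (2 * max 1 2 * (s powr - (1 + p) * min 1 (s powr 1)))" for i
  proof (rule AE_I2)
   fix s :: real
   show "norm (indicat_real {0<..} s *\<^sub>R (complex_of_real (s powr - (1 + p)) * (exp (- (c i * complex_of_real s)) - 1)))
    <= indicat_real {0<..} s *\<^sub>R (2 * max 1 2 * (s powr - (1 + p) * min 1 (s powr 1)))"
    using powr_int_tilde[OF p less_imp_le[OF Rc] nc, of s i] by (cases "0 < s") auto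
  qed
 qed auto
 have L2: "(%n. - of_real (Gamma (1 - p) / p) * c n powr (of_real p))
  ----> - of_real (Gamma (1 - p) / p) * (complex_of_real 0 - \<i>) powr (of_real p)"
  by (intro tendsto_mult tendsto_const tendsto_powr_complex c) (auto simp: complex_nonpos_Reals_iff)
 have "(complex_of_real 0 - \<i>) powr (of_real p) = exp (- (\<i> * of_real (pi * p / 2)))"
  by (simp add: powr_def field_simps)
 then show ?thesis
  using LIMSEQ_unique[OF L1[unfolded integral_powr_exp_minus_1_pos[OF p Rc]] L2] by (simp only:)
qed

section \<open>Exchanging expectations, integrals and series\<close>

lemma Fubini_prob_lborel:
 fixes h :: "real => 'a => 'b::{banach, second_countable_topology}"
 assumes "prob_space M"
  and h[measurable]: "case_prod h \<in> borel_measurable (lborel \<Otimes>\<^sub>M M)"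
  and B: "integrable lborel B"
  and le: "!!t w. w \<in> space M ==> norm (h t w) <= B t"
 shows "integrable lborel (%t. \<integral>w. h t w \<partial>M)"
  and "integrable M (%w. \<integral>t. h t w \<partial>lborel)"
  and "(LINT w|M. (LBINT t. h t w)) = (LBINT t. (LINT w|M. h t w))"
proof -
 interpret prob_space M by fact
 interpret P: pair_sigma_finite lborel M ..
 have [measurable]: "B \<in> borel_measurable lborel" using B by auto
 have int: "integrable (lborel \<Otimes>\<^sub>M M) (case_prod h)"
 proof (rule integrable_bound)
  show "integrable (lborel \<Otimes>\<^sub>M M) (%(t, w). B t)"
   using B by (intro P.Fubini_integrable) auto
  show "AE x in lborel \<Otimes>\<^sub>M M. norm (case_prod h x) <= norm (case x of (t, w) => B t)"
   using le by (intro AE_I2) (auto simp: space_pair_measure intro: order_trans[OF _ abs_ge_self])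
 qed auto
 show "integrable lborel (%t. \<integral>w. h t w \<partial>M)" by (rule P.integrable_fst[OF int])
 show "integrable M (%w. \<integral>t. h t w \<partial>lborel)" by (rule P.integrable_snd[OF int])
 show "(LINT w|M. (LBINT t. h t w)) = (LBINT t. (LINT w|M. h t w))"
  by (rule P.Fubini_integral[OF int])
qed

text \<open>A single integrable bound is put on the sum of the norms. This matches how the series
  over n is controlled later, namely as a whole at each frequency t.\<close>

lemma dominated_suminf:
 fixes f :: "nat => 'a => 'b::{banach, second_countable_topology}"
 assumes f[measurable]: "!!n. f n \<in> borel_measurable M" and w: "integrable M w"
  and sm: "!!x. x \<in> space M ==> summable (%n. norm (f n x))"
  and le: "!!x. x \<in> space M ==> (\<Sum>n. norm (f n x)) <= w x"
 shows "integrable M (f n)"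
  and "summable (%n. norm (integral\<^sup>L M (f n)))"
  and "integrable M (%x. \<Sum>n. f n x)"
  and "(LINT x|M. (\<Sum>n. f n x)) = (\<Sum>n. integral\<^sup>L M (f n))"
proof -
 have part: "(\<Sum>n<N. norm (f n x)) <= w x" if "x \<in> space M" for x N
  using sum_le_suminf[OF sm[OF that], of "{..<N}"] le[OF that] by simp
 have int: "integrable M (f n)" for n
 proof (rule integrable_bound[OF w])
  show "AE x in M. norm (f n x) <= norm (w x)"
  proof (rule AE_I2)
   fix x assume x: "x \<in> space M"
   have "norm (f n x) <= (\<Sum>n<Suc n. norm (f n x))" by (simp add: sum_nonneg)
   also have "... <= w x" by (rule part[OF x])
   finally show "norm (f n x) <= norm (w x)" by simp
  qed
 qed auto
 then show "integrable M (f n)" .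
 have s: "summable (%n. \<integral>x. norm (f n x) \<partial>M)"
 proof (rule bounded_imp_summable)
  show "(\<Sum>k\<le>n. \<integral>x. norm (f k x) \<partial>M) <= integral\<^sup>L M w" for n
  proof -
   have "(\<Sum>k\<le>n. \<integral>x. norm (f k x) \<partial>M) = (LINT x|M. (\<Sum>k\<le>n. norm (f k x)))"
    using int by (simp add: integral_sum)
   also have "... <= integral\<^sup>L M w"
    using int w part[of _ "Suc n"] by (intro integral_mono) (auto simp: lessThan_Suc_atMost)
   finally show ?thesis .
  qed
 qed auto
 have ae: "AE x in M. summable (%n. norm (f n x))" using sm by (intro AE_I2)
 show "integrable M (%x. \<Sum>n. f n x)" "(LINT x|M. (\<Sum>n. f n x)) = (\<Sum>n. integral\<^sup>L M (f n))"
  using integrable_suminf[OF int ae s] integral_suminf[OF int ae s] by auto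
 show "summable (%n. norm (integral\<^sup>L M (f n)))"
  by (rule summable_comparison_test[OF _ s]) (auto intro!: exI[of _ 0] integral_norm_bound)
qed

section \<open>Oscillatory integrals over a half-line\<close>

text \<open>The maximum sits at \<open>v = s / a\<close>; the inequality ln x <= x - 1 at x = a v /
  s expresses this.\<close>

lemma powr_exp_le:
 fixes s a v :: real
 assumes "0 < s" "0 < a" "0 < v"
 shows "v powr s * exp (- (a * v)) <= (s / a) powr s"
proof -
 have "ln (a * v / s) <= a * v / s - 1" using assms by (intro ln_le_minus_one) auto
 then have "s * ln (a * v / s) <= s * (a * v / s)" using assms by (intro mult_left_mono) auto
 moreover have "ln (a * v / s) = ln v - ln (s / a)" using assms by (simp add: ln_div ln_mult)
 ultimately have "s * ln v - a * v <= s * ln (s / a)" using assms by (simp add: algebra_simps)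
 then have "exp (s * ln v - a * v) <= exp (s * ln (s / a))" by simp
 then show ?thesis using assms by (simp add: powr_def exp_diff exp_minus field_simps)
qed

lemma norm_linear_exp_le:
 fixes c :: complex
 assumes q: "0 < q" and c: "0 < Re c"
 obtains C where "0 < C" "!!v. 0 < v ==> norm (c * of_real v * exp (- (c * of_real v))) <= C * min 1 (v powr (- q))"
  "!!v. 0 < v ==> norm (exp (- (c * of_real v))) <= C * min 1 (v powr (- q))"
proof
 let ?a = "Re c"
 let ?C = "1 + norm c * ((1 / ?a) powr 1 + ((q + 1) / ?a) powr (q + 1)) + (q / ?a) powr q"
 have nn: "0 <= norm c * (1 / ?a) powr 1" "0 <= norm c * ((q + 1) / ?a) powr (q + 1)" "0 <= (q / ?a) powr q" by auto
 then show "0 < ?C" unfolding distrib_left by linarith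
 show "norm (c * of_real v * exp (- (c * of_real v))) <= ?C * min 1 (v powr (- q))" if v: "0 < v" for v
 proof -
  have n: "norm (c * of_real v * exp (- (c * of_real v))) = norm c * (v * exp (- (?a * v)))"
   using v by (simp add: norm_mult)
  have "norm c * (v * exp (- (?a * v))) <= norm c * (1 / ?a) powr 1"
   using powr_exp_le[of 1 ?a v] v c by (intro mult_left_mono) auto
  then have 1: "norm c * (v * exp (- (?a * v))) <= ?C" using nn unfolding distrib_left by linarith
  have "v powr (q + 1) * exp (- (?a * v)) <= ((q + 1) / ?a) powr (q + 1)"
   using v c q by (intro powr_exp_le) auto
  then have "norm c * (v powr (q + 1) * exp (- (?a * v))) <= norm c * ((q + 1) / ?a) powr (q + 1)"
   by (intro mult_left_mono) auto
  then have 2: "norm c * (v powr (q + 1) * exp (- (?a * v))) <= ?C" using nn unfolding distrib_left by linarith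
  have "norm c * (v * exp (- (?a * v))) = norm c * (v powr (q + 1) * exp (- (?a * v))) * v powr (- q)"
   using v by (simp add: powr_add powr_minus field_simps)
  also have "... <= ?C * v powr (- q)" by (rule mult_right_mono[OF 2]) auto
  finally show ?thesis unfolding n using 1 by (auto simp: min_def)
 qed
 show "norm (exp (- (c * of_real v))) <= ?C * min 1 (v powr (- q))" if v: "0 < v" for v
 proof -
  have n: "norm (exp (- (c * of_real v))) = exp (- (?a * v))" by simp
  have "exp (- (?a * v)) <= 1" using v c by simp
  then have 1: "exp (- (?a * v)) <= ?C" using nn unfolding distrib_left by linarith
  have "v powr q * exp (- (?a * v)) <= (q / ?a) powr q"
   using v c q by (intro powr_exp_le) auto
  then have 2: "v powr q * exp (- (?a * v)) <= ?C" using nn unfolding distrib_left by linarith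
  have "exp (- (?a * v)) = (v powr q * exp (- (?a * v))) * v powr (- q)"
   using v by (simp add: powr_add powr_minus field_simps)
  also have "... <= ?C * v powr (- q)" by (rule mult_right_mono[OF 2]) auto
  finally show ?thesis unfolding n using 1 by (auto simp: min_def)
 qed
qed

text \<open>Both bounds exploit that the modulus of \<open>iexp x - 1\<close> is at most 2 and at
  most x. The first makes a singularity of order 1 + p integrable; the second interpolates by 2 x^p
  and is uniform in t at the price of a^p.\<close>

lemma norm_powr_iexp_le:
 assumes p: "0 < p" "p < 1" and a: "0 < a" and t: "0 < t"
 shows "t powr (- (1 + p)) * norm (iexp (a * t) - 1) <= 2 * max 1 a * (t powr (- (1 + p)) * min 1 (t powr 1))"
  and "t powr (- p) * norm (iexp (a * t) - 1) <= 2 * a powr p"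
proof -
 have "norm (complex_of_real (t powr (- (1 + p))) * (exp (- ((- \<i> * of_real a) * of_real t)) - 1))
   <= 2 * max 1 a * (t powr (- (1 + p)) * min 1 (t powr 1))"
  by (rule powr_int_tilde) (use assms in \<open>auto simp: norm_mult\<close>)
 then show "t powr (- (1 + p)) * norm (iexp (a * t) - 1) <= 2 * max 1 a * (t powr (- (1 + p)) * min 1 (t powr 1))"
  by (simp add: norm_mult mult_ac)
 have "norm (exp (- (- \<i> * of_real (a * t))) - 1) <= min 2 (norm (- \<i> * complex_of_real (a * t)))"
  by (rule norm_exp_minus_1_le_min) simp
 then have b: "norm (iexp (a * t) - 1) <= min 2 (a * t)" using a t by (simp add: norm_mult)
 have "min 2 x <= 2 * x powr p" if "0 < x" for x :: real
 proof (cases "x <= 1")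
  case True
  then have "x powr 1 <= x powr p" using that p by (intro powr_mono') auto
  then show ?thesis using that by (auto simp: min_def)
 next
  case False
  then have "1 <= x powr p" using p by (intro ge_one_powr_ge_zero) auto
  then show ?thesis by (auto simp: min_def)
 qed
 from order_trans[OF b this[of "a * t"]] have "norm (iexp (a * t) - 1) <= 2 * (a * t) powr p" using a t by auto
 then have "t powr (- p) * norm (iexp (a * t) - 1) <= t powr (- p) * (2 * (a * t) powr p)"
  by (rule mult_left_mono) auto
 also have "... = 2 * a powr p" using a t by (simp add: powr_mult powr_minus)
 finally show "t powr (- p) * norm (iexp (a * t) - 1) <= 2 * a powr p" .
qed

text \<open>Think of \<open>d n\<close> as minus the derivative of \<open>\<psi> n\<close>; then
  \<open>ident\<close> is an integration by parts with the primitive of iexp that vanishes at 0. Of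
  the two resulting integrals the one containing \<open>g'\<close> has smaller order. In the other,
  the substitution t = s / a concentrates \<open>g\<close> at its boundary value \<open>g0\<close>
  and the sum of the \<open>d n\<close> at its singular profile D s^(- (1 + p)), which leaves the
  constant of \<open>integral_powr_iexp_minus_1\<close>.\<close>

lemma halfline_limit:
 fixes g g' :: "real => complex" and \<psi> d :: "nat => real => complex"
 assumes p: "0 < p" "p < 1"
  and g: "set_integrable lborel {0<..} g" and g': "set_integrable lborel {0<..} g'"
  and gm[measurable]: "g \<in> borel_measurable borel" "g' \<in> borel_measurable borel"
  and B: "!!t. 0 < t ==> norm (g t) <= B" and g0: "(g ---> g0) (at_right 0)"
  and m[measurable]: "!!n. \<psi> n \<in> borel_measurable borel" "!!n. d n \<in> borel_measurable borel"
  and s\<psi>: "!!t. 0 < t ==> summable (%n. norm (\<psi> n t))"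
  and le\<psi>: "!!t. 0 < t ==> (\<Sum>n. norm (\<psi> n t)) <= K * t powr (- p)"
  and sd: "!!t. 0 < t ==> summable (%n. norm (d n t))"
  and led: "!!t. 0 < t ==> (\<Sum>n. norm (d n t)) <= K * t powr (- (1 + p))"
  and D: "((%t. t powr (1 + p) *\<^sub>R (\<Sum>n. d n t)) ---> D) (at_right 0)"
  and ident: "!!n a. 0 < a ==> (LBINT t:{0<..}. g t * iexp (a * t) * \<psi> n t)
   = \<i> / of_real a * (LBINT t:{0<..}. (g' t * \<psi> n t - g t * d n t) * (iexp (a * t) - 1))"
 shows "((%a. complex_of_real (a powr (1 - p)) * (\<Sum>n. LBINT t:{0<..}. g t * iexp (a * t) * \<psi> n t))
  ---> \<i> * g0 * D * of_real (Gamma (1 - p) / p) * exp (- (\<i> * of_real (pi * p / 2)))) at_top"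
proof -
 define P where "P t = (\<Sum>n. \<psi> n t)" for t
 define X where "X t = (\<Sum>n. d n t)" for t
 have [measurable]: "P \<in> borel_measurable borel" "X \<in> borel_measurable borel"
  unfolding P_def X_def by measurable
 have K0: "0 <= K" using order_trans[OF suminf_nonneg[OF s\<psi>] le\<psi>, of 1] by simp
 have B0: "0 <= B" using order_trans[OF norm_ge_zero B, of 1] by simp
 have nP: "norm (P t) <= K * t powr (- p)" if "0 < t" for t
  unfolding P_def using summable_norm[OF s\<psi>[OF that]] le\<psi>[OF that] by linarith
 have nX: "norm (X t) <= K * t powr (- (1 + p))" if "0 < t" for t
  unfolding X_def using summable_norm[OF sd[OF that]] led[OF that] by linarith
 let ?w1 = "%a t. indicator {0<..} t *\<^sub>R (K * (2 * a powr p) * norm (g' t))"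
 let ?w2 = "%a s. indicator {0<..} s *\<^sub>R (B * K * (2 * max 1 a * (s powr (- (1 + p)) * min 1 (s powr 1))))"
 have w1: "integrable lborel (?w1 a)" for a
  using set_integrable_norm[OF g'] unfolding set_integrable_def[symmetric]
  by (intro set_integrable_mult_right) auto
 have w2: "integrable lborel (?w2 a)" for a
  using set_integrable_powr_min[of "1 + p" 1] p unfolding set_integrable_def[symmetric]
  by (intro set_integrable_mult_right) auto
 let ?h1 = "%a t. indicator {0<..} t *\<^sub>R (g' t * P t * (iexp (a * t) - 1))"
 let ?h2 = "%a t. indicator {0<..} t *\<^sub>R (g t * X t * (iexp (a * t) - 1))"
 let ?H1 = "%a. integral\<^sup>L lborel (?h1 a)" and ?H2 = "%a. integral\<^sup>L lborel (?h2 a)" and ?c = "%a x. complex_of_real (a powr x)"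
 let ?K = "LBINT s:{0<..}. ?c s (- (1 + p)) * (iexp s - 1)" and ?S = "%a. \<Sum>n. LBINT t:{0<..}. g t * iexp (a * t) * \<psi> n t"
 have b1: "norm (?h1 a t) <= ?w1 a t" if a: "0 < a" for a t
 proof (cases "0 < t")
  case True
  have "norm (g' t * P t * (iexp (a * t) - 1)) <= norm (g' t) * (K * t powr (- p)) * norm (iexp (a * t) - 1)"
   unfolding norm_mult by (intro mult_right_mono mult_left_mono nP True) auto
  also have "... = K * (t powr (- p) * norm (iexp (a * t) - 1)) * norm (g' t)" by (simp add: mult_ac)
  also have "... <= K * (2 * a powr p) * norm (g' t)"
   by (intro mult_right_mono mult_left_mono norm_powr_iexp_le p a True K0) auto
  finally show ?thesis using True by simp
 qed auto
 have b2: "norm (?h2 a t) <= ?w2 a t" if a: "0 < a" for a t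
 proof (cases "0 < t")
  case True
  have "norm (g t * X t * (iexp (a * t) - 1)) <= B * (K * t powr (- (1 + p))) * norm (iexp (a * t) - 1)"
   unfolding norm_mult by (intro mult_right_mono mult_mono nX B True B0) auto
  also have "... = B * K * (t powr (- (1 + p)) * norm (iexp (a * t) - 1))" by (simp add: mult_ac)
  also have "... <= B * K * (2 * max 1 a * (t powr (- (1 + p)) * min 1 (t powr 1)))"
   using B0 K0 by (intro mult_left_mono norm_powr_iexp_le p a True) auto
  finally show ?thesis using True by simp
 qed auto
 have i1: "integrable lborel (?h1 a)" and i2: "integrable lborel (?h2 a)" if a: "0 < a" for a
  by (rule integrable_bound[OF w1[of a]], measurable, rule AE_I2, use b1[OF a] in \<open>auto intro: order_trans[OF _ abs_ge_self]\<close>)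
   (rule integrable_bound[OF w2[of a]], measurable, rule AE_I2, use b2[OF a] in \<open>auto intro: order_trans[OF _ abs_ge_self]\<close>)
 have main: "?S a
  = \<i> / of_real a * (?H1 a - ?H2 a)" if a: "0 < a" for a
 proof -
  let ?f = "%n t. indicator {0<..} t *\<^sub>R ((g' t * \<psi> n t - g t * d n t) * (iexp (a * t) - 1))"
  have sm: "summable (%n. norm (?f n t))"
   and le: "(\<Sum>n. norm (?f n t)) <= ?w1 a t + ?w2 a t"
   and eq: "(\<Sum>n. ?f n t) = ?h1 a t - ?h2 a t" for t
  proof -
   have "summable (%n. norm (?f n t)) \<and> (\<Sum>n. norm (?f n t)) <= ?w1 a t + ?w2 a t \<and> (\<Sum>n. ?f n t) = ?h1 a t - ?h2 a t"
   proof (cases "0 < t")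
    case True
    let ?e = "norm (iexp (a * t) - 1)"
    let ?b = "%n. norm (g' t) * ?e * norm (\<psi> n t) + norm (g t) * ?e * norm (d n t)"
    have sb: "summable ?b" by (intro summable_add summable_mult s\<psi> sd True)
    have fb: "norm (?f n t) <= ?b n" for n
    proof -
     have "norm (?f n t) = norm (g' t * \<psi> n t - g t * d n t) * ?e" using True by (simp add: norm_mult)
     also have "norm (g' t * \<psi> n t - g t * d n t) * ?e <= (norm (g' t * \<psi> n t) + norm (g t * d n t)) * ?e"
      by (intro mult_right_mono norm_triangle_ineq4) auto
     also have "(norm (g' t * \<psi> n t) + norm (g t * d n t)) * ?e = ?b n"
      by (simp only: norm_mult ring_distribs mult_ac)
     finally show ?thesis .
    qed
    have s: "summable (%n. norm (?f n t))"
     by (rule summable_comparison_test'[OF sb, of 0]) (use fb in auto)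
    have "(\<Sum>n. norm (?f n t)) <= (\<Sum>n. ?b n)" by (rule suminf_le[OF fb s sb])
    also have "... = norm (g' t) * ?e * (\<Sum>n. norm (\<psi> n t)) + norm (g t) * ?e * (\<Sum>n. norm (d n t))"
     using s\<psi>[OF True] sd[OF True] by (subst suminf_add[symmetric]) (auto intro!: summable_mult simp: suminf_mult)
    also have "... <= norm (g' t) * ?e * (K * t powr (- p)) + B * ?e * (K * t powr (- (1 + p)))"
     using B0 suminf_nonneg[OF sd[OF True]] by (intro add_mono mult_mono mult_left_mono le\<psi> led B True) auto
    also have "... = K * (t powr (- p) * ?e) * norm (g' t) + B * K * (t powr (- (1 + p)) * ?e)"
     by (simp add: mult_ac)
    also have "... <= K * (2 * a powr p) * norm (g' t) + B * K * (2 * max 1 a * (t powr (- (1 + p)) * min 1 (t powr 1)))"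
     using B0 K0 by (intro add_mono mult_right_mono mult_left_mono norm_powr_iexp_le p a True) auto
    finally have l: "(\<Sum>n. norm (?f n t)) <= ?w1 a t + ?w2 a t" using True by simp
    have c1: "summable (%n. \<psi> n t)" "summable (%n. d n t)"
     by (auto intro: summable_norm_cancel s\<psi>[OF True] sd[OF True])
    have "(%n. (g' t * \<psi> n t - g t * d n t) * (iexp (a * t) - 1)) sums ((g' t * P t - g t * X t) * (iexp (a * t) - 1))"
     unfolding P_def X_def by (intro sums_mult2 sums_diff sums_mult summable_sums c1)
    then have "(\<Sum>n. (g' t * \<psi> n t - g t * d n t) * (iexp (a * t) - 1)) = (g' t * P t - g t * X t) * (iexp (a * t) - 1)"
     by (rule sums_unique[symmetric])
    then have e: "(\<Sum>n. ?f n t) = ?h1 a t - ?h2 a t" using True by (simp add: algebra_simps)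
    show ?thesis using s l e by blast
   qed auto
   then show "summable (%n. norm (?f n t))" "(\<Sum>n. norm (?f n t)) <= ?w1 a t + ?w2 a t" "(\<Sum>n. ?f n t) = ?h1 a t - ?h2 a t"
    by blast+
  qed
  have mf: "!!n. ?f n \<in> borel_measurable lborel" by measurable
  have wi: "integrable lborel (%t. ?w1 a t + ?w2 a t)" by (intro integrable_add w1 w2)
  have S1: "(LBINT t. (\<Sum>n. ?f n t)) = (\<Sum>n. integral\<^sup>L lborel (?f n))"
   by (rule dominated_suminf(4)[OF mf wi sm le])
  have S2: "(LBINT t. (\<Sum>n. ?f n t)) = ?H1 a - ?H2 a"
   unfolding eq by (rule integral_diff[OF i1[OF a] i2[OF a]])
  have S3: "summable (%n. integral\<^sup>L lborel (?f n))"
   by (rule summable_norm_cancel, rule dominated_suminf(2)[OF mf wi sm le])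
  have "?S a = (\<Sum>n. \<i> / of_real a * integral\<^sup>L lborel (?f n))"
   unfolding ident[OF a] unfolding set_lebesgue_integral_def by (rule refl)
  also have "... = \<i> / of_real a * (\<Sum>n. integral\<^sup>L lborel (?f n))"
   by (rule suminf_mult[OF S3])
  finally show ?thesis unfolding S1[symmetric] S2 .
 qed
 \<comment> \<open>The bound \<open>?w1 a\<close> carries a factor a^p, which a^(- p) cancels
   exactly; this is the domination. Pointwise in t, the factor a^(- p) alone forces the limit
   0.\<close>
 have L1: "((%a. ?c a (- p) * ?H1 a) ---> 0) at_top"
 proof -
  let ?s = "%a t. indicator {0<..} t *\<^sub>R (?c a (- p) * (g' t * P t * (iexp (a * t) - 1)))"
  have "((%a. integral\<^sup>L lborel (?s a)) ---> integral\<^sup>L lborel (%t::real. 0)) at_top"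
  proof (rule integral_dominated_convergence_at_top[where w="%t. indicator {0<..} t *\<^sub>R (K * 2 * norm (g' t))"])
   show "integrable lborel (%t. indicator {0<..} t *\<^sub>R (K * 2 * norm (g' t)))"
    using set_integrable_norm[OF g'] unfolding set_integrable_def[symmetric]
    by (intro set_integrable_mult_right) auto
   show "\<forall>\<^sub>F a in at_top. AE t in lborel. norm (?s a t) <= indicator {0<..} t *\<^sub>R (K * 2 * norm (g' t))"
    using eventually_gt_at_top[of 0]
   proof eventually_elim
    case (elim a)
    show ?case
    proof (rule AE_I2)
     fix t
     have "norm (?s a t) = a powr (- p) * norm (?h1 a t)" by (simp add: norm_mult mult_ac)
     also have "... <= a powr (- p) * ?w1 a t" by (intro mult_left_mono b1 elim) auto
     also have "... = indicator {0<..} t *\<^sub>R (K * 2 * norm (g' t))"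
      using elim by (simp add: powr_minus)
     finally show "norm (?s a t) <= indicator {0<..} t *\<^sub>R (K * 2 * norm (g' t))" .
    qed
   qed
   show "AE t in lborel. ((%a. ?s a t) ---> 0) at_top"
   proof (rule AE_I2)
    fix t :: real
    show "((%a. ?s a t) ---> 0) at_top"
    proof (rule Lim_null_comparison)
     have "((%a. a powr (- p)) ---> 0) at_top"
      using p by (intro tendsto_neg_powr filterlim_ident) auto
     then show "((%a. a powr (- p) * (norm (g' t * P t) * 2)) ---> 0) at_top"
      by (rule tendsto_mult_left_zero)
     show "\<forall>\<^sub>F a in at_top. norm (?s a t) <= a powr (- p) * (norm (g' t * P t) * 2)"
     proof (rule always_eventually, rule allI)
      fix a :: real
      have "norm (iexp (a * t) - 1) <= 2"
       using norm_triangle_ineq4[of "iexp (a * t)" 1] by simp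
      then have "a powr (- p) * (norm (g' t * P t) * norm (iexp (a * t) - 1)) <= a powr (- p) * (norm (g' t * P t) * 2)"
       by (intro mult_left_mono) auto
      moreover have "0 <= a powr (- p) * (norm (g' t * P t) * 2)" by auto
      ultimately show "norm (?s a t) <= a powr (- p) * (norm (g' t * P t) * 2)"
       by (cases "0 < t") (auto simp: norm_mult mult_ac)
     qed
    qed
   qed
  qed measurable
  moreover have "integral\<^sup>L lborel (?s a) = ?c a (- p) * ?H1 a" for a
   by (subst integral_mult_right_zero[symmetric]) (intro integral_cong, auto simp: indicator_def)
  ultimately show ?thesis by simp
 qed
 \<comment> \<open>After t = s / a the powers of a cancel against those in \<open>nX\<close>, so
   \<open>?w2 1\<close> dominates for every a > 0.\<close>
 have L2: "((%a. ?c a (- p) * ?H2 a) --->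
   g0 * D * ?K) at_top"
 proof -
  let ?s = "%a s. indicator {0<..} s *\<^sub>R (?c a (- (1 + p)) * (g (s / a) * X (s / a) * (iexp s - 1)))"
  let ?l = "%s. indicator {0<..} s *\<^sub>R (g0 * D * (?c s (- (1 + p)) * (iexp s - 1)))"
  have "((%a. integral\<^sup>L lborel (?s a)) ---> integral\<^sup>L lborel ?l) at_top"
  proof (rule integral_dominated_convergence_at_top[where w="?w2 1"])
   show "\<forall>\<^sub>F a in at_top. AE t in lborel. norm (?s a t) <= ?w2 1 t"
    using eventually_gt_at_top[of 0]
   proof eventually_elim
    case (elim a)
    show ?case
    proof (rule AE_I2)
     fix t :: real
     show "norm (?s a t) <= ?w2 1 t"
     proof (cases "0 < t")
      case True
      have ta: "0 < t / a" using True elim by simp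
      have "norm (?c a (- (1 + p)) * (g (t / a) * X (t / a) * (iexp t - 1)))
       <= a powr (- (1 + p)) * (B * (K * (t / a) powr (- (1 + p))) * norm (iexp t - 1))"
       unfolding norm_mult norm_of_real
       by (intro mult_mono mult_right_mono nX B ta B0) auto
      also have "... = B * K * (t powr (- (1 + p)) * norm (iexp (1 * t) - 1))"
       using elim True by (simp add: powr_divide)
      also have "... <= B * K * (2 * max 1 1 * (t powr (- (1 + p)) * min 1 (t powr 1)))"
       using B0 K0 by (intro mult_left_mono norm_powr_iexp_le p True) auto
      finally show ?thesis using True by simp
     qed auto
    qed
   qed
   show "AE s in lborel. ((%a. ?s a s) ---> ?l s) at_top"
   proof (rule AE_I2)
    fix s :: real
    show "((%a. ?s a s) ---> ?l s) at_top"
    proof (cases "0 < s")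
     case True
     have "filterlim (%a. s / a) (nhds 0) at_top"
      by (intro tendsto_divide_0[OF tendsto_const] filterlim_at_top_imp_at_infinity filterlim_ident)
     moreover have "\<forall>\<^sub>F a in at_top. 0 < s / a"
      using eventually_gt_at_top[of 0] by eventually_elim (use True in auto)
     ultimately have f: "filterlim (%a. s / a) (at_right 0) at_top"
      by (auto simp: filterlim_at elim: eventually_mono)
     have "((%a. g (s / a) * ((s / a) powr (1 + p) *\<^sub>R X (s / a)) * (?c s (- (1 + p)) * (iexp s - 1)))
      ---> g0 * D * (?c s (- (1 + p)) * (iexp s - 1))) at_top"
      unfolding X_def
      by (intro tendsto_mult tendsto_const filterlim_compose[OF g0 f] filterlim_compose[OF D f])
     then have "((%a. ?c a (- (1 + p)) * (g (s / a) * X (s / a) * (iexp s - 1)))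
      ---> g0 * D * (?c s (- (1 + p)) * (iexp s - 1))) at_top"
     proof (rule Lim_transform_eventually)
      show "\<forall>\<^sub>F a in at_top. g (s / a) * ((s / a) powr (1 + p) *\<^sub>R X (s / a)) * (?c s (- (1 + p)) * (iexp s - 1))
        = ?c a (- (1 + p)) * (g (s / a) * X (s / a) * (iexp s - 1))"
       using eventually_gt_at_top[of 0]
      proof eventually_elim
       case (elim a)
       have "(s / a) powr (1 + p) * s powr (- (1 + p)) = a powr (- (1 + p))"
        using elim True by (simp only: powr_divide less_imp_le powr_minus) (auto simp: inverse_eq_divide)
       then have "?c a (- (1 + p)) = of_real ((s / a) powr (1 + p)) * of_real (s powr (- (1 + p)))"
        by (metis of_real_mult)
       then show ?case by (simp only: scaleR_conv_of_real mult_ac)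
      qed
     qed
     then show ?thesis using True by simp
    qed auto
   qed
   show "integrable lborel (?w2 1)" by (rule w2)
  qed measurable
  moreover have "integral\<^sup>L lborel ?l = g0 * D * ?K"
   unfolding set_lebesgue_integral_def
   by (subst integral_mult_right_zero[symmetric]) (intro integral_cong, auto simp: indicator_def)
  moreover have "\<forall>\<^sub>F a in at_top. integral\<^sup>L lborel (?s a) = ?c a (- p) * ?H2 a"
   using eventually_gt_at_top[of 0]
  proof eventually_elim
   case (elim a)
   have "?H2 a = \<bar>1 / a\<bar> *\<^sub>R integral\<^sup>L lborel (%s. ?h2 a (0 + (1 / a) * s))"
    using elim by (intro lborel_integral_real_affine) auto
   also have "... = \<bar>1 / a\<bar> *\<^sub>R integral\<^sup>L lborel (%s. indicator {0<..} s *\<^sub>R (g (s / a) * X (s / a) * (iexp s - 1)))"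
    using elim by (intro arg_cong2[where f="scaleR"] integral_cong refl)
     (auto simp: indicator_def zero_less_divide_iff)
   also have "... = ?c a (- 1) * integral\<^sup>L lborel (%s. indicator {0<..} s *\<^sub>R (g (s / a) * X (s / a) * (iexp s - 1)))"
    using elim by (simp add: scaleR_conv_of_real powr_minus field_simps)
   finally have h: "?H2 a = ..." .
   have "?c a (- p) * ?c a (- 1) = ?c a (- (1 + p))"
    by (simp only: of_real_mult[symmetric] powr_add[symmetric]) (simp add: add.commute)
   then show ?case
    unfolding h mult.assoc[symmetric]
    by (simp only:) (subst integral_mult_right_zero[symmetric], intro integral_cong, auto simp: indicator_def)
  qed
  ultimately show ?thesis
   by (auto intro: Lim_transform_eventually)
 qed
 have "((%a. \<i> * (?c a (- p) * ?H1 a - ?c a (- p) * ?H2 a))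
  ---> \<i> * (0 - g0 * D * ?K)) at_top"
  by (intro tendsto_mult tendsto_diff tendsto_const L1 L2)
 moreover have "\<i> * (0 - g0 * D * ?K)
  = \<i> * g0 * D * of_real (Gamma (1 - p) / p) * exp (- (\<i> * of_real (pi * p / 2)))"
  unfolding integral_powr_iexp_minus_1[OF p] by (simp only: mult_minus_left mult_minus_right diff_0 minus_minus mult.assoc)
 moreover have "\<forall>\<^sub>F a in at_top. \<i> * (?c a (- p) * ?H1 a - ?c a (- p) * ?H2 a)
  = ?c a (1 - p) * ?S a"
  using eventually_gt_at_top[of 0]
 proof eventually_elim
  case (elim a)
  have "?c a (1 - p) = of_real a * of_real (a powr (- p))"
   using elim by (simp only: of_real_mult[symmetric]) (simp add: powr_diff powr_minus field_simps)
  then have "?c a (1 - p) * (\<i> / of_real a) = \<i> * of_real (a powr (- p))"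
   using elim by simp
  then show ?case unfolding main[OF elim] mult.assoc[symmetric] by (simp add: algebra_simps)
 qed
 ultimately show ?thesis by (simp only:) (rule Lim_transform_eventually)
qed

lemma powr_at_top:
 assumes "0 < (b::real)"
 shows "LIM t at_top. t powr b :> at_top"
proof -
 have "LIM t at_top. exp (b * ln t) :> at_top"
  by (intro filterlim_compose[OF exp_at_top] filterlim_tendsto_pos_mult_at_top[OF tendsto_const assms] ln_at_top)
 then show ?thesis
  by (rule filterlim_cong[THEN iffD1, rotated 3])
   (use eventually_gt_at_top[of 0] in \<open>auto elim!: eventually_mono simp: powr_def\<close>)
qed

text \<open>The primitive of \<open>iexp (a * t)\<close> is normalised to vanish at 0, so the
  boundary term at 0 disappears and the singular factor \<open>t powr (b - 1)\<close> of
  \<open>E'\<close>, which is minus the derivative of \<open>E\<close>, is compensated. With v = t^b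
  V, the inequality v exp (- Re c v) <= 1 / Re c makes the first conclusion independent of
  \<open>V\<close>, as is required for averaging over \<open>V\<close> in
  \<open>expected_halfline_ibp\<close>.\<close>

lemma halfline_ibp:
 fixes g g' :: "real => complex" and c :: complex
 assumes c: "0 < Re c" and b: "0 < b" and V: "0 < V" and a: "0 < a"
  and der: "!!t. 0 < t ==> (g has_vector_derivative g' t) (at t)"
  and cont: "!!t. 0 < t ==> isCont g' t"
  and g: "set_integrable lborel {0<..} g" and g': "set_integrable lborel {0<..} g'"
  and gm[measurable]: "g \<in> borel_measurable borel" "g' \<in> borel_measurable borel"
  and B: "!!t. 0 < t ==> norm (g t) <= B" and g0: "(g ---> g0) (at_right 0)"
 defines "E \<equiv> %t. exp (- (c * of_real (t powr b * V)))"
 defines "E' \<equiv> %t. c * of_real (b * t powr (b - 1) * V) * E t"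
 shows "t > 0 ==> norm ((g' t * E t - g t * E' t) * (iexp (a * t) - 1)) <= 2 * norm (g' t) + a * b * norm c / Re c * norm (g t)"
  and "(LBINT t:{0<..}. g t * iexp (a * t) * E t)
   = \<i> / of_real a * (LBINT t:{0<..}. (g' t * E t - g t * E' t) * (iexp (a * t) - 1))"
proof -
 have nE: "norm (E t) = exp (- (Re c * (t powr b * V)))" if "0 < t" for t
  unfolding E_def by simp
 have nE1: "norm (E t) <= 1" if "0 < t" for t
  unfolding nE[OF that] using c V by simp
 have ie2: "norm (iexp x - 1) <= 2" for x
  using norm_triangle_ineq4[of "iexp x" 1] by simp
 have iex: "norm (iexp x - 1) <= \<bar>x\<bar>" for x
  using iexp_approx1[of x 0] by simp
 have bnd: "norm ((g' t * E t - g t * E' t) * (iexp (a * t) - 1)) <= 2 * norm (g' t) + a * b * norm c / Re c * norm (g t)"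
  if t: "0 < t" for t
 proof -
  let ?v = "t powr b * V" and ?e = "norm (iexp (a * t) - 1)"
  have v: "0 < ?v" using t V by simp
  have "1 + Re c * ?v <= exp (Re c * ?v)" by (rule exp_ge_add_one_self)
  then have "Re c * ?v <= exp (Re c * ?v)" by linarith
  then have "Re c * ?v * exp (- (Re c * ?v)) <= 1"
   by (simp add: exp_minus field_simps)
  then have l: "?v * exp (- (Re c * ?v)) <= 1 / Re c" using c by (simp add: field_simps)
  have "t powr (b - 1) * t = t powr b" using t by (simp add: powr_diff)
  then have "b * t powr (b - 1) * V = b / t * ?v" using t by (simp add: field_simps)
  then have E'eq: "norm (E' t) = norm c * (b / t * ?v) * exp (- (Re c * ?v))"
  proof -
   have "norm (complex_of_real (b / t * ?v)) = b / t * ?v" using t b v by (subst norm_of_real) simp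
   then show ?thesis unfolding E'_def norm_mult[of "c * _"] norm_mult[of c] nE[OF t]
    using \<open>b * t powr (b - 1) * V = b / t * ?v\<close> by (simp only:)
  qed
  have "norm (E' t) * ?e <= norm (E' t) * (a * t)"
   using iex[of "a * t"] a t by (intro mult_left_mono) auto
  also have "... = a * b * norm c * (?v * exp (- (Re c * ?v)))"
   unfolding E'eq using t by (simp add: field_simps)
  also have "... <= a * b * norm c * (1 / Re c)"
   using a b by (intro mult_left_mono l) auto
  finally have 1: "norm (E' t) * ?e <= a * b * norm c / Re c" by simp
  have "norm ((g' t * E t - g t * E' t) * (iexp (a * t) - 1)) <= (norm (g' t * E t) + norm (g t * E' t)) * ?e"
   unfolding norm_mult[of _ "iexp (a * t) - 1"] by (intro mult_right_mono norm_triangle_ineq4) auto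
  also have "... = norm (g' t) * norm (E t) * ?e + norm (g t) * (norm (E' t) * ?e)"
   by (simp only: norm_mult ring_distribs mult_ac)
  also have "... <= norm (g' t) * 1 * 2 + norm (g t) * (a * b * norm c / Re c)"
   by (intro add_mono mult_mono mult_left_mono nE1 t ie2 1) auto
  finally show ?thesis by (simp add: mult_ac)
 qed
 then show "t > 0 ==> norm ((g' t * E t - g t * E' t) * (iexp (a * t) - 1)) <= 2 * norm (g' t) + a * b * norm c / Re c * norm (g t)" .
 have Em: "E \<in> borel_measurable borel" "E' \<in> borel_measurable borel"
  unfolding E_def E'_def by measurable
 let ?J = "%t. (g' t * E t - g t * E' t) * (iexp (a * t) - 1)"
 let ?I = "%t. g t * iexp (a * t) * E t"
 have iJ: "set_integrable lborel {0<..} ?J"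
 proof -
  have "set_integrable lborel {0<..} (%t. 2 * norm (g' t) + a * b * norm c / Re c * norm (g t))"
   using set_integrable_norm[OF g] set_integrable_norm[OF g'] by (intro set_integral_add set_integrable_mult_right) auto
  then show ?thesis unfolding set_integrable_def
  proof (rule integrable_bound)
   show "AE t in lborel. norm (indicat_real {0<..} t *\<^sub>R ?J t) <= norm (indicat_real {0<..} t *\<^sub>R (2 * norm (g' t) + a * b * norm c / Re c * norm (g t)))"
   proof (rule AE_I2)
    fix t :: real
    show "norm (indicat_real {0<..} t *\<^sub>R ?J t) <= norm (indicat_real {0<..} t *\<^sub>R (2 * norm (g' t) + a * b * norm c / Re c * norm (g t)))"
     using bnd[of t] by (cases "0 < t") (auto intro: order_trans[OF _ abs_ge_self])
   qed
  qed (use Em in measurable)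
 qed
 have iI: "set_integrable lborel {0<..} ?I"
  using g unfolding set_integrable_def
 proof (rule integrable_bound)
  show "AE t in lborel. norm (indicat_real {0<..} t *\<^sub>R ?I t) <= norm (indicat_real {0<..} t *\<^sub>R g t)"
  proof (rule AE_I2)
   fix t :: real
   have "norm (g t) * norm (E t) <= norm (g t) * 1" if "0 < t"
    by (intro mult_left_mono nE1 that) auto
   then show "norm (indicat_real {0<..} t *\<^sub>R ?I t) <= norm (indicat_real {0<..} t *\<^sub>R g t)"
    by (cases "0 < t") (auto simp: norm_mult)
  qed
 qed (use Em in measurable)
 let ?F = "%t. g t * (E t * ((iexp (a * t) - 1) / (\<i> * of_real a)))"
 have "(LBINT t:{0<..}. ?J t / (\<i> * of_real a) + ?I t) = 0 - 0"
 proof (rule integral_FTC_Ioi[where F="?F"])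
  fix t :: real assume t: "0 < t"
  have "((%t. c * complex_of_real (t powr b * V)) has_vector_derivative c * of_real (b * t powr (b - 1) * V)) (at t)"
   using t by (intro has_vector_derivative_mult_right has_vector_derivative_of_real)
    (auto intro!: derivative_eq_intros simp: has_real_derivative_iff_has_vector_derivative[symmetric])
  then have "((%t. - (c * complex_of_real (t powr b * V))) has_vector_derivative - (c * of_real (b * t powr (b - 1) * V))) (at t)"
   by (rule has_vector_derivative_minus)
  from field_vector_diff_chain_at[OF this DERIV_exp]
  have dE: "(E has_vector_derivative - E' t) (at t)"
   unfolding E_def E'_def by (simp add: o_def)
  have di: "((%t. (iexp (a * t) - 1) / (\<i> * of_real a)) has_vector_derivative iexp (a * t)) (at t)"
  proof -
   have "((%z. (exp (\<i> * of_real a * z) - 1) / (\<i> * of_real a)) has_field_derivative exp (\<i> * of_real a * of_real t)) (at (of_real t))"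
    using a by (auto intro!: derivative_eq_intros)
   from has_vector_derivative_real_field[OF this] show ?thesis by (simp add: mult.assoc)
  qed
  have "(?F has_vector_derivative g t * (E t * iexp (a * t) + - E' t * ((iexp (a * t) - 1) / (\<i> * of_real a)))
   + g' t * (E t * ((iexp (a * t) - 1) / (\<i> * of_real a)))) (at t)"
   by (rule has_vector_derivative_mult[OF der[OF t] has_vector_derivative_mult[OF dE di]])
  moreover have "g t * (E t * iexp (a * t) + - E' t * ((iexp (a * t) - 1) / (\<i> * of_real a)))
   + g' t * (E t * ((iexp (a * t) - 1) / (\<i> * of_real a))) = ?J t / (\<i> * of_real a) + ?I t"
   using a by (simp add: divide_simps) (simp add: algebra_simps)
  ultimately show "(?F has_vector_derivative ?J t / (\<i> * of_real a) + ?I t) (at t)"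
   by (simp only:)
  have cg: "isCont g t" by (rule has_vector_derivative_continuous[OF der[OF t]])
  have cE: "isCont E t" by (rule has_vector_derivative_continuous[OF dE])
  have "isCont E' t" unfolding E'_def using t by (intro continuous_intros cE) auto
  then show "isCont (%t. ?J t / (\<i> * of_real a) + ?I t) t"
   using a by (intro continuous_intros cont[OF t] cg cE) auto
 next
  show "set_integrable lborel {0<..} (%t. ?J t / (\<i> * of_real a) + ?I t)"
   using iJ iI by (intro set_integral_add set_integrable_divide) auto
  have nF: "norm (?F t) <= B * (norm (E t) * (norm (iexp (a * t) - 1) / a))" if "0 < t" for t
  proof -
   have "norm (?F t) = norm (g t) * (norm (E t) * (norm (iexp (a * t) - 1) / a))"
    using a by (simp only: norm_mult norm_divide) simp
   then show ?thesis using mult_right_mono[OF B[OF that], of "norm (E t) * (norm (iexp (a * t) - 1) / a)"] a by simp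
  qed
  have B0: "0 <= B" using order_trans[OF norm_ge_zero B, of 1] by simp
  show "(?F ---> 0) (at_right 0)"
  proof (rule Lim_null_comparison)
   show "((%t. B * t) ---> 0) (at_right 0)"
    by (intro tendsto_mult_right_zero tendsto_ident_at)
   show "\<forall>\<^sub>F t in at_right 0. norm (?F t) <= B * t"
    using eventually_at_right_less[of 0]
   proof eventually_elim
    case (elim t)
    have "norm (E t) * (norm (iexp (a * t) - 1) / a) <= 1 * t"
     using iex[of "a * t"] a elim by (intro mult_mono nE1) (auto simp: field_simps)
    then have "B * (norm (E t) * (norm (iexp (a * t) - 1) / a)) <= B * t"
     using B0 by (intro mult_left_mono) auto
    then show ?case using nF[OF elim] by simp
   qed
  qed
  show "(?F ---> 0) at_top"
  proof (rule Lim_null_comparison)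
   have "LIM t at_top. t powr b :> at_top" using b by (rule powr_at_top)
   then have "LIM t at_top. - (Re c * V) * t powr b :> at_bot"
    using c V by (intro filterlim_tendsto_neg_mult_at_bot[OF tendsto_const]) auto
   then have "((%t. exp (- (Re c * V) * t powr b)) ---> 0) at_top"
    by (rule filterlim_compose[OF exp_at_bot])
   then show "((%t. B * (2 / a) * exp (- (Re c * V) * t powr b)) ---> 0) at_top"
    by (rule tendsto_mult_right_zero)
   show "\<forall>\<^sub>F t in at_top. norm (?F t) <= B * (2 / a) * exp (- (Re c * V) * t powr b)"
    using eventually_gt_at_top[of 0]
   proof eventually_elim
    case (elim t)
    have "norm (E t) = exp (- (Re c * V) * t powr b)" unfolding nE[OF elim] by (simp add: mult_ac)
    moreover have "norm (iexp (a * t) - 1) / a <= 2 / a" using ie2[of "a * t"] a by (intro divide_right_mono) auto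
    ultimately have "norm (E t) * (norm (iexp (a * t) - 1) / a) <= exp (- (Re c * V) * t powr b) * (2 / a)"
     using a by (intro mult_mono) auto
    then have "B * (norm (E t) * (norm (iexp (a * t) - 1) / a)) <= B * (exp (- (Re c * V) * t powr b) * (2 / a))"
     using B0 by (intro mult_left_mono) auto
    also have "... = B * (2 / a) * exp (- (Re c * V) * t powr b)" by (simp add: mult_ac)
    finally show ?case using nF[OF elim] by simp
   qed
  qed
 qed
 moreover have "(LBINT t:{0<..}. ?J t / (\<i> * of_real a) + ?I t)
  = (LBINT t:{0<..}. ?J t / (\<i> * of_real a)) + (LBINT t:{0<..}. ?I t)"
  by (rule set_integral_add(2)) (use iJ iI in \<open>auto intro: set_integrable_divide\<close>)
 moreover have "(LBINT t:{0<..}. ?J t / (\<i> * of_real a)) = (LBINT t:{0<..}. ?J t) / (\<i> * of_real a)"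
  by (rule set_integral_divide_zero)
 ultimately have e: "(LBINT t:{0<..}. ?I t) = - ((LBINT t:{0<..}. ?J t) / (\<i> * of_real a))"
  by (simp only: add_eq_0_iff diff_self)
 show "(LBINT t:{0<..}. ?I t) = \<i> / of_real a * (LBINT t:{0<..}. ?J t)"
  unfolding e using a by (simp add: field_simps)
qed

section \<open>Riemann sums\<close>

text \<open>Ceilings sample at right endpoints: on (r n, r (n + 1)] the step function has the value
  \<open>a (Suc n)\<close>, so index 0 never occurs on the open half-line and the series becomes an
  integral over a fixed domain.\<close>

lemma sum_eq_integral_ceiling:
 fixes a :: "nat => 'b::{banach, second_countable_topology}"
 assumes r: "0 < r" and s: "summable (%n. norm (a (Suc n)))"
 shows "set_integrable lborel {0<..} (%x. a (nat \<lceil>x / r\<rceil>))"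
  and "(LBINT x:{0<..}. a (nat \<lceil>x / r\<rceil>)) = r *\<^sub>R (\<Sum>n. a (Suc n))"
proof -
 let ?f = "%n x. indicator {r * real n<..r * real (Suc n)} x *\<^sub>R a (Suc n)"
 have eq: "?f n x = (if n = nat \<lceil>x / r\<rceil> - 1 \<and> 0 < x then a (nat \<lceil>x / r\<rceil>) else 0)" for n x
 proof -
  have "(r * real n < x \<and> x <= r * real (Suc n)) \<longleftrightarrow> (n = nat \<lceil>x / r\<rceil> - 1 \<and> 0 < x)"
  proof
   assume h: "r * real n < x \<and> x <= r * real (Suc n)"
   then have "\<lceil>x / r\<rceil> = int (Suc n)"
    using r by (intro ceiling_unique) (auto simp: field_simps)
   moreover have "0 < x" using h r by (meson le_less_trans mult_nonneg_nonneg less_imp_le of_nat_0_le_iff)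
   ultimately show "n = nat \<lceil>x / r\<rceil> - 1 \<and> 0 < x" by simp
  next
   assume h: "n = nat \<lceil>x / r\<rceil> - 1 \<and> 0 < x"
   then have p: "0 < x / r" using r by simp
   then have "0 < \<lceil>x / r\<rceil>" by simp
   then have e: "\<lceil>x / r\<rceil> = int n + 1" using h by linarith
   have "of_int \<lceil>x / r\<rceil> - 1 < x / r \<and> x / r <= of_int \<lceil>x / r\<rceil>" using ceiling_correct by blast
   then show "r * real n < x \<and> x <= r * real (Suc n)"
    unfolding e using r by (auto simp: field_simps)
  qed
  moreover have "Suc (nat \<lceil>x / r\<rceil> - 1) = nat \<lceil>x / r\<rceil>" if "0 < x"
   using that r by (simp add: divide_pos_pos Suc_pred)
  ultimately show ?thesis by (auto simp: indicator_def)
 qed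
 have fin: "finite {n. ?f n x ~= 0}" for x
  unfolding eq by (rule finite_subset[of _ "{nat \<lceil>x / r\<rceil> - 1}"]) auto
 have sum: "(\<Sum>n. ?f n x) = indicator {0<..} x *\<^sub>R a (nat \<lceil>x / r\<rceil>)" for x
 proof -
  have "(\<Sum>n. ?f n x) = (\<Sum>n\<in>{nat \<lceil>x / r\<rceil> - 1}. ?f n x)"
   unfolding eq by (rule suminf_finite) auto
  then show ?thesis unfolding eq by (simp add: indicator_def)
 qed
 have int: "integrable lborel (?f n)" for n using r by (intro integrable_scaleR_left integrable_real_indicator) (auto simp: algebra_simps)
 have val: "integral\<^sup>L lborel (?f n) = r *\<^sub>R a (Suc n)" for n
  using r by (simp add: algebra_simps)
 have ae: "AE x in lborel. summable (%n. norm (?f n x))"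
  by (intro AE_I2 summable_finite[OF fin]) auto
 have nval: "(LBINT x. norm (?f n x)) = r * norm (a (Suc n))" for n
  using r by (simp add: algebra_simps)
 have sm: "summable (%n. \<integral>x. norm (?f n x) \<partial>lborel)"
  unfolding nval by (rule summable_mult[OF s])
 show "set_integrable lborel {0<..} (%x. a (nat \<lceil>x / r\<rceil>))"
  unfolding set_integrable_def using integrable_suminf[OF int ae sm] unfolding sum .
 have "(LBINT x:{0<..}. a (nat \<lceil>x / r\<rceil>)) = (\<Sum>n. r *\<^sub>R a (Suc n))"
  unfolding set_lebesgue_integral_def using integral_suminf[OF int ae sm] unfolding sum val .
 also have "... = r *\<^sub>R (\<Sum>n. a (Suc n))"
  by (rule suminf_scaleR_right[symmetric, OF summable_norm_cancel[OF s]])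
 finally show "(LBINT x:{0<..}. a (nat \<lceil>x / r\<rceil>)) = r *\<^sub>R (\<Sum>n. a (Suc n))" .
qed

lemma min_powr_eq:
 fixes g x :: real
 assumes "0 < x"
 shows "min 1 (x powr (- g)) = x powr (- g) * min 1 (x powr g)"
 using assms by (auto simp: min_def powr_minus field_simps)

text \<open>The step functions of \<open>sum_eq_integral_ceiling\<close> are sampled at points not
  smaller than x, so the decreasing bound evaluated at x dominates them for every \<open>r\<close>.
  The hypothesis \<open>lim\<close> is phrased along sequences because convergence in law will
  deliver it in that form.\<close>

lemma riemann_sum_limit:
 fixes A :: "nat => real => 'b::{banach, second_countable_topology}" and F :: "real => 'b"
 assumes g: "1 < g"
  and bound: "!!n r. 0 < r ==> 1 <= n ==> norm (A n r) <= K * min 1 ((r * real n) powr (- g))"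
  and lim: "!!n r x. 0 < x ==> (!!k. 0 < r k) ==> r ----> 0 ==> (%k. r k * real (n k)) ----> x
    ==> filterlim n at_top sequentially ==> (%k. A (n k) (r k)) ----> F x"
 defines "S \<equiv> LBINT x:{0<..}. min 1 (x powr (- g))"
 shows "!!r. 0 < r ==> summable (%n. norm (A (Suc n) r))"
  and "!!r. 0 < r ==> r * (\<Sum>n. norm (A (Suc n) r)) <= K * S"
  and "set_integrable lborel {0<..} F"
  and "((%r. r *\<^sub>R (\<Sum>n. A (Suc n) r)) ---> (LBINT x:{0<..}. F x)) (at_right 0)"
  and "!!x. 0 < x ==> norm (F x) <= K * min 1 (x powr (- g))"
proof -
 have "0 <= K * min 1 ((1 * real 1) powr (- g))" by (rule order_trans[OF norm_ge_zero bound]) auto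
 then have K0: "0 <= K" by simp
 have "set_integrable lborel {0<..} (%x. x powr (- g) * min 1 (x powr g))"
  using g by (intro set_integrable_powr_min) auto
 then have iS: "set_integrable lborel {0<..} (%x. min 1 (x powr (- g)))"
  by (rule set_integrable_cong[THEN iffD1, rotated -1]) (auto simp: min_powr_eq)
 show sm: "summable (%n. norm (A (Suc n) r))" if r: "0 < r" for r
 proof (rule summable_comparison_test)
  show "summable (%n. K * r powr (- g) * (real (Suc n)) powr (- g))"
   using g summable_Suc_iff[of "%n. real n powr (- g)"] by (intro summable_mult) (simp add: summable_real_powr_iff)
  show "\<exists>N. \<forall>n\<ge>N. norm (norm (A (Suc n) r)) <= K * r powr (- g) * (real (Suc n)) powr (- g)"
  proof (intro exI allI impI)
   fix n :: nat
   have "norm (A (Suc n) r) <= K * min 1 ((r * real (Suc n)) powr (- g))" using r by (intro bound) auto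
   also have "... <= K * (r * real (Suc n)) powr (- g)" using K0 by (intro mult_left_mono) auto
   also have "... = K * r powr (- g) * (real (Suc n)) powr (- g)" using r by (simp add: powr_mult del: of_nat_Suc)
   finally show "norm (norm (A (Suc n) r)) <= K * r powr (- g) * (real (Suc n)) powr (- g)" by simp
  qed
 qed
 have ceil: "x <= r * real (nat \<lceil>x / r\<rceil>)" "r * real (nat \<lceil>x / r\<rceil>) <= x + r" "1 <= nat \<lceil>x / r\<rceil>" if "0 < x" "0 < r" for x r
 proof -
  have p: "0 < \<lceil>x / r\<rceil>" using that by simp
  have e: "real (nat \<lceil>x / r\<rceil>) = of_int \<lceil>x / r\<rceil>" using p by simp
  have "x / r <= of_int \<lceil>x / r\<rceil>" "of_int \<lceil>x / r\<rceil> <= x / r + 1" by linarith+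
  then have "r * (x / r) <= r * of_int \<lceil>x / r\<rceil>" "r * of_int \<lceil>x / r\<rceil> <= r * (x / r + 1)"
   using that by (auto intro!: mult_left_mono simp del: times_divide_eq_right)
  then show "x <= r * real (nat \<lceil>x / r\<rceil>)" "r * real (nat \<lceil>x / r\<rceil>) <= x + r"
   unfolding e using that by (auto simp: distrib_left)
  show "1 <= nat \<lceil>x / r\<rceil>" using p by linarith
 qed
 have bc: "norm (A (nat \<lceil>x / r\<rceil>) r) <= K * min 1 (x powr (- g))" if "0 < x" "0 < r" for x r
 proof -
  have "norm (A (nat \<lceil>x / r\<rceil>) r) <= K * min 1 ((r * real (nat \<lceil>x / r\<rceil>)) powr (- g))"
   by (intro bound ceil that)
  also have "(r * real (nat \<lceil>x / r\<rceil>)) powr (- g) <= x powr (- g)"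
   using ceil(1)[OF that] that g by (intro powr_mono2') auto
  then have "K * min 1 ((r * real (nat \<lceil>x / r\<rceil>)) powr (- g)) <= K * min 1 (x powr (- g))"
   using K0 by (intro mult_left_mono) auto
  finally show ?thesis .
 qed
 show "r * (\<Sum>n. norm (A (Suc n) r)) <= K * S" if r: "0 < r" for r
 proof -
  have sm': "summable (%n. norm (norm (A (Suc n) r)))" using sm[OF r] by simp
  have "r * (\<Sum>n. norm (A (Suc n) r)) = (LBINT x:{0<..}. norm (A (nat \<lceil>x / r\<rceil>) r))"
   using sum_eq_integral_ceiling(2)[OF r, of "%n. norm (A n r)"] sm' by simp
  also have "... <= (LBINT x:{0<..}. K * min 1 (x powr (- g)))"
   by (rule set_integral_mono) (use sum_eq_integral_ceiling(1)[OF r, of "%n. norm (A n r)"] sm' iS bc r in \<open>auto intro: set_integrable_mult_right\<close>)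
  also have "... = K * S" unfolding S_def by (rule set_integral_mult_right)
  finally show ?thesis .
 qed
 let ?s = "%r x. indicator {0<..} x *\<^sub>R A (nat \<lceil>x / r\<rceil>) r"
 let ?w = "%x. indicator {0<..} x *\<^sub>R (K * min 1 (x powr (- g)))"
 have wi: "integrable lborel ?w"
  unfolding set_integrable_def[symmetric] by (rule set_integrable_mult_right) (use iS in auto)
 have pw: "(%k. A (nat \<lceil>x / r k\<rceil>) (r k)) ----> F x" if x: "0 < x" and r: "!!k. 0 < r k" "r ----> 0" for x r
 proof (rule lim[OF x r])
  show l: "(%k. r k * real (nat \<lceil>x / r k\<rceil>)) ----> x"
  proof (rule real_tendsto_sandwich)
   show "\<forall>\<^sub>F k in sequentially. x <= r k * real (nat \<lceil>x / r k\<rceil>)" using ceil(1)[OF x r(1)] by simp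
   show "\<forall>\<^sub>F k in sequentially. r k * real (nat \<lceil>x / r k\<rceil>) <= x + r k" using ceil(2)[OF x r(1)] by simp
   show "(%k. x + r k) ----> x" using tendsto_add[OF tendsto_const r(2), of x] by simp
  qed simp
  have "filterlim (%k. x / r k) at_top sequentially"
   unfolding divide_inverse
   by (rule filterlim_tendsto_pos_mult_at_top[OF tendsto_const x])
    (use r less_imp_neq[OF r(1)] in \<open>auto simp: filterlim_at intro!: filterlim_compose[OF filterlim_inverse_at_top_right] always_eventually\<close>)
  then have "filterlim (%k. real (nat \<lceil>x / r k\<rceil>)) at_top sequentially"
  proof (rule filterlim_at_top_mono)
   show "\<forall>\<^sub>F k in sequentially. x / r k <= real (nat \<lceil>x / r k\<rceil>)"
    by (intro always_eventually allI) linarith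
  qed
  then show "filterlim (%k. nat \<lceil>x / r k\<rceil>) at_top sequentially"
   by (simp add: filterlim_sequentially_iff_filterlim_real)
 qed
 have ms: "?s r \<in> borel_measurable lborel" if "0 < r" for r
  using sum_eq_integral_ceiling(1)[OF that, of "%n. A n r"] sm[OF that] unfolding set_integrable_def by auto
 define r0 where "r0 k = 1 / real (Suc k)" for k
 have r0: "0 < r0 k" for k by (simp add: r0_def)
 have r0l: "r0 ----> 0" unfolding r0_def by (rule LIMSEQ_Suc[OF lim_1_over_n])
 have aeL: "AE x in lborel. (%k. ?s (r k) x) ----> indicator {0<..} x *\<^sub>R F x" if r: "!!k. 0 < r k" "r ----> 0" for r
 proof (rule AE_I2)
  fix x :: real show "(%k. ?s (r k) x) ----> indicator {0<..} x *\<^sub>R F x"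
   using pw[of x r] r by (cases "0 < x") auto
 qed
 have mF: "(%x. indicator {0<..} x *\<^sub>R F x) \<in> borel_measurable lborel"
 proof (rule borel_measurable_LIMSEQ_metric)
  show "?s (r0 k) \<in> borel_measurable lborel" for k by (rule ms[OF r0])
  fix x :: real show "(%k. ?s (r0 k) x) ----> indicator {0<..} x *\<^sub>R F x"
   using pw[of x r0] r0 r0l by (cases "0 < x") auto
 qed
 have dom: "AE x in lborel. norm (?s r x) <= ?w x" if "0 < r" for r
 proof (rule AE_I2)
  fix x :: real show "norm (?s r x) <= ?w x"
   using bc[of x r] that by (cases "0 < x") auto
 qed
 show "set_integrable lborel {0<..} F"
  unfolding set_integrable_def
  by (rule integrable_dominated_convergence[OF mF ms[OF r0] wi aeL[OF r0 r0l] dom[OF r0]])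
 show "((%r. r *\<^sub>R (\<Sum>n. A (Suc n) r)) ---> (LBINT x:{0<..}. F x)) (at_right 0)"
  unfolding tendsto_at_iff_sequentially
 proof (intro allI impI)
  fix r :: "nat => real" assume h: "\<forall>i. r i \<in> {0<..} - {0}" and l: "r ----> 0"
  then have r: "0 < r k" for k by auto
  have "(%k. integral\<^sup>L lborel (?s (r k))) ----> integral\<^sup>L lborel (%x. indicator {0<..} x *\<^sub>R F x)"
   by (rule integral_dominated_convergence[OF mF ms[OF r] wi aeL[OF r l] dom[OF r]])
  then show "((%r. r *\<^sub>R (\<Sum>n. A (Suc n) r)) \<circ> r) ----> (LBINT x:{0<..}. F x)"
   unfolding set_lebesgue_integral_def[symmetric] sum_eq_integral_ceiling(2)[OF r sm[OF r]] by (simp add: o_def)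
 qed
 show "norm (F x) <= K * min 1 (x powr (- g))" if "0 < x" for x
  by (rule LIMSEQ_le_const2[OF tendsto_norm[OF pw[OF that r0 r0l]]]) (use bc[OF that r0] in auto)
qed

text \<open>The substitution y = x^\<eta> W turns the integral into
  \<open>cGam (1 / \<eta> + 1) c\<close>. The Jacobian produces W^(- 1 / \<eta>), the source of the
  negative moment in the final constant.\<close>

lemma integral_linear_exp_power:
 fixes c :: complex
 assumes \<eta>: "0 < \<eta>" and c: "0 < Re c" and W: "0 < W"
 defines "h \<equiv> %x. c * of_real (x powr \<eta> * W) * exp (- (c * of_real (x powr \<eta> * W)))"
 shows "set_integrable lborel {0<..} h"
  and "(LBINT x:{0<..}. h x) = of_real (W powr (- 1 / \<eta>)) * (of_real (Gamma (1 + 1 / \<eta>) / \<eta>) * c powr (- of_real (1 / \<eta>)))"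
proof -
 obtain C where C: "0 < C" "!!v. 0 < v ==> norm (c * of_real v * exp (- (c * of_real v))) <= C * min 1 (v powr (- (2 / \<eta>)))"
  using norm_linear_exp_le[of "2 / \<eta>" c] \<eta> c by (metis divide_pos_pos zero_less_numeral)
 have bnd: "norm (h x) <= C * (max 1 (W powr (- (2 / \<eta>)))) * (x powr (- 2) * min 1 (x powr 2))" if x: "0 < x" for x
 proof -
  have "norm (h x) <= C * min 1 ((x powr \<eta> * W) powr (- (2 / \<eta>)))"
   unfolding h_def using C(2)[of "x powr \<eta> * W"] x W by simp
  also have "(x powr \<eta> * W) powr (- (2 / \<eta>)) = x powr (- 2) * W powr (- (2 / \<eta>))"
   using x W \<eta> by (simp add: powr_mult powr_powr)
  also have "min 1 (x powr (- 2) * W powr (- (2 / \<eta>))) <= max 1 (W powr (- (2 / \<eta>))) * min 1 (x powr (- 2))"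
  proof -
   have "x powr (- 2) * W powr (- (2 / \<eta>)) <= x powr (- 2) * max 1 (W powr (- (2 / \<eta>)))"
    by (intro mult_left_mono) auto
   then show ?thesis by (auto simp: min_def mult.commute)
  qed
  also have "min 1 (x powr (- 2)) = x powr (- 2) * min 1 (x powr 2)" by (rule min_powr_eq[OF x])
  finally show ?thesis using C(1) by (simp add: mult_ac)
 qed
 have [measurable]: "h \<in> borel_measurable borel" unfolding h_def by measurable
 show ih: "set_integrable lborel {0<..} h"
 proof -
  have "set_integrable lborel {0<..} (%x. C * (max 1 (W powr (- (2 / \<eta>)))) * (x powr (- 2) * min 1 (x powr 2)))"
   using set_integrable_powr_min[of 2 2] by (intro set_integrable_mult_right) auto
  then show ?thesis unfolding set_integrable_def
  proof (rule integrable_bound)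
   show "AE x in lborel. norm (indicat_real {0<..} x *\<^sub>R h x) <= norm (indicat_real {0<..} x *\<^sub>R (C * (max 1 (W powr (- (2 / \<eta>)))) * (x powr (- 2) * min 1 (x powr 2))))"
   proof (rule AE_I2)
    fix x :: real
    show "norm (indicat_real {0<..} x *\<^sub>R h x) <= norm (indicat_real {0<..} x *\<^sub>R (C * (max 1 (W powr (- (2 / \<eta>)))) * (x powr (- 2) * min 1 (x powr 2))))"
     using bnd[of x] by (cases "0 < x") (auto intro: order_trans[OF _ abs_ge_self])
   qed
  qed measurable
 qed
 \<comment> \<open>\<open>?k\<close> collects c and the constants of the Jacobian; the exponent in
   \<open>?f\<close> is left as \<open>1 / \<eta> + 1 - 1\<close> to match the definition of
   \<open>cGam\<close>.\<close>
 let ?k = "c * of_real (W powr (- 1 / \<eta>)) / of_real \<eta>"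
 let ?f = "%y. ?k * (complex_of_real (y powr (1 / \<eta> + 1 - 1)) * exp (- (c * of_real y)))"
 let ?g = "%x. x powr \<eta> * W" and ?g' = "%x. \<eta> * x powr (\<eta> - 1) * W"
 have fg: "?g' x *\<^sub>R ?f (?g x) = h x" if x: "0 < x" for x
 proof -
  have "(x powr \<eta> * W) powr (1 / \<eta>) = x * W powr (1 / \<eta>)"
   using x W \<eta> by (simp add: powr_mult powr_powr)
  moreover have "W powr (- 1 / \<eta>) * W powr (1 / \<eta>) = 1"
   using W by (simp add: powr_add[symmetric])
  moreover have "x powr (\<eta> - 1) * x = x powr \<eta>" using x by (simp add: powr_diff)
  ultimately have "?g' x * (W powr (- 1 / \<eta>) / \<eta> * (x powr \<eta> * W) powr (1 / \<eta>)) = x powr \<eta> * W"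
   using \<eta> by (simp add: field_simps)
  then have e: "complex_of_real (x powr \<eta> * W) = of_real (?g' x) * (of_real (W powr (- 1 / \<eta>)) / of_real \<eta> * of_real ((x powr \<eta> * W) powr (1 / \<eta>)))"
   by (metis (mono_tags, lifting) of_real_divide of_real_mult)
  have "h x = c * (of_real (?g' x) * (of_real (W powr (- 1 / \<eta>)) / of_real \<eta> * of_real ((x powr \<eta> * W) powr (1 / \<eta>)))) * exp (- (c * of_real (x powr \<eta> * W)))"
   unfolding h_def by (subst e) (rule refl)
  then show ?thesis by (simp add: scaleR_conv_of_real mult_ac)
 qed
 have iF: "set_integrable lborel {0<..} ?f"
  using \<eta> c by (intro set_integrable_mult_right set_integrable_cGam) (auto intro: add_pos_pos)
 have "(LBINT x=ereal 0..\<infinity>. ?f x) = (LBINT x=ereal 0..\<infinity>. ?g' x *\<^sub>R ?f (?g x))"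
 proof (rule interval_integral_substitution_integrable)
  show "ereal 0 < \<infinity>" by simp
  show "DERIV ?g x :> ?g' x" if "ereal 0 < ereal x" for x
   using that by (auto intro!: derivative_eq_intros)
  show "isCont ?f (?g x)" if "ereal 0 < ereal x" for x
   using that W by (intro continuous_intros) auto
  show "isCont ?g' x" if "ereal 0 < ereal x" for x
   using that by (intro continuous_intros) auto
  show "0 <= ?g' x" for x using \<eta> W by auto
  have "(?g ---> 0 powr \<eta> * W) (at_right 0)"
   using \<eta> by (intro tendsto_mult tendsto_powr' tendsto_const tendsto_ident_at) (auto simp: eventually_at_filter)
  then have "(?g ---> 0) (at_right 0)" by simp
  then show "((ereal \<circ> ?g \<circ> real_of_ereal) ---> ereal 0) (at_right (ereal 0))"
   by (simp add: ereal_tendsto_simps del: zero_ereal_def[symmetric] ereal_eq_0)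
  have "LIM x at_top. ?g x :> at_top"
   using filterlim_tendsto_pos_mult_at_top[OF tendsto_const W powr_at_top[OF \<eta>]] by (simp add: mult.commute)
  then show "((ereal \<circ> ?g \<circ> real_of_ereal) ---> \<infinity>) (at_left \<infinity>)"
   by (simp add: ereal_tendsto_simps)
  show "set_integrable lborel (einterval (ereal 0) \<infinity>) (%x. ?g' x *\<^sub>R ?f (?g x))"
   unfolding einterval_eq by (rule set_integrable_cong[THEN iffD1, OF refl refl _ ih]) (use fg in auto)
  show "set_integrable lborel (einterval (ereal 0) \<infinity>) ?f"
   unfolding einterval_eq by (rule iF)
 qed
 then have "(LBINT x:{0<..}. ?g' x *\<^sub>R ?f (?g x)) = (LBINT x:{0<..}. ?f x)"
  by (simp only: interval_lebesgue_integral_def einterval_eq ereal_less_PInfty if_True less_ereal.simps less_imp_le PInfty_neq_ereal)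
 moreover have "(LBINT x:{0<..}. h x) = (LBINT x:{0<..}. ?g' x *\<^sub>R ?f (?g x))"
  by (intro set_lebesgue_integral_cong allI impI fg[symmetric]) auto
 moreover have "(LBINT x:{0<..}. ?f x) = ?k * cGam (1 / \<eta> + 1) c"
  unfolding cGam_def by (rule set_integral_mult_right)
 moreover have "cGam (1 / \<eta> + 1) c = of_real (Gamma (1 / \<eta> + 1)) * c powr (- of_real (1 / \<eta> + 1))"
  by (rule cGam_eq) (use \<eta> c in \<open>auto intro: add_pos_pos\<close>)
 ultimately have "(LBINT x:{0<..}. h x) = ?k * (of_real (Gamma (1 / \<eta> + 1)) * c powr (- of_real (1 / \<eta> + 1)))"
  by metis
 also have "c * c powr (- of_real (1 / \<eta> + 1)) = c powr (- of_real (1 / \<eta>))"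
 proof -
  have e: "- complex_of_real (1 / \<eta> + 1) = - of_real (1 / \<eta>) - 1" by simp
  show ?thesis using c unfolding e powr_diff by auto
 qed
 then have "?k * (of_real (Gamma (1 / \<eta> + 1)) * c powr (- of_real (1 / \<eta> + 1)))
  = of_real (W powr (- 1 / \<eta>)) * (of_real (Gamma (1 + 1 / \<eta>) / \<eta>) * c powr (- of_real (1 / \<eta>)))"
  by (simp add: add.commute field_simps)
 finally show "(LBINT x:{0<..}. h x) = of_real (W powr (- 1 / \<eta>)) * (of_real (Gamma (1 + 1 / \<eta>) / \<eta>) * c powr (- of_real (1 / \<eta>)))" .
qed

text \<open>Joint integrability follows from the hypothesis \<open>int\<close>. Integrating over x
  first then gives W^(- 1 / \<eta>) times a constant, so finiteness of the negative moment comes out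
  as a conclusion together with the formula.\<close>

lemma expected_linear_exp_integral:
 fixes c :: complex and W :: "'a => real"
 assumes "prob_space M" and W[measurable]: "W \<in> borel_measurable M" and pos: "AE w in M. 0 < W w"
  and \<eta>: "0 < \<eta>" and c: "0 < Re c"
  and int: "set_integrable lborel {0<..} (%x. \<integral>w. norm (c * of_real (x powr \<eta> * W w) * exp (- (c * of_real (x powr \<eta> * W w)))) \<partial>M)"
 shows "integrable M (%w. W w powr (- 1 / \<eta>))"
  and "(LBINT x:{0<..}. \<integral>w. c * of_real (x powr \<eta> * W w) * exp (- (c * of_real (x powr \<eta> * W w))) \<partial>M)
   = of_real (LINT w|M. W w powr (- 1 / \<eta>)) * (of_real (Gamma (1 + 1 / \<eta>) / \<eta>) * c powr (- of_real (1 / \<eta>)))"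
proof -
 interpret prob_space M by fact
 interpret P: pair_sigma_finite lborel M ..
 let ?h = "%x w. c * of_real (x powr \<eta> * W w) * exp (- (c * of_real (x powr \<eta> * W w)))"
 let ?H = "%x w. indicator {0<..} x *\<^sub>R ?h x w"
 obtain C where C: "0 < C" "!!v. 0 < v ==> norm (c * of_real v * exp (- (c * of_real v))) <= C * min 1 (v powr (- 1))"
  using norm_linear_exp_le[of 1 c] c by (metis zero_less_one)
 have hb: "AE w in M. norm (?h x w) <= C" if "0 < x" for x
  using pos
 proof eventually_elim
  case (elim w)
  have "norm (?h x w) <= C * min 1 ((x powr \<eta> * W w) powr (- 1))" using C(2)[of "x powr \<eta> * W w"] that elim by simp
  also have "... <= C * 1" using C(1) by (intro mult_left_mono) auto
  finally show ?case by simp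
 qed
 have int2: "integrable (lborel \<Otimes>\<^sub>M M) (case_prod ?H)"
 proof (rule P.Fubini_integrable)
  show "integrable lborel (%x. \<integral>w. norm (case (x, w) of (x, w) => ?H x w) \<partial>M)"
   using int unfolding set_integrable_def
   by (rule integrable_cong[THEN iffD1, rotated -1]) (auto simp: indicator_def)
  show "AE x in lborel. integrable M (%w. case (x, w) of (x, w) => ?H x w)"
  proof (rule AE_I2)
   fix x :: real
   show "integrable M (%w. case (x, w) of (x, w) => ?H x w)"
   proof (cases "0 < x")
    case True
    then show ?thesis
     by (intro integrable_const_bound[where B=C]) (use hb[OF True] in auto)
   qed auto
  qed
 qed measurable
 let ?d = "of_real (Gamma (1 + 1 / \<eta>) / \<eta>) * c powr (- of_real (1 / \<eta>))"
 \<comment> \<open>The constant \<open>?d\<close> has to be nonzero so that it can be divided out of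
   the integrability statement.\<close>
 have "0 < 1 + 1 / \<eta>" using \<eta> by (intro add_pos_pos) auto
 then have "0 < Gamma (1 + 1 / \<eta>)" by (rule Gamma_real_pos)
 then have d0: "?d ~= 0" using \<eta> c by auto
 have val: "AE w in M. (LBINT x. ?H x w) = of_real (W w powr (- 1 / \<eta>)) * ?d"
  using pos
 proof eventually_elim
  case (elim w)
  show ?case using integral_linear_exp_power(2)[OF \<eta> c elim] unfolding set_lebesgue_integral_def .
 qed
 have "integrable M (%w. \<integral>x. ?H x w \<partial>lborel)"
  by (rule P.integrable_snd[OF int2])
 then have i: "integrable M (%w. of_real (W w powr (- 1 / \<eta>)) * ?d)"
  by (rule integrable_cong_AE_imp) (use val in \<open>auto elim: eventually_mono\<close>)
 then have "integrable M (%w. complex_of_real (W w powr (- 1 / \<eta>)) * ?d * inverse ?d)"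
  by (rule integrable_mult_left[OF _])
 then have "integrable M (%w. complex_of_real (W w powr (- 1 / \<eta>)))"
  using d0 by (simp add: mult.assoc)
 then show int3: "integrable M (%w. W w powr (- 1 / \<eta>))"
  by (simp only: complex_of_real_integrable_eq)
 have "(LBINT x:{0<..}. \<integral>w. ?h x w \<partial>M) = (LBINT x. (LINT w|M. ?H x w))"
  unfolding set_lebesgue_integral_def by (intro integral_cong) auto
 also have "... = (LINT w|M. (LBINT x. ?H x w))"
  by (rule P.Fubini_integral[OF int2, symmetric])
 also have "... = (LINT w|M. of_real (W w powr (- 1 / \<eta>)) * ?d)"
  by (rule integral_cong_AE) (use val P.integrable_snd[OF int2] in auto)
 also have "... = of_real (LINT w|M. W w powr (- 1 / \<eta>)) * ?d"
  by (simp only: integral_mult_left_zero integral_complex_of_real)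
 finally show "(LBINT x:{0<..}. \<integral>w. ?h x w \<partial>M) = of_real (LINT w|M. W w powr (- 1 / \<eta>)) * ?d" .
qed

lemma expected_halfline_ibp:
 fixes g g' :: "real => complex" and c :: complex and V :: "'a => real"
 assumes M: "prob_space M" and V[measurable]: "V \<in> borel_measurable M" and pos: "!!x. x \<in> space M ==> 0 < V x"
  and c: "0 < Re c" and b: "0 < b" and a: "0 < a"
  and der: "!!t. 0 < t ==> (g has_vector_derivative g' t) (at t)"
  and cont: "!!t. 0 < t ==> isCont g' t"
  and g: "set_integrable lborel {0<..} g" and g': "set_integrable lborel {0<..} g'"
  and gm[measurable]: "g \<in> borel_measurable borel" "g' \<in> borel_measurable borel"
  and B: "!!t. 0 < t ==> norm (g t) <= B" and g0: "(g ---> g0) (at_right 0)"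
 defines "E \<equiv> %t x. exp (- (c * of_real (t powr b * V x)))"
 defines "E' \<equiv> %t x. c * of_real (b * t powr (b - 1) * V x) * E t x"
 assumes iE': "!!t. 0 < t ==> integrable M (E' t)"
 shows "(LBINT t:{0<..}. g t * iexp (a * t) * (LINT x|M. E t x))
   = \<i> / of_real a * (LBINT t:{0<..}. (g' t * (LINT x|M. E t x) - g t * (LINT x|M. E' t x)) * (iexp (a * t) - 1))"
proof -
 interpret prob_space M by fact
 have Em[measurable]: "case_prod E \<in> borel_measurable (borel \<Otimes>\<^sub>M M)" "case_prod E' \<in> borel_measurable (borel \<Otimes>\<^sub>M M)"
  unfolding E_def E'_def by measurable
 have nE1: "norm (E t x) <= 1" if "x \<in> space M" for t x
  unfolding E_def using c pos[OF that] by simp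
 have iE: "integrable M (E t)" for t
 proof (rule integrable_const_bound[where B=1])
  show "E t \<in> borel_measurable M" unfolding E_def by measurable
 qed (use nE1 in auto)
 let ?I = "%t x. indicator {0<..} t *\<^sub>R (g t * iexp (a * t) * E t x)"
 let ?J = "%t x. indicator {0<..} t *\<^sub>R ((g' t * E t x - g t * E' t x) * (iexp (a * t) - 1))"
 have 1: "(LINT x|M. (LBINT t. ?I t x)) = (LBINT t. (LINT x|M. ?I t x))"
 proof (rule Fubini_prob_lborel(3)[OF M])
  show "integrable lborel (%t. norm (indicator {0<..} t *\<^sub>R g t))"
   using g unfolding set_integrable_def by (rule integrable_norm)
  fix t x assume w: "x \<in> space M"
  have "norm (g t) * norm (E t x) <= norm (g t) * 1"
   by (intro mult_left_mono nE1 w) auto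
  then show "norm (?I t x) <= norm (indicator {0<..} t *\<^sub>R g t)"
   by (cases "0 < t") (auto simp: norm_mult)
 qed measurable
 have 2: "(LINT x|M. (LBINT t. ?J t x)) = (LBINT t. (LINT x|M. ?J t x))"
 proof (rule Fubini_prob_lborel(3)[OF M])
  show "integrable lborel (%t. indicator {0<..} t *\<^sub>R (2 * norm (g' t) + a * b * norm c / Re c * norm (g t)))"
   using set_integrable_norm[OF g] set_integrable_norm[OF g'] unfolding set_integrable_def[symmetric]
   by (intro set_integral_add set_integrable_mult_right) auto
  fix t x assume w: "x \<in> space M"
  show "norm (?J t x) <= indicator {0<..} t *\<^sub>R (2 * norm (g' t) + a * b * norm c / Re c * norm (g t))"
   using halfline_ibp(1)[OF c b pos[OF w] a der cont g g' gm B g0, of t]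
   by (cases "0 < t") (auto simp: E_def E'_def)
 qed measurable
 have 3: "(LBINT t. ?I t x) = \<i> / of_real a * (LBINT t. ?J t x)" if w: "x \<in> space M" for x
  using halfline_ibp(2)[OF c b pos[OF w] a der cont g g' gm B g0]
  unfolding set_lebesgue_integral_def E_def E'_def .
 have "(LBINT t:{0<..}. g t * iexp (a * t) * (LINT x|M. E t x)) = (LBINT t. (LINT x|M. ?I t x))"
  unfolding set_lebesgue_integral_def by (intro integral_cong) auto
 also have "... = (LINT x|M. \<i> / of_real a * (LBINT t. ?J t x))"
  unfolding 1[symmetric] by (intro integral_cong refl 3)
 also have "... = \<i> / of_real a * (LBINT t. (LINT x|M. ?J t x))"
  unfolding 2[symmetric] by (rule integral_mult_right_zero)
 also have "(LBINT t. (LINT x|M. ?J t x))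
  = (LBINT t:{0<..}. (g' t * (LINT x|M. E t x) - g t * (LINT x|M. E' t x)) * (iexp (a * t) - 1))"
  unfolding set_lebesgue_integral_def
 proof (intro integral_cong refl)
  fix t :: real
  show "(LINT x|M. ?J t x) = indicator {0<..} t *\<^sub>R ((g' t * (LINT x|M. E t x) - g t * (LINT x|M. E' t x)) * (iexp (a * t) - 1))"
  proof (cases "0 < t")
   case True
   have "(LINT x|M. (g' t * E t x - g t * E' t x)) = g' t * (LINT x|M. E t x) - g t * (LINT x|M. E' t x)"
    using iE[of t] iE'[OF True] by simp
   then show ?thesis using True by simp
  qed simp
 qed
 finally show ?thesis .
qed

section \<open>Fourier inversion\<close>

lemma integral_iexp_Ioc:
 assumes "a <= b" "t ~= 0"
 shows "(LBINT x:{a<..b}. iexp (- (t * x))) = (iexp (- (t * a)) - iexp (- (t * b))) / (\<i> * t)"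
proof -
 let ?F = "%x. (- 1 / (\<i> * of_real t)) * iexp (- (t * x))"
 have "(LBINT x=a..b. iexp (- (t * x))) = ?F b - ?F a"
 proof (rule interval_integral_FTC_finite)
  fix x
  have "((%z. (- 1 / (\<i> * of_real t)) * exp (- (\<i> * of_real t * z))) has_field_derivative exp (- (\<i> * of_real t * of_real x))) (at (of_real x))"
   using assms by (auto intro!: derivative_eq_intros)
  from has_vector_derivative_real_field[OF this]
  have "(?F has_vector_derivative iexp (- (t * x))) (at x)" by (simp add: mult.assoc)
  then show "(?F has_vector_derivative iexp (- (t * x))) (at x within {min a b..max a b})"
   by (rule has_vector_derivative_at_within)
 qed (intro continuous_intros)
 then have "(LBINT x:{a..b}. iexp (- (t * x))) = ?F b - ?F a"
  using assms by (simp add: interval_integral_Icc)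
 moreover have "(LBINT x:{a<..b}. iexp (- (t * x))) = (LBINT x:{a..b}. iexp (- (t * x)))"
  unfolding set_lebesgue_integral_def
  by (intro integral_cong_AE) (auto intro: AE_mp[OF AE_lborel_singleton[of a]] simp: indicator_def)
 moreover have "?F b - ?F a = (iexp (- (t * a)) - iexp (- (t * b))) / (\<i> * t)"
  using assms by (simp add: divide_simps)
 ultimately show ?thesis by simp
qed

context real_distribution
begin

text \<open>Levy inversion is valid at endpoints that carry no mass. For those it bounds the mass of
  an interval by a constant times its length; shrinking such intervals around a point excludes
  atoms, and the formula then holds for all endpoints.\<close>

lemma char_inversion_interval:
 assumes int: "integrable lborel (char M)" and ab: "a <= b"
 shows "measure M {a<..b} <= (b - a) * ((LBINT t. norm (char M t)) / (2 * pi))"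
  and "complex_of_real (measure M {a<..b}) = (LBINT x:{a<..b}. (LBINT t. char M t * iexp (- (t * x))) / (2 * pi))"
proof -
 let ?k = "%a b t. (iexp (-(t * a)) - iexp (-(t * b))) / (\<i> * t) * char M t"
 have kb: "norm (?k a b t) <= (b - a) * norm (char M t)" if "a <= b" for a b t
 proof (cases "t = 0")
  case False
  have "norm ((iexp (-(t * a)) - iexp (-(t * b))) / (\<i> * t)) <= b - a"
   using Levy_Inversion_aux2[of a b "- t"] that False
   by (simp add: norm_divide norm_mult norm_minus_commute)
  then show ?thesis unfolding norm_mult by (intro mult_right_mono) auto
 qed (use that in simp)
 have ki: "integrable lborel (?k a b)" if "a <= b" for a b
 proof (rule integrable_bound)
  show "integrable lborel (%t. (b - a) * norm (char M t))" using int by auto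
  show "AE t in lborel. norm (?k a b t) <= norm ((b - a) * norm (char M t))"
   using kb[OF that] by (auto intro!: AE_I2 intro: order_trans[OF _ abs_ge_self])
 qed measurable
 have main: "complex_of_real (measure M {a<..b}) = (LBINT t. ?k a b t) / (2 * pi)"
  if ab: "a <= b" and at: "measure M {a} = 0" "measure M {b} = 0" for a b
 proof -
  have "(%n. LBINT t:{-real n<..<real n}. ?k a b t) ----> (LBINT t. ?k a b t)"
   unfolding set_lebesgue_integral_def
  proof (rule integral_dominated_convergence[where w="%t. norm (?k a b t)"])
   show "AE t in lborel. (%n. indicat_real {- real n<..<real n} t *\<^sub>R ?k a b t) ----> ?k a b t"
   proof (rule AE_I2)
    fix t :: real
    obtain N where N: "\<bar>t\<bar> < real N" using reals_Archimedean2 by blast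
    show "(%n. indicat_real {- real n<..<real n} t *\<^sub>R ?k a b t) ----> ?k a b t"
    proof (rule tendsto_eventually)
     show "\<forall>\<^sub>F n in sequentially. indicat_real {- real n<..<real n} t *\<^sub>R ?k a b t = ?k a b t"
      using eventually_ge_at_top[of N]
     proof eventually_elim
      case (elim n)
      then have "real N <= real n" by simp
      then have "\<bar>t\<bar> < real n" using N by linarith
      then show ?case by (auto simp: indicator_def)
     qed
    qed
   qed
   show "integrable lborel (%t. norm (?k a b t))" using ki[OF ab] by (rule integrable_norm)
  qed (auto simp: indicator_def)
  moreover have "(CLBINT t=-(real n)..real n. ?k a b t) = (LBINT t:{-real n<..<real n}. ?k a b t)" for n
   by (simp add: interval_lebesgue_integral_def)
  ultimately have "(%n. 1 / (2 * pi) * (CLBINT t=-(real n)..real n. ?k a b t)) ----> 1 / (2 * pi) * (LBINT t. ?k a b t)"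
   by (intro tendsto_mult tendsto_const) simp
  moreover have "(%n. 1 / (2 * pi) * (CLBINT t=-(real n)..real n. ?k a b t)) ----> measure M {a<..b}"
   using Levy_Inversion[OF ab at] by simp
  ultimately have "complex_of_real (measure M {a<..b}) = 1 / (2 * pi) * (LBINT t. ?k a b t)"
   by (blast intro: LIMSEQ_unique)
  then show ?thesis by simp
 qed
 let ?I = "LBINT t. norm (char M t)"
 have le0: "measure M {a<..b} <= (b - a) * (?I / (2 * pi))"
  if ab: "a <= b" and at: "measure M {a} = 0" "measure M {b} = 0" for a b
 proof -
  have "measure M {a<..b} = norm (complex_of_real (measure M {a<..b}))" by simp
  also have "... = norm (LBINT t. ?k a b t) / (2 * pi)" unfolding main[OF that] by (simp add: norm_divide)
  also have "norm (LBINT t. ?k a b t) <= (LBINT t. (b - a) * norm (char M t))"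
   by (rule integral_norm_bound_integral) (use ki[OF ab] int kb[OF ab] in auto)
  also have "... = (b - a) * ?I" by simp
  finally show ?thesis by (simp add: divide_right_mono)
 qed
 have cnt: "countable {x. measure M {x} ~= 0}" by (rule countable_support)
 have noatom: "measure M {x} = 0" for x
 proof (rule ccontr)
  assume n: "measure M {x} ~= 0"
  define J where "J = ?I / (2 * pi)"
  \<comment> \<open>Chosen so that \<open>2 * e * (1 + J)\<close> equals the mass of
    \<open>x\<close>; an interval of length at most \<open>2 * e\<close> has mass at most
    \<open>2 * e * J\<close>, which is strictly smaller.\<close>
  define e where "e = measure M {x} / (2 * (1 + J))"
  have J0: "0 <= J" unfolding J_def by (intro divide_nonneg_nonneg integral_nonneg) auto
  have m0: "0 < measure M {x}" using n by (simp add: zero_less_measure_iff)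
  have e0: "0 < e" unfolding e_def using m0 J0 by (intro divide_pos_pos) auto
  obtain a where a: "a \<in> {x - e<..<x}" "measure M {a} = 0"
   using open_minus_countable[OF cnt, of "{x - e<..<x}"] e0 by auto
  obtain b where b: "b \<in> {x<..<x + e}" "measure M {b} = 0"
   using open_minus_countable[OF cnt, of "{x<..<x + e}"] e0 by auto
  have "measure M {x} <= measure M {a<..b}" by (rule finite_measure_mono) (use a b in auto)
  also have "... <= (b - a) * J" unfolding J_def by (rule le0) (use a b in auto)
  also have "... <= (2 * e) * J" using a b J0 by (intro mult_right_mono) auto
  also have "... < (2 * e) * (1 + J)" using e0 by (intro mult_strict_left_mono) auto
  also have "... = measure M {x}" unfolding e_def using J0 by (simp add: field_simps)
  finally show False by simp
 qed
 show "measure M {a<..b} <= (b - a) * (?I / (2 * pi))" by (rule le0[OF ab noatom noatom])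
 let ?h = "%x t. indicator {a<..b} x *\<^sub>R (char M t * iexp (- (t * x)))"
 have "integrable (lborel \<Otimes>\<^sub>M lborel) (%(x, t). ?h x t)"
 proof (rule lborel_pair.Fubini_integrable)
  show "(%(x, t). ?h x t) \<in> borel_measurable (lborel \<Otimes>\<^sub>M lborel)" by measurable
  have "norm (char M t * iexp (- (t * x))) = norm (char M t)" for t x
   by (simp only: norm_mult norm_exp_i_times mult_1_right)
  then have "(LBINT t. norm (case (x, t) of (x, t) => ?h x t)) = indicator {a<..b} x * ?I" for x
   by (cases "x \<in> {a<..b}") (simp_all only: split norm_scaleR, simp_all)
  moreover have "integrable lborel (%x. indicator {a<..b} x * ?I)"
   using ab by (intro integrable_mult_left integrable_real_indicator) auto
  ultimately show "integrable lborel (%x. \<integral>t. norm (case (x, t) of (x, t) => ?h x t) \<partial>lborel)" by (simp only:)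
  show "AE x in lborel. integrable lborel (%t. case (x, t) of (x, t) => ?h x t)"
  proof (rule AE_I2)
   fix x :: real
   have "integrable lborel (%t. ?h x t)"
    by (rule integrable_bound[OF int]) (auto simp: norm_mult indicator_def)
   then show "integrable lborel (%t. case (x, t) of (x, t) => ?h x t)" by simp
  qed
 qed
 then have fub: "(LBINT t. (LBINT x. ?h x t)) = (LBINT x. (LBINT t. ?h x t))"
  by (intro lborel_pair.Fubini_integral) simp
 have inner: "(LBINT x. ?h x t) = ?k a b t" if "t ~= 0" for t
 proof -
  have "(LBINT x. ?h x t) = (LBINT x. char M t * (indicator {a<..b} x *\<^sub>R iexp (- (t * x))))"
   by (intro integral_cong) auto
  also have "... = char M t * (LBINT x:{a<..b}. iexp (- (t * x)))"
   unfolding set_lebesgue_integral_def by (rule integral_mult_right_zero)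
  finally show ?thesis unfolding integral_iexp_Ioc[OF ab that] by (simp add: mult.commute)
 qed
 have "(LBINT t. ?k a b t) = (LBINT t. (LBINT x. ?h x t))"
 proof (intro integral_cong_AE)
  show "AE t in lborel. ?k a b t = (LBINT x. ?h x t)"
   using AE_lborel_singleton[of 0] by eventually_elim (rule inner[symmetric])
 qed measurable
 also have "... = (LBINT x. indicator {a<..b} x *\<^sub>R (LBINT t. char M t * iexp (- (t * x))))"
  unfolding fub by (intro integral_cong) auto
 finally have "complex_of_real (measure M {a<..b}) = (LBINT x. indicator {a<..b} x *\<^sub>R (LBINT t. char M t * iexp (- (t * x)))) / (2 * pi)"
  using main[OF ab noatom noatom] by simp
 then show "complex_of_real (measure M {a<..b}) = (LBINT x:{a<..b}. (LBINT t. char M t * iexp (- (t * x))) / (2 * pi))"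
  unfolding set_integral_divide_zero unfolding set_lebesgue_integral_def .
qed

text \<open>Dominated convergence makes \<open>q\<close> continuous, so what is known about its
  integrals over intervals becomes pointwise: the real part is nonnegative and the imaginary part
  vanishes. Equality of the measures is then checked on half-open intervals.\<close>

lemma char_inversion_density:
 assumes int: "integrable lborel (char M)"
 defines "q \<equiv> %x. (LBINT t. char M t * iexp (- (t * x))) / (2 * pi)"
 shows "M = density lborel (%x. ennreal (Re (q x)))" and "!!x. 0 <= Re (q x)"
  and "!!x. q x = of_real (Re (q x))" and "q \<in> borel_measurable borel"
proof -
 have cont: "isCont q x" for x
  unfolding continuous_at_sequentially
 proof (intro allI impI)
  fix X :: "nat => real" assume X: "X ----> x"
  have "(%n. \<integral>t. char M t * iexp (- (t * X n)) \<partial>lborel) ----> (LBINT t. char M t * iexp (- (t * x)))"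
  proof (rule integral_dominated_convergence[where w="%t. norm (char M t)"])
   show "AE t in lborel. (%n. char M t * iexp (- (t * X n))) ----> char M t * iexp (- (t * x))"
    by (intro AE_I2 tendsto_intros X)
  qed (use int in \<open>auto simp: norm_mult\<close>)
  then show "(q \<circ> X) ----> q x" unfolding q_def o_def by (intro tendsto_intros) auto
 qed
 then show qm[measurable]: "q \<in> borel_measurable borel"
  by (intro borel_measurable_continuous_onI continuous_at_imp_continuous_on) auto
 have qi: "set_integrable lborel {a<..b} q" for a b
 proof (cases "a <= b")
  case True
  have "set_integrable lborel {a..b} q"
   using True cont by (intro borel_integrable_atLeastAtMost' continuous_at_imp_continuous_on) auto
  then show ?thesis by (rule set_integrable_subset) auto
 qed (simp add: set_integrable_def)
 have eq: "complex_of_real (measure M {a<..b}) = (LBINT x:{a<..b}. q x)" if "a <= b" for a b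
  using char_inversion_interval(2)[OF int that] unfolding q_def .
 have Req: "measure M {a<..b} = (LBINT x:{a<..b}. Re (q x))" and Imq: "0 = (LBINT x:{a<..b}. Im (q x))" if "a <= b" for a b
 proof -
  have "(LBINT x:{a<..b}. Re (q x)) = Re (LBINT x:{a<..b}. q x)"
   using integral_Re[OF qi[of a b, unfolded set_integrable_def]] unfolding set_lebesgue_integral_def by simp
  then show "measure M {a<..b} = (LBINT x:{a<..b}. Re (q x))" using eq[OF that] by (metis Re_complex_of_real)
  have "(LBINT x:{a<..b}. Im (q x)) = Im (LBINT x:{a<..b}. q x)"
   using integral_Im[OF qi[of a b, unfolded set_integrable_def]] unfolding set_lebesgue_integral_def by simp
  then show "0 = (LBINT x:{a<..b}. Im (q x))" using eq[OF that] by (metis Im_complex_of_real)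
 qed
 \<comment> \<open>A continuous function with nonnegative integrals over all intervals is
   nonnegative. It is applied to \<open>Re q\<close>, \<open>Im q\<close> and
   \<open>- Im q\<close>.\<close>
 have nn: "0 <= r x" if r: "!!x. isCont r x" "!!a b. a <= b ==> 0 <= (LBINT x:{a<..b}. r x)" for r :: "real => real" and x
 proof (rule ccontr)
  assume n: "\<not> 0 <= r x"
  then have "\<forall>\<^sub>F y in at x. r y < r x / 2"
   using r(1)[of x] by (intro order_tendstoD(2)[where y="r x"]) (auto simp: isCont_def)
  then obtain d where d: "0 < d" "!!y. y ~= x ==> \<bar>y - x\<bar> < d ==> r y < r x / 2"
   unfolding eventually_at dist_real_def by auto
  have ri: "set_integrable lborel {x<..x + d / 2} r"
  proof -
   have "set_integrable lborel {x..x + d / 2} r"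
    using r(1) d by (intro borel_integrable_atLeastAtMost' continuous_at_imp_continuous_on) auto
   then show ?thesis by (rule set_integrable_subset) auto
  qed
  have "(LBINT y:{x<..x + d / 2}. r y) <= (LBINT y:{x<..x + d / 2}. r x / 2)"
  proof (rule set_integral_mono[OF ri])
   show "set_integrable lborel {x<..x + d / 2} (%y. r x / 2)"
    unfolding set_integrable_def using d(1) by (intro integrable_scaleR_left integrable_real_indicator) auto
   show "r y <= r x / 2" if "y \<in> {x<..x + d / 2}" for y
    by (rule less_imp_le, rule d(2)) (use that d(1) in auto)
  qed
  also have "... = d / 2 * (r x / 2)" using d(1) by (simp add: set_lebesgue_integral_def)
  also have "... < 0" using n d(1) by (intro mult_pos_neg) auto
  finally show False using r(2)[of x "x + d / 2"] d(1) by simp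
 qed
 show re: "0 <= Re (q x)" for x
  by (rule nn[of "%x. Re (q x)"]) (use cont Req in \<open>auto intro!: continuous_intros simp: Req[symmetric]\<close>)
 have "0 <= Im (q x)" for x
  by (rule nn[of "%x. Im (q x)"]) (use cont Imq in \<open>auto intro!: continuous_intros simp: Imq[symmetric]\<close>)
 moreover have "0 <= - Im (q x)" for x
 proof (rule nn[of "%x. - Im (q x)"])
  show "isCont (%x. - Im (q x)) x" for x using cont by (intro continuous_intros) auto
  show "0 <= (LBINT x:{a<..b}. - Im (q x))" if "a <= b" for a b
   using Imq[OF that] unfolding set_lebesgue_integral_def by simp
 qed
 ultimately have "Im (q x) = 0" for x by (metis antisym neg_0_le_iff_le)
 then show "q x = of_real (Re (q x))" for x by (simp add: complex_eq_iff)
 show "M = density lborel (%x. ennreal (Re (q x)))" (is "_ = ?D")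
 proof (rule measure_eqI_generator_eq[where \<Omega>=UNIV and E="range (%(a, b). {a<..b::real})" and A="%i. {-real i<..real i}"])
  fix X assume "X \<in> range (%(a, b). {a<..b::real})"
  then obtain a b where X: "X = {a<..b}" by auto
  show "emeasure M X = emeasure ?D X"
  proof (cases "a <= b")
   case True
   have "emeasure ?D X = (\<integral>\<^sup>+x. ennreal (indicator {a<..b} x * Re (q x)) \<partial>lborel)"
    unfolding X by (subst emeasure_density) (auto intro!: nn_integral_cong simp: indicator_def)
   also have "... = ennreal (LBINT x. indicator {a<..b} x * Re (q x))"
   proof (rule nn_integral_eq_integral)
    show "integrable lborel (%x. indicator {a<..b} x * Re (q x))"
     using integrable_Re[OF qi[of a b, unfolded set_integrable_def]] by simp
   qed (use re in auto)
   also have "... = ennreal (measure M {a<..b})" unfolding Req[OF True] set_lebesgue_integral_def by simp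
   finally show ?thesis unfolding X by (simp add: emeasure_eq_measure)
  qed (simp add: X)
 next
  show "(\<Union>i. {-real i<..real i}) = UNIV"
  proof -
   have "\<exists>i. x \<in> {-real i<..real i}" for x
   proof -
    obtain i where "\<bar>x\<bar> < real i" using reals_Archimedean2 by blast
    then show ?thesis by (intro exI[of _ i]) auto
   qed
   then show ?thesis by blast
  qed
  show "sets M = sigma_sets UNIV (range (%(a, b). {a<..b::real}))"
   by (simp add: borel_sigma_sets_Ioc)
  show "sets ?D = sigma_sets UNIV (range (%(a, b). {a<..b::real}))"
   by (simp add: borel_sigma_sets_Ioc)
 qed (auto simp: Int_stable_def)
qed

end

section \<open>From Lebesgue measurable test functions to the Fourier side\<close>

lemma lebesgue_borel_modification:
 fixes h :: "real => complex"
 assumes "h \<in> borel_measurable lebesgue"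
 obtains h' where "h' \<in> borel_measurable borel" "AE x in lborel. h x = h' x"
proof -
 obtain a where a: "a \<in> borel_measurable lborel" "AE x in lborel. Re (h x) = a x"
  using completion_ex_borel_measurable_real[of "%x. Re (h x)" lborel] assms by auto
 obtain b where b: "b \<in> borel_measurable lborel" "AE x in lborel. Im (h x) = b x"
  using completion_ex_borel_measurable_real[of "%x. Im (h x)" lborel] assms by auto
 show ?thesis
 proof
  show "(%x. complex_of_real (a x) + \<i> * of_real (b x)) \<in> borel_measurable borel" using a(1) b(1) by measurable
  show "AE x in lborel. h x = complex_of_real (a x) + \<i> * of_real (b x)"
   using a(2) b(2) by eventually_elim (simp add: complex_eq_iff)
 qed
qed

lemma AE_completion_measurable:
 fixes f g :: "'a => 'b::{second_countable_topology, t2_space}"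
 assumes g: "g \<in> borel_measurable M" and ae: "AE x in M. f x = g x"
 shows "f \<in> borel_measurable (completion M)"
proof (rule measurableI)
 fix A :: "'b set" assume A: "A \<in> sets borel"
 obtain N where N: "{x \<in> space M. f x ~= g x} \<subseteq> N" "N \<in> null_sets M"
  using ae by (auto elim!: AE_E simp: null_sets_def)
 have gA: "g -` A \<inter> space M \<in> sets M" using g A by (rule measurable_sets)
 have "f -` A \<inter> space M = (g -` A \<inter> space M - N) \<union> (f -` A \<inter> space M \<inter> N)"
  using N(1) by auto
 moreover have "g -` A \<inter> space M - N \<in> sets M"
  using gA N by auto
 ultimately have "f -` A \<inter> space M \<in> sets (completion M)"
  using N(2) by (intro sets_completionI[of _ "g -` A \<inter> space M - N" "f -` A \<inter> space M \<inter> N" N]) auto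
 then show "f -` A \<inter> space (completion M) \<in> sets (completion M)" by simp
qed simp

text \<open>The law of \<open>Z\<close> has a density, so it ignores Lebesgue null sets and
  \<open>h\<close> may be exchanged for a Borel version; the density is bounded, which gives
  integrability. The formula is Fubini after inserting the inversion integral for the
  density.\<close>

lemma (in prob_space) integral_via_char:
 fixes h :: "real => complex"
 assumes Z[measurable]: "Z \<in> borel_measurable M"
  and int: "integrable lborel (char (distr M borel Z))" and h: "integrable lebesgue h"
 shows "integrable (completion M) (%w. h (Z w - a))"
  and "(\<integral>w. h (Z w - a) \<partial>completion M)
   = (LBINT t. char (distr M borel Z) t * iexp (- (t * a)) * fourier_transform h (- t)) / (2 * pi)"
proof -
 let ?D = "distr M borel Z"
 interpret D: real_distribution ?D by (rule real_distribution_distr[OF Z])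
 define q where "q x = (LBINT t. char ?D t * iexp (- (t * x))) / (2 * pi)" for x
 note dens = D.char_inversion_density[OF int, folded q_def]
 obtain h' where h'[measurable]: "h' \<in> borel_measurable borel" and ae: "AE x in lborel. h x = h' x"
  using lebesgue_borel_modification[of h] h by (metis borel_measurable_integrable)
 have ae': "AE x in lebesgue. h x = h' x" using ae by (rule AE_completion)
 have h'i: "integrable lborel h'"
 proof -
  have "integrable lebesgue h'"
   by (rule integrable_cong_AE_imp[OF h]) (use ae' in \<open>auto elim: eventually_mono intro: measurable_completion\<close>)
  then show ?thesis by (subst (asm) integrable_completion) auto
 qed
 have ft: "fourier_transform h x = (LBINT y. h' y * iexp (x * y))" for x
 proof -
  have "fourier_transform h x = (LINT y|lebesgue. h' y * iexp (x * y))"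
   unfolding fourier_transform_def
  proof (rule integral_cong_AE)
   show "(%y. h y * iexp (x * y)) \<in> borel_measurable lebesgue"
    by (intro borel_measurable_times borel_measurable_integrable[OF h]) (rule measurable_completion, measurable)
   show "(%y. h' y * iexp (x * y)) \<in> borel_measurable lebesgue"
    by (intro measurable_completion) measurable
  qed (use ae' in \<open>auto elim: eventually_mono\<close>)
  then show ?thesis by (subst (asm) integral_completion) auto
 qed
 have shift: "integrable lborel (%x. h' (x - a))"
  using lborel_integrable_real_affine[OF h'i, of 1 "- a"] by simp
 have qb: "norm (q x) <= (LBINT t. norm (char ?D t)) / (2 * pi)" for x
 proof -
  have "norm (LBINT t. char ?D t * iexp (- (t * x))) <= (LBINT t. norm (char ?D t * iexp (- (t * x))))"
   by (rule integral_norm_bound)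
  then show ?thesis unfolding q_def by (simp add: norm_divide norm_mult divide_right_mono)
 qed
 have ND: "integrable ?D (%x. h' (x - a))"
 proof -
  have "integrable (density lborel (%x. ennreal (Re (q x)))) (%x. h' (x - a))"
  proof (subst integrable_density)
   show "integrable lborel (%x. Re (q x) *\<^sub>R h' (x - a))"
   proof (rule integrable_bound)
    show "integrable lborel (%x. (LBINT t. norm (char ?D t)) / (2 * pi) * norm (h' (x - a)))"
     using shift by (intro integrable_mult_right integrable_norm) auto
    show "AE x in lborel. norm (Re (q x) *\<^sub>R h' (x - a)) <= norm ((LBINT t. norm (char ?D t)) / (2 * pi) * norm (h' (x - a)))"
    proof (rule AE_I2)
     fix x :: real
     have "\<bar>Re (q x)\<bar> <= (LBINT t. norm (char ?D t)) / (2 * pi)"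
      using abs_Re_le_cmod[of "q x"] qb[of x] by linarith
     then have "\<bar>Re (q x)\<bar> * norm (h' (x - a)) <= (LBINT t. norm (char ?D t)) / (2 * pi) * norm (h' (x - a))"
      by (rule mult_right_mono) auto
     then show "norm (Re (q x) *\<^sub>R h' (x - a)) <= norm ((LBINT t. norm (char ?D t)) / (2 * pi) * norm (h' (x - a)))"
      by (simp only: norm_scaleR) (erule order_trans, simp)
    qed
   qed (use dens in measurable)
  qed (use dens in auto)
  then show ?thesis unfolding dens(1)[symmetric] .
 qed
 have i2: "integrable M (%w. h' (Z w - a))"
  using ND by (subst (asm) integrable_distr_eq) auto
 have aeD: "AE w in M. h (Z w - a) = h' (Z w - a)"
 proof -
  obtain N where N: "{x \<in> space lborel. h x ~= h' x} \<subseteq> N" "N \<in> null_sets lborel"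
   using ae by (auto elim!: AE_E simp: null_sets_def)
  then have "AE x in lborel. x \<notin> N" by (intro AE_not_in)
  then have "AE x in lborel. - a + 1 * x \<notin> N"
   using N(2) by (intro AE_borel_affine) auto
  then have "AE x in lborel. h (x - a) = h' (x - a)"
   by eventually_elim (use N(1) in auto)
  then have "AE x in density lborel (%x. ennreal (Re (q x))). h (x - a) = h' (x - a)"
   using dens(4) by (subst AE_density) (auto elim: eventually_mono)
  then have "AE x in ?D. h (x - a) = h' (x - a)" unfolding dens(1)[symmetric] .
  then show ?thesis by (rule AE_distrD[OF Z])
 qed
 have meas: "(%w. h (Z w - a)) \<in> borel_measurable (completion M)"
  by (rule AE_completion_measurable[OF _ aeD]) measurable
 have i2c: "integrable (completion M) (%w. h' (Z w - a))"
  using i2 by (subst integrable_completion) auto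
 have aeDc: "AE w in completion M. h (Z w - a) = h' (Z w - a)" by (rule AE_completion[OF aeD])
 show "integrable (completion M) (%w. h (Z w - a))"
  by (rule integrable_cong_AE_imp[OF i2c meas]) (use aeDc in \<open>auto elim: eventually_mono\<close>)
 have "(\<integral>w. h (Z w - a) \<partial>completion M) = (\<integral>w. h' (Z w - a) \<partial>completion M)"
  by (rule integral_cong_AE) (use meas i2c aeDc in auto)
 also have "... = (LINT w|M. h' (Z w - a))" by (rule integral_completion) measurable
 also have "... = (\<integral>x. h' (x - a) \<partial>?D)" by (rule integral_distr[symmetric]) measurable
 also have "... = (\<integral>x. h' (x - a) \<partial>density lborel (%x. ennreal (Re (q x))))" unfolding dens(1)[symmetric] ..
 also have "... = (LBINT x. Re (q x) *\<^sub>R h' (x - a))"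
  by (rule integral_density) (use dens in auto)
 also have "... = (LBINT x. q x * h' (x - a))"
  using dens(3) by (intro integral_cong) (auto simp: scaleR_conv_of_real)
 also have "... = (LBINT x. (LBINT t. char ?D t * iexp (- (t * x)) * h' (x - a))) / (2 * pi)"
  unfolding q_def by (simp add: mult.commute)
 also have "(LBINT x. (LBINT t. char ?D t * iexp (- (t * x)) * h' (x - a)))
  = (LBINT t. (LBINT x. char ?D t * iexp (- (t * x)) * h' (x - a)))"
 proof -
   have "integrable (lborel \<Otimes>\<^sub>M lborel) (%(x, t). char ?D t * iexp (- (t * x)) * h' (x - a))"
  proof (rule lborel_pair.Fubini_integrable)
   show "integrable lborel (%x. \<integral>t. norm (case (x, t) of (x, t) => char ?D t * iexp (- (t * x)) * h' (x - a)) \<partial>lborel)"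
    using shift by (auto simp: norm_mult intro!: integrable_mult_right integrable_norm)
   show "AE x in lborel. integrable lborel (%t. case (x, t) of (x, t) => char ?D t * iexp (- (t * x)) * h' (x - a))"
   proof (rule AE_I2)
    fix x :: real
    have "integrable lborel (%t. char ?D t * iexp (- (t * x)))"
     by (rule integrable_bound[OF int]) (auto simp: norm_mult)
    then show "integrable lborel (%t. case (x, t) of (x, t) => char ?D t * iexp (- (t * x)) * h' (x - a))"
     by auto
   qed
  qed measurable
  then show ?thesis by (rule lborel_pair.Fubini_integral[symmetric])
 qed
 also have "... = (LBINT t. char ?D t * iexp (- (t * a)) * fourier_transform h (- t))"
 proof (intro integral_cong refl)
  fix t :: real
  have "(LBINT x. char ?D t * iexp (- (t * x)) * h' (x - a)) = (LBINT x. char ?D t * iexp (- (t * (a + 1 * x))) * h' ((a + 1 * x) - a))"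
   by (subst lborel_integral_real_affine[where c=1 and t=a]) auto
  also have "... = (LBINT x. char ?D t * iexp (- (t * a)) * (h' x * iexp (- t * x)))"
   by (intro integral_cong refl) (simp add: exp_add[symmetric] algebra_simps flip: exp_add)
  also have "... = char ?D t * iexp (- (t * a)) * fourier_transform h (- t)"
   unfolding ft by (rule integral_mult_right_zero)
  finally show "(LBINT x. char ?D t * iexp (- (t * x)) * h' (x - a)) = char ?D t * iexp (- (t * a)) * fourier_transform h (- t)" .
 qed
 finally show "(\<integral>w. h (Z w - a) \<partial>completion M)
   = (LBINT t. char ?D t * iexp (- (t * a)) * fourier_transform h (- t)) / (2 * pi)" .
qed

section \<open>Characteristic functions of stable laws and of the step\<close>

lemma char_scale:
 assumes "real_distribution \<mu>"
 shows "char (distr \<mu> borel (%x. a * x)) t = char \<mu> (a * t)"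
proof -
 interpret real_distribution \<mu> by fact
 show ?thesis unfolding char_def by (subst integral_distr) (auto simp: mult_ac)
qed

lemma char_convolution:
 assumes "real_distribution \<mu>" "real_distribution \<nu>"
 shows "char (\<mu> \<star> \<nu>) t = char \<mu> t * char \<nu> t"
proof -
 interpret A: real_distribution \<mu> by fact
 interpret B: real_distribution \<nu> by fact
 interpret P: pair_prob_space \<mu> \<nu> ..
 have [measurable_cong]: "sets \<mu> = sets borel" "sets \<nu> = sets borel" by auto
 have int: "integrable (\<mu> \<Otimes>\<^sub>M \<nu>) (%(x, y). iexp (t * x) * iexp (t * y))"
  by (rule P.integrable_const_bound[where B=1]) (auto simp: norm_mult split_beta')
 have "char (\<mu> \<star> \<nu>) t = (\<integral>z. iexp (t * z) \<partial>distr (\<mu> \<Otimes>\<^sub>M \<nu>) borel (%(x, y). x + y))"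
  unfolding char_def convolution_def ..
 also have "... = (\<integral>z. (%(x, y). iexp (t * x) * iexp (t * y)) z \<partial>(\<mu> \<Otimes>\<^sub>M \<nu>))"
  by (subst integral_distr) (auto intro!: integral_cong simp: split_beta' distrib_left exp_add)
 also have "... = (LINT x|\<mu>. (LINT y|\<nu>. iexp (t * x) * iexp (t * y)))"
  using P.integral_fst'[OF int] by simp
 also have "... = char \<mu> t * char \<nu> t"
  unfolding char_def by simp
 finally show ?thesis .
qed

lemma strictly_stable_char:
 assumes st: "strictly_stable \<alpha> \<mu>" and ab: "0 < a" "0 < b"
 shows "char \<mu> (a * t) * char \<mu> (b * t) = char \<mu> ((a powr \<alpha> + b powr \<alpha>) powr (1 / \<alpha>) * t)"
proof -
 have rd: "real_distribution \<mu>" using st by (simp add: strictly_stable_def)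
 then interpret real_distribution \<mu> .
 have rdd: "real_distribution (distr \<mu> borel (%x. c * x))" for c by (rule real_distribution_distr) auto
 have "char (distr \<mu> borel (%x. a * x) \<star> distr \<mu> borel (%x. b * x)) t
   = char (distr \<mu> borel (%x. (a powr \<alpha> + b powr \<alpha>) powr (1 / \<alpha>) * x)) t"
  using st ab unfolding strictly_stable_def by simp
 then show ?thesis
  unfolding char_convolution[OF rdd rdd] char_scale[OF rd] .
qed

lemma strictly_stable_char_power:
 assumes st: "strictly_stable \<alpha> \<mu>" and \<alpha>: "0 < \<alpha>" and n: "0 < n"
 shows "char \<mu> t ^ n = char \<mu> (real n powr (1 / \<alpha>) * t)"
 using n
proof (induction n)
 case (Suc n)
 show ?case
 proof (cases "n = 0")
  case False
  have "char \<mu> (real n powr (1 / \<alpha>) * t) * char \<mu> (1 * t)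
   = char \<mu> (((real n powr (1 / \<alpha>)) powr \<alpha> + 1 powr \<alpha>) powr (1 / \<alpha>) * t)"
   using False by (intro strictly_stable_char[OF st]) auto
  also have "(real n powr (1 / \<alpha>)) powr \<alpha> + 1 powr \<alpha> = real (Suc n)"
   using \<alpha> False by (simp add: powr_powr)
  finally show ?thesis using Suc.IH False by (simp add: mult.commute[of "char \<mu> t"])
 qed simp
qed simp

text \<open>The case of equality in the triangle inequality: after a rotation by \<open>d\<close>
  the mean of 1 - cos is 0, and this integrand is nonnegative.\<close>

lemma norm_char_eq_1_AE:
 assumes "real_distribution \<mu>" and n: "norm (char \<mu> s) = 1"
 obtains d where "AE x in \<mu>. cos (s * x - d) = 1"
proof -
 interpret real_distribution \<mu> by fact
 obtain d where d: "char \<mu> s = iexp d"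
  using n complex_norm_eq_1_exp[of "char \<mu> s"] by metis
 have i: "integrable \<mu> (%x. cos (s * x - d))"
  by (rule integrable_const_bound[where B=1]) auto
 have i2: "integrable \<mu> (%x. iexp (s * x))" by (rule integrable_iexp) auto
 have "(LINT x|\<mu>. iexp (s * x) * iexp (- d)) = 1"
  using d unfolding char_def by (simp add: exp_minus)
 moreover have "iexp (s * x) * iexp (- d) = iexp (s * x - d)" for x
  by (simp add: exp_add[symmetric] algebra_simps flip: exp_add)
 ultimately have "(LINT x|\<mu>. iexp (s * x - d)) = 1" by (simp only:)
 moreover have i3: "integrable \<mu> (%x. iexp (s * x - d))" by (rule integrable_iexp) auto
 ultimately have "(LINT x|\<mu>. Re (iexp (s * x - d))) = 1" using integral_Re[OF i3] by simp
 then have "(LINT x|\<mu>. 1 - cos (s * x - d)) = 0"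
  using i by (simp add: prob_space Re_exp del: space_eq_univ)
 then have "AE x in \<mu>. 1 - cos (s * x - d) = 0"
  using i by (subst (asm) integral_nonneg_eq_0_iff_AE) auto
 then show ?thesis by (intro that[of d]) auto
qed

text \<open>By stability, modulus 1 at \<open>s\<close> propagates to all frequencies s n^(- 1 /
  \<alpha>). Each of them confines the law to a lattice of spacing 2 pi / |r n|, and these spacings
  tend to infinity, so a single point remains, against non-degeneracy.\<close>

lemma strictly_stable_norm_char_less_1:
 assumes st: "strictly_stable \<alpha> \<mu>" and \<alpha>: "0 < \<alpha>" and s: "s ~= 0"
 shows "norm (char \<mu> s) < 1"
proof (rule ccontr)
 have rd: "real_distribution \<mu>" using st by (simp add: strictly_stable_def)
 then interpret real_distribution \<mu> .
 assume "\<not> norm (char \<mu> s) < 1"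
 then have n1: "norm (char \<mu> s) = 1" using cmod_char_le_1[of s] by linarith
 define r where "r n = s * real (Suc n) powr (- 1 / \<alpha>)" for n
 have "norm (char \<mu> (r n)) = 1" for n
 proof -
  have "char \<mu> (r n) ^ Suc n = char \<mu> (real (Suc n) powr (1 / \<alpha>) * r n)"
   by (rule strictly_stable_char_power[OF st \<alpha>]) simp
  also have "real (Suc n) powr (1 / \<alpha>) * r n = s"
   unfolding r_def by (simp add: powr_minus field_simps)
  finally have "norm (char \<mu> (r n) ^ Suc n) = 1" using n1 by (simp only:)
  then have "norm (char \<mu> (r n)) ^ Suc n = 1 ^ Suc n" by (simp only: norm_power power_one)
  then show ?thesis by (rule power_eq_imp_eq_base) auto
 qed
 then have "\<exists>d. AE x in \<mu>. cos (r n * x - d) = 1" for n by (metis norm_char_eq_1_AE[OF rd])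
 then obtain d where "!!n. AE x in \<mu>. cos (r n * x - d n) = 1" by metis
 then have ae: "AE x in \<mu>. \<forall>n. cos (r n * x - d n) = 1" by (simp add: AE_all_countable)
 then obtain x0 where x0: "\<forall>n. cos (r n * x0 - d n) = 1"
  using eventually_happens'[OF ae_filter_bot ae] by blast
 have r0: "r ----> 0"
 proof -
  have "((%x. x powr (- 1 / \<alpha>)) ---> 0) at_top" using \<alpha> by (intro tendsto_neg_powr filterlim_ident) auto
  then have "(%n. real (Suc n) powr (- 1 / \<alpha>)) ----> 0"
   by (rule filterlim_compose[OF _ filterlim_compose[OF filterlim_real_sequentially filterlim_Suc]])
  then show ?thesis unfolding r_def by (rule tendsto_mult_right_zero)
 qed
 have uniq: "x = x0" if x: "\<forall>n. cos (r n * x - d n) = 1" for x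
 proof (rule ccontr)
  assume ne: "x ~= x0"
  have "(%n. r n * (x - x0)) ----> 0 * (x - x0)" by (intro tendsto_mult r0 tendsto_const)
  then have "\<forall>\<^sub>F n in sequentially. \<bar>r n * (x - x0)\<bar> < 2 * pi"
   by (intro order_tendstoD(2)[where y=0]) (auto intro: tendsto_rabs_zero)
  then obtain n where n: "\<bar>r n * (x - x0)\<bar> < 2 * pi" by (auto simp: eventually_sequentially)
  obtain i where i: "r n * x - d n = real_of_int i * 2 * pi" using x cos_one_2pi_int by blast
  obtain j where j: "r n * x0 - d n = real_of_int j * 2 * pi" using x0 cos_one_2pi_int by blast
  have e: "r n * (x - x0) = real_of_int (i - j) * (2 * pi)" using i j by (simp add: algebra_simps)
  then have "\<bar>real_of_int (i - j)\<bar> * (2 * pi) < 1 * (2 * pi)" using n by (simp add: abs_mult)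
  then have "\<bar>real_of_int (i - j)\<bar> < 1" using pi_gt_zero by (auto simp only: mult_less_cancel_right)
  then have "i - j = 0" by linarith
  then have "r n * (x - x0) = 0" using e by simp
  moreover have "r n ~= 0" unfolding r_def using s by simp
  ultimately show False using ne by simp
 qed
 have "AE x in \<mu>. x = x0" using ae by eventually_elim (rule uniq)
 then have "\<mu> = return borel x0"
 proof (intro measure_eqI)
  fix A assume A: "A \<in> sets \<mu>"
  assume aex: "AE x in \<mu>. x = x0"
  show "emeasure \<mu> A = emeasure (return borel x0) A"
  proof (cases "x0 \<in> A")
   case True
   have "emeasure \<mu> A = emeasure \<mu> (space \<mu>)"
    by (rule emeasure_eq_AE) (use aex True A in \<open>auto elim: eventually_mono\<close>)
   then show ?thesis using True A emeasure_space_1 by simp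
  next
   case False
   have "emeasure \<mu> A = emeasure \<mu> {}"
    by (rule emeasure_eq_AE) (use aex False A in \<open>auto elim: eventually_mono\<close>)
   then show ?thesis using False A by simp
  qed
 qed simp
 then show False using st unfolding strictly_stable_def by blast
qed

text \<open>The least positive element of the subgroup \<open>G\<close> divides every element of
  \<open>G\<close>, hence every element of \<open>T\<close>, hence their gcd.\<close>

lemma Gcd_1_subgroup:
 fixes T G :: "int set"
 assumes "Gcd T = 1" "T \<subseteq> G" and diff: "!!x y. x \<in> G ==> y \<in> G ==> x - y \<in> G"
 shows "1 \<in> G"
proof -
 have "\<not> T \<subseteq> {0}" using assms(1) by (metis Gcd_0_iff zero_neq_one)
 then obtain x where x: "x \<in> G" "x ~= 0" using assms(2) by blast
 have z: "0 \<in> G" using diff[OF x(1) x(1)] by simp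
 have neg: "- y \<in> G" if "y \<in> G" for y using diff[OF z that] by simp
 have add: "y + w \<in> G" if "y \<in> G" "w \<in> G" for y w using diff[OF that(1) neg[OF that(2)]] by simp
 have "\<exists>n. 0 < n \<and> int n \<in> G"
  using x neg[OF x(1)] by (intro exI[of _ "nat \<bar>x\<bar>"]) (auto simp: abs_if)
 define d where "d = (LEAST n. 0 < n \<and> int n \<in> G)"
 have d: "0 < d" "int d \<in> G" using LeastI_ex[OF \<open>\<exists>n. 0 < n \<and> int n \<in> G\<close>] unfolding d_def by auto
 have dmin: "d <= n" if "0 < n" "int n \<in> G" for n unfolding d_def using that by (intro Least_le) auto
 have mult: "int k * int d \<in> G" for k by (induction k) (auto simp: z algebra_simps intro: add d(2))
 have multi: "k * int d \<in> G" for k :: int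
  using mult[of "nat k"] neg[OF mult[of "nat (- k)"]] by (cases "0 <= k") auto
 have "int d dvd y" if "y \<in> G" for y
 proof -
  have "y mod int d = y - (y div int d) * int d" by (simp add: minus_div_mult_eq_mod)
  then have m: "y mod int d \<in> G" using diff[OF that multi[of "y div int d"]] by simp
  have b: "0 <= y mod int d" "y mod int d < int d" using d(1) by auto
  have "y mod int d = 0"
  proof (rule ccontr)
   assume "y mod int d ~= 0"
   then have "0 < nat (y mod int d)" "int (nat (y mod int d)) = y mod int d" using b by linarith+
   then have "d <= nat (y mod int d)" using m by (intro dmin) auto
   then show False using b by linarith
  qed
  then show ?thesis by (simp add: dvd_eq_mod_eq_0)
 qed
 then have "int d dvd Gcd T" using assms(2) by (intro Gcd_greatest) auto
 then have "d = 1" using assms(1) d(1) by simp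
 then show ?thesis using d(2) by simp
qed

section \<open>The walk and the characteristic function of its step\<close>

locale stable_walk = prob_space M for M :: "'a measure" +
 fixes X :: "nat => 'a => int" and \<mu> :: "real measure" and \<alpha> :: real
 assumes \<alpha>: "1 < \<alpha>" "\<alpha> <= 2"
  and iid: "iid_on M (count_space UNIV) X {1..}"
  and supp: "support_generates_int M (X 1)"
  and stable: "strictly_stable \<alpha> \<mu>"
  and wconv: "weak_conv_m
     (%n. distr M borel (%w. real n powr (- 1 / \<alpha>) * real_of_int (random_walk X n w))) \<mu>"
begin

abbreviation "S \<equiv> random_walk X"

abbreviation "T k w \<equiv> real_of_int (S k w)"

definition \<phi> :: "real => complex" where
 "\<phi> = char (distr M borel (%w. real_of_int (X 1 w)))"

lemma X_measurable: "1 <= k ==> X k \<in> measurable M (count_space UNIV)"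
 using iid unfolding iid_on_def indep_vars_def by auto

lemma S_measurable[measurable]: "S n \<in> measurable M (count_space UNIV)"
proof (induction n)
 case (Suc n)
 have e: "S (Suc n) = (%w. S n w + X (Suc n) w)" by (auto simp: random_walk_def)
 have [measurable]: "X (Suc n) \<in> measurable M (count_space UNIV)" by (rule X_measurable) simp
 note Suc[measurable]
 show ?case unfolding e by measurable
qed (simp add: random_walk_def)

lemma indep_X: "indep_vars (%_. count_space UNIV) X {1..}"
 using iid by (simp add: iid_on_def)

lemma indep_X_real: "A \<subseteq> {1..} ==> indep_vars (%_. borel) (%k w. real_of_int (X k w)) A"
 by (rule indep_vars_compose2[OF indep_vars_subset[OF indep_X]]) auto

lemma distr_X: "1 <= k ==> distr M borel (%w. real_of_int (X k w)) = distr M borel (%w. real_of_int (X 1 w))"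
proof -
 assume k: "1 <= k"
 have e1: "distr M (count_space UNIV) (X k) = distr M (count_space UNIV) (X 1)"
  using iid k unfolding iid_on_def by (metis atLeast_iff order_refl)
 have e2: "distr M borel (%w. real_of_int (X j w)) = distr (distr M (count_space UNIV) (X j)) borel real_of_int" if "1 <= j" for j
 proof -
  have "distr (distr M (count_space UNIV) (X j)) borel real_of_int = distr M borel (real_of_int \<circ> X j)"
   by (rule distr_distr[OF _ X_measurable[OF that]]) simp
  then show ?thesis unfolding o_def by (rule sym)
 qed
 show ?thesis unfolding e2[OF k] e2[OF order_refl] e1 ..
qed

lemma char_sum:
 assumes "finite A" "A \<subseteq> {1..}"
 shows "char (distr M borel (%w. real_of_int (\<Sum>k\<in>A. X k w))) t = \<phi> t ^ card A"
proof -
 have "char (distr M borel (%w. \<Sum>k\<in>A. real_of_int (X k w))) t = (\<Prod>k\<in>A. char (distr M borel (%w. real_of_int (X k w))) t)"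
  by (rule char_distr_sum[OF indep_X_real[OF assms(2)]])
 also have "... = (\<Prod>k\<in>A. \<phi> t)" unfolding \<phi>_def using assms(2) by (intro prod.cong refl) (subst distr_X, auto)
 finally show ?thesis by simp
qed

lemma sum_X_measurable: "A \<subseteq> {1..} ==> (%w. \<Sum>k\<in>A. X k w) \<in> measurable M (count_space UNIV)"
proof (induction A rule: infinite_finite_induct)
 case (insert x F)
 moreover have "X x \<in> measurable M (count_space UNIV)" using insert by (intro X_measurable) auto
 ultimately show ?case by simp
qed auto

lemma distr_sum_X:
 assumes "finite A" "A \<subseteq> {1..}"
 shows "distr M borel (%w. real_of_int (\<Sum>k\<in>A. X k w)) = distr M borel (%w. T (card A) w)"
proof (rule Levy_uniqueness)
 have m: "(%w. real_of_int (\<Sum>k\<in>B. X k w)) \<in> borel_measurable M" if "B \<subseteq> {1..}" for B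
  by (rule measurable_compose[OF sum_X_measurable[OF that]]) simp
 show "real_distribution (distr M borel (%w. real_of_int (\<Sum>k\<in>A. X k w)))"
  using m[OF assms(2)] by (rule real_distribution_distr)
 show "real_distribution (distr M borel (%w. T (card A) w))"
  by (rule real_distribution_distr) measurable
 show "char (distr M borel (%w. real_of_int (\<Sum>k\<in>A. X k w))) = char (distr M borel (%w. T (card A) w))"
  using char_sum[OF assms] char_sum[of "{1..card A}"] by (auto simp: random_walk_def)
qed

lemma expectation_sum_X:
 fixes f :: "int => 'b::{banach, second_countable_topology}"
 assumes "finite A" "A \<subseteq> {1..}"
 shows "expectation (%w. f (\<Sum>k\<in>A. X k w)) = expectation (%w. f (S (card A) w))"
proof -
 let ?f = "%x::real. f \<lfloor>x\<rfloor>"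
 have fm: "?f \<in> borel_measurable borel"
  by (rule measurable_compose[OF measurable_real_floor, where g=f]) simp
 have "expectation (%w. ?f (real_of_int (\<Sum>k\<in>A. X k w))) = (\<integral>x. ?f x \<partial>distr M borel (%w. real_of_int (\<Sum>k\<in>A. X k w)))"
  by (rule integral_distr[symmetric, OF measurable_compose[OF sum_X_measurable[OF assms(2)]] fm]) simp
 also have "... = expectation (%w. ?f (T (card A) w))"
  unfolding distr_sum_X[OF assms] by (rule integral_distr[OF measurable_compose[OF S_measurable] fm]) simp
 finally show ?thesis by (simp only: floor_of_int)
qed

text \<open>Weak convergence is traded for pointwise convergence on an auxiliary space. Limits in
  law then reduce to dominated convergence, and the pointwise supremum of the
  \<open>\<bar>Y n\<bar>\<close> serves as an envelope in \<open>tight\<close>.\<close>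

lemma skorohod:
 obtains Q :: "real measure" and Y :: "nat => real => real" and Y' :: "real => real"
 where "prob_space Q" "!!n. Y n \<in> borel_measurable Q"
  "!!n. distr Q borel (Y n) = distr M borel (%w. real n powr (- 1 / \<alpha>) * T n w)"
  "Y' \<in> borel_measurable Q" "distr Q borel Y' = \<mu>" "!!x. x \<in> space Q ==> (%n. Y n x) ----> Y' x"
proof -
 have "real_distribution \<mu>" using stable by (simp add: strictly_stable_def)
 moreover have "real_distribution (distr M borel (%w. real n powr (- 1 / \<alpha>) * T n w))" for n
  by (rule real_distribution_distr) measurable
 ultimately show ?thesis using Skorohod[OF _ _ wconv] that by (metis measurable_lborel1 measurable_lborel2)
qed

text \<open>The frequency \<open>s k\<close> and the time \<open>n k\<close> move together; on the
  coupled space both limits are taken inside the exponential.\<close>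

lemma char_\<phi>_tendsto:
 assumes n: "filterlim n at_top sequentially" and s: "s ----> s0" and npos: "!!k. 0 < n k"
 shows "(%k. \<phi> (s k * real (n k) powr (- 1 / \<alpha>)) ^ n k) ----> char \<mu> s0"
proof -
 obtain Q :: "real measure" and Y Y' where Y: "prob_space Q" "!!n. Y n \<in> borel_measurable Q"
  "!!n. distr Q borel (Y n) = distr M borel (%z. real n powr (- 1 / \<alpha>) * T n z)"
  "Y' \<in> borel_measurable Q" "distr Q borel Y' = \<mu>" "!!x. x \<in> space Q ==> (%n. Y n x) ----> Y' x"
  using skorohod by blast
 interpret O: prob_space Q by fact
 note [measurable] = Y(2,4)
 have e: "char (distr Q borel (Y m)) t = \<phi> (t * real m powr (- 1 / \<alpha>)) ^ m" for m t
 proof -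
  have "char (distr Q borel (Y m)) t = expectation (%z. iexp (t * (real m powr (- 1 / \<alpha>) * T m z)))"
   unfolding Y(3) char_def by (subst integral_distr) auto
  also have "... = char (distr M borel (%z. T m z)) (t * real m powr (- 1 / \<alpha>))"
   unfolding char_def by (subst integral_distr) (auto simp: mult_ac)
  also have "... = \<phi> (t * real m powr (- 1 / \<alpha>)) ^ m"
   using char_sum[of "{1..m}"] by (auto simp: random_walk_def)
  finally show ?thesis .
 qed
 have "(%k. \<integral>x. iexp (s k * Y (n k) x) \<partial>Q) ----> (LINT x|Q. iexp (s0 * Y' x))"
 proof (rule integral_dominated_convergence[where w="%_. 1"])
  show "AE x in Q. (%k. iexp (s k * Y (n k) x)) ----> iexp (s0 * Y' x)"
  proof (rule AE_I2)
   fix x assume x: "x \<in> space Q"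
   have "(%k. Y (n k) x) ----> Y' x" by (rule filterlim_compose[OF Y(6)[OF x] n])
   then show "(%k. iexp (s k * Y (n k) x)) ----> iexp (s0 * Y' x)" by (intro tendsto_intros s)
  qed
 qed auto
 moreover have "(LINT x|Q. iexp (s k * Y (n k) x)) = \<phi> (s k * real (n k) powr (- 1 / \<alpha>)) ^ n k" for k
  unfolding e[symmetric] char_def by (subst integral_distr) auto
 moreover have "(LINT x|Q. iexp (s0 * Y' x)) = char \<mu> s0"
  unfolding Y(5)[symmetric] char_def by (subst integral_distr) auto
 ultimately show ?thesis by simp
qed

lemma \<phi>_dist: "real_distribution (distr M borel (%w. real_of_int (X 1 w)))"
 using X_measurable[of 1] by (intro real_distribution_distr) simp

lemma norm_\<phi>_minus: "norm (\<phi> (- t)) = norm (\<phi> t)"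
proof -
 have "\<phi> (- t) = cnj (\<phi> t)"
  unfolding \<phi>_def char_def by (subst integral_cnj[symmetric]) (simp add: exp_cnj)
 then show ?thesis by simp
qed

text \<open>If no constants worked, there would be positive \<open>t k\<close> tending to 0 with the
  modulus of \<open>\<phi> (t k)\<close> above exp (- (t k)^\<alpha> / (k + 1)). At times
  \<open>n k\<close> of order (t k)^(- \<alpha>) the modulus of the power tends to that of
  \<open>char \<mu> 1\<close>, whereas the lower bound tends to 1. This contradicts
  \<open>strictly_stable_norm_char_less_1\<close>.\<close>

lemma norm_\<phi>_near_0:
 obtains d \<kappa> where "0 < d" "0 < \<kappa>" "!!t. \<bar>t\<bar> <= d ==> norm (\<phi> t) <= exp (- (\<kappa> * \<bar>t\<bar> powr \<alpha>))"
proof (rule ccontr)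
 assume "\<not> thesis"
 then have nex: "\<not> (\<forall>t. \<bar>t\<bar> <= 1 / real (Suc k) --> norm (\<phi> t) <= exp (- ((1 / real (Suc k)) * \<bar>t\<bar> powr \<alpha>)))" for k
  using that[of "1 / real (Suc k)" "1 / real (Suc k)"] by auto
 have ex: "\<exists>t. 0 < t \<and> t <= 1 / real (Suc k) \<and> exp (- ((1 / real (Suc k)) * t powr \<alpha>)) < norm (\<phi> t)" for k
 proof -
  obtain t where t: "\<bar>t\<bar> <= 1 / real (Suc k)" "exp (- ((1 / real (Suc k)) * \<bar>t\<bar> powr \<alpha>)) < norm (\<phi> t)"
   using nex[of k] by (auto simp: not_le)
  have "t ~= 0"
  proof
   assume "t = 0"
   then show False using t(2) real_distribution.cmod_char_le_1[OF \<phi>_dist, of 0] by (simp add: \<phi>_def)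
  qed
  moreover have "norm (\<phi> \<bar>t\<bar>) = norm (\<phi> t)" using norm_\<phi>_minus[of t] by (cases "0 <= t") auto
  ultimately show ?thesis using t by (intro exI[of _ "\<bar>t\<bar>"]) auto
 qed
 then obtain t where t: "!!k. 0 < t k" "!!k. t k <= 1 / real (Suc k)" "!!k. exp (- ((1 / real (Suc k)) * t k powr \<alpha>)) < norm (\<phi> (t k))"
  by metis
 define n where "n k = nat \<lceil>t k powr (- \<alpha>)\<rceil>" for k
 have tpos: "0 < t k powr (- \<alpha>)" for k using t(1)[of k] by simp
 have npos: "0 < n k" for k unfolding n_def using tpos[of k] by simp
 have nb: "t k powr (- \<alpha>) <= real (n k)" "real (n k) <= t k powr (- \<alpha>) + 1" for k
  unfolding n_def using tpos[of k] by linarith+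
 have t0: "t ----> 0"
 proof (rule real_tendsto_sandwich)
  show "\<forall>\<^sub>F k in sequentially. 0 <= t k" by (intro always_eventually allI less_imp_le t(1))
  show "\<forall>\<^sub>F k in sequentially. t k <= 1 / real (Suc k)" using t(2) by auto
  show "(%k. 1 / real (Suc k)) ----> 0" by (rule LIMSEQ_Suc[OF lim_1_over_n])
 qed simp
 have ta0: "(%k. t k powr \<alpha>) ----> 0"
 proof -
  have "\<forall>\<^sub>F k in sequentially. 0 <= t k" by (intro always_eventually allI less_imp_le t(1))
  then show ?thesis using tendsto_powr'[OF t0 tendsto_const[of \<alpha>]] \<alpha> by simp
 qed
 have n_top: "filterlim n at_top sequentially"
  unfolding filterlim_sequentially_iff_filterlim_real
 proof (rule filterlim_at_top_mono)
  have "LIM k sequentially. inverse (t k powr \<alpha>) :> at_top"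
   by (rule filterlim_compose[OF filterlim_inverse_at_top_right]) (use ta0 t(1) less_imp_neq[OF t(1)] in \<open>auto simp: filterlim_at\<close>)
  then show "LIM k sequentially. t k powr (- \<alpha>) :> at_top" by (simp add: powr_minus)
  show "\<forall>\<^sub>F k in sequentially. t k powr (- \<alpha>) <= real (n k)" using nb(1) by simp
 qed
 have ratio: "(%k. t k powr \<alpha> * real (n k)) ----> 1"
 proof (rule real_tendsto_sandwich)
  have e: "t k powr \<alpha> * t k powr (- \<alpha>) = 1" for k using t(1)[of k] by (simp add: powr_minus)
  show "\<forall>\<^sub>F k in sequentially. 1 <= t k powr \<alpha> * real (n k)"
   using mult_left_mono[OF nb(1), of "t _ powr \<alpha>"] e by (intro always_eventually allI) (metis powr_ge_zero)
  show "\<forall>\<^sub>F k in sequentially. t k powr \<alpha> * real (n k) <= 1 + t k powr \<alpha>"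
  proof (intro always_eventually allI)
   fix k
   have "t k powr \<alpha> * real (n k) <= t k powr \<alpha> * (t k powr (- \<alpha>) + 1)" by (intro mult_left_mono nb) auto
   also have "... = 1 + t k powr \<alpha>" by (simp only: distrib_left e mult_1_right)
   finally show "t k powr \<alpha> * real (n k) <= 1 + t k powr \<alpha>" .
  qed
  show "(%k. 1 + t k powr \<alpha>) ----> 1" using tendsto_add[OF tendsto_const ta0, of 1] by simp
 qed simp
 define s where "s k = t k * real (n k) powr (1 / \<alpha>)" for k
 have s1: "s ----> 1"
 proof -
  have "s = (%k. (t k powr \<alpha> * real (n k)) powr (1 / \<alpha>))"
   unfolding s_def using less_imp_le[OF t(1)] \<alpha> by (auto simp: powr_mult powr_powr)
  moreover have "(%k. (t k powr \<alpha> * real (n k)) powr (1 / \<alpha>)) ----> 1 powr (1 / \<alpha>)"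
   by (intro tendsto_powr ratio tendsto_const) auto
  ultimately show ?thesis by simp
 qed
 have st: "s k * real (n k) powr (- 1 / \<alpha>) = t k" for k
  unfolding s_def using npos[of k] by (simp add: powr_minus field_simps)
 have "(%k. norm (\<phi> (t k) ^ n k)) ----> norm (char \<mu> 1)"
  using tendsto_norm[OF char_\<phi>_tendsto[OF n_top s1 npos]] unfolding st .
 moreover have "(%k. exp (- ((1 / real (Suc k)) * (t k powr \<alpha> * real (n k))))) ----> exp (- (0 * 1))"
  by (intro tendsto_intros ratio) (rule LIMSEQ_Suc[OF lim_1_over_n])
 moreover have "exp (- ((1 / real (Suc k)) * (t k powr \<alpha> * real (n k)))) <= norm (\<phi> (t k) ^ n k)" for k
 proof -
  have "exp (- ((1 / real (Suc k)) * t k powr \<alpha>)) ^ n k <= norm (\<phi> (t k)) ^ n k"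
   by (rule power_mono) (use t(3)[of k] in auto)
  then show ?thesis by (simp add: norm_power exp_of_nat_mult[symmetric] mult_ac del: of_nat_Suc)
 qed
 ultimately have "exp (- (0 * 1)) <= norm (char \<mu> 1)"
  by (intro LIMSEQ_le) auto
 then show False using strictly_stable_norm_char_less_1[OF stable, of 1] \<alpha> by simp
qed

text \<open>\<open>\<phi> t = 1\<close> puts the step almost surely into the subgroup of integers x
  with t x a multiple of 2 pi. That subgroup contains the support, hence 1, so t itself is a
  multiple of 2 pi. The modulus of \<phi> may still be 1 in this range, as it is at pi for a walk of
  period 2.\<close>

lemma \<phi>_neq_1:
 assumes t: "t ~= 0" "\<bar>t\<bar> <= pi"
 shows "\<phi> t ~= 1"
proof
 assume e: "\<phi> t = 1"
 have m[measurable]: "X (Suc 0) \<in> measurable M (count_space UNIV)" by (rule X_measurable) simp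
 have i: "integrable M (%w. iexp (t * real_of_int (X 1 w)))"
  by (rule integrable_iexp) auto
 have "expectation (%w. iexp (t * real_of_int (X 1 w))) = 1"
  using e unfolding \<phi>_def char_def by (subst (asm) integral_distr) auto
 then have "expectation (%w. Re (iexp (t * real_of_int (X 1 w)))) = 1"
  using integral_Re[OF i] by simp
 moreover have ic: "integrable M (%w. cos (t * real_of_int (X 1 w)))"
  by (rule integrable_const_bound[where B=1]) auto
 ultimately have "expectation (%w. 1 - cos (t * real_of_int (X 1 w))) = 0"
  by (simp add: prob_space Re_exp)
 then have ae: "AE w in M. cos (t * real_of_int (X 1 w)) = 1"
  using ic by (subst (asm) integral_nonneg_eq_0_iff_AE) auto
 let ?G = "{x::int. \<exists>k::int. t * real_of_int x = real_of_int k * (2 * pi)}"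
 let ?T = "{x. measure M {w \<in> space M. X 1 w = x} > 0}"
 have TG: "?T \<subseteq> ?G"
 proof
  fix x assume x: "x \<in> ?T"
  have "cos (t * real_of_int x) = 1"
  proof (rule ccontr)
   assume n: "cos (t * real_of_int x) ~= 1"
   have "AE w in M. X 1 w ~= x" using ae by eventually_elim (use n in auto)
   then have "measure M {w \<in> space M. X 1 w = x} = 0"
    by (subst prob_eq_0) auto
   then show False using x by simp
  qed
  then show "x \<in> ?G" using cos_one_2pi_int[of "t * real_of_int x"] by (auto simp: mult.assoc)
 qed
 have "1 \<in> ?G"
 proof (rule Gcd_1_subgroup[OF _ TG])
  show "Gcd ?T = 1" using supp by (simp add: support_generates_int_def)
  fix x y assume "x \<in> ?G" "y \<in> ?G"
  then obtain k l :: int where "t * real_of_int x = real_of_int k * (2 * pi)" "t * real_of_int y = real_of_int l * (2 * pi)" by auto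
  then have "t * real_of_int (x - y) = real_of_int (k - l) * (2 * pi)" by (simp add: algebra_simps)
  then show "x - y \<in> ?G" by blast
 qed
 then obtain k :: int where k: "t = real_of_int k * (2 * pi)" by auto
 then have "\<bar>real_of_int k\<bar> * (2 * pi) <= pi" using t(2) by (simp add: abs_mult)
 then have "\<bar>real_of_int k\<bar> * 2 <= 1" using pi_gt_zero by (simp add: mult.assoc[symmetric])
 then have "k = 0" by linarith
 then show False using k t(1) by simp
qed

text \<open>Near 0 the bound is inherited from the modulus of \<phi>; away from 0 it follows from
  compactness and \<open>\<phi>_neq_1\<close>.\<close>

lemma one_minus_\<phi>_bound:
 obtains \<kappa> where "0 < \<kappa>" "!!t. \<bar>t\<bar> <= pi ==> \<kappa> * \<bar>t\<bar> powr \<alpha> <= norm (1 - \<phi> t)"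
proof -
 obtain d \<kappa> where d: "0 < d" and \<kappa>: "0 < \<kappa>" and near: "!!t. \<bar>t\<bar> <= d ==> norm (\<phi> t) <= exp (- (\<kappa> * \<bar>t\<bar> powr \<alpha>))"
  using norm_\<phi>_near_0 by metis
 \<comment> \<open>The second entry keeps x = \<kappa> |t|^\<alpha> at most 1, the range in which
   exp (- x) <= 1 - x / 2 is derived.\<close>
 define e where "e = min d ((1 / \<kappa>) powr (1 / \<alpha>))"
 have e0: "0 < e" using d \<kappa> by (simp add: e_def)
 have near': "\<kappa> / 2 * \<bar>t\<bar> powr \<alpha> <= norm (1 - \<phi> t)" if "\<bar>t\<bar> <= e" for t
 proof -
  let ?x = "\<kappa> * \<bar>t\<bar> powr \<alpha>"
  have "\<bar>t\<bar> powr \<alpha> <= ((1 / \<kappa>) powr (1 / \<alpha>)) powr \<alpha>"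
   using that \<alpha> by (intro powr_mono2) (auto simp: e_def)
  also have "... = 1 / \<kappa>" using \<alpha> \<kappa> by (simp add: powr_powr)
  finally have x1: "?x <= 1" using \<kappa> by (simp add: field_simps)
  have x0: "0 <= ?x" using \<kappa> by simp
  have "1 + ?x <= exp ?x" by (rule exp_ge_add_one_self)
  then have "exp (- ?x) <= 1 / (1 + ?x)" using x0 le_imp_inverse_le[of "1 + ?x" "exp ?x"] by (simp add: exp_minus inverse_eq_divide)
  also have "... <= 1 - ?x / 2"
  proof -
   have "0 <= ?x * (1 - ?x)" using x1 by (intro mult_nonneg_nonneg[OF x0]) simp
   then have "1 <= (1 - ?x / 2) * (1 + ?x)" by (simp add: algebra_simps)
   moreover have "0 < 1 + ?x" using x0 by linarith
   ultimately show ?thesis by (simp only: pos_divide_le_eq)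
  qed
  finally have "norm (\<phi> t) <= 1 - ?x / 2" using near[of t] that by (auto simp: e_def)
  moreover have "1 - norm (\<phi> t) <= norm (1 - \<phi> t)" using norm_triangle_ineq2[of 1 "\<phi> t"] by simp
  ultimately show ?thesis by simp
 qed
 let ?C = "{-pi..-e} \<union> {e..pi}"
 show ?thesis
 proof (cases "?C = {}")
  case True
  then have "pi < e" by (metis Un_empty atLeastatMost_empty_iff not_le)
  then show ?thesis using near' \<kappa> by (intro that[of "\<kappa> / 2"]) auto
 next
  case False
  have "continuous_on ?C (%t. norm (1 - \<phi> t))"
   unfolding \<phi>_def using real_distribution.isCont_char[OF \<phi>_dist]
   by (intro continuous_intros continuous_at_imp_continuous_on) auto
  moreover have "compact ?C" by (intro compact_Un) auto
  ultimately obtain t0 where t0: "t0 \<in> ?C" "!!t. t \<in> ?C ==> norm (1 - \<phi> t0) <= norm (1 - \<phi> t)"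
   using continuous_attains_inf[of ?C "%t. norm (1 - \<phi> t)"] False by blast
  have "\<phi> t0 ~= 1" using t0(1) e0 by (intro \<phi>_neq_1) auto
  then have m0: "0 < norm (1 - \<phi> t0)" by simp
  define k where "k = min (\<kappa> / 2) (norm (1 - \<phi> t0) / pi powr \<alpha>)"
  have "k * \<bar>t\<bar> powr \<alpha> <= norm (1 - \<phi> t)" if t: "\<bar>t\<bar> <= pi" for t
  proof (cases "\<bar>t\<bar> <= e")
   case True
   have "k * \<bar>t\<bar> powr \<alpha> <= \<kappa> / 2 * \<bar>t\<bar> powr \<alpha>" by (intro mult_right_mono) (simp_all only: k_def min.cobounded1 powr_ge_zero)
   then show ?thesis using near'[OF True] by linarith
  next
   case False
   have "k * \<bar>t\<bar> powr \<alpha> <= norm (1 - \<phi> t0) / pi powr \<alpha> * pi powr \<alpha>"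
    using t \<alpha> m0 by (intro mult_mono powr_mono2) (auto simp: k_def intro: min.cobounded2)
   also have "... = norm (1 - \<phi> t0)" by simp
   also have "... <= norm (1 - \<phi> t)" by (rule t0(2)) (use False t in auto)
   finally show ?thesis .
  qed
  moreover have "0 < k" using \<kappa> m0 by (simp add: k_def)
  ultimately show ?thesis by (intro that[of k]) auto
 qed
qed

end

section \<open>Green function and potential kernel\<close>

lemma even_integral:
 fixes F :: "real => real"
 assumes F: "set_integrable lborel {0<..} F" and m[measurable]: "F \<in> borel_measurable borel"
 shows "integrable lborel (%t. F \<bar>t\<bar>)" and "(LBINT t. F \<bar>t\<bar>) = 2 * (LBINT t:{0<..}. F t)"
proof -
 let ?f = "%t. indicator {0<..} t *\<^sub>R F t"
 have i: "integrable lborel ?f" using F unfolding set_integrable_def .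
 have i2: "integrable lborel (%t. ?f (0 + (-1) * t))" by (rule lborel_integrable_real_affine[OF i]) simp
 have v: "(LBINT t. ?f t) = (LBINT t. ?f (0 + (-1) * t))"
  using lborel_integral_real_affine[of "-1" ?f 0] by simp
 have ae: "AE t in lborel. ?f t + ?f (0 + (-1) * t) = F \<bar>t\<bar>"
  using AE_lborel_singleton[of 0] by eventually_elim (auto simp: indicator_def)
 show "integrable lborel (%t. F \<bar>t\<bar>)"
  by (rule integrable_cong_AE_imp[OF integrable_add[OF i i2] _ ae]) measurable
 have "(LBINT t. F \<bar>t\<bar>) = (LBINT t. ?f t + ?f (0 + (-1) * t))"
  by (rule integral_cong_AE) (use ae in \<open>auto elim: eventually_mono\<close>)
 also have "... = (LBINT t. ?f t) + (LBINT t. ?f (0 + (-1) * t))"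
  by (rule integral_add[OF i i2])
 finally show "(LBINT t. F \<bar>t\<bar>) = 2 * (LBINT t:{0<..}. F t)"
  unfolding v[symmetric] set_lebesgue_integral_def by simp
qed

lemma scaled_integral:
 fixes F :: "real => real"
 assumes c: "0 < c" and F: "set_integrable lborel {0<..} F"
 shows "set_integrable lborel {0<..} (%t. F (c * t))" and "(LBINT t:{0<..}. F (c * t)) = (LBINT t:{0<..}. F t) / c"
proof -
 let ?f = "%t. indicator {0<..} t *\<^sub>R F t"
 have e: "?f (0 + c * t) = indicator {0<..} t *\<^sub>R F (c * t)" for t
  using c by (auto simp: indicator_def zero_less_mult_iff)
 have "integrable lborel (%t. ?f (0 + c * t))"
  using F c unfolding set_integrable_def by (intro lborel_integrable_real_affine) auto
 then show "set_integrable lborel {0<..} (%t. F (c * t))" unfolding e set_integrable_def .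
 have "(LBINT t. ?f t) = \<bar>c\<bar> *\<^sub>R (LBINT t. ?f (0 + c * t))"
  using c by (intro lborel_integral_real_affine) auto
 then show "(LBINT t:{0<..}. F (c * t)) = (LBINT t:{0<..}. F t) / c"
  unfolding e set_lebesgue_integral_def using c by simp
qed

lemma integral_iexp_period:
 "(LBINT t:{-pi<..pi}. iexp (t * real_of_int k)) = (if k = 0 then 2 * pi else 0)"
proof (cases "k = 0")
 case False
 have "(LBINT t:{-pi<..pi}. iexp (- ((- real_of_int k) * t))) = (iexp (- ((- real_of_int k) * (- pi))) - iexp (- ((- real_of_int k) * pi))) / (\<i> * (- real_of_int k))"
  by (rule integral_iexp_Ioc) (use False in auto)
 also have "iexp (- ((- real_of_int k) * (- pi))) = iexp (- ((- real_of_int k) * pi))"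
 proof -
  have "sin (real_of_int k * pi) = 0" by (metis mult.commute sin_int_times_real sin_zero_iff_int2 mult.commute)
  then show ?thesis by (simp add: complex_eq_iff Re_exp Im_exp)
 qed
 finally show ?thesis using False by (simp add: mult.commute)
qed (simp add: set_lebesgue_integral_def scaleR_conv_of_real)

lemma geometric_sum_bound:
 fixes z :: complex
 assumes "norm z <= 1" "z ~= 1"
 shows "norm (\<Sum>i<n. z ^ i) <= 2 / norm (1 - z)"
proof -
 have "(\<Sum>i<n. z ^ i) = (1 - z ^ n) / (1 - z)" using assms(2) by (simp add: sum_gp_strict)
 moreover have "norm (1 - z ^ n) <= 2"
 proof -
  have "norm (1 - z ^ n) <= norm (1::complex) + norm (z ^ n)" by (rule norm_triangle_ineq4)
  also have "norm (z ^ n) <= 1" using assms(1) by (simp add: norm_power power_le_one)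
  finally show ?thesis by simp
 qed
 ultimately show ?thesis by (simp add: norm_divide divide_right_mono)
qed

context stable_walk
begin

abbreviation "p n x \<equiv> \<P>(w in M. S n w = x)"

lemma norm_\<phi>_le_1: "norm (\<phi> t) <= 1"
 unfolding \<phi>_def by (rule real_distribution.cmod_char_le_1[OF \<phi>_dist])

lemma \<phi>_measurable[measurable]: "\<phi> \<in> borel_measurable borel"
 unfolding \<phi>_def by (rule real_distribution.char_measurable[OF \<phi>_dist])

lemma expectation_iexp_S: "expectation (%w. iexp (t * T n w)) = \<phi> t ^ n"
proof -
 have "char (distr M borel (%w. T n w)) t = \<phi> t ^ n"
  using char_sum[of "{1..n}"] by (auto simp: random_walk_def)
 then show ?thesis unfolding char_def by (subst (asm) integral_distr) auto
qed

lemma p_eq: "complex_of_real (p n x) = (LBINT t:{-pi<..pi}. \<phi> t ^ n * iexp (- (t * real_of_int x))) / (2 * pi)"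
proof -
 let ?h = "%t w. indicator {-pi<..pi} t *\<^sub>R iexp (t * real_of_int (S n w - x))"
 have fub: "(LINT w|M. (LBINT t. ?h t w)) = (LBINT t. (LINT w|M. ?h t w))"
 proof (rule Fubini_prob_lborel(3)[OF prob_space_axioms])
  show "integrable lborel (%t. indicator {-pi<..pi} t :: real)" by (intro integrable_real_indicator) auto
 qed (auto simp: indicator_def simp del: of_int_diff)
 have "(LBINT t. ?h t w) = of_real (2 * pi) * complex_of_real (indicator {w \<in> space M. S n w = x} w)" if "w \<in> space M" for w
  using integral_iexp_period[of "S n w - x"] that unfolding set_lebesgue_integral_def by (auto simp: indicator_def)
 then have "(LINT w|M. (LBINT t. ?h t w)) = (LINT w|M. of_real (2 * pi) * complex_of_real (indicator {w \<in> space M. S n w = x} w))"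
  by (intro integral_cong) auto
 also have "... = of_real (2 * pi) * complex_of_real (p n x)"
  by (simp only: integral_mult_right_zero integral_complex_of_real) simp
 finally have 1: "(LBINT t. (LINT w|M. ?h t w)) = of_real (2 * pi) * complex_of_real (p n x)" unfolding fub .
 have "(LINT w|M. ?h t w) = indicator {-pi<..pi} t *\<^sub>R (\<phi> t ^ n * iexp (- (t * real_of_int x)))" for t
 proof -
  have "iexp (t * real_of_int (S n w - x)) = iexp (t * T n w) * iexp (- (t * real_of_int x))" for w
   by (simp add: exp_add[symmetric] algebra_simps flip: exp_add)
  then show ?thesis using expectation_iexp_S[of t n] by simp
 qed
 then have "(LBINT t. (LINT w|M. ?h t w)) = (LBINT t:{-pi<..pi}. \<phi> t ^ n * iexp (- (t * real_of_int x)))"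
  unfolding set_lebesgue_integral_def by (simp only:)
 then show ?thesis using 1 by (simp add: field_simps)
qed

lemma p_integrable: "set_integrable lborel {-pi<..pi} (%t. \<phi> t ^ n * iexp (- (t * real_of_int x)))"
 unfolding set_integrable_def
proof (rule integrable_bound)
 show "integrable lborel (%t. indicator {-pi<..pi} t :: real)" by (intro integrable_real_indicator) auto
 have "norm (\<phi> t ^ n) <= 1" for t using norm_\<phi>_le_1 by (simp add: norm_power power_le_one)
 then show "AE t in lborel. norm (indicat_real {- pi<..pi} t *\<^sub>R (\<phi> t ^ n * iexp (- (t * real_of_int x)))) <= norm (indicat_real {- pi<..pi} t)"
  by (intro AE_I2) (auto simp: indicator_def norm_mult)
qed measurable

lemma integral_Ioc_even_le:
 fixes F :: "real => real"
 assumes F: "set_integrable lborel {0<..} F" and m[measurable]: "F \<in> borel_measurable borel" and nn: "!!t. 0 <= F t"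
  and g: "set_integrable lborel {-pi<..pi} g" and le: "!!t. \<bar>t\<bar> <= pi ==> t ~= 0 ==> norm (g t) <= F \<bar>t\<bar>"
 shows "norm (LBINT t:{-pi<..pi}. (g t :: complex)) <= 2 * (LBINT t:{0<..}. F t)"
proof -
 have "norm (LBINT t:{-pi<..pi}. g t) <= (LBINT t. norm (indicator {-pi<..pi} t *\<^sub>R g t))"
  unfolding set_lebesgue_integral_def by (rule integral_norm_bound)
 also have "... <= (LBINT t. F \<bar>t\<bar>)"
 proof (rule integral_mono_AE)
  show "integrable lborel (%t. norm (indicator {-pi<..pi} t *\<^sub>R g t))"
   using g unfolding set_integrable_def by (rule integrable_norm)
  show "integrable lborel (%t. F \<bar>t\<bar>)" by (rule even_integral[OF F m])
  show "AE t in lborel. norm (indicator {-pi<..pi} t *\<^sub>R g t) <= F \<bar>t\<bar>"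
   using AE_lborel_singleton[of 0] by eventually_elim (use le nn in \<open>auto simp: indicator_def\<close>)
 qed
 finally show ?thesis unfolding even_integral(2)[OF F m] .
qed

text \<open>The geometric sum of the powers of \<phi> is at most of the order of the minimum of n
  and |t|^(- \<alpha>), and rescaling t by n^(1 / \<alpha>) gives n n^(- 1 / \<alpha>). Bounding the
  sum as a whole by 2 / |1 - \<phi>| covers frequencies at which |\<phi>| = 1.\<close>

lemma green_bound:
 obtains C where "0 < C" "!!n. 1 <= n ==> (\<Sum>j\<le>n. p j 0) <= C * real n powr (1 - 1 / \<alpha>)"
proof -
 obtain k where k: "0 < k" "!!t. \<bar>t\<bar> <= pi ==> k * \<bar>t\<bar> powr \<alpha> <= norm (1 - \<phi> t)" using one_minus_\<phi>_bound by metis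
 define I where "I = (LBINT s:{0<..}. min 1 (s powr (- \<alpha>)))"
 define K where "K = max 2 (2 / k)"
 have Fi: "set_integrable lborel {0<..} (%s. min 1 (s powr (- \<alpha>)))"
 proof -
  have "set_integrable lborel {0<..} (%x. x powr (- \<alpha>) * min 1 (x powr \<alpha>))"
   using \<alpha> by (intro set_integrable_powr_min) auto
  then show ?thesis
   by (rule set_integrable_cong[THEN iffD1, rotated -1]) (auto simp: min_powr_eq)
 qed
 have I0: "0 <= I" unfolding I_def set_lebesgue_integral_def by (intro integral_nonneg_AE) auto
 have K0: "0 < K" by (simp add: K_def)
 have bd: "(\<Sum>j\<le>n. p j 0) <= K * I / pi * real n powr (1 - 1 / \<alpha>)" if n: "1 <= n" for n
 proof -
  define c where "c = real n powr (1 / \<alpha>)"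
  have c0: "0 < c" using n by (simp add: c_def)
  let ?F = "%t. K * real n * min 1 ((c * t) powr (- \<alpha>))"
  let ?g = "%t. \<Sum>j\<le>n. \<phi> t ^ j * iexp (- (t * real_of_int 0))"
  have gi: "set_integrable lborel {-pi<..pi} ?g"
   using p_integrable[of _ 0] unfolding set_integrable_def scaleR_sum_right by (intro integrable_sum)
  have "(LBINT t:{-pi<..pi}. ?g t) = (\<Sum>j\<le>n. LBINT t:{-pi<..pi}. \<phi> t ^ j * iexp (- (t * real_of_int 0)))"
   using p_integrable[of _ 0] unfolding set_integrable_def set_lebesgue_integral_def scaleR_sum_right
   by (intro integral_sum)
  then have eq: "complex_of_real (\<Sum>j\<le>n. p j 0) = (LBINT t:{-pi<..pi}. ?g t) / (2 * pi)"
   by (simp only: of_real_sum p_eq sum_divide_distrib)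
  have "norm (LBINT t:{-pi<..pi}. ?g t) <= 2 * (LBINT t:{0<..}. ?F t)"
  proof (rule integral_Ioc_even_le[OF _ _ _ gi])
   show "set_integrable lborel {0<..} ?F"
    using scaled_integral(1)[OF c0 Fi] by (intro set_integrable_mult_right) auto
   show "0 <= ?F t" for t using K0 by (intro mult_nonneg_nonneg) auto
   fix t :: real assume t: "\<bar>t\<bar> <= pi" "t ~= 0"
   have g: "?g t = (\<Sum>j<Suc n. \<phi> t ^ j)" by (simp add: lessThan_Suc_atMost)
   have "norm (?g t) <= (\<Sum>j<Suc n. norm (\<phi> t ^ j))" unfolding g by (rule norm_sum)
   also have "... <= (\<Sum>j<Suc n. 1)" using norm_\<phi>_le_1 by (intro sum_mono) (simp add: norm_power power_le_one)
   also have "... <= 2 * real n" using n by simp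
   also have "... <= K * real n" by (intro mult_right_mono) (auto simp: K_def)
   finally have b1: "norm (?g t) <= K * real n" .
   have pt: "0 < k * \<bar>t\<bar> powr \<alpha>" using k t by simp
   have "norm (?g t) <= 2 / norm (1 - \<phi> t)"
    unfolding g by (rule geometric_sum_bound[OF norm_\<phi>_le_1 \<phi>_neq_1[OF t(2,1)]])
   also have "... <= 2 / (k * \<bar>t\<bar> powr \<alpha>)" using pt k(2)[OF t(1)] by (intro divide_left_mono mult_pos_pos[OF less_le_trans[OF pt] pt]) simp_all
   also have "... = 2 / k * \<bar>t\<bar> powr (- \<alpha>)" by (simp add: powr_minus field_simps)
   also have "... <= K * \<bar>t\<bar> powr (- \<alpha>)" by (intro mult_right_mono) (auto simp: K_def)
   also have "\<bar>t\<bar> powr (- \<alpha>) = real n * (c * \<bar>t\<bar>) powr (- \<alpha>)"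
   proof -
    have "c powr (- \<alpha>) = real n powr (- 1)" using \<alpha> by (simp add: c_def powr_powr)
    then show ?thesis using n c0 by (simp add: powr_mult powr_minus)
   qed
   finally have b2: "norm (?g t) <= K * real n * (c * \<bar>t\<bar>) powr (- \<alpha>)" by (simp add: mult_ac)
   show "norm (?g t) <= ?F \<bar>t\<bar>" using b1 b2 by (auto simp: min_def)
  qed measurable
  also have "(LBINT t:{0<..}. ?F t) = K * real n * (I / c)"
   unfolding I_def scaled_integral(2)[OF c0 Fi, symmetric] by (rule set_integral_mult_right)
  finally have F: "norm (LBINT t:{-pi<..pi}. ?g t) <= 2 * (K * real n * (I / c))" .
  have "(\<Sum>j\<le>n. p j 0) <= norm (complex_of_real (\<Sum>j\<le>n. p j 0))" unfolding norm_of_real by linarith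
  also have "... = norm (LBINT t:{-pi<..pi}. ?g t) / (2 * pi)"
   unfolding eq norm_divide by simp
  also have "... <= 2 * (K * real n * (I / c)) / (2 * pi)" by (intro divide_right_mono F) simp
  also have "... = K * I / pi * (real n / c)" by (simp add: field_simps)
  also have "real n / c = real n powr (1 - 1 / \<alpha>)" using n by (simp add: c_def powr_diff)
  finally show ?thesis .
 qed
 show ?thesis
 proof (rule that[of "K * I / pi + 1"])
  show "0 < K * I / pi + 1" using K0 I0 by (intro add_nonneg_pos) auto
  fix n :: nat assume "1 <= n"
  have "K * I / pi * real n powr (1 - 1 / \<alpha>) <= (K * I / pi + 1) * real n powr (1 - 1 / \<alpha>)"
   by (intro mult_right_mono) auto
  then show "(\<Sum>j\<le>n. p j 0) <= (K * I / pi + 1) * real n powr (1 - 1 / \<alpha>)" using bd[OF \<open>1 <= n\<close>] by linarith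
 qed
qed

text \<open>Symmetrising in \<open>h\<close> brings in 2 - 2 cos (t h), which is of order (t h)^2
  and tames the singularity |t|^(- \<alpha>) of 1 / |1 - \<phi>| at 0. The bound on the geometric
  sum is the same for all \<open>m\<close>, and rescaling t by |h| yields the power \<alpha> -
  1.\<close>

lemma potential_bound:
 obtains C where "0 < C" "!!m h. (\<Sum>i=1..m. 2 * p i 0 - p i h - p i (- h)) <= C * \<bar>real_of_int h\<bar> powr (\<alpha> - 1)"
proof -
 obtain \<kappa> where \<kappa>: "0 < \<kappa>" "!!t. \<bar>t\<bar> <= pi ==> \<kappa> * \<bar>t\<bar> powr \<alpha> <= norm (1 - \<phi> t)" using one_minus_\<phi>_bound by metis
 define I where "I = (LBINT s:{0<..}. s powr (- \<alpha>) * min 1 (s powr 2))"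
 have Fi: "set_integrable lborel {0<..} (%s. s powr (- \<alpha>) * min 1 (s powr 2))"
  using \<alpha> by (intro set_integrable_powr_min) auto
 have I0: "0 <= I" unfolding I_def set_lebesgue_integral_def by (intro integral_nonneg_AE) auto
 define C where "C = 8 / \<kappa> * I / pi + 1"
 have C0: "0 < C" unfolding C_def using I0 \<kappa> by (intro add_nonneg_pos) auto
 have bd: "(\<Sum>i=1..m. 2 * p i 0 - p i h - p i (- h)) <= C * \<bar>real_of_int h\<bar> powr (\<alpha> - 1)" for m h
 proof (cases "h = 0")
  case False
  define c where "c = \<bar>real_of_int h\<bar>"
  have c0: "0 < c" using False by (simp add: c_def)
  let ?F = "%t. 8 / \<kappa> * c powr \<alpha> * ((c * t) powr (- \<alpha>) * min 1 ((c * t) powr 2))"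
  let ?e = "%x t. iexp (- (t * real_of_int x))"
  let ?g = "%t. \<Sum>i=1..m. 2 * (\<phi> t ^ i * ?e 0 t) - \<phi> t ^ i * ?e h t - \<phi> t ^ i * ?e (- h) t"
  have i1: "integrable lborel (%t. indicator {-pi<..pi} t *\<^sub>R (\<phi> t ^ i * ?e x t))" for i x
   using p_integrable[of i x] unfolding set_integrable_def .
  have i2: "integrable lborel (%t. indicator {-pi<..pi} t *\<^sub>R (2 * (\<phi> t ^ i * ?e 0 t) - \<phi> t ^ i * ?e h t - \<phi> t ^ i * ?e (- h) t))" for i
  proof -
   have "integrable lborel (%t. 2 * (indicator {-pi<..pi} t *\<^sub>R (\<phi> t ^ i * ?e 0 t)) - indicator {-pi<..pi} t *\<^sub>R (\<phi> t ^ i * ?e h t) - indicator {-pi<..pi} t *\<^sub>R (\<phi> t ^ i * ?e (- h) t))"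
    by (intro integrable_diff integrable_mult_right i1)
   then show ?thesis by (rule integrable_cong[THEN iffD1, rotated -1]) (auto simp: indicator_def)
  qed
  have gi: "set_integrable lborel {-pi<..pi} ?g"
   unfolding set_integrable_def scaleR_sum_right by (intro integrable_sum i2)
  have one: "(LBINT t:{-pi<..pi}. 2 * (\<phi> t ^ i * ?e 0 t) - \<phi> t ^ i * ?e h t - \<phi> t ^ i * ?e (- h) t)
   = (2 * pi) * complex_of_real (2 * p i 0 - p i h - p i (- h))" for i
  proof -
   have "(LBINT t:{-pi<..pi}. 2 * (\<phi> t ^ i * ?e 0 t) - \<phi> t ^ i * ?e h t - \<phi> t ^ i * ?e (- h) t)
    = (LBINT t. 2 * (indicator {-pi<..pi} t *\<^sub>R (\<phi> t ^ i * ?e 0 t)) - indicator {-pi<..pi} t *\<^sub>R (\<phi> t ^ i * ?e h t) - indicator {-pi<..pi} t *\<^sub>R (\<phi> t ^ i * ?e (- h) t))"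
    unfolding set_lebesgue_integral_def by (intro integral_cong) (auto simp: indicator_def)
   also have "... = 2 * (LBINT t:{-pi<..pi}. \<phi> t ^ i * ?e 0 t) - (LBINT t:{-pi<..pi}. \<phi> t ^ i * ?e h t) - (LBINT t:{-pi<..pi}. \<phi> t ^ i * ?e (- h) t)"
    unfolding set_lebesgue_integral_def
    by (subst integral_diff integral_diff; (intro integrable_diff integrable_mult_right i1)?)+
     (simp only: integral_mult_right_zero)
   also have "... = (2 * pi) * complex_of_real (2 * p i 0 - p i h - p i (- h))"
    by (simp only: of_real_diff of_real_mult p_eq) (simp add: algebra_simps)
   finally show ?thesis .
  qed
  have "(LBINT t:{-pi<..pi}. ?g t) = (\<Sum>i=1..m. LBINT t:{-pi<..pi}. 2 * (\<phi> t ^ i * ?e 0 t) - \<phi> t ^ i * ?e h t - \<phi> t ^ i * ?e (- h) t)"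
   unfolding set_lebesgue_integral_def scaleR_sum_right by (intro integral_sum i2)
  then have eq: "(LBINT t:{-pi<..pi}. ?g t) = (2 * pi) * complex_of_real (\<Sum>i=1..m. 2 * p i 0 - p i h - p i (- h))"
   unfolding one by (simp only: of_real_sum sum_distrib_left)
  have "norm (LBINT t:{-pi<..pi}. ?g t) <= 2 * (LBINT t:{0<..}. ?F t)"
  proof (rule integral_Ioc_even_le[OF _ _ _ gi])
   show "set_integrable lborel {0<..} ?F"
    using scaled_integral(1)[OF c0 Fi] by (intro set_integrable_mult_right) auto
   show "0 <= ?F t" for t using \<kappa> c0 by (intro mult_nonneg_nonneg) auto
   fix t :: real assume t: "\<bar>t\<bar> <= pi" "t ~= 0"
   have pt: "0 < \<kappa> * \<bar>t\<bar> powr \<alpha>" using \<kappa> t by simp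
   have "?g t = (\<Sum>i=1..m. \<phi> t ^ i * (2 - ?e h t - ?e (- h) t))"
    by (intro sum.cong) (simp_all add: algebra_simps)
   also have "... = (\<Sum>i<m. \<phi> t ^ i) * \<phi> t * (2 - ?e h t - ?e (- h) t)"
   proof -
    have "(\<Sum>i=1..m. \<phi> t ^ i) = (\<Sum>i<m. \<phi> t ^ Suc i)"
     by (rule sum.reindex_bij_witness[of _ Suc "%i. i - 1"]) auto
    also have "... = (\<Sum>i<m. \<phi> t ^ i) * \<phi> t" unfolding sum_distrib_right by (simp add: mult.commute)
    finally show ?thesis by (simp only: sum_distrib_right[symmetric])
   qed
   finally have g: "?g t = (\<Sum>i<m. \<phi> t ^ i) * \<phi> t * (2 - ?e h t - ?e (- h) t)" .
   have k: "norm (2 - ?e h t - ?e (- h) t) <= 4 * min 1 ((c * \<bar>t\<bar>) powr 2)"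
   proof -
    have e: "2 - ?e h t - ?e (- h) t = of_real (2 - 2 * cos (t * real_of_int h))"
     by (simp add: complex_eq_iff Re_exp Im_exp)
    have "1 - cos (t * real_of_int h) = 2 * (sin (t * real_of_int h / 2))^2"
     using cos_double_sin[of "t * real_of_int h / 2"] by simp
    moreover have "(sin (t * real_of_int h / 2))^2 <= (t * real_of_int h / 2)^2"
     by (rule abs_le_square_iff[THEN iffD1, OF abs_sin_x_le_abs_x])
    moreover have "(t * real_of_int h / 2)^2 = (c * \<bar>t\<bar>) powr 2 / 4"
     using c0 t by (simp add: c_def power_mult_distrib power_divide powr_realpow)
    moreover have "(sin (t * real_of_int h / 2))^2 <= 1" by (rule abs_square_le_1[THEN iffD2]) simp
    moreover have "0 <= 2 - 2 * cos (t * real_of_int h)" using cos_le_one[of "t * real_of_int h"] by linarith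
    moreover have "0 <= (c * \<bar>t\<bar>) powr 2" by (rule powr_ge_zero)
    ultimately have "\<bar>2 - 2 * cos (t * real_of_int h)\<bar> <= 4" "\<bar>2 - 2 * cos (t * real_of_int h)\<bar> <= 4 * (c * \<bar>t\<bar>) powr 2" by linarith+
    then show ?thesis unfolding e norm_of_real by (simp only: min_def split: if_splits) simp
   qed
   have "norm (\<Sum>i<m. \<phi> t ^ i) <= 2 / norm (1 - \<phi> t)"
    by (rule geometric_sum_bound[OF norm_\<phi>_le_1 \<phi>_neq_1[OF t(2,1)]])
   also have "... <= 2 / (\<kappa> * \<bar>t\<bar> powr \<alpha>)" using pt \<kappa>(2)[OF t(1)] by (intro divide_left_mono mult_pos_pos[OF less_le_trans[OF pt] pt]) simp_all
   also have "... = 2 / \<kappa> * \<bar>t\<bar> powr (- \<alpha>)" by (simp add: powr_minus field_simps)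
   also have "\<bar>t\<bar> powr (- \<alpha>) = c powr \<alpha> * (c * \<bar>t\<bar>) powr (- \<alpha>)"
    using c0 by (simp add: powr_mult powr_minus)
   finally have s: "norm (\<Sum>i<m. \<phi> t ^ i) <= 2 / \<kappa> * (c powr \<alpha> * (c * \<bar>t\<bar>) powr (- \<alpha>))" .
   have "norm (?g t) = norm (\<Sum>i<m. \<phi> t ^ i) * norm (\<phi> t) * norm (2 - ?e h t - ?e (- h) t)"
    unfolding g norm_mult ..
   also have "... <= (2 / \<kappa> * (c powr \<alpha> * (c * \<bar>t\<bar>) powr (- \<alpha>))) * 1 * (4 * min 1 ((c * \<bar>t\<bar>) powr 2))"
    using \<kappa> by (intro mult_mono s k norm_\<phi>_le_1 mult_nonneg_nonneg) auto
   also have "... = ?F \<bar>t\<bar>" by (simp add: mult_ac)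
   finally show "norm (?g t) <= ?F \<bar>t\<bar>" .
  qed measurable
  also have "(LBINT t:{0<..}. ?F t) = 8 / \<kappa> * c powr \<alpha> * (I / c)"
   unfolding I_def scaled_integral(2)[OF c0 Fi, symmetric] by (rule set_integral_mult_right)
  finally have "2 * pi * \<bar>\<Sum>i=1..m. 2 * p i 0 - p i h - p i (- h)\<bar> <= 2 * (8 / \<kappa> * c powr \<alpha> * (I / c))"
   unfolding eq by (simp only: norm_mult norm_of_real) simp
  then have "\<bar>\<Sum>i=1..m. 2 * p i 0 - p i h - p i (- h)\<bar> * pi <= 8 / \<kappa> * c powr \<alpha> * (I / c)"
   by (simp only: mult.assoc mult.commute[of pi] mult_le_cancel_left_pos zero_less_numeral)
  then have "\<bar>\<Sum>i=1..m. 2 * p i 0 - p i h - p i (- h)\<bar> <= 8 / \<kappa> * c powr \<alpha> * (I / c) / pi"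
   by (simp only: pos_le_divide_eq pi_gt_zero)
  also have "... = 8 / \<kappa> * I / pi * (c powr \<alpha> / c)" by (simp add: mult_ac)
  also have "c powr \<alpha> / c = c powr (\<alpha> - 1)" using c0 by (simp add: powr_diff)
  also have "8 / \<kappa> * I / pi * c powr (\<alpha> - 1) <= C * c powr (\<alpha> - 1)"
   unfolding C_def by (intro mult_right_mono) auto
  finally show ?thesis unfolding c_def by linarith
 qed simp
 show ?thesis by (rule that[OF C0 bd])
qed

end

section \<open>Occupation numbers and the maximal inequality\<close>

definition occ :: "(nat => int) => nat => int => nat" where
 "occ s n y = card {k \<in> {1..n}. s k = y}"

text \<open>The sum of N(y)^\<beta> over sites y, with N(y) the number of visits, written over
  times: a site is met N(y) times, each time with weight N(y)^(\<beta> - 1). In this form the index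
  set is fixed and every base is at least 1.\<close>

definition occ_sum :: "real => (nat => int) => nat => real" where
 "occ_sum \<beta> s n = (\<Sum>k=1..n. real (occ s n (s k)) powr (\<beta> - 1))"

lemma occ_eq_sum: "real (occ s n y) = (\<Sum>k=1..n. of_bool (s k = y))"
 unfolding occ_def by (simp add: sum.If_cases of_bool_def Int_def)

lemma occ_pos: "k \<in> {1..n} ==> 1 <= occ s n (s k)"
 unfolding occ_def by (simp add: Suc_le_eq card_gt_0_iff) auto

lemma occ_le: "occ s n y <= n"
 unfolding occ_def by (rule order_trans[OF card_mono[of "{1..n}"]]) auto

lemma occ_sum_ge_1:
 assumes "1 <= n" "0 < \<beta>"
 shows "1 <= occ_sum \<beta> s n"
proof -
 have "real n powr (\<beta> - 1) <= real (occ s n (s k)) powr (\<beta> - 1) \<or> 1 <= real (occ s n (s k)) powr (\<beta> - 1)" if "k \<in> {1..n}" for k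
 proof (cases "\<beta> <= 1")
  case True
  then show ?thesis using occ_pos[OF that, of s] occ_le[of s n "s k"] by (intro disjI1 powr_mono2') auto
 next
  case False
  then show ?thesis using occ_pos[OF that, of s] by (intro disjI2 ge_one_powr_ge_zero) auto
 qed
 then have "min 1 (real n powr (\<beta> - 1)) <= real (occ s n (s k)) powr (\<beta> - 1)" if "k \<in> {1..n}" for k
  using that by (meson min.coboundedI1 min.coboundedI2)
 then have "(\<Sum>k=1..n. min 1 (real n powr (\<beta> - 1))) <= occ_sum \<beta> s n"
  unfolding occ_sum_def by (intro sum_mono)
 moreover have "1 <= (\<Sum>k=1..n. min 1 (real n powr (\<beta> - 1)))"
 proof -
  have "real n * real n powr (\<beta> - 1) = real n powr \<beta>" using assms by (simp add: powr_diff)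
  moreover have "1 <= real n powr \<beta>" using assms by (intro ge_one_powr_ge_zero) auto
  ultimately show ?thesis using assms by (simp add: min_def)
 qed
 ultimately show ?thesis by linarith
qed

text \<open>The right side is minimal at \<open>y = 1\<close>, with equality there. The tangent line
  of exp at 0, used for both powers, makes this explicit: the logarithms cancel.\<close>

lemma weighted_am_gm_powr:
 fixes b y :: real
 assumes "0 < b" "0 < y"
 shows "2 + b <= 2 * y powr (- b) + b * y^2"
proof -
 have "1 + (- b) * ln y <= exp ((- b) * ln y)" by (rule exp_ge_add_one_self)
 moreover have "1 + 2 * ln y <= exp (2 * ln y)" by (rule exp_ge_add_one_self)
 moreover have "exp (2 * ln y) = y^2" using assms by (simp add: exp_double)
 moreover have "exp ((- b) * ln y) = y powr (- b)" using assms by (simp add: powr_def)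
 ultimately have "1 - b * ln y <= y powr (- b)" "b * (1 + 2 * ln y) <= b * y^2" using assms by auto
 then show ?thesis by (simp add: algebra_simps)
qed

text \<open>A comparison of the power means of exponents - b and 2. Rescaling by \<open>l\<close>
  brings the mean square to 1, where \<open>weighted_am_gm_powr\<close> can be summed term by
  term.\<close>

lemma sum_powr_neg_bound:
 fixes x :: "'i => real"
 assumes fin: "finite A" "A ~= {}" and x: "!!i. i \<in> A ==> 0 < x i" and b: "0 < b"
 shows "(\<Sum>i\<in>A. x i powr (- b)) powr (- 2 / b) <= real (card A) powr (- 2 / b - 1) * (\<Sum>i\<in>A. (x i)^2)"
proof -
 let ?n = "real (card A)" and ?V = "\<Sum>i\<in>A. x i powr (- b)" and ?Q = "\<Sum>i\<in>A. (x i)^2"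
 have n0: "0 < ?n" using fin by (simp add: card_gt_0_iff)
 have Q0: "0 < ?Q" using fin by (intro sum_pos zero_less_power x) auto
 define l where "l = sqrt (?n / ?Q)"
 have l0: "0 < l" using n0 Q0 by (simp add: l_def)
 have l2: "l^2 = ?n / ?Q" using n0 Q0 by (simp add: l_def)
 have "?n * (2 + b) = (\<Sum>i\<in>A. 2 + b)" by simp
 also have "... <= (\<Sum>i\<in>A. 2 * (l * x i) powr (- b) + b * (l * x i)^2)"
  using x l0 by (intro sum_mono weighted_am_gm_powr b mult_pos_pos) auto
 also have "... = (\<Sum>i\<in>A. 2 * l powr (- b) * x i powr (- b) + b * l^2 * (x i)^2)"
  using x l0 by (intro sum.cong refl) (simp add: powr_mult power_mult_distrib less_imp_le)
 also have "... = 2 * l powr (- b) * ?V + b * l^2 * ?Q"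
  by (simp only: sum.distrib sum_distrib_left)
 also have "b * l^2 * ?Q = b * ?n" unfolding l2 using Q0 by simp
 finally have "?n <= l powr (- b) * ?V" by (simp add: algebra_simps)
 then have "?n * l powr b <= l powr (- b) * ?V * l powr b" by (intro mult_right_mono) auto
 also have "... = ?V" using l0 by (simp add: powr_minus)
 finally have V: "?n * l powr b <= ?V" .
 have "?V powr (- 2 / b) <= (?n * l powr b) powr (- 2 / b)"
  using V n0 l0 b by (intro powr_mono2') auto
 also have "... = ?n powr (- 2 / b) * l powr (- 2)" using n0 l0 b by (simp add: powr_mult powr_powr)
 also have "l powr (- 2) = inverse (l^2)" using l0 by (simp add: powr_minus powr_realpow)
 also have "... = ?Q / ?n" unfolding l2 by simp
 also have "?n powr (- 2 / b) * (?Q / ?n) = ?n powr (- 2 / b - 1) * ?Q" using n0 by (simp add: powr_diff)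
 finally show ?thesis .
qed

lemma square_of_bool_sum_le:
 fixes e :: "nat => real"
 assumes "finite I" "!!i. 0 <= e i"
 shows "(\<Sum>i\<in>I. e i)^2 <= 2 * (\<Sum>i\<in>I. \<Sum>j\<in>I. of_bool (i <= j) * (e i * e j))"
proof -
 have "(\<Sum>i\<in>I. e i)^2 = (\<Sum>i\<in>I. \<Sum>j\<in>I. e i * e j)" by (simp add: power2_eq_square sum_product)
 also have "... <= (\<Sum>i\<in>I. \<Sum>j\<in>I. of_bool (i <= j) * (e i * e j) + of_bool (j <= i) * (e j * e i))"
  using assms(2) by (intro sum_mono) (auto simp: mult.commute)
 also have "... = (\<Sum>i\<in>I. \<Sum>j\<in>I. of_bool (i <= j) * (e i * e j)) + (\<Sum>i\<in>I. \<Sum>j\<in>I. of_bool (j <= i) * (e j * e i))"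
  by (simp only: sum.distrib)
 also have "(\<Sum>i\<in>I. \<Sum>j\<in>I. of_bool (j <= i) * (e j * e i)) = (\<Sum>i\<in>I. \<Sum>j\<in>I. of_bool (i <= j) * (e i * e j))"
  by (rule sum.swap)
 finally show ?thesis by simp
qed

lemma sum_inj_le:
 fixes g :: "'b => real"
 assumes "finite B" "inj_on f A" "f ` A \<subseteq> B" "!!b. 0 <= g b"
 shows "(\<Sum>a\<in>A. g (f a)) <= (\<Sum>b\<in>B. g b)"
proof -
 have "(\<Sum>a\<in>A. g (f a)) = (\<Sum>b\<in>f ` A. g b)" using assms(2) by (simp add: sum.reindex)
 also have "... <= (\<Sum>b\<in>B. g b)" using assms by (intro sum_mono2) auto
 finally show ?thesis .
qed

lemma add_int_measurable:
 fixes f g :: "'a => int"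
 assumes [measurable]: "f \<in> measurable M (count_space UNIV)" "g \<in> measurable M (count_space UNIV)"
 shows "(%x. f x + g x) \<in> measurable M (count_space UNIV)"
 by measurable

lemma sum_coordinates_measurable:
 assumes "finite J" "J \<subseteq> I"
 shows "(%x. \<Sum>i\<in>J. x i) \<in> measurable (PiM I (%_. count_space UNIV :: int measure)) (count_space UNIV)"
 using assms
proof (induction J rule: finite_induct)
 case (insert i F)
 have [measurable]: "(%x. x i) \<in> measurable (PiM I (%_. count_space UNIV :: int measure)) (count_space UNIV)"
  using insert by (intro measurable_component_singleton) auto
 have [measurable]: "(%x. \<Sum>i\<in>F. x i) \<in> measurable (PiM I (%_. count_space UNIV :: int measure)) (count_space UNIV)"
  using insert by auto
 have e: "(%x. \<Sum>i\<in>insert i F. x i) = (%x. x i + (\<Sum>i\<in>F. (x i :: int)))" using insert by auto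
 show ?case unfolding e by (rule add_int_measurable) fact+
qed simp

section \<open>Second moment of the occupation numbers and the maximal inequality\<close>

context stable_walk
begin

lemma prob_sum_X:
 assumes "finite A" "A \<subseteq> {1..}"
 shows "\<P>(w in M. Q (\<Sum>k\<in>A. X k w)) = \<P>(w in M. Q (S (card A) w))"
proof -
 have e: "expectation (%w. of_bool (Q (f w)) :: real) = \<P>(w in M. Q (f w))" if f: "f \<in> measurable M (count_space UNIV)" for f
 proof -
  have "{w \<in> space M. Q (f w)} = f -` {x. Q x} \<inter> space M" by auto
  then have s: "{w \<in> space M. Q (f w)} \<in> sets M" using measurable_sets[OF f, of "{x. Q x}"] by simp
  have "expectation (%w. of_bool (Q (f w)) :: real) = expectation (indicator {w \<in> space M. Q (f w)})"
   by (intro integral_cong) (auto simp: indicator_def)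
  then show ?thesis using s by simp
 qed
 show ?thesis
  using expectation_sum_X[OF assms, of "%x. of_bool (Q x) :: real"]
  unfolding e[OF sum_X_measurable[OF assms(2)]] e[OF S_measurable] .
qed

lemma indep_blocks:
 assumes "A \<inter> B = {}" "A \<subseteq> {1..}" "B \<subseteq> {1..}"
  and [measurable]: "Measurable.pred (PiM A (%_. count_space UNIV)) P" "Measurable.pred (PiM B (%_. count_space UNIV)) Q"
 shows "\<P>(w in M. P (restrict (%i. X i w) A) \<and> Q (restrict (%i. X i w) B))
  = \<P>(w in M. P (restrict (%i. X i w) A)) * \<P>(w in M. Q (restrict (%i. X i w) B))"
proof -
 let ?PA = "PiM A (%_. count_space UNIV :: int measure)" and ?PB = "PiM B (%_. count_space UNIV :: int measure)"
 let ?f = "%w. restrict (%i. X i w) A" and ?g = "%w. restrict (%i. X i w) B"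
 have iv: "indep_var ?PA ?f ?PB ?g"
  by (rule indep_var_restrict[OF indep_X assms(1-3)])
 have sp: "?f w \<in> space ?PA" "?g w \<in> space ?PB" for w by (auto simp: space_PiM)
 have "prob ((%x. (?f x, ?g x)) -` ({x \<in> space ?PA. P x} \<times> {x \<in> space ?PB. Q x}) \<inter> space M) =
  prob (?f -` {x \<in> space ?PA. P x} \<inter> space M) * prob (?g -` {x \<in> space ?PB. Q x} \<inter> space M)"
  by (rule indep_varD[OF iv]) auto
 moreover have "(%x. (?f x, ?g x)) -` ({x \<in> space ?PA. P x} \<times> {x \<in> space ?PB. Q x}) \<inter> space M = {w \<in> space M. P (?f w) \<and> Q (?g w)}"
  using sp by auto
 moreover have "?f -` {x \<in> space ?PA. P x} \<inter> space M = {w \<in> space M. P (?f w)}" using sp by auto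
 moreover have "?g -` {x \<in> space ?PB. Q x} \<inter> space M = {w \<in> space M. Q (?g w)}" using sp by auto
 ultimately show ?thesis by simp
qed

lemma S_diff: "a <= b ==> S b w - S a w = (\<Sum>k\<in>{a+1..b}. X k w)"
proof -
 assume "a <= b"
 then have "{1..b} = {1..a} \<union> {a+1..b}" by auto
 then have "(\<Sum>k\<in>{1..b}. X k w) = (\<Sum>k\<in>{1..a}. X k w) + (\<Sum>k\<in>{a+1..b}. X k w)"
  by (simp add: sum.union_disjoint)
 then show ?thesis by (simp add: random_walk_def)
qed

lemma prob_S_diff: "a <= b ==> \<P>(w in M. Q (S b w - S a w)) = \<P>(w in M. Q (S (b - a) w))"
 using prob_sum_X[of "{a+1..b}" Q] by (simp add: S_diff)

lemma prob_triple:
 assumes "a <= b" "b <= c"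
 shows "\<P>(w in M. S a w = S b w \<and> S b w = S c w) = \<P>(w in M. S (b - a) w = 0) * \<P>(w in M. S (c - b) w = 0)"
proof -
 let ?A = "{a+1..b}" and ?B = "{b+1..c}"
 have "\<P>(w in M. (\<Sum>k\<in>?A. restrict (%i. X i w) ?A k) = 0 \<and> (\<Sum>k\<in>?B. restrict (%i. X i w) ?B k) = 0)
  = \<P>(w in M. (\<Sum>k\<in>?A. restrict (%i. X i w) ?A k) = 0) * \<P>(w in M. (\<Sum>k\<in>?B. restrict (%i. X i w) ?B k) = 0)"
 proof (rule indep_blocks)
  have [measurable]: "(%x. \<Sum>i\<in>J. x i) \<in> measurable (PiM J (%_. count_space UNIV :: int measure)) (count_space UNIV)" if "finite J" for J :: "nat set"
   using that by (intro sum_coordinates_measurable) auto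
  show "Measurable.pred (PiM ?A (%_. count_space UNIV)) (%x. (\<Sum>k\<in>?A. x k) = (0::int))" by measurable
  show "Measurable.pred (PiM ?B (%_. count_space UNIV)) (%x. (\<Sum>k\<in>?B. x k) = (0::int))" by measurable
 qed auto
 moreover have "(\<Sum>k\<in>C. restrict (%i. X i w) C k) = (\<Sum>k\<in>C. X k w)" for C w by (intro sum.cong) auto
 ultimately have "\<P>(w in M. S b w - S a w = 0 \<and> S c w - S b w = 0) = \<P>(w in M. S b w - S a w = 0) * \<P>(w in M. S c w - S b w = 0)"
  using assms by (simp only: S_diff)
 also have "... = \<P>(w in M. S (b - a) w = 0) * \<P>(w in M. S (c - b) w = 0)"
  using prob_S_diff[OF assms(1), of "%x. x = 0"] prob_S_diff[OF assms(2), of "%x. x = 0"] by simp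
 finally have "\<P>(w in M. S b w - S a w = 0 \<and> S c w - S b w = 0) = \<P>(w in M. S (b - a) w = 0) * \<P>(w in M. S (c - b) w = 0)" .
 moreover have "{w \<in> space M. S b w - S a w = 0 \<and> S c w - S b w = 0} = {w \<in> space M. S a w = S b w \<and> S b w = S c w}" by auto
 ultimately show ?thesis by (simp only:)
qed

text \<open>Seen from time \<open>k\<close>, the visits to the current site split into future and
  past, both including \<open>k\<close> itself. An ordered pair of visits on one side amounts to two
  successive returns to 0 and factorises by independence, so each side has second moment at most 2
  G^2, with \<open>G\<close> the truncated Green function.\<close>

lemma expectation_occ_square:
 shows "expectation (%w. \<Sum>k=1..n. (real (occ (%j. S j w) n (S k w)))^2) <= 8 * real n * (\<Sum>j\<le>n. \<P>(w in M. S j w = 0))^2"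
proof -
 define p where "p j = \<P>(w in M. S j w = 0)" for j
 have p0: "0 <= p j" for j by (simp add: p_def)
 define G where "G = (\<Sum>j\<le>n. p j)"
 have G0: "0 <= G" unfolding G_def by (intro sum_nonneg p0)
 let ?e = "%w i k. of_bool (S i w = S k w) :: real"
 let ?P = "%i j k. \<P>(w in M. S i w = S k w \<and> S j w = S k w)" and ?o = "%k w. real (occ (%j. S j w) n (S k w))"
 let ?l = "%k w. (\<Sum>i\<in>{1..k}. ?e w i k)" and ?r = "%k w. (\<Sum>i\<in>{k..n}. ?e w i k)"
 have int: "integrable M (%w. ?e w i k * ?e w j k)" for i j k
  by (rule integrable_const_bound[where B=1]) auto
 have E: "expectation (%w. ?e w i k * ?e w j k) = ?P i j k" for i j k
 proof -
  have "expectation (%w. ?e w i k * ?e w j k) = expectation (indicator {w \<in> space M. S i w = S k w \<and> S j w = S k w})"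
   by (intro integral_cong) (auto simp: indicator_def)
  then show ?thesis by simp
 qed
 have sq: "integrable M (%w. (\<Sum>i\<in>I. ?e w i k)^2)" and
  sqE: "expectation (%w. (\<Sum>i\<in>I. ?e w i k)^2) <= 2 * (\<Sum>i\<in>I. \<Sum>j\<in>I. of_bool (i <= j) * ?P i j k)"
  if I: "finite I" for I k
 proof -
  have "(\<Sum>i\<in>I. ?e w i k)^2 = (\<Sum>i\<in>I. \<Sum>j\<in>I. ?e w i k * ?e w j k)" for w by (simp only: power2_eq_square sum_product)
  then show s: "integrable M (%w. (\<Sum>i\<in>I. ?e w i k)^2)"
   using int by (simp only:) (intro integrable_sum int)
  have i2: "integrable M (%w. \<Sum>i\<in>I. \<Sum>j\<in>I. of_bool (i <= j) * (?e w i k * ?e w j k))"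
   by (intro integrable_sum integrable_mult_right int)
  have "expectation (%w. (\<Sum>i\<in>I. ?e w i k)^2) <= expectation (%w. 2 * (\<Sum>i\<in>I. \<Sum>j\<in>I. of_bool (i <= j) * (?e w i k * ?e w j k)))"
   using i2 by (intro integral_mono s integrable_mult_right square_of_bool_sum_le I) auto
  also have "... = 2 * (\<Sum>i\<in>I. \<Sum>j\<in>I. of_bool (i <= j) * expectation (%w. ?e w i k * ?e w j k))"
   by (simp only: integral_mult_right_zero integral_sum integrable_sum integrable_mult_right int)
  finally show "expectation (%w. (\<Sum>i\<in>I. ?e w i k)^2) <= 2 * (\<Sum>i\<in>I. \<Sum>j\<in>I. of_bool (i <= j) * ?P i j k)"
   unfolding E .
 qed
 have R: "expectation (%w. (?r k w)^2) <= 2 * G^2" for k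
 proof -
  have "(\<Sum>i\<in>{k..n}. \<Sum>j\<in>{k..n}. of_bool (i <= j) * ?P i j k)
   = (\<Sum>i\<in>{k..n}. p (i - k) * (\<Sum>j\<in>{k..n}. of_bool (i <= j) * p (j - i)))"
   unfolding sum_distrib_left
  proof (intro sum.cong refl)
   fix i j assume i: "i \<in> {k..n}" and j: "j \<in> {k..n}"
   show "of_bool (i <= j) * ?P i j k = p (i - k) * (of_bool (i <= j) * p (j - i))"
   proof (cases "i <= j")
    case True
    have "{w \<in> space M. S i w = S k w \<and> S j w = S k w} = {w \<in> space M. S k w = S i w \<and> S i w = S j w}" by auto
    then show ?thesis using prob_triple[of k i j] i True by (simp add: p_def)
   qed simp
  qed
  also have "... <= (\<Sum>i\<in>{k..n}. p (i - k) * G)"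
  proof (intro sum_mono mult_left_mono p0)
   fix i assume i: "i \<in> {k..n}"
   have "(\<Sum>j\<in>{k..n}. of_bool (i <= j) * p (j - i)) = (\<Sum>j\<in>{i..n}. p (j - i))"
    using i by (intro sum.mono_neutral_cong_right) auto
   also have "... <= G" unfolding G_def by (rule sum_inj_le) (auto simp: inj_on_def p0)
   finally show "(\<Sum>j\<in>{k..n}. of_bool (i <= j) * p (j - i)) <= G" .
  qed
  also have "... = (\<Sum>i\<in>{k..n}. p (i - k)) * G" by (simp only: sum_distrib_right)
  also have "... <= G * G"
   by (intro mult_right_mono G0) (unfold G_def, rule sum_inj_le, auto simp: inj_on_def p0)
  finally show ?thesis using sqE[of "{k..n}" k] by (simp add: power2_eq_square)
 qed
 have L: "expectation (%w. (?l k w)^2) <= 2 * G^2" if k: "k <= n" for k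
 proof -
  have "(\<Sum>i\<in>{1..k}. \<Sum>j\<in>{1..k}. of_bool (i <= j) * ?P i j k)
   = (\<Sum>j\<in>{1..k}. \<Sum>i\<in>{1..k}. of_bool (i <= j) * ?P i j k)"
   by (rule sum.swap)
  also have "... = (\<Sum>j\<in>{1..k}. p (k - j) * (\<Sum>i\<in>{1..k}. of_bool (i <= j) * p (j - i)))"
   unfolding sum_distrib_left
  proof (intro sum.cong refl)
   fix i j assume i: "i \<in> {1..k}" and j: "j \<in> {1..k}"
   show "of_bool (i <= j) * ?P i j k = p (k - j) * (of_bool (i <= j) * p (j - i))"
   proof (cases "i <= j")
    case True
    have "{w \<in> space M. S i w = S k w \<and> S j w = S k w} = {w \<in> space M. S i w = S j w \<and> S j w = S k w}" by auto
    then show ?thesis using prob_triple[of i j k] j True by (simp add: p_def)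
   qed simp
  qed
  also have "... <= (\<Sum>j\<in>{1..k}. p (k - j) * G)"
  proof (intro sum_mono mult_left_mono p0)
   fix j assume j: "j \<in> {1..k}"
   have "(\<Sum>i\<in>{1..k}. of_bool (i <= j) * p (j - i)) = (\<Sum>i\<in>{1..j}. p (j - i))"
    using j by (intro sum.mono_neutral_cong_right) auto
   also have "... <= G" unfolding G_def using j k by (intro sum_inj_le) (auto simp: inj_on_def p0)
   finally show "(\<Sum>i\<in>{1..k}. of_bool (i <= j) * p (j - i)) <= G" .
  qed
  also have "... = (\<Sum>j\<in>{1..k}. p (k - j)) * G" by (simp only: sum_distrib_right)
  also have "... <= G * G"
   by (intro mult_right_mono G0) (unfold G_def, rule sum_inj_le, use k in \<open>auto simp: inj_on_def p0\<close>)
  finally show ?thesis using sqE[of "{1..k}" k] by (simp add: power2_eq_square)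
 qed
 have one: "(?o k w)^2 <= 2 * (?l k w)^2 + 2 * (?r k w)^2"
  if k: "k \<in> {1..n}" for k w
 proof -
   have "?o k w <= ?l k w + ?r k w"
  proof -
   have "{1..n} = {1..k} \<union> {k..n}" using k by auto
   moreover have "(\<Sum>i\<in>{1..k} \<union> {k..n}. ?e w i k) <= ?l k w + ?r k w"
    by (subst sum_Un) (auto intro!: sum_nonneg)
   ultimately show ?thesis unfolding occ_eq_sum by simp
  qed
  then have "(?o k w)^2 <= (?l k w + ?r k w)^2" by (intro power_mono) auto
  also have "... <= 2 * (?l k w)^2 + 2 * (?r k w)^2"
   using zero_le_power2[of "?l k w - ?r k w"] by (simp add: power2_sum power2_diff)
  finally show ?thesis .
 qed
 have "expectation (%w. \<Sum>k=1..n. (?o k w)^2)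
  <= expectation (%w. \<Sum>k=1..n. (2 * (?l k w)^2 + 2 * (?r k w)^2))"
 proof (intro integral_mono sum_mono one)
  show "integrable M (%w. \<Sum>k=1..n. (?o k w)^2)"
   unfolding occ_eq_sum by (intro integrable_sum sq) auto
  show "integrable M (%w. \<Sum>k=1..n. (2 * (?l k w)^2 + 2 * (?r k w)^2))"
   by (intro integrable_sum integrable_add integrable_mult_right sq) auto
 qed
 also have "... = (\<Sum>k=1..n. 2 * expectation (%w. (?l k w)^2) + 2 * expectation (%w. (?r k w)^2))"
  by (simp only: integral_mult_right_zero integral_sum integral_add integrable_add
    integrable_mult_right sq finite_atLeastAtMost)
 also have "... <= (\<Sum>k=1..n. 2 * (2 * G^2) + 2 * (2 * G^2))"
  by (intro sum_mono add_mono mult_left_mono L R) auto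
 also have "... = 8 * real n * G^2" by simp
 finally show ?thesis unfolding G_def p_def .
qed

text \<open>\<open>Z\<close> is the supremum of the coupled variables
  \<open>\<bar>Y n\<bar>\<close>, finite because a convergent sequence is bounded. One variable thus
  dominates all rescaled positions in law, and bounded monotone \<open>f\<close> carry this over to
  expectations.\<close>

lemma tight:
 obtains Q :: "real measure" and Z where "prob_space Q" "Z \<in> borel_measurable Q" "!!x. x \<in> space Q ==> 0 <= Z x"
  "!!r (f :: real => real). mono_on {0..} f ==> f \<in> borel_measurable borel ==> (!!x. 0 <= x ==> \<bar>f x\<bar> <= B) ==>
   expectation (%w. f \<bar>T r w\<bar>) <= (LINT x|Q. f (real r powr (1 / \<alpha>) * Z x))"
proof -
 obtain Q :: "real measure" and Y Y' where Y: "prob_space Q" "!!n. Y n \<in> borel_measurable Q"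
  "!!n. distr Q borel (Y n) = distr M borel (%w. real n powr (- 1 / \<alpha>) * T n w)"
  "Y' \<in> borel_measurable Q" "distr Q borel Y' = \<mu>" "!!x. x \<in> space Q ==> (%n. Y n x) ----> Y' x"
  using skorohod by blast
 interpret O: prob_space Q by fact
 note [measurable] = Y(2,4)
 define Z where "Z x = (SUP n. \<bar>Y n x\<bar>)" for x
 have bdd: "bdd_above (range (%n. \<bar>Y n x\<bar>))" if "x \<in> space Q" for x
 proof -
  have "Bseq (%n. Y n x)" by (rule convergent_imp_Bseq) (use Y(6)[OF that] in \<open>auto simp: convergent_def\<close>)
  then obtain K where "!!n. norm (Y n x) <= K" unfolding Bseq_def by auto
  then show ?thesis by (intro bdd_aboveI2[where M=K]) auto
 qed
 have Zge: "\<bar>Y n x\<bar> <= Z x" if "x \<in> space Q" for n x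
  unfolding Z_def by (rule cSUP_upper[OF _ bdd[OF that]]) simp
 have Zm: "Z \<in> borel_measurable Q"
  unfolding Z_def by (rule borel_measurable_cSUP) (use bdd in auto)
 show ?thesis
 proof (rule that[OF Y(1) Zm])
  show Z0: "0 <= Z x" if "x \<in> space Q" for x using Zge[OF that, of 0] by linarith
  fix r and f :: "real => real" assume f: "mono_on {0..} f" "f \<in> borel_measurable borel" "!!x. 0 <= x ==> \<bar>f x\<bar> <= B"
  note [measurable] = f(2) Zm
  have "expectation (%w. f \<bar>T r w\<bar>) = expectation (%w. f (real r powr (1 / \<alpha>) * \<bar>real r powr (- 1 / \<alpha>) * T r w\<bar>))"
  proof (intro integral_cong refl)
   fix w
   show "f \<bar>T r w\<bar> = f (real r powr (1 / \<alpha>) * \<bar>real r powr (- 1 / \<alpha>) * T r w\<bar>)"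
   proof (cases "r = 0")
    case False
    then show ?thesis by (simp add: abs_mult powr_minus mult.assoc[symmetric])
   qed (simp add: random_walk_def)
  qed
  also have "... = (\<integral>y. f (real r powr (1 / \<alpha>) * \<bar>y\<bar>) \<partial>distr M borel (%w. real r powr (- 1 / \<alpha>) * T r w))"
   by (rule integral_distr[symmetric]) auto
  also have "... = (LINT x|Q. f (real r powr (1 / \<alpha>) * \<bar>Y r x\<bar>))"
   unfolding Y(3)[symmetric] by (rule integral_distr) auto
  also have "... <= (LINT x|Q. f (real r powr (1 / \<alpha>) * Z x))"
  proof (rule integral_mono)
   show "integrable Q (%x. f (real r powr (1 / \<alpha>) * \<bar>Y r x\<bar>))"
    by (rule O.integrable_const_bound[where B=B]) (auto intro!: f(3))
   show "integrable Q (%x. f (real r powr (1 / \<alpha>) * Z x))"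
    by (rule O.integrable_const_bound[where B=B]) (auto intro!: AE_I2 f(3) mult_nonneg_nonneg Z0)
   fix x assume x: "x \<in> space Q"
   show "f (real r powr (1 / \<alpha>) * \<bar>Y r x\<bar>) <= f (real r powr (1 / \<alpha>) * Z x)"
    using Zge[OF x, of r] Z0[OF x] by (intro mono_onD[OF f(1)]) (auto intro: mult_left_mono)
  qed
  finally show "expectation (%w. f \<bar>T r w\<bar>) <= (LINT x|Q. f (real r powr (1 / \<alpha>) * Z x))" .
 qed
qed

text \<open>Decompose by the first time \<open>k\<close> at which the level \<open>2 * c\<close> is
  exceeded. The increment after \<open>k\<close> is independent of that event and is at most
  \<open>c\<close> in modulus with probability at least 1/2; in that case the final position still
  exceeds \<open>c\<close>.\<close>

lemma ottaviani:
 assumes half: "!!k. k <= n ==> \<P>(z in M. c < \<bar>T k z\<bar>) <= 1 / 2"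
 shows "\<P>(z in M. \<exists>k\<in>{1..n}. 2 * c < \<bar>T k z\<bar>) <= 2 * \<P>(z in M. c < \<bar>T n z\<bar>)"
proof -
 let ?a = "%k z. 2 * c < \<bar>T k z\<bar> \<and> (\<forall>j\<in>{1..<k}. \<not> 2 * c < \<bar>T j z\<bar>)"
 define A where "A k = {z \<in> space M. ?a k z}" for k
 define B where "B k = {z \<in> space M. \<bar>real_of_int (S n z - S k z)\<bar> <= c}" for k
 have Am[measurable]: "A k \<in> sets M" "B k \<in> sets M" for k unfolding A_def B_def by measurable
 have ind: "prob (A k \<inter> B k) = prob (A k) * prob (B k)" if k: "k \<in> {1..n}" for k
 proof -
  let ?I = "{1..k}" and ?J = "{k+1..n}"
  let ?P = "%x. 2 * c < \<bar>real_of_int (\<Sum>i\<in>{1..k}. x i)\<bar> \<and> (\<forall>j\<in>{1..<k}. \<not> 2 * c < \<bar>real_of_int (\<Sum>i\<in>{1..j}. x i)\<bar>)"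
  let ?Q = "%x. \<bar>real_of_int (\<Sum>i\<in>?J. x i)\<bar> <= c"
  have m1: "(%x. \<Sum>i\<in>{1..j}. x i) \<in> measurable (PiM ?I (%_. count_space UNIV :: int measure)) (count_space UNIV)" if "j <= k" for j
   using that by (intro sum_coordinates_measurable) auto
  have "Measurable.pred (PiM ?I (%_. count_space UNIV)) ?P"
  proof (intro pred_intros_logic pred_intros_finite)
   have big: "Measurable.pred (PiM ?I (%_. count_space UNIV)) (%x. 2 * c < \<bar>real_of_int (\<Sum>i\<in>{1..j}. x i)\<bar>)" if "j <= k" for j
   proof -
    note [measurable] = m1[OF that]
    show ?thesis by measurable
   qed
   show "Measurable.pred (PiM ?I (%_. count_space UNIV)) (%x. 2 * c < \<bar>real_of_int (\<Sum>i\<in>{1..k}. x i)\<bar>)"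
    by (rule big) simp
   show "Measurable.pred (PiM ?I (%_. count_space UNIV)) (%x. 2 * c < \<bar>real_of_int (\<Sum>i\<in>{1..j}. x i)\<bar>)" if "j \<in> {1..<k}" for j
    by (rule big) (use that in simp)
  qed auto
  have [measurable]: "(%x. \<Sum>i\<in>?J. x i) \<in> measurable (PiM ?J (%_. count_space UNIV :: int measure)) (count_space UNIV)"
   by (intro sum_coordinates_measurable) auto
  moreover have "Measurable.pred (PiM ?J (%_. count_space UNIV)) ?Q" by measurable
  ultimately have "\<P>(z in M. ?P (restrict (%i. X i z) ?I) \<and> ?Q (restrict (%i. X i z) ?J))
   = \<P>(z in M. ?P (restrict (%i. X i z) ?I)) * \<P>(z in M. ?Q (restrict (%i. X i z) ?J))"
   by (intro indep_blocks) auto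
  moreover have "?P (restrict (%i. X i z) ?I) \<longleftrightarrow> ?a k z" for z
  proof -
   have "(\<Sum>i\<in>{1..j}. restrict (%i. X i z) ?I i) = S j z" if "j <= k" for j
    unfolding random_walk_def using that by (intro sum.cong) auto
   then show ?thesis by auto
  qed
  moreover have "?Q (restrict (%i. X i z) ?J) \<longleftrightarrow> \<bar>real_of_int (S n z - S k z)\<bar> <= c" for z
  proof -
   have "(\<Sum>i\<in>?J. restrict (%i. X i z) ?J i) = S n z - S k z"
    using k by (subst S_diff) (auto intro!: sum.cong)
   then show ?thesis by (simp only:)
  qed
  ultimately have "\<P>(z in M. ?a k z \<and> \<bar>real_of_int (S n z - S k z)\<bar> <= c)
   = prob (A k) * prob (B k)" unfolding A_def B_def by (simp only:)
  moreover have "{z \<in> space M. ?a k z \<and> \<bar>real_of_int (S n z - S k z)\<bar> <= c} = A k \<inter> B k"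
   unfolding A_def B_def by auto
  ultimately show ?thesis by simp
 qed
 have Bhalf: "1 / 2 <= prob (B k)" if k: "k \<in> {1..n}" for k
 proof -
  have "B k = space M - {z \<in> space M. c < \<bar>real_of_int (S n z - S k z)\<bar>}" unfolding B_def by auto
  then have e: "prob (B k) = 1 - \<P>(z in M. c < \<bar>real_of_int (S n z - S k z)\<bar>)" by (simp add: prob_compl)
  have "\<P>(z in M. c < \<bar>real_of_int (S n z - S k z)\<bar>) = \<P>(z in M. c < \<bar>T (n - k) z\<bar>)"
   using k by (intro prob_S_diff) auto
  also have "... <= 1 / 2" by (rule half) simp
  finally show ?thesis unfolding e by linarith
 qed
 have disj: "disjoint_family_on A {1..n}"
  unfolding disjoint_family_on_def
 proof (intro ballI impI)
  fix k l assume "k \<in> {1..n}" "l \<in> {1..n}" "k ~= l"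
  then show "A k \<inter> A l = {}" unfolding A_def by (cases "k < l") auto
 qed
 have un: "{z \<in> space M. \<exists>k\<in>{1..n}. 2 * c < \<bar>T k z\<bar>} \<subseteq> (\<Union>k\<in>{1..n}. A k)"
 proof
  fix z assume w: "z \<in> {z \<in> space M. \<exists>k\<in>{1..n}. 2 * c < \<bar>T k z\<bar>}"
  let ?R = "%k. k \<in> {1..n} \<and> 2 * c < \<bar>T k z\<bar>"
  have ex: "\<exists>k. ?R k" using w by auto
  obtain k0 where k0: "?R k0" "!!j. j < k0 ==> \<not> ?R j"
   using ex exists_least_iff[of ?R] by blast
  have "\<not> 2 * c < \<bar>T j z\<bar>" if "j \<in> {1..<k0}" for j
   using k0(2)[of j] that k0(1) by auto
  then have "z \<in> A k0" using w k0(1) unfolding A_def by auto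
  then show "z \<in> (\<Union>k\<in>{1..n}. A k)" using k0(1) by blast
 qed
 have "\<P>(z in M. \<exists>k\<in>{1..n}. 2 * c < \<bar>T k z\<bar>) <= prob (\<Union>k\<in>{1..n}. A k)"
  by (rule finite_measure_mono[OF un]) auto
 also have "... = (\<Sum>k\<in>{1..n}. prob (A k))"
  by (rule finite_measure_finite_Union) (use disj in auto)
 also have "... <= (\<Sum>k\<in>{1..n}. 2 * prob (A k \<inter> B k))"
 proof (rule sum_mono)
  fix k assume k: "k \<in> {1..n}"
  have "prob (A k) * (1 / 2) <= prob (A k) * prob (B k)" by (intro mult_left_mono Bhalf k) auto
  then show "prob (A k) <= 2 * prob (A k \<inter> B k)" unfolding ind[OF k] by simp
 qed
 also have "... = 2 * prob (\<Union>k\<in>{1..n}. A k \<inter> B k)"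
 proof -
  have "disjoint_family_on (%k. A k \<inter> B k) {1..n}" using disj unfolding disjoint_family_on_def by blast
  then have "prob (\<Union>k\<in>{1..n}. A k \<inter> B k) = (\<Sum>k\<in>{1..n}. prob (A k \<inter> B k))"
   by (intro finite_measure_finite_Union) auto
  then show ?thesis by (simp only: sum_distrib_left)
 qed
 also have "prob (\<Union>k\<in>{1..n}. A k \<inter> B k) <= \<P>(z in M. c < \<bar>T n z\<bar>)"
  by (rule finite_measure_mono) (auto simp: A_def B_def)
 finally show ?thesis by simp
qed

text \<open>The envelope of \<open>tight\<close> makes the tail probabilities small for all times r
  <= n at once, since r^(1 / \<alpha>) is at most n^(1 / \<alpha>). This supplies the hypothesis of
  \<open>ottaviani\<close> and bounds its right side.\<close>

lemma maximal_tight: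
 assumes \<eta>: "0 < \<eta>"
 obtains K where "0 < K" "!!n. 1 <= n ==> \<P>(w in M. \<exists>k\<in>{1..n}. K * real n powr (1 / \<alpha>) < \<bar>T k w\<bar>) <= \<eta>"
proof -
 obtain Q :: "real measure" and Z where Z: "prob_space Q" "Z \<in> borel_measurable Q" "!!x. x \<in> space Q ==> 0 <= Z x"
  "!!r (f :: real => real). mono_on {0..} f ==> f \<in> borel_measurable borel ==> (!!x. 0 <= x ==> \<bar>f x\<bar> <= 1) ==>
   expectation (%w. f \<bar>T r w\<bar>) <= (LINT x|Q. f (real r powr (1 / \<alpha>) * Z x))"
  using tight[of 1] by metis
 interpret O: prob_space Q by fact
 note [measurable] = Z(2)
 have "(%k. measure Q {x \<in> space Q. real k < Z x}) ----> measure Q (\<Inter>k. {x \<in> space Q. real k < Z x})"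
  by (rule O.finite_Lim_measure_decseq) (auto simp: decseq_def)
 moreover have "(\<Inter>k. {x \<in> space Q. real k < Z x}) = {}"
 proof -
  have "\<exists>k::nat. \<not> real k < Z x" for x using reals_Archimedean2[of "Z x"] less_asym by blast
  then show ?thesis by blast
 qed
 ultimately have "(%k. measure Q {x \<in> space Q. real k < Z x}) ----> 0" by simp
 then have "\<forall>\<^sub>F k in sequentially. measure Q {x \<in> space Q. real k < Z x} < min (\<eta> / 2) (1 / 2)"
  using \<eta> by (intro order_tendstoD(2)) auto
 then obtain k0 where k0: "!!k. k0 <= k ==> measure Q {x \<in> space Q. real k < Z x} < min (\<eta> / 2) (1 / 2)"
  by (auto simp: eventually_sequentially)
 define k where "k = Suc k0"
 have t: "\<P>(w in M. real k * real n powr (1 / \<alpha>) < \<bar>T r w\<bar>) < min (\<eta> / 2) (1 / 2)" if "r <= n" for r n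
 proof -
  let ?c = "real k * real n powr (1 / \<alpha>)"
  let ?f = "%x::real. of_bool (?c < x) :: real"
  have c0: "0 <= ?c" by simp
  have "\<P>(w in M. ?c < \<bar>T r w\<bar>) = expectation (%w. ?f \<bar>T r w\<bar>)"
  proof -
   have "expectation (%w. ?f \<bar>T r w\<bar>) = expectation (indicator {w \<in> space M. ?c < \<bar>T r w\<bar>})"
    by (intro integral_cong) (auto simp: indicator_def)
   then show ?thesis by simp
  qed
  also have "... <= (LINT x|Q. ?f (real r powr (1 / \<alpha>) * Z x))"
   by (rule Z(4)) (auto simp: mono_on_def)
  also have "... = measure Q {x \<in> space Q. ?c < real r powr (1 / \<alpha>) * Z x}"
  proof -
   have "(LINT x|Q. ?f (real r powr (1 / \<alpha>) * Z x)) = (LINT x|Q. indicator {x \<in> space Q. ?c < real r powr (1 / \<alpha>) * Z x} x)"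
    by (intro integral_cong) (auto simp: indicator_def)
   then show ?thesis by simp
  qed
  also have "... <= measure Q {x \<in> space Q. real k < Z x}"
  proof (rule O.finite_measure_mono)
   show "{x \<in> space Q. ?c < real r powr (1 / \<alpha>) * Z x} \<subseteq> {x \<in> space Q. real k < Z x}"
   proof safe
    fix x assume x: "x \<in> space Q" "?c < real r powr (1 / \<alpha>) * Z x"
    have "real r powr (1 / \<alpha>) <= real n powr (1 / \<alpha>)" using that \<alpha> by (intro powr_mono2) auto
    then have "real r powr (1 / \<alpha>) * Z x <= real n powr (1 / \<alpha>) * Z x" using Z(3)[OF x(1)] by (intro mult_right_mono)
    then have "real n powr (1 / \<alpha>) * real k < real n powr (1 / \<alpha>) * Z x" using x(2) by (simp add: mult.commute)
    then show "real k < Z x" by (rule mult_left_less_imp_less) simp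
   qed
  qed auto
  also have "... < min (\<eta> / 2) (1 / 2)" by (rule k0) (simp add: k_def)
  finally show ?thesis .
 qed
 show ?thesis
 proof (rule that[of "2 * real k"])
  show "0 < 2 * real k" by (simp add: k_def)
  fix n :: nat assume "1 <= n"
  have "\<P>(w in M. \<exists>j\<in>{1..n}. 2 * (real k * real n powr (1 / \<alpha>)) < \<bar>T j w\<bar>)
   <= 2 * \<P>(w in M. real k * real n powr (1 / \<alpha>) < \<bar>T n w\<bar>)"
   by (rule ottaviani) (use t less_imp_le in fastforce)
  also have "... <= \<eta>" using t[of n n] by simp
  finally show "\<P>(w in M. \<exists>j\<in>{1..n}. 2 * real k * real n powr (1 / \<alpha>) < \<bar>T j w\<bar>) <= \<eta>"
   by (simp add: mult.assoc)
 qed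
qed

end

section \<open>Smoothed occupation fields\<close>

text \<open>The window is half-open and one-sided so that its translates by multiples of
  \<open>e\<close> tile the line; the exact identities on lattices below rely on this.\<close>

definition bump :: "real => real => real" where
 "bump e u = indicator {0..<e} u / e"

lemma bump_measurable[measurable]: "bump e \<in> borel_measurable borel"
 unfolding bump_def by measurable

lemma bump_nonneg: "0 <= e ==> 0 <= bump e u"
 by (simp add: bump_def)

lemma bump_shift_eq: "bump e (x - u) = indicator {u..<u + e} x / e"
 by (auto simp: bump_def indicator_def)

lemma bump_integral:
 assumes "0 < e"
 shows "integrable lborel (%x. bump e (x - u))" "(LBINT x. bump e (x - u)) = 1"
proof -
 have i: "integrable lborel (indicator {u..<u + e} :: real => real)"
  using assms by (intro integrable_real_indicator) auto
 show "integrable lborel (%x. bump e (x - u))" unfolding bump_shift_eq using i by (rule integrable_divide)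
 show "(LBINT x. bump e (x - u)) = 1" unfolding bump_shift_eq using assms by simp
qed

lemma bump_width_diff:
 assumes "0 < e" "e <= e'"
 shows "(LBINT x. \<bar>bump e' (x - u) - bump e (x - u)\<bar>) <= 2 * (e' - e) / e"
proof -
 have pos: "0 < e'" using assms by simp
 have pw: "\<bar>bump e' (x - u) - bump e (x - u)\<bar> = (1 / e - 1 / e') * indicator {u..<u + e} x + 1 / e' * indicator {u + e..<u + e'} x" for x
 proof -
  have "1 / e' <= 1 / e" using assms by (intro divide_left_mono) auto
  then show ?thesis unfolding bump_shift_eq using assms pos by (auto simp: indicator_def abs_of_nonpos)
 qed
 have "(LBINT x. \<bar>bump e' (x - u) - bump e (x - u)\<bar>)
  = (LBINT x. (1 / e - 1 / e') * indicator {u..<u + e} x) + (LBINT x. 1 / e' * indicator {u + e..<u + e'} x)"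
  unfolding pw using assms
  by (intro integral_add integrable_mult_right integrable_real_indicator) auto
 also have "... = (1 / e - 1 / e') * e + 1 / e' * (e' - e)"
  using assms by simp
 also have "... = 2 * (e' - e) / e'" using assms pos by (simp add: field_simps)
 also have "... <= 2 * (e' - e) / e" using assms by (intro divide_left_mono) auto
 finally show ?thesis .
qed

lemma bump_shift_diff:
 assumes "0 < e"
 shows "integrable lborel (%x. \<bar>bump e (x - u) - bump e (x - v)\<bar>)"
  and "(LBINT x. \<bar>bump e (x - u) - bump e (x - v)\<bar>) <= min 2 (2 / e * \<bar>u - v\<bar>)"
proof -
 let ?D = "%u v. \<integral>x. \<bar>bump e (x - u) - bump e (x - v)\<bar> \<partial>lborel"
 show i: "integrable lborel (%x. \<bar>bump e (x - u) - bump e (x - v)\<bar>)"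
  by (intro integrable_abs integrable_diff bump_integral assms)
 have "?D u v <= (LBINT x. bump e (x - u) + bump e (x - v))"
  using assms by (intro integral_mono i integrable_add bump_integral)
   (auto simp: abs_le_iff add_increasing add_increasing2 bump_nonneg intro: order_trans[OF _ add_mono])
 also have "... = 2" using assms by (subst integral_add) (auto simp: bump_integral)
 finally have 1: "?D u v <= 2" .
 have gen: "?D u v <= 2 / e * \<bar>u - v\<bar>" if uv: "u <= v" for u v
 proof -
  have pw: "\<bar>bump e (x - u) - bump e (x - v)\<bar> <= 1 / e * (indicator {u..<v} x + indicator {u + e..<v + e} x)" for x
   unfolding bump_shift_eq using assms uv by (auto simp: indicator_def)
  have i2: "integrable lborel (%x. 1 / e * (indicator {u..<v} x + indicator {u + e..<v + e} x) :: real)"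
   using uv by (intro integrable_mult_right integrable_add integrable_real_indicator) auto
  have "?D u v <= (LBINT x. 1 / e * (indicator {u..<v} x + indicator {u + e..<v + e} x))"
   by (intro integral_mono i2 pw integrable_abs integrable_diff bump_integral assms)
  also have "... = 1 / e * ((v - u) + (v - u))"
   unfolding integral_mult_right_zero using uv
   by (subst integral_add) (auto intro!: integrable_real_indicator)
  also have "... = 2 / e * \<bar>u - v\<bar>" using uv by simp
  finally show ?thesis .
 qed
 have "?D u v <= 2 / e * \<bar>u - v\<bar>"
 proof (cases "u <= v")
  case False
  then have "?D v u <= 2 / e * \<bar>v - u\<bar>" by (intro gen) simp
  then show ?thesis by (simp only: abs_minus_commute)
 qed (rule gen)
 then show "?D u v <= min 2 (2 / e * \<bar>u - v\<bar>)" using 1 by simp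
qed

lemma bump_lattice:
 fixes a :: int
 assumes "0 < w"
 shows "bump w (x - real_of_int a * w) = of_bool (\<lfloor>x / w\<rfloor> = a) / w"
proof -
 have "\<lfloor>x / w\<rfloor> = a \<longleftrightarrow> 0 <= x - real_of_int a * w \<and> x - real_of_int a * w < w"
  unfolding floor_eq_iff using assms by (auto simp: field_simps)
 then show ?thesis by (auto simp: bump_def indicator_def)
qed

lemma bump_lattice_product:
 fixes a b :: int
 assumes "0 < w"
 shows "integrable lborel (%x. bump w (x - real_of_int a * w) * bump w (x - real_of_int b * w))"
  and "(LBINT x. bump w (x - real_of_int a * w) * bump w (x - real_of_int b * w)) = of_bool (a = b) / w"
proof -
 have e: "bump w (x - real_of_int a * w) * bump w (x - real_of_int b * w) = of_bool (a = b) / w * bump w (x - real_of_int a * w)" for x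
  unfolding bump_lattice[OF assms] by auto
 show "integrable lborel (%x. bump w (x - real_of_int a * w) * bump w (x - real_of_int b * w))"
  unfolding e by (intro integrable_mult_right bump_integral assms)
 show "(LBINT x. bump w (x - real_of_int a * w) * bump w (x - real_of_int b * w)) = of_bool (a = b) / w"
  unfolding e integral_mult_right_zero bump_integral(2)[OF assms] by simp
qed

text \<open>Translates of the narrow window by multiples of its width fit without gap or overlap, so
  their average is the wide window itself. Smoothing at scale b w is therefore the same as averaging
  b lattice shifts.\<close>

lemma bump_average:
 assumes "0 < w" "0 < b"
 shows "(\<Sum>h<b. bump w (u - real h * w)) / real b = bump (real b * w) u"
proof -
 have e: "bump w (u - real h * w) = of_bool (\<lfloor>u / w\<rfloor> = int h) / w" for h
  using bump_lattice[OF assms(1), of u "int h"] by simp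
 have "(\<Sum>h<b. bump w (u - real h * w)) = (\<Sum>h<b. of_bool (\<lfloor>u / w\<rfloor> = int h)) / w"
  unfolding e by (simp only: sum_divide_distrib)
 also have "(\<Sum>h<b. of_bool (\<lfloor>u / w\<rfloor> = int h) :: real) = of_bool (0 <= u \<and> u < real b * w)"
 proof (cases "0 <= \<lfloor>u / w\<rfloor> \<and> \<lfloor>u / w\<rfloor> < int b")
  case True
  then obtain h0 where h0: "\<lfloor>u / w\<rfloor> = int h0" using zero_le_imp_eq_int by blast
  have "(\<Sum>h<b. of_bool (\<lfloor>u / w\<rfloor> = int h) :: real) = 1"
   using True unfolding h0 by (simp add: of_bool_def)
  moreover have "0 <= u \<and> u < real b * w"
   using True assms by (auto simp: floor_less_iff zero_le_divide_iff pos_divide_less_eq)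
  ultimately show ?thesis by simp
 next
  case False
  then have "(\<Sum>h<b. of_bool (\<lfloor>u / w\<rfloor> = int h) :: real) = 0"
  proof (intro sum.neutral ballI)
   fix h assume h: "h \<in> {..<b}"
   have "\<lfloor>u / w\<rfloor> ~= int h"
   proof
    assume "\<lfloor>u / w\<rfloor> = int h"
    then have "0 <= \<lfloor>u / w\<rfloor> \<and> \<lfloor>u / w\<rfloor> < int b" using h by (simp only:) simp
    then show False using False by blast
   qed
   then show "of_bool (\<lfloor>u / w\<rfloor> = int h) = (0 :: real)" by (simp only:) simp
  qed
  moreover have "\<not> (0 <= u \<and> u < real b * w)"
   using False assms by (auto simp: floor_less_iff zero_le_divide_iff pos_divide_less_eq)
  ultimately show ?thesis by simp
 qed
 finally show ?thesis using assms by (auto simp: bump_def indicator_def)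
qed

text \<open>Subadditivity gives Hoelder continuity of order \<beta>, and u^\<beta> is then bounded
  by d^\<beta> below the threshold \<open>d\<close> and linearly above it. The free \<open>d\<close>
  later trades a small constant against an L1 distance.\<close>

lemma powr_diff_le:
 fixes a b \<beta> :: real
 assumes "0 <= a" "0 <= b" "0 < \<beta>" "\<beta> < 1" "0 < d"
 shows "\<bar>a powr \<beta> - b powr \<beta>\<bar> <= d powr \<beta> + d powr (\<beta> - 1) * \<bar>a - b\<bar>"
proof -
 have sub: "(x + y) powr \<beta> <= x powr \<beta> + y powr \<beta>" if "0 <= x" "0 <= y" for x y
 proof (cases "x + y = 0")
  case False
  then have p: "0 < x + y" using that by simp
  have "x / (x + y) <= (x / (x + y)) powr \<beta>" if "0 <= x" "0 <= y" "0 < x + y" for x y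
  proof (cases "x = 0")
   case False
   then show ?thesis using that assms powr_mono'[of \<beta> 1 "x / (x + y)"] by simp
  qed simp
  note * = this
  have "x / (x + y) + y / (x + y) = 1" using p by (simp add: add_divide_distrib[symmetric])
  then have "(x + y) / (x + y) <= (x / (x + y)) powr \<beta> + (y / (x + y)) powr \<beta>"
   using *[OF that p] *[of y x] that p by (simp add: add.commute)
  also have "... = (x powr \<beta> + y powr \<beta>) / (x + y) powr \<beta>"
   using that p by (simp add: powr_divide add_divide_distrib)
  finally show ?thesis using p by (simp add: field_simps)
 qed (use that in simp)
 have mon: "\<bar>x powr \<beta> - y powr \<beta>\<bar> <= (x - y) powr \<beta>" if "0 <= y" "y <= x" for x y
  using sub[of y "x - y"] that powr_mono2[of \<beta> y x] assms by auto
 have 1: "\<bar>a powr \<beta> - b powr \<beta>\<bar> <= \<bar>a - b\<bar> powr \<beta>"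
 proof (cases "b <= a")
  case True then show ?thesis using mon[of b a] assms by simp
 next
  case False then show ?thesis using mon[of a b] assms by (simp add: abs_minus_commute)
 qed
 have "u powr \<beta> <= d powr \<beta> + d powr (\<beta> - 1) * u" if u: "0 <= u" for u
 proof (cases "u <= d")
  case True
  then have "u powr \<beta> <= d powr \<beta>" using u assms by (intro powr_mono2) auto
  then show ?thesis using u by (simp add: add_increasing2)
 next
  case False
  then have "u powr (\<beta> - 1) <= d powr (\<beta> - 1)" using assms by (intro powr_mono2') auto
  then have "u powr (\<beta> - 1) * u <= d powr (\<beta> - 1) * u" using u by (rule mult_right_mono)
  moreover have "u powr (\<beta> - 1) * u = u powr \<beta>" using False assms by (simp add: powr_diff)
  ultimately show ?thesis by (simp add: add_increasing)
 qed
 from order_trans[OF 1 this[of "\<bar>a - b\<bar>"]] show ?thesis by simp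
qed

text \<open>Truncation to a window of radius \<open>R\<close> is what makes the functional
  continuous in L1: for \<beta> < 1, small values spread over a long interval could contribute any
  amount.\<close>

definition pow_int :: "real => real => (real => real) => real" where
 "pow_int \<beta> R f = (LBINT x:{-R..R}. f x powr \<beta>)"

lemma pow_int_integrable:
 fixes f :: "real => real"
 assumes "0 < \<beta>" "\<beta> < 1" and [measurable]: "f \<in> borel_measurable borel" and "!!x. 0 <= f x"
  and f: "set_integrable lborel {-R..R} f"
 shows "set_integrable lborel {-R..R} (%x. f x powr \<beta>)"
proof -
 have c: "set_integrable lborel {-R..R} (%x. 1 :: real)"
  by (rule borel_integrable_atLeastAtMost') (rule continuous_on_const)
 have "set_integrable lborel {-R..R} (%x. 1 + f x)" by (rule set_integral_add(1)[OF c f])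
 then show ?thesis unfolding set_integrable_def
 proof (rule integrable_bound)
  have "f x powr \<beta> <= 1 + f x" for x
   using powr_diff_le[of "f x" 0 \<beta> 1] assms by simp
  then show "AE x in lborel. norm (indicat_real {- R..R} x *\<^sub>R f x powr \<beta>) <= norm (indicat_real {- R..R} x *\<^sub>R (1 + f x))"
   by (intro AE_I2) (auto simp: indicator_def intro: order_trans[OF _ abs_ge_self])
 qed measurable
qed

lemma pow_int_diff:
 fixes f g :: "real => real"
 assumes \<beta>: "0 < \<beta>" "\<beta> < 1" and s: "0 < s" and R: "0 <= R"
  and [measurable]: "f \<in> borel_measurable borel" "g \<in> borel_measurable borel" and nn: "!!x. 0 <= f x" "!!x. 0 <= g x"
  and f: "set_integrable lborel {-R..R} f" and g: "set_integrable lborel {-R..R} g"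
 shows "\<bar>pow_int \<beta> R f - pow_int \<beta> R g\<bar> <= 2 * R * s powr \<beta> + s powr (\<beta> - 1) * (LBINT x:{-R..R}. \<bar>f x - g x\<bar>)"
proof -
 note pf = pow_int_integrable[OF \<beta> \<open>f \<in> _\<close> nn(1) f] and pg = pow_int_integrable[OF \<beta> \<open>g \<in> _\<close> nn(2) g]
 have c: "set_integrable lborel {-R..R} (%x. k :: real)" for k
  by (rule borel_integrable_atLeastAtMost') (rule continuous_on_const)
 have d: "set_integrable lborel {-R..R} (%x. \<bar>f x - g x\<bar>)"
  using set_integrable_abs[OF set_integral_diff(1)[OF f g]] .
 have "\<bar>pow_int \<beta> R f - pow_int \<beta> R g\<bar> = \<bar>LBINT x:{-R..R}. f x powr \<beta> - g x powr \<beta>\<bar>"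
  unfolding pow_int_def by (simp add: set_integral_diff(2)[OF pf pg])
 also have "... <= (LBINT x:{-R..R}. \<bar>f x powr \<beta> - g x powr \<beta>\<bar>)"
  using set_integral_norm_bound[OF set_integral_diff(1)[OF pf pg]] by simp
 also have "... <= (LBINT x:{-R..R}. s powr \<beta> + s powr (\<beta> - 1) * \<bar>f x - g x\<bar>)"
 proof (rule set_integral_mono)
  show "set_integrable lborel {-R..R} (%x. \<bar>f x powr \<beta> - g x powr \<beta>\<bar>)"
   by (rule set_integrable_abs[OF set_integral_diff(1)[OF pf pg]])
  show "set_integrable lborel {-R..R} (%x. s powr \<beta> + s powr (\<beta> - 1) * \<bar>f x - g x\<bar>)"
   by (intro set_integral_add c set_integrable_mult_right) (rule d)
 qed (rule powr_diff_le[OF nn \<beta> s])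
 also have "... = (LBINT x:{-R..R}. s powr \<beta>) + (LBINT x:{-R..R}. s powr (\<beta> - 1) * \<bar>f x - g x\<bar>)"
  by (rule set_integral_add(2)) (use c d in \<open>auto intro: set_integrable_mult_right\<close>)
 also have "(LBINT x:{-R..R}. s powr \<beta>) = 2 * R * s powr \<beta>"
  using R by (simp add: set_lebesgue_integral_def)
 also have "(LBINT x:{-R..R}. s powr (\<beta> - 1) * \<bar>f x - g x\<bar>) = s powr (\<beta> - 1) * (LBINT x:{-R..R}. \<bar>f x - g x\<bar>)"
  by (rule set_integral_mult_right)
 finally show ?thesis .
qed

text \<open>The occupation density of \<open>u 1, ..., u n\<close>, smoothed at scale \<open>e\<close>; if \<open>e\<close> is the mesh of a lattice containing the points, no smoothing takes place.\<close>

definition profile :: "real => nat => (nat => real) => real => real" where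
 "profile e n u x = (\<Sum>k=1..n. bump e (x - u k)) / real n"

lemma profile_measurable[measurable]: "profile e n u \<in> borel_measurable borel"
 unfolding profile_def by measurable

lemma profile_nonneg: "0 <= e ==> 0 <= profile e n u x"
 unfolding profile_def by (intro divide_nonneg_nonneg sum_nonneg bump_nonneg) auto

lemma profile_integrable: "0 < e ==> integrable lborel (profile e n u)"
 unfolding profile_def by (intro integrable_divide integrable_sum bump_integral)

lemma profile_set_integrable: "0 < e ==> set_integrable lborel {-R..R} (profile e n u)"
 using profile_integrable[of e n u] unfolding set_integrable_def by (intro integrable_mult_indicator) auto

lemma set_integral_le_integral:
 fixes f :: "real => real"
 assumes "integrable lborel f" "!!x. 0 <= f x"
 shows "(LBINT x:{-R..R}. f x) <= (LBINT x. f x)"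
 unfolding set_lebesgue_integral_def
 by (intro integral_mono integrable_mult_indicator assms) (auto simp: indicator_def assms)

text \<open>On the cell of a site with N visits the unsmoothed profile equals N / (n w), so the
  integral is w (n w)^(- \<beta>) times the sum of the N^\<beta>. The hypothesis on \<open>R\<close>
  puts every visited cell inside the window.\<close>

lemma profile_pow_int:
 fixes s :: "nat => int"
 assumes n: "1 <= n" and w: "0 < w" and \<beta>: "0 < \<beta>"
  and R: "!!k. k \<in> {1..n} ==> \<bar>real_of_int (s k) * w\<bar> + w <= R"
 shows "pow_int \<beta> R (profile w n (%k. real_of_int (s k) * w)) = occ_sum \<beta> s n * (real n * w) powr (1 - \<beta>) / real n"
proof -
 let ?l = "profile w n (%k. real_of_int (s k) * w)"
 have l: "?l x = real (occ s n \<lfloor>x / w\<rfloor>) / (real n * w)" for x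
  unfolding profile_def bump_lattice[OF w] occ_eq_sum eq_commute[of "\<lfloor>x / w\<rfloor>"] sum_divide_distrib[symmetric]
  by (simp add: mult.commute)
 \<comment> \<open>One factor is expanded over times and the remaining power is evaluated on the
   cell of \<open>s k\<close>; off the visited cells both sides are 0.\<close>
 have pw: "?l x powr \<beta> = (\<Sum>k=1..n. (real (occ s n (s k)) / (real n * w)) powr (\<beta> - 1) / real n * bump w (x - real_of_int (s k) * w))" for x
 proof -
  have "?l x powr \<beta> = ?l x * ?l x powr (\<beta> - 1)"
   using profile_nonneg[of w n _ x] w by (cases "?l x = 0") (auto simp: powr_diff)
  also have "... = (\<Sum>k=1..n. ?l x powr (\<beta> - 1) / real n * bump w (x - real_of_int (s k) * w))"
   unfolding profile_def by (simp add: sum_distrib_left sum_divide_distrib mult.commute sum_distrib_right)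
  also have "... = (\<Sum>k=1..n. (real (occ s n (s k)) / (real n * w)) powr (\<beta> - 1) / real n * bump w (x - real_of_int (s k) * w))"
  proof (intro sum.cong refl)
   fix k assume "k \<in> {1..n}"
   show "?l x powr (\<beta> - 1) / real n * bump w (x - real_of_int (s k) * w) = (real (occ s n (s k)) / (real n * w)) powr (\<beta> - 1) / real n * bump w (x - real_of_int (s k) * w)"
    unfolding bump_lattice[OF w] l by (cases "\<lfloor>x / w\<rfloor> = s k") auto
  qed
  finally show ?thesis .
 qed
 have b: "indicator {-R..R} x * bump w (x - real_of_int (s k) * w) = bump w (x - real_of_int (s k) * w)" if "k \<in> {1..n}" for k x
  unfolding bump_shift_eq using R[OF that] by (auto simp: indicator_def)
 have "pow_int \<beta> R ?l = (LBINT x. (\<Sum>k=1..n. (real (occ s n (s k)) / (real n * w)) powr (\<beta> - 1) / real n * (indicator {-R..R} x * bump w (x - real_of_int (s k) * w))))"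
  unfolding pow_int_def set_lebesgue_integral_def pw
  by (intro integral_cong) (auto simp: sum_distrib_left mult_ac)
 also have "... = (LBINT x. (\<Sum>k=1..n. (real (occ s n (s k)) / (real n * w)) powr (\<beta> - 1) / real n * bump w (x - real_of_int (s k) * w)))"
  using b by (intro integral_cong sum.cong) auto
 also have "... = (\<Sum>k=1..n. (real (occ s n (s k)) / (real n * w)) powr (\<beta> - 1) / real n * 1)"
  by (simp add: integral_sum bump_integral[OF w])
 also have "... = (\<Sum>k=1..n. real (occ s n (s k)) powr (\<beta> - 1) * ((real n * w) powr (1 - \<beta>) / real n))"
 proof (intro sum.cong refl)
  fix k assume k: "k \<in> {1..n}"
  have "(real (occ s n (s k)) / (real n * w)) powr (\<beta> - 1) = real (occ s n (s k)) powr (\<beta> - 1) * (real n * w) powr (1 - \<beta>)"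
  proof -
   have "(real n * w) powr (\<beta> - 1) = inverse ((real n * w) powr (1 - \<beta>))"
    using powr_minus[of "real n * w" "1 - \<beta>"] by simp
   moreover have "(real (occ s n (s k)) / (real n * w)) powr (\<beta> - 1) = real (occ s n (s k)) powr (\<beta> - 1) / (real n * w) powr (\<beta> - 1)"
    by (rule powr_divide)
   ultimately show ?thesis by (simp only: divide_inverse inverse_inverse_eq)
  qed
  then show "(real (occ s n (s k)) / (real n * w)) powr (\<beta> - 1) / real n * 1 = real (occ s n (s k)) powr (\<beta> - 1) * ((real n * w) powr (1 - \<beta>) / real n)" by simp
 qed
 finally show ?thesis unfolding occ_sum_def sum_distrib_right[symmetric] by simp
qed

text \<open>Lattice windows are orthogonal, so expanding the square counts pairs of times whose
  positions differ by 0, \<open>h\<close> or \<open>- h\<close>. In expectation this is the kernel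
  of \<open>potential_bound\<close>.\<close>

lemma profile_shift_square:
 fixes s :: "nat => int" and h :: int and n :: nat
 assumes w: "0 < w"
 defines "l \<equiv> profile w n (%k. real_of_int (s k) * w)"
 shows "integrable lborel (%x. (l x - l (x - real_of_int h * w))^2)"
  and "(LBINT x. (l x - l (x - real_of_int h * w))^2)
   = (\<Sum>j=1..n. \<Sum>k=1..n. 2 * of_bool (s j - s k = 0) - of_bool (s j - s k = h) - of_bool (s j - s k = - h)) / ((real n)^2 * w)"
proof -
 let ?b = "%a x. bump w (x - real_of_int a * w)"
 have sh: "bump w (x - real_of_int h * w - real_of_int a * w) = ?b (a + h) x" for a x by (simp add: algebra_simps)
 have e: "(l x - l (x - real_of_int h * w))^2 = (\<Sum>j=1..n. \<Sum>k=1..n. ?b (s j) x * ?b (s k) x - ?b (s j) x * ?b (s k + h) x - ?b (s j + h) x * ?b (s k) x + ?b (s j + h) x * ?b (s k + h) x) / (real n)^2" for x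
 proof -
  have "l x - l (x - real_of_int h * w) = (\<Sum>k=1..n. ?b (s k) x - ?b (s k + h) x) / real n"
   unfolding l_def profile_def sh by (simp add: sum_subtractf diff_divide_distrib)
  then have "(l x - l (x - real_of_int h * w))^2 = (\<Sum>j=1..n. \<Sum>k=1..n. (?b (s j) x - ?b (s j + h) x) * (?b (s k) x - ?b (s k + h) x)) / (real n)^2"
   by (simp only: power_divide) (simp only: power2_eq_square[of "sum _ _"] sum_product)
  also have "(\<Sum>j=1..n. \<Sum>k=1..n. (?b (s j) x - ?b (s j + h) x) * (?b (s k) x - ?b (s k + h) x))
   = (\<Sum>j=1..n. \<Sum>k=1..n. ?b (s j) x * ?b (s k) x - ?b (s j) x * ?b (s k + h) x - ?b (s j + h) x * ?b (s k) x + ?b (s j + h) x * ?b (s k + h) x)"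
   by (intro sum.cong refl) (simp add: algebra_simps)
  finally show ?thesis .
 qed
 have i: "integrable lborel (%x. ?b a x * ?b c x - ?b a x * ?b d x - ?b f x * ?b c x + ?b f x * ?b d x)" for a c d f
  by (intro integrable_add integrable_diff bump_lattice_product w)
 have v: "(LBINT x. ?b a x * ?b c x - ?b a x * ?b d x - ?b f x * ?b c x + ?b f x * ?b d x)
  = of_bool (a = c) / w - of_bool (a = d) / w - of_bool (f = c) / w + of_bool (f = d) / w" for a c d f
  by (simp only: integral_add integral_diff integrable_add integrable_diff bump_lattice_product[OF w])
 show "integrable lborel (%x. (l x - l (x - real_of_int h * w))^2)"
  unfolding e by (intro integrable_divide integrable_sum i)
 have "(LBINT x. (l x - l (x - real_of_int h * w))^2)
  = (\<Sum>j=1..n. \<Sum>k=1..n. of_bool (s j = s k) / w - of_bool (s j = s k + h) / w - of_bool (s j + h = s k) / w + of_bool (s j + h = s k + h) / w) / (real n)^2"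
  unfolding e integral_divide_zero
  by (subst integral_sum, intro integrable_sum i,
    subst integral_sum, intro i, simp only: v)
 also have "(\<Sum>j=1..n. \<Sum>k=1..n. of_bool (s j = s k) / w - of_bool (s j = s k + h) / w - of_bool (s j + h = s k) / w + of_bool (s j + h = s k + h) / w)
  = (\<Sum>j=1..n. \<Sum>k=1..n. (2 * of_bool (s j - s k = 0) - of_bool (s j - s k = h) - of_bool (s j - s k = - h)) / w)"
  by (intro sum.cong refl) (auto simp: diff_divide_distrib algebra_simps)
 also have "... = (\<Sum>j=1..n. \<Sum>k=1..n. 2 * of_bool (s j - s k = 0) - of_bool (s j - s k = h) - of_bool (s j - s k = - h)) / w"
  by (simp only: sum_divide_distrib)
 finally show "(LBINT x. (l x - l (x - real_of_int h * w))^2)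
   = (\<Sum>j=1..n. \<Sum>k=1..n. 2 * of_bool (s j - s k = 0) - of_bool (s j - s k = h) - of_bool (s j - s k = - h)) / ((real n)^2 * w)"
  by (simp add: mult.commute)
qed

text \<open>By \<open>bump_average\<close> the smoothed profile is the mean of \<open>b\<close>
  lattice shifts of the raw one; the Cauchy-Schwarz inequality moves the square inside the
  mean.\<close>

lemma profile_average_square:
 fixes s :: "nat => int" and n :: nat
 assumes w: "0 < w" and b: "0 < b"
 defines "l \<equiv> profile w n (%k. real_of_int (s k) * w)" and "m \<equiv> profile (real b * w) n (%k. real_of_int (s k) * w)"
 shows "integrable lborel (%x. (l x - m x)^2)"
  and "(LBINT x. (l x - m x)^2) <= (\<Sum>h<b. \<integral>x. (l x - l (x - real h * w))^2 \<partial>lborel) / real b"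
proof -
 let ?d = "%h x. l x - l (x - real h * w)"
 let ?s = "%x. \<Sum>h<b. (?d h x)^2"
 have meq: "m x = (\<Sum>h<b. l (x - real h * w)) / real b" for x
 proof -
  have "m x = (\<Sum>k=1..n. (\<Sum>h<b. bump w (x - real_of_int (s k) * w - real h * w)) / real b) / real n"
   unfolding m_def profile_def bump_average[OF w b] ..
  also have "... = (\<Sum>k=1..n. \<Sum>h<b. bump w (x - real h * w - real_of_int (s k) * w)) / real b / real n"
   by (simp add: sum_divide_distrib algebra_simps)
  also have "(\<Sum>k=1..n. \<Sum>h<b. bump w (x - real h * w - real_of_int (s k) * w)) = (\<Sum>h<b. \<Sum>k=1..n. bump w (x - real h * w - real_of_int (s k) * w))"
   by (rule sum.swap)
  finally show ?thesis unfolding l_def profile_def by (simp add: sum_divide_distrib mult.commute)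
 qed
 have pw: "(l x - m x)^2 <= ?s x / real b" for x
 proof -
  have "l x - m x = (\<Sum>h<b. ?d h x) / real b"
   unfolding meq using b by (simp add: sum_subtractf field_simps)
  then have "(l x - m x)^2 = (\<Sum>h<b. ?d h x)^2 / (real b)^2" by (simp add: power_divide)
  also have "(\<Sum>h<b. ?d h x)^2 <= ?s x * real b"
   using sum_squared_le_sum_of_squares[of "%h. ?d h x" "{..<b}"] b by simp
  then have "(\<Sum>h<b. ?d h x)^2 / (real b)^2 <= ?s x * real b / (real b)^2"
   by (rule divide_right_mono) simp
  also have "... = ?s x / real b" using b by (simp add: power2_eq_square)
  finally show ?thesis .
 qed
 have i: "integrable lborel (%x. (?d h x)^2)" for h
  using profile_shift_square(1)[OF w, of n s "int h"] unfolding l_def by simp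
 have i2: "integrable lborel (%x. ?s x / real b)"
  by (intro integrable_divide integrable_sum i)
 show i3: "integrable lborel (%x. (l x - m x)^2)"
 proof (rule integrable_bound[OF i2])
  show "AE x in lborel. norm ((l x - m x)^2) <= norm (?s x / real b)"
  proof (rule AE_I2)
   fix x
   have "norm ((l x - m x)^2) = (l x - m x)^2" by (simp only: real_norm_def abs_power2)
   then show "norm ((l x - m x)^2) <= norm (?s x / real b)"
    using pw[of x] unfolding real_norm_def by linarith
  qed
 qed (simp add: l_def m_def)
 have "(LBINT x. (l x - m x)^2) <= (LBINT x. ?s x / real b)"
  by (intro integral_mono i3 i2 pw)
 also have "... = (\<Sum>h<b. \<integral>x. (?d h x)^2 \<partial>lborel) / real b"
  unfolding integral_divide_zero by (subst integral_sum) (auto intro: i)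
 finally show "(LBINT x. (l x - m x)^2) <= (\<Sum>h<b. \<integral>x. (?d h x)^2 \<partial>lborel) / real b" .
qed

lemma profile_width_dist:
 assumes "0 < e" "e <= e'" "1 <= n"
 shows "(LBINT x. \<bar>profile e' n u x - profile e n u x\<bar>) <= 2 * (e' - e) / e"
proof -
 have e': "0 < e'" using assms by simp
 have i: "integrable lborel (%x. \<bar>bump e' (x - u k) - bump e (x - u k)\<bar>)" for k
  by (intro integrable_abs integrable_diff bump_integral assms e')
 have "(LBINT x. \<bar>profile e' n u x - profile e n u x\<bar>) <= (LBINT x. (\<Sum>k=1..n. \<bar>bump e' (x - u k) - bump e (x - u k)\<bar>) / real n)"
 proof (intro integral_mono)
  show "integrable lborel (%x. \<bar>profile e' n u x - profile e n u x\<bar>)"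
   by (intro integrable_abs integrable_diff profile_integrable assms e')
  show "integrable lborel (%x. (\<Sum>k=1..n. \<bar>bump e' (x - u k) - bump e (x - u k)\<bar>) / real n)"
   by (intro integrable_divide integrable_sum i)
  show "\<bar>profile e' n u x - profile e n u x\<bar> <= (\<Sum>k=1..n. \<bar>bump e' (x - u k) - bump e (x - u k)\<bar>) / real n" for x
   unfolding profile_def diff_divide_distrib[symmetric] sum_subtractf[symmetric] abs_divide
   by (simp add: divide_right_mono sum_abs)
 qed
 also have "... = (\<Sum>k=1..n. \<integral>x. \<bar>bump e' (x - u k) - bump e (x - u k)\<bar> \<partial>lborel) / real n"
  unfolding integral_divide_zero by (subst integral_sum) (auto intro: i)
 also have "... <= (\<Sum>k=1..n. 2 * (e' - e) / e) / real n"
  by (intro divide_right_mono sum_mono bump_width_diff assms) auto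
 also have "... = 2 * (e' - e) / e" using assms by simp
 finally show ?thesis .
qed

text \<open>Times are written as j q - r with r < q, and each is moved to the end j q of its block.
  The two terms m / n pay for the fewer than \<open>m\<close> times after the last block and for the
  difference between the weights q / n and 1 / m.\<close>

lemma profile_block_dist:
 assumes e: "0 < e" and m: "0 < m" and n: "1 <= n"
 defines "q \<equiv> n div m"
 shows "(LBINT x. \<bar>profile e n u x - profile e m (%j. u (j * q)) x\<bar>)
  <= (\<Sum>j=1..m. \<Sum>r<q. min 2 (2 / e * \<bar>u (j * q - r) - u (j * q)\<bar>)) / real n + 2 * real m / real n"
proof -
 have mq: "m * q <= n" "n - m * q < m" unfolding q_def using m by (auto simp: modulo_nat_def[symmetric] minus_mult_div_eq_mod)
 have split: "(\<Sum>k=1..m * q. f k) = (\<Sum>j=1..m. \<Sum>r<q. f (j * q - r))" for f :: "nat => real"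
 proof -
  have "(\<Sum>k=1..m * q. f k) = (\<Sum>j=1..m. \<Sum>r<q. f (j * q - r))" for m
  proof (induction m)
   case (Suc m)
   have "{1..Suc m * q} = {1..m * q} \<union> {m * q + 1..m * q + q}" by auto
   then have "(\<Sum>k=1..Suc m * q. f k) = (\<Sum>k=1..m * q. f k) + (\<Sum>k\<in>{m * q + 1..m * q + q}. f k)"
    by (simp only:) (rule sum.union_disjoint, auto)
   also have "(\<Sum>k\<in>{m * q + 1..m * q + q}. f k) = (\<Sum>r<q. f (Suc m * q - r))"
    by (rule sum.reindex_bij_witness[of _ "%r. Suc m * q - r" "%k. Suc m * q - k"]) auto
   finally show ?case using Suc by simp
  qed simp
  then show ?thesis .
 qed
 have sp2: "(\<Sum>k=1..n. f k) = (\<Sum>j=1..m. \<Sum>r<q. f (j * q - r)) + (\<Sum>k=m * q + 1..n. f k)" for f :: "nat => real"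
 proof -
  have "{1..n} = {1..m * q} \<union> {m * q + 1..n}" using mq by auto
  then have "(\<Sum>k=1..n. f k) = (\<Sum>k=1..m * q. f k) + (\<Sum>k=m * q + 1..n. f k)"
   by (simp only:) (rule sum.union_disjoint, auto)
  then show ?thesis unfolding split .
 qed
 let ?b = "%k x. bump e (x - u k)"
 let ?c = "1 / real m - real q / real n"
 let ?F = "%x. \<Sum>j=1..m. \<Sum>r<q. \<bar>?b (j * q - r) x - ?b (j * q) x\<bar>" and ?G = "%x. \<Sum>k=m * q + 1..n. ?b k x" and ?H = "%x. \<Sum>j=1..m. ?c * ?b (j * q) x"
 have c0: "0 <= ?c" and cm: "real m * ?c <= real m / real n"
 proof -
  have "real (m * q) <= real n" using mq by (simp only: of_nat_le_iff)
  then show "0 <= ?c" using m n by (simp add: field_simps)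
  have "real m * ?c = (real n - real (m * q)) / real n" using m n by (simp add: field_simps)
  also have "real n - real (m * q) = real (n - m * q)" using mq by (simp add: of_nat_diff)
  also have "real (n - m * q) / real n <= real m / real n"
   by (intro divide_right_mono of_nat_mono less_imp_le[OF mq(2)]) simp
  finally show "real m * ?c <= real m / real n" .
 qed
 have pw: "\<bar>profile e n u x - profile e m (%j. u (j * q)) x\<bar>
  <= ?F x / real n + ?G x / real n + ?H x" for x
 proof -
  have eq: "profile e n u x - profile e m (%j. u (j * q)) x
   = (\<Sum>j=1..m. \<Sum>r<q. ?b (j * q - r) x - ?b (j * q) x) / real n + ?G x / real n - ?H x"
  proof -
   have "(\<Sum>j=1..m. \<Sum>r<q. ?b (j * q - r) x - ?b (j * q) x) = (\<Sum>j=1..m. \<Sum>r<q. ?b (j * q - r) x) - real q * (\<Sum>j=1..m. ?b (j * q) x)"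
    by (simp add: sum_subtractf sum_distrib_left)
   moreover have "?H x = ?c * (\<Sum>j=1..m. ?b (j * q) x)" by (simp only: sum_distrib_left)
   ultimately show ?thesis
    unfolding profile_def sp2 by (simp add: add_divide_distrib diff_divide_distrib left_diff_distrib)
  qed
  have h1: "\<bar>?G x / real n\<bar> = ?G x / real n"
   using e by (intro abs_of_nonneg divide_nonneg_nonneg sum_nonneg bump_nonneg) auto
  have h2: "\<bar>\<Sum>j=1..m. ?c * ?b (j * q) x\<bar> = ?H x"
   using e c0 by (intro abs_of_nonneg sum_nonneg mult_nonneg_nonneg bump_nonneg) auto
  have h3: "\<bar>(\<Sum>j=1..m. \<Sum>r<q. ?b (j * q - r) x - ?b (j * q) x) / real n\<bar> <= ?F x / real n"
  proof -
   have "\<bar>\<Sum>j=1..m. \<Sum>r<q. ?b (j * q - r) x - ?b (j * q) x\<bar> <= (\<Sum>j=1..m. \<bar>\<Sum>r<q. ?b (j * q - r) x - ?b (j * q) x\<bar>)" by (rule sum_abs)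
   also have "... <= ?F x" by (intro sum_mono sum_abs)
   finally show ?thesis by (simp add: abs_divide divide_right_mono)
  qed
  show ?thesis unfolding eq using h1 h2 h3 by linarith
 qed
 have i1: "integrable lborel (%x. ?F x / real n)"
  by (intro integrable_divide integrable_sum bump_shift_diff e)
 have i2: "integrable lborel (%x. ?G x / real n)"
  by (intro integrable_divide integrable_sum bump_integral e)
 have i3: "integrable lborel (%x. \<Sum>j=1..m. ?c * ?b (j * q) x)"
  by (intro integrable_sum integrable_mult_right bump_integral e)
 have "(LBINT x. \<bar>profile e n u x - profile e m (%j. u (j * q)) x\<bar>)
  <= (LBINT x. ?F x / real n + ?G x / real n + ?H x)"
  by (intro integral_mono pw integrable_abs integrable_diff profile_integrable e integrable_add i1 i2 i3)
 also have "... = (LBINT x. ?F x / real n) + (LBINT x. ?G x / real n) + (LBINT x. ?H x)"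
  by (simp only: integral_add integrable_add i1 i2 i3)
 also have "(LBINT x. ?F x / real n)
  = (\<Sum>j=1..m. \<Sum>r<q. \<integral>x. \<bar>?b (j * q - r) x - ?b (j * q) x\<bar> \<partial>lborel) / real n"
  unfolding integral_divide_zero
  by (subst integral_sum, intro integrable_sum bump_shift_diff e,
    subst integral_sum, intro bump_shift_diff e, rule refl)
 also have "... <= (\<Sum>j=1..m. \<Sum>r<q. min 2 (2 / e * \<bar>u (j * q - r) - u (j * q)\<bar>)) / real n"
  by (intro divide_right_mono sum_mono bump_shift_diff e) auto
 also have "(LBINT x. ?G x / real n) <= real m / real n"
 proof -
  have "(LBINT x. ?G x / real n) = (\<Sum>k=m * q + 1..n. 1) / real n"
   unfolding integral_divide_zero by (simp only: integral_sum bump_integral[OF e])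
  also have "... = real (n - m * q) / real n" by simp
  also have "... <= real m / real n" by (intro divide_right_mono of_nat_mono less_imp_le[OF mq(2)]) simp
  finally show ?thesis .
 qed
 also have "(LBINT x. ?H x) <= real m / real n"
 proof -
  have "(LBINT x. ?H x) = (\<Sum>j=1..m. ?c)"
   by (subst integral_sum) (auto intro!: integrable_mult_right bump_integral e simp: bump_integral(2)[OF e])
  also have "... = real m * ?c" by simp
  finally show ?thesis using cm by linarith
 qed
 finally show ?thesis by simp
qed

text \<open>A pointwise arithmetic-geometric inequality with parameter \<open>d\<close>. Being
  linear in the square, it passes directly to expectations.\<close>

lemma set_integral_abs_le_square:
 fixes f :: "real => real"
 assumes d: "0 < d" and R: "0 <= R" and f: "set_integrable lborel {-R..R} (%x. \<bar>f x\<bar>)" and f2: "integrable lborel (%x. (f x)^2)"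
 shows "(LBINT x:{-R..R}. \<bar>f x\<bar>) <= R * d + (LBINT x. (f x)^2) / (2 * d)"
proof -
 have s2: "set_integrable lborel {-R..R} (%x. (f x)^2 / (2 * d))"
  using f2 unfolding set_integrable_def by (intro integrable_mult_indicator) auto
 have c: "set_integrable lborel {-R..R} (%x. d / 2)"
  by (rule borel_integrable_atLeastAtMost') (rule continuous_on_const)
 have "\<bar>y\<bar> <= d / 2 + y^2 / (2 * d)" for y
 proof -
  have "0 <= (\<bar>y\<bar> - d)^2" by simp
  then have "2 * \<bar>y\<bar> * d <= d^2 + y^2" by (simp add: power2_diff)
  then show ?thesis using d by (simp add: field_simps power2_eq_square)
 qed
 then have "(LBINT x:{-R..R}. \<bar>f x\<bar>) <= (LBINT x:{-R..R}. d / 2 + (f x)^2 / (2 * d))"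
  by (intro set_integral_mono f set_integral_add c s2)
 also have "... = (LBINT x:{-R..R}. d / 2) + (LBINT x:{-R..R}. (f x)^2 / (2 * d))"
  by (rule set_integral_add(2)[OF c s2])
 also have "(LBINT x:{-R..R}. d / 2) = R * d" using R by (simp add: set_lebesgue_integral_def)
 also have "(LBINT x:{-R..R}. (f x)^2 / (2 * d)) <= (LBINT x. (f x)^2 / (2 * d))"
  using f2 d by (intro set_integral_le_integral) auto
 finally show ?thesis by simp
qed

lemma profile_integral: "0 < e ==> 1 <= n ==> (LBINT x. profile e n u x) = 1"
 unfolding profile_def integral_divide_zero by (simp add: integral_sum bump_integral)

lemma profile_dist_le_2:
 assumes "0 < e" "0 < e'" "1 <= n" "1 <= n'"
 shows "(LBINT x. \<bar>profile e n u x - profile e' n' v x\<bar>) <= 2"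
proof -
 have "(LBINT x. \<bar>profile e n u x - profile e' n' v x\<bar>) <= (LBINT x. profile e n u x + profile e' n' v x)"
 proof (intro integral_mono integrable_abs integrable_diff integrable_add profile_integrable assms)
  fix x
  show "\<bar>profile e n u x - profile e' n' v x\<bar> <= profile e n u x + profile e' n' v x"
   using profile_nonneg[of e n u x] profile_nonneg[of e' n' v x] assms by linarith
 qed
 also have "... = 2" using assms by (subst integral_add) (auto simp: profile_integral profile_integrable)
 finally show ?thesis .
qed

lemma integral_dist_triangle:
 fixes f g h k :: "real => real"
 assumes i: "integrable lborel f" "integrable lborel g" "integrable lborel h" "integrable lborel k"
 shows "(LBINT x:{-R..R}. \<bar>f x - k x\<bar>) <= (LBINT x:{-R..R}. \<bar>f x - g x\<bar>) + (LBINT x. \<bar>g x - h x\<bar>) + (LBINT x. \<bar>h x - k x\<bar>)"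
proof -
 have d: "integrable lborel (%x. \<bar>a x - b x\<bar>)" if "integrable lborel a" "integrable lborel b" for a b :: "real => real"
  using that by (intro integrable_abs integrable_diff)
 have s: "set_integrable lborel {-R..R} (%x. \<bar>a x - b x\<bar>)" if "integrable lborel a" "integrable lborel b" for a b :: "real => real"
  using d[OF that] unfolding set_integrable_def by (intro integrable_mult_indicator) auto
 have "(LBINT x:{-R..R}. \<bar>f x - k x\<bar>) <= (LBINT x:{-R..R}. \<bar>f x - g x\<bar> + (\<bar>g x - h x\<bar> + \<bar>h x - k x\<bar>))"
  by (intro set_integral_mono set_integral_add s i) linarith
 also have "... = (LBINT x:{-R..R}. \<bar>f x - g x\<bar>) + ((LBINT x:{-R..R}. \<bar>g x - h x\<bar>) + (LBINT x:{-R..R}. \<bar>h x - k x\<bar>))"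
  by (simp only: set_integral_add s i)
 also have "... <= (LBINT x:{-R..R}. \<bar>f x - g x\<bar>) + ((LBINT x. \<bar>g x - h x\<bar>) + (LBINT x. \<bar>h x - k x\<bar>))"
  by (intro add_mono order_refl set_integral_le_integral d i) auto
 finally show ?thesis by simp
qed

section \<open>Expected cost of replacing the occupation field by finitely many positions\<close>

context stable_walk
begin

abbreviation wd :: "nat => real" where "wd n \<equiv> real n powr (- 1 / \<alpha>)"

text \<open>The exponent of the normalisation is \<beta> \<delta>.\<close>

abbreviation "scaled_occ_sum \<beta> n w \<equiv> occ_sum \<beta> (%k. S k w) n * real n powr (- (\<beta> - \<beta> / \<alpha> + 1 / \<alpha>))"

abbreviation loc :: "nat => 'a => real => real" where
 "loc n w \<equiv> profile (wd n) n (%k. T k w * wd n)"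

lemma profile_joint_measurable[measurable]:
 "(%(z, x). profile e n (%k. T (f k) z * w) x) \<in> borel_measurable (M \<Otimes>\<^sub>M lborel)"
 unfolding profile_def by measurable

lemma pow_int_profile_measurable[measurable]:
 "(%x. pow_int \<beta> R (profile e n (%k. T (f k) x * w))) \<in> borel_measurable M"
 unfolding pow_int_def set_lebesgue_integral_def by measurable

lemma occ_sum_measurable[measurable]: "(%w. occ_sum \<beta> (%k. S k w) n) \<in> borel_measurable M"
 unfolding occ_sum_def occ_eq_sum by measurable

lemma expectation_of_bool:
 assumes [measurable]: "Measurable.pred M P"
 shows "expectation (%w. of_bool (P w) :: real) = \<P>(w in M. P w)" "integrable M (%w. of_bool (P w) :: real)"
proof -
 have "expectation (%w. of_bool (P w) :: real) = expectation (indicator {w \<in> space M. P w})"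
  by (intro integral_cong) (auto simp: indicator_def)
 then show "expectation (%w. of_bool (P w) :: real) = \<P>(w in M. P w)" by simp
 show "integrable M (%w. of_bool (P w) :: real)" by (rule integrable_const_bound[where B=1]) auto
qed

text \<open>The expectation of a summand depends only on the time lag, because both signs of
  \<open>h\<close> enter alike. For fixed \<open>j\<close> the lags form two one-sided partial sums,
  each controlled by the potential kernel, and one diagonal term, which is at most 2.\<close>

lemma expected_shift_square:
 assumes C: "!!m h. (\<Sum>i=1..m. 2 * p i 0 - p i h - p i (- h)) <= C * \<bar>real_of_int h\<bar> powr (\<alpha> - 1)"
  and n: "1 <= n" and w: "0 < w"
 shows "integrable M (%y. \<Sum>j=1..n. \<Sum>k=1..n. 2 * of_bool (S j y - S k y = 0) - of_bool (S j y - S k y = h) - of_bool (S j y - S k y = - h) :: real)"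
  and "expectation (%y. \<Sum>j=1..n. \<Sum>k=1..n. 2 * of_bool (S j y - S k y = 0) - of_bool (S j y - S k y = h) - of_bool (S j y - S k y = - h) :: real)
  <= real n * (2 + 2 * (C * \<bar>real_of_int h\<bar> powr (\<alpha> - 1)))"
proof -
 define r where "r i = 2 * p i 0 - p i h - p i (- h)" for i :: nat
 let ?r = "%j k. r (if k <= j then j - k else k - j)"
 let ?q = "%y j k. 2 * of_bool (S j y - S k y = 0) - of_bool (S j y - S k y = h) - of_bool (S j y - S k y = - h) :: real"
 have qi: "integrable M (%y. ?q y j k)" for j k
  by (intro integrable_diff integrable_mult_right expectation_of_bool(2)) measurable
 have Eq: "expectation (%y. ?q y j k) = ?r j k" for j k
 proof -
  have E: "expectation (%y. ?q y j k) = 2 * \<P>(y in M. S j y - S k y = 0) - \<P>(y in M. S j y - S k y = h) - \<P>(y in M. S j y - S k y = - h)"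
  proof -
   have m: "Measurable.pred M (%y. S j y - S k y = z)" for z by measurable
   show ?thesis
    by (simp only: integral_diff integrable_diff integrable_mult_right expectation_of_bool[OF m] integral_mult_right_zero)
  qed
  show ?thesis
  proof (cases "k <= j")
   case True
   show ?thesis unfolding E r_def using True
     prob_S_diff[OF True, of "%x. x = 0"] prob_S_diff[OF True, of "%x. x = h"] prob_S_diff[OF True, of "%x. x = - h"] by simp
  next
   case False
   then have jk: "j <= k" by simp
   have sets: "{y \<in> space M. S j y - S k y = z} = {y \<in> space M. S k y - S j y = - z}" for z by auto
   show ?thesis unfolding E r_def sets using False
     prob_S_diff[OF jk, of "%x. x = 0"] prob_S_diff[OF jk, of "%x. x = h"] prob_S_diff[OF jk, of "%x. x = - h"] by simp
  qed
 qed
 show "integrable M (%y. \<Sum>j=1..n. \<Sum>k=1..n. ?q y j k)"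
  by (intro integrable_sum qi)
 have r0: "r 0 <= 2"
 proof -
  have "p 0 0 <= 1" "0 <= p 0 h" "0 <= p 0 (- h)" by auto
  then show ?thesis unfolding r_def by linarith
 qed
 let ?D = "C * \<bar>real_of_int h\<bar> powr (\<alpha> - 1)"
 have "expectation (%y. \<Sum>j=1..n. \<Sum>k=1..n. ?q y j k) = (\<Sum>j=1..n. \<Sum>k=1..n. ?r j k)"
  by (simp only: integral_sum integrable_sum qi Eq)
 also have "... <= (\<Sum>j=1..n. 2 + ?D + ?D)"
 proof (rule sum_mono)
  fix j assume j: "j \<in> {1..n}"
  have "(\<Sum>k=1..n. ?r j k) = (\<Sum>k\<in>{1..<j}. r (j - k)) + r 0 + (\<Sum>k\<in>{j+1..n}. r (k - j))"
  proof -
   have "{1..n} = {1..<j} \<union> {j} \<union> {j+1..n}" using j by auto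
   then have "(\<Sum>k=1..n. ?r j k) = (\<Sum>k\<in>{1..<j} \<union> {j}. ?r j k) + (\<Sum>k\<in>{j+1..n}. ?r j k)"
    by (simp only:) (rule sum.union_disjoint, auto)
   also have "(\<Sum>k\<in>{1..<j} \<union> {j}. ?r j k) = (\<Sum>k\<in>{1..<j}. ?r j k) + r 0"
    by (subst sum.union_disjoint) auto
   finally show ?thesis by simp
  qed
  also have "(\<Sum>k\<in>{1..<j}. r (j - k)) = (\<Sum>i=1..j - 1. r i)"
   by (rule sum.reindex_bij_witness[of _ "%i. j - i" "%k. j - k"]) auto
  also have "(\<Sum>k\<in>{j+1..n}. r (k - j)) = (\<Sum>i=1..n - j. r i)"
   by (rule sum.reindex_bij_witness[of _ "%i. i + j" "%k. k - j"]) auto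
  also have "(\<Sum>i=1..j - 1. r i) + r 0 + (\<Sum>i=1..n - j. r i) <= ?D + 2 + ?D"
   using C[of h "j - 1"] C[of h "n - j"] r0 unfolding r_def by linarith
  finally show "(\<Sum>k=1..n. ?r j k) <= 2 + ?D + ?D" by simp
 qed
 also have "... = real n * (2 + 2 * ?D)" by simp
 finally show "expectation (%y. \<Sum>j=1..n. \<Sum>k=1..n. ?q y j k) <= real n * (2 + 2 * ?D)" .
qed

text \<open>All shifts h < b share the bound for the largest one, as the kernel grows like
  |h|^(\<alpha> - 1). Averaging over the b shifts therefore costs no more than a shift by b.\<close>

lemma expected_average_dist:
 assumes C: "0 < C" "!!m h. (\<Sum>i=1..m. 2 * p i 0 - p i h - p i (- h)) <= C * \<bar>real_of_int h\<bar> powr (\<alpha> - 1)"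
  and n: "1 <= n" and w: "0 < w" and b: "0 < b" and d: "0 < d" and R: "0 <= R"
 shows "expectation (%z. LBINT x:{-R..R}. \<bar>profile w n (%k. T k z * w) x - profile (real b * w) n (%k. T k z * w) x\<bar>)
  <= R * d + (2 + 2 * (C * real b powr (\<alpha> - 1))) / (real n * w) / (2 * d)"
proof -
 let ?l = "%z. profile w n (%k. T k z * w)" and ?m = "%z. profile (real b * w) n (%k. T k z * w)"
 let ?Q = "%h z. \<Sum>j=1..n. \<Sum>k=1..n. 2 * of_bool (S j z - S k z = 0) - of_bool (S j z - S k z = h) - of_bool (S j z - S k z = - h) :: real"
 let ?G = "%z. R * d + ((\<Sum>h<b. ?Q (int h) z / ((real n)^2 * w)) / real b) / (2 * d)"
 have bw: "0 < real b * w" using b w by simp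
 have pw: "(LBINT x:{-R..R}. \<bar>?l z x - ?m z x\<bar>) <= ?G z" for z
 proof -
  have "(LBINT x:{-R..R}. \<bar>?l z x - ?m z x\<bar>) <= R * d + (LBINT x. (?l z x - ?m z x)^2) / (2 * d)"
   by (intro set_integral_abs_le_square d R set_integrable_abs set_integral_diff(1) profile_set_integrable w bw profile_average_square(1) b)
  also have "(LBINT x. (?l z x - ?m z x)^2) / (2 * d) <= ((\<Sum>h<b. \<integral>x. (?l z x - ?l z (x - real h * w))^2 \<partial>lborel) / real b) / (2 * d)"
   using d by (intro divide_right_mono profile_average_square(2)[OF w b]) auto
  also have "(\<Sum>h<b. \<integral>x. (?l z x - ?l z (x - real h * w))^2 \<partial>lborel) = (\<Sum>h<b. ?Q (int h) z / ((real n)^2 * w))"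
   by (rule sum.cong[OF refl]) (rule profile_shift_square(2)[OF w, of n _ "int h" for h, simplified of_int_of_nat_eq])
  finally show ?thesis by simp
 qed
 have Qi: "integrable M (%z. ?Q (int h) z / ((real n)^2 * w))" for h
  by (intro integrable_divide expected_shift_square(1)[OF C(2) n w])
 have Gi: "integrable M ?G"
  by (intro integrable_add integrable_divide integrable_sum Qi) auto
 have "expectation (%z. LBINT x:{-R..R}. \<bar>?l z x - ?m z x\<bar>) <= expectation ?G"
 proof (rule integral_mono_AE'[OF Gi])
  show "AE z in M. (LBINT x:{-R..R}. \<bar>?l z x - ?m z x\<bar>) <= ?G z" by (intro AE_I2 pw)
  have "0 <= (LBINT x:{-R..R}. \<bar>?l z x - ?m z x\<bar>)" for z
   unfolding set_lebesgue_integral_def by (intro integral_nonneg) auto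
  then show "AE z in M. 0 <= ?G z" by (intro AE_I2 order_trans[OF _ pw])
 qed
 also have "... = R * d + ((\<Sum>h<b. expectation (?Q (int h)) / ((real n)^2 * w)) / real b) / (2 * d)"
 proof -
  have "expectation ?G = expectation (%z. R * d) + expectation (%z. ((\<Sum>h<b. ?Q (int h) z / ((real n)^2 * w)) / real b) / (2 * d))"
   by (intro integral_add integrable_divide integrable_sum Qi) auto
  also have "expectation (%z. R * d) = R * d" by (simp add: prob_space)
  also have "expectation (%z. ((\<Sum>h<b. ?Q (int h) z / ((real n)^2 * w)) / real b) / (2 * d)) = ((\<Sum>h<b. expectation (%z. ?Q (int h) z / ((real n)^2 * w))) / real b) / (2 * d)"
   unfolding integral_divide_zero[where c="2 * d"] integral_divide_zero[where c="real b"]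
   by (subst integral_sum) (rule Qi, rule refl)
  finally show ?thesis unfolding integral_divide_zero[where c="(real n)^2 * w"] .
 qed
 also have "... <= R * d + ((\<Sum>h<b. real n * (2 + 2 * (C * real b powr (\<alpha> - 1))) / ((real n)^2 * w)) / real b) / (2 * d)"
 proof (intro add_mono order_refl divide_right_mono sum_mono)
  fix h assume h: "h \<in> {..<b}"
  have "expectation (?Q (int h)) <= real n * (2 + 2 * (C * \<bar>real_of_int (int h)\<bar> powr (\<alpha> - 1)))"
   by (rule expected_shift_square(2)[OF C(2) n w])
  also have "... <= real n * (2 + 2 * (C * real b powr (\<alpha> - 1)))"
   using h C(1) \<alpha> by (intro mult_left_mono add_mono powr_mono2) auto
  finally show "expectation (?Q (int h)) <= real n * (2 + 2 * (C * real b powr (\<alpha> - 1)))" .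
 qed (use w d in auto)
 also have "((\<Sum>h<b. real n * (2 + 2 * (C * real b powr (\<alpha> - 1))) / ((real n)^2 * w)) / real b) / (2 * d) = (2 + 2 * (C * real b powr (\<alpha> - 1))) / (real n * w) / (2 * d)"
  using b n w by (simp add: power2_eq_square)
 finally show ?thesis .
qed

text \<open>A displacement inside a block has the law of \<open>T r\<close> up to sign, with r < n
  div m, and r^(1 / \<alpha>) n^(- 1 / \<alpha>) is at most m^(- 1 / \<alpha>). The truncation at 2
  keeps the test function bounded, so the envelope \<open>Z\<close> applies.\<close>

lemma expected_block_dist:
 assumes e: "0 < e" and m: "0 < m"
  and Q: "prob_space Q" "Z \<in> borel_measurable Q" "!!x. x \<in> space Q ==> 0 <= Z x"
  and dom: "!!r (f :: real => real). mono_on {0..} f ==> f \<in> borel_measurable borel ==> (!!x. 0 <= x ==> \<bar>f x\<bar> <= 2) ==>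
   expectation (%w. f \<bar>T r w\<bar>) <= (LINT x|Q. f (real r powr (1 / \<alpha>) * Z x))"
  and n: "1 <= n"
 shows "expectation (%w. \<integral>x. \<bar>profile e n (%k. T k w * wd n) x - profile e m (%j. T (j * (n div m)) w * wd n) x\<bar> \<partial>lborel)
  <= (LINT x|Q. min 2 (2 / e * real m powr (- 1 / \<alpha>) * Z x)) + 2 * real m / real n"
proof -
 interpret O: prob_space Q by fact
 note [measurable] = Q(2)
 let ?q = "n div m"
 let ?T = "LINT x|Q. min 2 (2 / e * real m powr (- 1 / \<alpha>) * Z x)"
 let ?d = "%j r w. min 2 (2 / e * \<bar>T (j * ?q - r) w * wd n - T (j * ?q) w * wd n\<bar>)"
 let ?u = "%w. profile e n (%k. T k w * wd n)" and ?v = "%w. profile e m (%j. T (j * ?q) w * wd n)"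
 have mq: "m * ?q <= n" by simp
 have wn: "0 < wd n" using n by simp
 let ?f = "%x. min 2 (2 / e * (x * wd n))"
 let ?G = "%w. (\<Sum>j=1..m. \<Sum>r<?q. ?d j r w) / real n + 2 * real m / real n"
 have gi: "integrable M (%w. min 2 (2 / e * \<bar>T i w * wd n - T j w * wd n\<bar>))" for i j
  using e by (intro integrable_const_bound[where B=2]) (auto simp: abs_le_iff min_def intro!: AE_I2)
 have Gi: "integrable M ?G"
  by (intro integrable_add integrable_divide integrable_sum gi) auto
 have "expectation (%w. \<integral>x. \<bar>?u w x - ?v w x\<bar> \<partial>lborel) <= expectation ?G"
 proof (rule integral_mono_AE'[OF Gi])
  show "AE w in M. (LBINT x. \<bar>?u w x - ?v w x\<bar>) <= ?G w"
  proof (rule AE_I2)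
   fix w
   show "(LBINT x. \<bar>?u w x - ?v w x\<bar>) <= ?G w"
    using profile_block_dist[OF e m n, of "%k. T k w * wd n"] .
  qed
 qed (use e in \<open>auto intro!: AE_I2 add_nonneg_nonneg divide_nonneg_nonneg sum_nonneg\<close>)
 also have "expectation ?G = (\<Sum>j=1..m. \<Sum>r<?q. expectation (?d j r)) / real n + 2 * real m / real n"
 proof -
  have "expectation ?G = expectation (%w. (\<Sum>j=1..m. \<Sum>r<?q. ?d j r w) / real n) + expectation (%w. 2 * real m / real n)"
   by (intro integral_add integrable_divide integrable_sum gi) auto
  also have "expectation (%w. 2 * real m / real n) = 2 * real m / real n" by (simp add: prob_space)
  finally show ?thesis
   unfolding integral_divide_zero by (simp only: integral_sum integrable_sum gi)
 qed
 also have "(\<Sum>j=1..m. \<Sum>r<?q. expectation (?d j r)) / real n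
  <= (\<Sum>j=1..m. \<Sum>r<?q. ?T) / real n"
 proof (intro divide_right_mono sum_mono)
  fix j r assume j: "j \<in> {1..m}" and r: "r \<in> {..<?q}"
  have q0: "r < ?q" using r by simp
  have jq: "?q <= j * ?q" using j by simp
  have "expectation (?d j r)
   = expectation (%w. ?f \<bar>real_of_int (S (j * ?q) w - S (j * ?q - r) w)\<bar>)"
  proof (intro integral_cong refl)
   fix w
   have "\<bar>T (j * ?q - r) w * wd n - T (j * ?q) w * wd n\<bar> = \<bar>real_of_int (S (j * ?q) w - S (j * ?q - r) w)\<bar> * wd n"
    using wn by (simp add: abs_mult[symmetric] left_diff_distrib[symmetric] abs_minus_commute)
     (metis abs_minus_commute abs_mult abs_of_pos wn powr_ge_zero abs_of_nonneg)
   then show "?d j r w = ?f \<bar>real_of_int (S (j * ?q) w - S (j * ?q - r) w)\<bar>"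
    by (simp only:)
  qed
  also have "... = expectation (%w. ?f \<bar>T r w\<bar>)"
  proof -
   have sd: "S (j * ?q) w - S (j * ?q - r) w = (\<Sum>k\<in>{j * ?q - r + 1..j * ?q}. X k w)" for w
    by (rule S_diff) simp
   have "card {j * ?q - r + 1..j * ?q} = r" using less_imp_le[OF order.strict_trans2[OF q0 jq]] by simp
   then show ?thesis unfolding sd using expectation_sum_X[of "{j * ?q - r + 1..j * ?q}" "%x. ?f \<bar>real_of_int x\<bar>"] by simp
  qed
  also have "... <= (LINT x|Q. ?f (real r powr (1 / \<alpha>) * Z x))"
  proof (rule dom)
   show "mono_on {0..} ?f"
   proof (rule mono_onI)
    fix x y :: real assume "x <= y"
    then have "2 / e * (x * wd n) <= 2 / e * (y * wd n)" using e by (intro mult_left_mono mult_right_mono) auto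
    then show "?f x <= ?f y" by (auto simp: min_def)
   qed
   show "\<bar>?f x\<bar> <= 2" if "0 <= x" for x using e that by (auto simp: min_def abs_le_iff)
  qed measurable
  also have "... <= ?T"
  proof (rule integral_mono)
   show "integrable Q (%x. ?f (real r powr (1 / \<alpha>) * Z x))"
    using e Q(3) by (intro O.integrable_const_bound[where B=2]) (auto simp: min_def abs_le_iff intro!: AE_I2)
   show "integrable Q (%x. min 2 (2 / e * real m powr (- 1 / \<alpha>) * Z x))"
    using e Q(3) by (intro O.integrable_const_bound[where B=2]) (auto simp: min_def abs_le_iff intro!: AE_I2)
   fix x assume x: "x \<in> space Q"
   have "real r powr (1 / \<alpha>) * wd n <= real m powr (- 1 / \<alpha>)"
   proof -
    have "m * r <= m * ?q" using q0 by (intro mult_left_mono) auto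
    then have "real m * real r <= real n" using mq by (metis le_trans of_nat_le_iff of_nat_mult)
    then have "real r <= real n / real m" using m by (simp add: field_simps)
    then have "real r powr (1 / \<alpha>) <= (real n / real m) powr (1 / \<alpha>)" using \<alpha> by (intro powr_mono2) auto
    also have "... = real n powr (1 / \<alpha>) * real m powr (- 1 / \<alpha>)" by (simp add: powr_divide powr_minus field_simps)
    finally have "real r powr (1 / \<alpha>) * wd n <= (real n powr (1 / \<alpha>) * real m powr (- 1 / \<alpha>)) * wd n" by (rule mult_right_mono) simp
    also have "... = real m powr (- 1 / \<alpha>)" using n by (simp add: powr_minus field_simps)
    finally show ?thesis .
   qed
   then have "2 / e * (real r powr (1 / \<alpha>) * wd n) * Z x <= 2 / e * real m powr (- 1 / \<alpha>) * Z x"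
    using e Q(3)[OF x] by (intro mult_right_mono mult_left_mono) auto
   then show "?f (real r powr (1 / \<alpha>) * Z x) <= min 2 (2 / e * real m powr (- 1 / \<alpha>) * Z x)"
    by (simp add: mult_ac min_le_iff_disj)
  qed
  finally show "expectation (?d j r) <= ?T" .
 qed simp
 also have "(\<Sum>j=1..m. \<Sum>r<?q. ?T) / real n <= ?T"
 proof -
  have T0: "0 <= ?T" using e Q(3) by (intro integral_nonneg) (auto simp: min_def)
  have "real (m * ?q) <= real n" using mq by (simp only: of_nat_le_iff)
  then have "real (m * ?q) * ?T <= real n * ?T" using T0 by (rule mult_right_mono)
  then have "real (m * ?q) * ?T / real n <= ?T" using n by (simp add: field_simps)
  then show ?thesis by simp
 qed
 finally show ?thesis by simp
qed

text \<open>The profile of the walk at \<open>m\<close> equally spaced times; the at most \<open>m\<close> left-over steps are dropped.\<close>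

abbreviation blk :: "real => nat => nat => 'a => real => real" where
 "blk e m n w \<equiv> profile e m (%j. T (j * (n div m)) w * wd n)"

text \<open>Three moves: from the raw field to width \<open>real b * w\<close>, from there to width
  \<open>e\<close>, and finally to block ends. The first uses an exact multiple of the mesh, because
  the mean-square estimate concerns averages of lattice shifts. \<open>d\<close> is the threshold of
  \<open>powr_diff_le\<close> and \<open>d'\<close> the parameter of
  \<open>set_integral_abs_le_square\<close>.\<close>

lemma expected_pow_int_dist:
 assumes \<beta>: "0 < \<beta>" "\<beta> < 1" and R: "0 <= R" and d: "0 < d" "0 < d'" and e: "0 < e" and m: "0 < m" and n: "1 <= n"
  and C: "0 < C" "!!m h. (\<Sum>i=1..m. 2 * p i 0 - p i h - p i (- h)) <= C * \<bar>real_of_int h\<bar> powr (\<alpha> - 1)"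
  and Q: "prob_space Q" "Z \<in> borel_measurable Q" "!!x. x \<in> space Q ==> 0 <= Z x"
  and dom: "!!r (f :: real => real). mono_on {0..} f ==> f \<in> borel_measurable borel ==> (!!x. 0 <= x ==> \<bar>f x\<bar> <= 2) ==>
   expectation (%z. f \<bar>T r z\<bar>) <= (LINT x|Q. f (real r powr (1 / \<alpha>) * Z x))"
 shows "expectation (%z. \<bar>pow_int \<beta> R (loc n z) - pow_int \<beta> R (blk e m n z)\<bar>)
  <= 2 * R * d powr \<beta> + d powr (\<beta> - 1) * (R * d' + (wd n powr (\<alpha> - 1) + C * (e + wd n) powr (\<alpha> - 1)) / d'
   + 2 * wd n / e + (LINT x|Q. min 2 (2 / e * real m powr (- 1 / \<alpha>) * Z x)) + 2 * real m / real n)"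
proof -
 define w where "w = wd n"
 have w: "0 < w" using n by (simp add: w_def)
 \<comment> \<open>The least number of mesh widths covering \<open>e\<close>; the overshoot is at
   most one mesh.\<close>
 define b where "b = nat \<lceil>e / w\<rceil>"
 have b1: "e <= real b * w" "real b * w <= e + w" and b0: "0 < b"
 proof -
  have c: "0 < e / w" using e w by simp
  then have rb: "real b = real_of_int \<lceil>e / w\<rceil>" unfolding b_def by simp
  have "e / w <= real b" "real b <= e / w + 1" unfolding rb using ceiling_correct[of "e / w"] by linarith+
  then show "e <= real b * w" "real b * w <= e + w" using w by (simp_all add: field_simps)
  show "0 < b" using c unfolding b_def by simp
 qed
 have bw: "0 < real b * w" using b0 w by simp
 let ?s = "%z k. T k z * w"
 let ?f = "%z. profile w n (?s z)" and ?g = "%z. profile (real b * w) n (?s z)" and ?h = "%z. profile e n (?s z)"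
  and ?k = "%z. profile e m (%j. T (j * (n div m)) z * w)"
 let ?d1 = "%z. LBINT x:{-R..R}. \<bar>?f z x - ?g z x\<bar>" and ?d3 = "%z. \<integral>x. \<bar>?h z x - ?k z x\<bar> \<partial>lborel"
 let ?G = "%z. 2 * R * d powr \<beta> + d powr (\<beta> - 1) * (?d1 z + 2 * w / e + ?d3 z)"
 have m1: "1 <= m" using m by simp
 have i1: "integrable M ?d1"
 proof (rule integrable_const_bound[where B=2])
  show "AE z in M. norm (?d1 z) <= 2"
  proof (rule AE_I2)
   fix z
   have i: "integrable lborel (%x. \<bar>?f z x - ?g z x\<bar>)"
    by (intro integrable_abs integrable_diff profile_integrable w bw)
   have "0 <= ?d1 z" unfolding set_lebesgue_integral_def by (intro integral_nonneg) auto
   moreover have "?d1 z <= 2" by (rule order_trans[OF set_integral_le_integral[OF i] profile_dist_le_2[OF w bw n n]]) simp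
   ultimately show "norm (?d1 z) <= 2" by simp
  qed
 qed (unfold set_lebesgue_integral_def, measurable)
 have i3: "integrable M ?d3"
 proof (rule integrable_const_bound[where B=2])
  show "AE z in M. norm (?d3 z) <= 2"
  proof (rule AE_I2)
   fix z
   have "0 <= ?d3 z" by (intro integral_nonneg) auto
   moreover have "?d3 z <= 2" by (rule profile_dist_le_2[OF e e n m1])
   ultimately show "norm (?d3 z) <= 2" by simp
  qed
 qed measurable
 have iG: "integrable M ?G"
  by (intro integrable_add integrable_mult_right i1 i3) auto
 have "expectation (%z. \<bar>pow_int \<beta> R (?f z) - pow_int \<beta> R (?k z)\<bar>) <= expectation ?G"
 proof (rule integral_mono_AE'[OF iG])
  have pw: "\<bar>pow_int \<beta> R (?f z) - pow_int \<beta> R (?k z)\<bar> <= ?G z" for z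
  proof -
   have le: "(LBINT x:{-R..R}. \<bar>?f z x - ?k z x\<bar>) <= ?d1 z + 2 * w / e + ?d3 z"
   proof -
    have "(LBINT x. \<bar>?g z x - ?h z x\<bar>) <= 2 * (real b * w - e) / e"
     by (rule profile_width_dist[OF e b1(1) n])
    also have "... <= 2 * w / e" using b1(2) e by (intro divide_right_mono) auto
    finally show ?thesis
     using integral_dist_triangle[of "?f z" "?g z" "?h z" "?k z" R, OF profile_integrable[OF w] profile_integrable[OF bw] profile_integrable[OF e] profile_integrable[OF e]]
     by linarith
   qed
   have "\<bar>pow_int \<beta> R (?f z) - pow_int \<beta> R (?k z)\<bar> <= 2 * R * d powr \<beta> + d powr (\<beta> - 1) * (LBINT x:{-R..R}. \<bar>?f z x - ?k z x\<bar>)"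
    using w e by (intro pow_int_diff \<beta> d R profile_measurable profile_nonneg profile_set_integrable) auto
   also have "... <= ?G z" by (intro add_left_mono mult_left_mono le) simp
   finally show ?thesis .
  qed
  show "AE z in M. \<bar>pow_int \<beta> R (?f z) - pow_int \<beta> R (?k z)\<bar> <= ?G z" by (intro AE_I2 pw)
  show "AE z in M. 0 <= ?G z" by (intro AE_I2 order_trans[OF abs_ge_zero pw])
 qed
 also have "... = 2 * R * d powr \<beta> + d powr (\<beta> - 1) * (expectation ?d1 + 2 * w / e + expectation ?d3)"
 proof -
  have "integrable M (%z. ?d1 z + 2 * w / e)" by (intro integrable_add i1) simp
  note j = this integrable_add[OF this i3]
  have "expectation (%z. ?d1 z + 2 * w / e + ?d3 z) = expectation ?d1 + 2 * w / e + expectation ?d3"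
   unfolding integral_add[OF j(1) i3] using i1 by (subst integral_add) (auto simp: prob_space)
  moreover have "expectation ?G = expectation (%z. 2 * R * d powr \<beta>) + expectation (%z. d powr (\<beta> - 1) * (?d1 z + 2 * w / e + ?d3 z))"
   by (rule integral_add) (use j in auto)
  ultimately show ?thesis by (simp add: prob_space)
 qed
 also have "... <= 2 * R * d powr \<beta> + d powr (\<beta> - 1) * (R * d' + (w powr (\<alpha> - 1) + C * (e + w) powr (\<alpha> - 1)) / d' + 2 * w / e
  + ((LINT x|Q. min 2 (2 / e * real m powr (- 1 / \<alpha>) * Z x)) + 2 * real m / real n))"
 proof (intro add_left_mono mult_left_mono add_mono order_refl)
  \<comment> \<open>Since n = w^(- \<alpha>), the factor 1 / (n w) is w^(\<alpha> - 1). Multiplied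
    by b^(\<alpha> - 1) it becomes (b w)^(\<alpha> - 1), which is at most (e + w)^(\<alpha> -
    1).\<close>
  have nw: "inverse (real n * w) = w powr (\<alpha> - 1)"
  proof -
   have "real n = w powr (- \<alpha>)" unfolding w_def powr_powr using n \<alpha> by simp
   then have "real n * w = w powr (- \<alpha>) * w powr 1" using w by simp
   also have "... = w powr (- (\<alpha> - 1))" unfolding powr_add[symmetric] by simp
   finally show ?thesis using powr_minus[of w "\<alpha> - 1"] by simp
  qed
  have "expectation ?d1 <= R * d' + (2 + 2 * (C * real b powr (\<alpha> - 1))) / (real n * w) / (2 * d')"
   by (rule expected_average_dist[OF C n w b0 d(2) R])
  also have "(2 + 2 * (C * real b powr (\<alpha> - 1))) / (real n * w) / (2 * d') = (w powr (\<alpha> - 1) + C * (real b * w) powr (\<alpha> - 1)) / d'"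
  proof -
   have "(2 + 2 * (C * real b powr (\<alpha> - 1))) / (real n * w) = 2 * (w powr (\<alpha> - 1) + C * (real b * w) powr (\<alpha> - 1))"
    unfolding divide_inverse nw by (simp add: powr_mult algebra_simps)
   then show ?thesis by (simp only: mult_divide_mult_cancel_left_if) simp
  qed
  also have "... <= (w powr (\<alpha> - 1) + C * (e + w) powr (\<alpha> - 1)) / d'"
   using b1(2) bw C(1) d \<alpha> by (intro divide_right_mono add_left_mono mult_left_mono powr_mono2) auto
  finally show "expectation ?d1 <= R * d' + (w powr (\<alpha> - 1) + C * (e + w) powr (\<alpha> - 1)) / d'" by simp
  show "expectation ?d3 <= (LINT x|Q. min 2 (2 / e * real m powr (- 1 / \<alpha>) * Z x)) + 2 * real m / real n"
   unfolding w_def by (rule expected_block_dist[OF e m Q dom n])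
 qed simp
 finally show ?thesis unfolding w_def by (simp only: add.assoc)
qed

text \<open>The nesting reflects the order of the limits: n to infinity, then m, and last e to 0.
  The thresholds \<open>d\<close> and \<open>d'\<close> are fixed beforehand, \<open>d'\<close>
  being chosen against the large factor d^(\<beta> - 1).\<close>

lemma pow_int_approx:
 assumes \<beta>: "0 < \<beta>" "\<beta> < 1" and R: "0 <= R" and \<eta>: "0 < \<eta>"
 shows "\<forall>\<^sub>F e in at_right 0. \<forall>\<^sub>F m in sequentially. \<forall>\<^sub>F n in sequentially.
  expectation (%v. \<bar>pow_int \<beta> R (loc n v) - pow_int \<beta> R (blk e m n v)\<bar>) < \<eta>"
proof -
 obtain C where C: "0 < C" "!!m h. (\<Sum>i=1..m. 2 * p i 0 - p i h - p i (- h)) <= C * \<bar>real_of_int h\<bar> powr (\<alpha> - 1)"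
  using potential_bound by blast
 obtain Q :: "real measure" and Z where Q: "prob_space Q" "Z \<in> borel_measurable Q" "!!x. x \<in> space Q ==> 0 <= Z x"
  and dom: "!!r (f :: real => real). mono_on {0..} f ==> f \<in> borel_measurable borel ==> (!!x. 0 <= x ==> \<bar>f x\<bar> <= 2) ==>
   expectation (%v. f \<bar>T r v\<bar>) <= (LINT x|Q. f (real r powr (1 / \<alpha>) * Z x))"
  using tight[of 2] by blast
 interpret O: prob_space Q by fact
 note [measurable] = Q(2)
 have w0: "wd ----> 0"
  by (rule filterlim_compose[OF tendsto_neg_powr filterlim_real_sequentially]) (use \<alpha> in \<open>auto intro: filterlim_ident\<close>)
 let ?\<tau> = "%e m. \<integral>x. min 2 (2 / e * real m powr (- 1 / \<alpha>) * Z x) \<partial>Q"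
 have \<tau>: "?\<tau> e ----> 0" if e: "0 < e" for e
 proof -
  have "?\<tau> e ----> (LINT x|Q. 0)"
  proof (rule integral_dominated_convergence[where w="%_. 2"])
   show "AE x in Q. (%m. min 2 (2 / e * real m powr (- 1 / \<alpha>) * Z x)) ----> 0"
   proof (rule AE_I2)
    fix x
    have "(%m. min 2 (2 / e * real m powr (- 1 / \<alpha>) * Z x)) ----> min 2 (2 / e * 0 * Z x)"
     by (intro tendsto_intros w0)
    then show "(%m. min 2 (2 / e * real m powr (- 1 / \<alpha>) * Z x)) ----> 0" by simp
   qed
   show "AE x in Q. norm (min 2 (2 / e * real m powr (- 1 / \<alpha>) * Z x)) <= 2" for m
    using e Q(3) by (intro AE_I2) (auto simp: min_def abs_le_iff)
  qed auto
  then show ?thesis by simp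
 qed
 \<comment> \<open>\<open>d\<close> and \<open>d'\<close> keep their contributions at most a quarter
   of the tolerance each; \<open>R + 1\<close> stands in the denominator so that
   \<open>R = 0\<close> is allowed.\<close>
 define d where "d = (\<eta> / (8 * (R + 1))) powr (1 / \<beta>)"
 have d0: "0 < d" using \<eta> R by (simp add: d_def)
 have d1: "2 * R * d powr \<beta> < \<eta> / 2"
 proof -
  have "d powr \<beta> = \<eta> / (8 * (R + 1))" unfolding d_def powr_powr using \<beta> \<eta> R by simp
  then have "2 * R * d powr \<beta> = \<eta> / 4 * (R / (R + 1))" using R by (simp add: field_simps)
  also have "... <= \<eta> / 4 * 1" using R \<eta> by (intro mult_left_mono) auto
  finally show ?thesis using \<eta> by simp
 qed
 define d' where "d' = \<eta> / (4 * (d powr (\<beta> - 1) * (R + 1)))"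
 have d'0: "0 < d'" using d0 R \<eta> by (simp add: d'_def)
 have d2: "d powr (\<beta> - 1) * (R * d') < \<eta> / 2"
 proof -
  have "d powr (\<beta> - 1) * (R * d') = \<eta> / 4 * (R / (R + 1))" using R d0 by (simp add: d'_def)
  also have "... <= \<eta> / 4 * 1" using R \<eta> by (intro mult_left_mono) auto
  finally show ?thesis using \<eta> by simp
 qed
 let ?B = "%x y z. 2 * R * d powr \<beta> + d powr (\<beta> - 1) * (R * d' + x / d' + y + z)"
 let ?A = "%e. 0 + C * (e + 0) powr (\<alpha> - 1)"
 have "((%e. ?B (?A e) 0 0) ---> ?B (0 + C * 0) 0 0) (at_right 0)"
 proof -
  have "((%e. (e + 0) powr (\<alpha> - 1)) ---> 0) (at_right (0 :: real))"
   using \<alpha> by (intro tendsto_eq_intros) (auto simp: eventually_at_filter)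
  then show ?thesis using d'0 by (intro tendsto_intros) auto
 qed
 then have "\<forall>\<^sub>F e in at_right 0. ?B (?A e) 0 0 < \<eta>"
  by (rule order_tendstoD(2)) (use d1 d2 in simp)
 moreover have "\<forall>\<^sub>F e in at_right 0. (0 :: real) < e" by (simp add: eventually_at_filter)
 ultimately show ?thesis
 proof eventually_elim
  case (elim e)
  have "(%m. ?B (?A e) 0 (?\<tau> e m)) ----> ?B (?A e) 0 0"
   using d'0 by (intro tendsto_intros \<tau> elim) auto
  then have "\<forall>\<^sub>F m in sequentially. ?B (?A e) 0 (?\<tau> e m) < \<eta>"
   by (rule order_tendstoD(2)) (use elim in simp)
  with eventually_gt_at_top[of 0] show ?case
  proof eventually_elim
   case (elim m)
   let ?b = "%n. ?B (wd n powr (\<alpha> - 1) + C * (e + wd n) powr (\<alpha> - 1)) (2 * wd n / e) (?\<tau> e m + 2 * real m / real n)"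
   have z: "(%n. wd n powr (\<alpha> - 1)) ----> 0"
    using tendsto_powr2[OF w0 tendsto_const[of "\<alpha> - 1"]] \<alpha> by simp
   have e: "(%n. (e + wd n) powr (\<alpha> - 1)) ----> (e + 0) powr (\<alpha> - 1)"
    using \<open>0 < e\<close> by (intro tendsto_intros w0) auto
   have mn: "(%n. 2 * real m / real n) ----> 0"
    by (rule tendsto_divide_0[OF tendsto_const filterlim_at_top_imp_at_infinity[OF filterlim_real_sequentially]])
   have "?b ----> ?B (?A e) (2 * 0 / e) (?\<tau> e m + 0)"
    using d'0 \<open>0 < e\<close> by (intro tendsto_add tendsto_mult tendsto_divide tendsto_const z e mn w0) auto
   then have "\<forall>\<^sub>F n in sequentially. ?b n < \<eta>"
    by (rule order_tendstoD(2)) (use elim in simp)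
   with eventually_ge_at_top[of 1] show ?case
   proof eventually_elim
    case (elim n)
    show ?case
     by (rule le_less_trans[OF expected_pow_int_dist[OF \<beta> R d0 d'0 \<open>0 < e\<close> \<open>0 < m\<close> elim(1) C Q dom]])
      (use elim(2) in \<open>simp_all only: add.assoc\<close>)
   qed
  qed
 qed
qed

text \<open>The two quantities agree exactly unless some position is too far out, which
  \<open>maximal_tight\<close> makes improbable uniformly in \<open>n\<close>. The extra 1 in
  \<open>K + 1\<close> absorbs the width of the outermost cell, as \<open>wd n <= 1\<close>.\<close>

lemma occ_sum_eq_pow_int:
 assumes \<beta>: "0 < \<beta>" and \<eta>: "0 < \<eta>"
 shows "\<forall>\<^sub>F R in at_top. \<forall>n\<ge>1. \<P>(w in M. scaled_occ_sum \<beta> n w ~= pow_int \<beta> R (loc n w)) <= \<eta>"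
proof -
 obtain K where K: "0 < K" "!!n. 1 <= n ==> \<P>(w in M. \<exists>k\<in>{1..n}. K * real n powr (1 / \<alpha>) < \<bar>T k w\<bar>) <= \<eta>"
  using maximal_tight[OF \<eta>] by blast
 have "\<P>(w in M. scaled_occ_sum \<beta> n w ~= pow_int \<beta> R (loc n w)) <= \<eta>"
  if R: "K + 1 <= R" and n: "1 <= n" for R n
 proof -
  have "\<P>(w in M. scaled_occ_sum \<beta> n w ~= pow_int \<beta> R (loc n w))
   <= \<P>(w in M. \<exists>k\<in>{1..n}. K * real n powr (1 / \<alpha>) < \<bar>T k w\<bar>)"
  proof (rule finite_measure_mono)
   show "{w \<in> space M. scaled_occ_sum \<beta> n w ~= pow_int \<beta> R (loc n w)}
    \<subseteq> {w \<in> space M. \<exists>k\<in>{1..n}. K * real n powr (1 / \<alpha>) < \<bar>T k w\<bar>}"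
    (is "?P \<subseteq> ?Q")
   proof (rule subsetI, rule ccontr)
    fix w assume o: "w \<in> ?P" "w \<notin> ?Q"
    have ne: "scaled_occ_sum \<beta> n w ~= pow_int \<beta> R (loc n w)"
     using o(1) by simp
    have "\<not> (\<exists>k\<in>{1..n}. K * real n powr (1 / \<alpha>) < \<bar>T k w\<bar>)"
     using o by simp
    then have b: "\<bar>T k w\<bar> <= K * real n powr (1 / \<alpha>)" if "k \<in> {1..n}" for k using that by (meson not_less)
    have w1: "wd n <= 1" using n \<alpha> powr_mono[of "- 1 / \<alpha>" 0 "real n"] by simp
    have nw: "real n powr (1 / \<alpha>) * wd n = 1" using n by (simp add: powr_add[symmetric])
    have "pow_int \<beta> R (loc n w) = occ_sum \<beta> (%k. S k w) n * (real n * wd n) powr (1 - \<beta>) / real n"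
    proof (rule profile_pow_int[OF n _ \<beta>])
     show "\<bar>T k w * wd n\<bar> + wd n <= R" if k: "k \<in> {1..n}" for k
     proof -
      have "\<bar>T k w * wd n\<bar> = \<bar>T k w\<bar> * wd n" by (simp only: abs_mult abs_of_nonneg[OF powr_ge_zero])
      moreover have "\<bar>T k w\<bar> * wd n <= (K * real n powr (1 / \<alpha>)) * wd n" by (rule mult_right_mono[OF b[OF k]]) simp
      moreover have "(K * real n powr (1 / \<alpha>)) * wd n = K" using nw by simp
      ultimately show ?thesis using w1 R by linarith
     qed
    qed (use n in simp)
    also have "(real n * wd n) powr (1 - \<beta>) = real n powr (1 - \<beta>) * real n powr (- 1 / \<alpha> * (1 - \<beta>))"
     by (simp add: powr_mult powr_powr)
    also have "occ_sum \<beta> (%k. S k w) n * (real n powr (1 - \<beta>) * real n powr (- 1 / \<alpha> * (1 - \<beta>))) / real n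
     = occ_sum \<beta> (%k. S k w) n * real n powr ((1 - \<beta>) + (- 1 / \<alpha> * (1 - \<beta>)) + (- 1))"
     using n by (simp only: powr_add powr_minus_divide powr_one) simp
    also have "(1 - \<beta>) + (- 1 / \<alpha> * (1 - \<beta>)) + (- 1) = - (\<beta> - \<beta> / \<alpha> + 1 / \<alpha>)" using \<alpha> by (simp add: field_simps)
    finally show False using ne by simp
   qed
  qed measurable
  also have "... <= \<eta>" by (rule K(2)[OF n])
  finally show ?thesis .
 qed
 then show ?thesis by (intro eventually_at_top_linorderI[of "K + 1"]) auto
qed

end

section \<open>Paths with an occupation density\<close>

lemma AE_completion_measurable':
 fixes f g :: "'a => 'b::{second_countable_topology, t2_space}"
 assumes g: "g \<in> borel_measurable (completion M)" and ae: "AE x in completion M. f x = g x"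
 shows "f \<in> borel_measurable (completion M)"
proof (rule measurableI)
 fix A :: "'b set" assume A: "A \<in> sets borel"
 let ?M = "completion M"
 obtain N where N: "{x \<in> space ?M. f x ~= g x} \<subseteq> N" "N \<in> null_sets ?M"
  using ae by (auto elim!: AE_E simp: null_sets_def)
 have gA: "g -` A \<inter> space ?M \<in> sets ?M" using g A by (rule measurable_sets)
 have "f -` A \<inter> space ?M \<inter> N \<in> sets ?M"
  by (rule completion.complete[of _ N]) (use N(2) in auto)
 moreover have "g -` A \<inter> space ?M - N \<in> sets ?M"
  using gA N(2) by auto
 moreover have "f -` A \<inter> space ?M = (g -` A \<inter> space ?M - N) \<union> (f -` A \<inter> space ?M \<inter> N)"
  using N(1) by auto
 ultimately show "f -` A \<inter> space ?M \<in> sets ?M" by (metis sets.Un)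
qed simp

lemma AE_LIMSEQ_completion_measurable:
 fixes f :: "nat => 'a => real"
 assumes [measurable]: "!!n. f n \<in> borel_measurable (completion M)" and lim: "AE x in completion M. (%n. f n x) ----> g x"
 shows "g \<in> borel_measurable (completion M)"
proof (rule AE_completion_measurable')
 show "(%x. lim (%n. f n x)) \<in> borel_measurable (completion M)" by measurable
 show "AE x in completion M. g x = lim (%n. f n x)" using lim by eventually_elim (simp add: limI)
qed

lemma bump_le: "0 < e ==> bump e u <= 1 / e"
 by (simp add: bump_def indicator_def)

lemma bump_tendsto:
 assumes y: "(y ---> y0) F" and "y0 ~= 0" "y0 ~= e"
 shows "((%n. bump e (y n)) ---> bump e y0) F"
proof (rule tendsto_eventually)
 consider "y0 < 0" | "e < y0" | "0 < y0" "y0 < e" using assms by linarith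
 then show "\<forall>\<^sub>F n in F. bump e (y n) = bump e y0"
 proof cases
  case 1
  from order_tendstoD(2)[OF y 1] show ?thesis by eventually_elim (use 1 in \<open>simp add: bump_def\<close>)
 next
  case 2
  from order_tendstoD(1)[OF y 2] show ?thesis by eventually_elim (use 2 in \<open>simp add: bump_def\<close>)
 next
  case 3
  from order_tendstoD(1)[OF y 3(1)] order_tendstoD(2)[OF y 3(2)] show ?thesis
   by eventually_elim (use 3 in \<open>simp add: bump_def\<close>)
 qed
qed

lemma profile_le: "0 < e ==> profile e n u x <= 1 / e"
proof (cases "n = 0")
 case False
 assume e: "0 < e"
 have "(\<Sum>k=1..n. bump e (x - u k)) <= (\<Sum>k=1..n. 1 / e)" by (intro sum_mono bump_le e)
 then have "profile e n u x <= (\<Sum>k=1..n. 1 / e) / real n" unfolding profile_def by (rule divide_right_mono) simp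
 then show ?thesis using False by simp
qed (simp add: profile_def)

lemma pow_int_LIMSEQ:
 fixes f :: "nat => real => real"
 assumes \<beta>: "0 < \<beta>" and [measurable]: "!!n. f n \<in> borel_measurable borel" "g \<in> borel_measurable borel"
  and b: "!!n x. 0 <= f n x" "!!n x. f n x <= B" and lim: "!!x. (%n. f n x) ----> g x"
 shows "(%n. pow_int \<beta> R (f n)) ----> pow_int \<beta> R g"
 unfolding pow_int_def set_lebesgue_integral_def
proof (rule integral_dominated_convergence[where w="%x. indicator {-R..R} x *\<^sub>R B powr \<beta>"])
 show "integrable lborel (%x. indicator {-R..R} x *\<^sub>R B powr \<beta>)"
  using borel_integrable_atLeastAtMost'[OF continuous_on_const, of "-R" R "B powr \<beta>"] unfolding set_integrable_def .
 show "AE x in lborel. (%n. indicator {-R..R} x *\<^sub>R f n x powr \<beta>) ----> indicator {-R..R} x *\<^sub>R g x powr \<beta>"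
  using \<beta> b(1) by (intro AE_I2 tendsto_scaleR tendsto_const tendsto_powr' lim) auto
 show "AE x in lborel. norm (indicat_real {-R..R} x *\<^sub>R f n x powr \<beta>) <= indicator {-R..R} x *\<^sub>R B powr \<beta>" for n
  using \<beta> b by (intro AE_I2) (auto simp: indicator_def intro!: powr_mono2)
qed measurable

text \<open>A deterministic path \<open>u\<close> with continuous occupation density
  \<open>l\<close> over the time interval [0, 1]. Almost every sample of the process and of its
  local time forms such a pair, so the analysis below is pathwise.\<close>

locale occupation_density =
 fixes u l :: "real => real"
 assumes right_cont: "!!s. 0 <= s ==> (u ---> u s) (at_right s)"
  and cont: "continuous_on UNIV l" and nonneg: "!!x. 0 <= l x"
  and compact_support: "compact (closure {x. l x ~= 0})"
  and occ: "!!A. A \<in> sets borel ==> emeasure lborel {s \<in> {0..1}. u s \<in> A} = (\<integral>\<^sup>+x\<in>A. ennreal (l x) \<partial>lborel)"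
begin

lemma l_measurable[measurable]: "l \<in> borel_measurable borel"
 by (rule borel_measurable_continuous_onI[OF cont])

lemma bounded:
 obtains B where "0 < B" "!!x. l x <= B" "!!x. B < \<bar>x\<bar> ==> l x = 0"
proof -
 let ?K = "closure {x. l x ~= 0}"
 have "compact (l ` ?K)" by (intro compact_continuous_image continuous_on_subset[OF cont] compact_support) auto
 then have "bounded (l ` ?K)" by (rule compact_imp_bounded)
 then obtain a where a: "!!x. x \<in> ?K ==> \<bar>l x\<bar> <= a" unfolding bounded_iff by auto
 have "bounded ?K" by (rule compact_imp_bounded[OF compact_support])
 then obtain b where b: "!!x. x \<in> ?K ==> \<bar>x\<bar> <= b" unfolding bounded_iff by auto
 have c: "l x ~= 0 ==> x \<in> ?K" for x using closure_subset[of "{x. l x ~= 0}"] by auto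
 define B where "B = max 1 (max a b)"
 have "l x <= B" for x
 proof (cases "l x = 0")
  case False
  then have "\<bar>l x\<bar> <= a" by (intro a c)
  then show ?thesis by (simp add: B_def)
 qed (simp add: B_def)
 moreover have "l x = 0" if "B < \<bar>x\<bar>" for x
 proof (rule ccontr)
  assume "l x ~= 0"
  then have "\<bar>x\<bar> <= b" by (intro b c)
  then show False using that by (simp add: B_def)
 qed
 ultimately show ?thesis by (intro that[of B]) (auto simp: B_def)
qed

text \<open>Rounding up approaches \<open>s\<close> from the right, which is the side on which the
  path is continuous.\<close>

lemma step_LIMSEQ:
 assumes s: "0 <= s"
 shows "(%m. u (real_of_int \<lceil>s * real (Suc m)\<rceil> / real (Suc m))) ----> u s"
proof (rule continuous_within_tendsto_compose'[where S="{s..}" and f=u])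
 show "continuous (at s within {s..}) u" unfolding continuous_within at_within_Ici_at_right by (rule right_cont[OF s])
 have b: "s <= real_of_int \<lceil>s * real (Suc m)\<rceil> / real (Suc m)" "real_of_int \<lceil>s * real (Suc m)\<rceil> / real (Suc m) <= s + 1 / real (Suc m)" for m
 proof -
  have p: "0 < real (Suc m)" by simp
  have "s * real (Suc m) <= real_of_int \<lceil>s * real (Suc m)\<rceil>" by (rule le_of_int_ceiling)
  then show "s <= real_of_int \<lceil>s * real (Suc m)\<rceil> / real (Suc m)" unfolding pos_le_divide_eq[OF p] .
  have "real_of_int \<lceil>s * real (Suc m)\<rceil> <= s * real (Suc m) + 1" using ceiling_correct[of "s * real (Suc m)"] by linarith
  also have "... = (s + 1 / real (Suc m)) * real (Suc m)" using p by (simp add: distrib_right del: of_nat_Suc)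
  finally show "real_of_int \<lceil>s * real (Suc m)\<rceil> / real (Suc m) <= s + 1 / real (Suc m)" unfolding pos_divide_le_eq[OF p] .
 qed
 show "real_of_int \<lceil>s * real (Suc m)\<rceil> / real (Suc m) \<in> {s..}" for m using b(1) by simp
 show "(%m. real_of_int \<lceil>s * real (Suc m)\<rceil> / real (Suc m)) ----> s"
 proof (rule real_tendsto_sandwich[of "%_. s" _ _ "%m. s + 1 / real (Suc m)"])
  have "(%m. s + 1 / real (Suc m)) ----> s + 0" by (intro tendsto_add tendsto_const LIMSEQ_Suc[OF lim_1_over_n])
  then show "(%m. s + 1 / real (Suc m)) ----> s" by simp
 qed (use b in \<open>auto intro!: always_eventually\<close>)
qed

lemma step_measurable[measurable]: "(%s. u (real_of_int \<lceil>s * real m\<rceil> / real m)) \<in> borel_measurable borel"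
 by (rule measurable_compose[of "%s. \<lceil>s * real m\<rceil>" borel "count_space UNIV" "%k. u (real_of_int k / real m)"]) measurable

text \<open>The step paths are measurable because a ceiling takes countably many values, and they
  converge to the path. The restriction to (0, 1] stays within the nonnegative times at which right
  continuity is given.\<close>

lemma path_measurable[measurable]: "(%s. indicator {0<..1} s * u s) \<in> borel_measurable borel"
proof (rule borel_measurable_LIMSEQ_real)
 show "(%m. indicator {0<..1} s * u (real_of_int \<lceil>s * real (Suc m)\<rceil> / real (Suc m))) ----> indicator {0<..1} s * u s" for s
  using step_LIMSEQ[of s] by (cases "0 <= s") (auto simp: indicator_def simp del: of_nat_Suc)
qed measurable

lemma occ_measure:
 assumes A[measurable]: "A \<in> sets borel"
 shows "{s \<in> {0<..1}. u s \<in> A} \<in> sets lborel" "emeasure lborel {s \<in> {0<..1}. u s \<in> A} = (\<integral>\<^sup>+x\<in>A. ennreal (l x) \<partial>lborel)"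
proof -
 have "{s \<in> {0<..1}. u s \<in> A} = {s \<in> {0<..1}. indicator {0<..1} s * u s \<in> A}" by (auto simp: indicator_def)
 also have "... \<in> sets borel" by measurable
 finally show m: "{s \<in> {0<..1}. u s \<in> A} \<in> sets lborel" by simp
 have e: "{s \<in> {0..1}. u s \<in> A} = {s \<in> {0<..1}. u s \<in> A} \<union> (if u 0 \<in> A then {0} else {})" by (auto simp: le_less)
 have "emeasure lborel {s \<in> {0<..1}. u s \<in> A} = emeasure lborel {s \<in> {0..1}. u s \<in> A}"
 proof (rule emeasure_eq_AE)
  show "AE s in lborel. (s \<in> {s \<in> {0<..1}. u s \<in> A}) = (s \<in> {s \<in> {0..1}. u s \<in> A})"
   using AE_lborel_singleton[of 0] by eventually_elim auto
  show "{s \<in> {0..1}. u s \<in> A} \<in> sets lborel" unfolding e using m by auto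
 qed (rule m)
 then show "emeasure lborel {s \<in> {0<..1}. u s \<in> A} = (\<integral>\<^sup>+x\<in>A. ennreal (l x) \<partial>lborel)" using occ[OF A] by simp
qed

text \<open>The window lies to the left of \<open>x\<close> because \<open>bump e (x - u)\<close> is
  nonzero exactly for u in (x - e, x].\<close>

definition avg :: "real => real => real" where
 "avg e x = (LBINT y:{x - e<..x}. l y) / e"

lemma l_integrable: "set_integrable lborel {a<..b} l"
proof (rule set_integrable_subset)
 show "set_integrable lborel {a..b} l" by (rule borel_integrable_atLeastAtMost') (rule continuous_on_subset[OF cont], simp)
qed auto

lemma occupation_integral:
 assumes e: "0 < e"
 shows "(LBINT s:{0<..1}. bump e (x - u s)) = avg e x"
proof -
 let ?A = "{x - e<..x}"
 have "(LBINT s:{0<..1}. bump e (x - u s)) = (LBINT s. indicator {s \<in> {0<..1}. u s \<in> ?A} s / e)"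
  unfolding set_lebesgue_integral_def bump_def by (intro integral_cong) (auto simp: indicator_def)
 also have "... = measure lborel {s \<in> {0<..1}. u s \<in> ?A} / e" unfolding integral_divide_zero by simp
 also have "measure lborel {s \<in> {0<..1}. u s \<in> ?A} = (LBINT y:?A. l y)"
 proof -
  have "(\<integral>\<^sup>+y\<in>?A. ennreal (l y) \<partial>lborel) = (\<integral>\<^sup>+y. ennreal (indicator ?A y *\<^sub>R l y) \<partial>lborel)"
   by (intro nn_integral_cong) (auto simp: indicator_def)
  also have "... = ennreal (LBINT y:?A. l y)"
   unfolding set_lebesgue_integral_def
   by (rule nn_integral_eq_integral) (use l_integrable nonneg in \<open>auto simp: set_integrable_def\<close>)
  finally have "emeasure lborel {s \<in> {0<..1}. u s \<in> ?A} = ennreal (LBINT y:?A. l y)"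
   by (intro trans[OF occ_measure(2)]) simp_all
  moreover have "0 <= (LBINT y:?A. l y)"
   unfolding set_lebesgue_integral_def using nonneg by (intro integral_nonneg) auto
  ultimately show ?thesis by (simp add: measure_def)
 qed
 finally show ?thesis unfolding avg_def .
qed

text \<open>The sample at j / m is the value of the ceiling step path on ((j - 1) / m, j / m].
  Padding \<open>a\<close> with 0 beyond \<open>m\<close> turns the finite sum into the series of
  \<open>sum_eq_integral_ceiling\<close>.\<close>

lemma profile_eq_integral:
 assumes m: "0 < m"
 shows "profile e m (%j. u (real j / real m)) x = (LBINT s:{0<..1}. bump e (x - u (real_of_int \<lceil>s * real m\<rceil> / real m)))"
proof -
 define a where "a j = (if 1 <= j \<and> j <= m then bump e (x - u (real j / real m)) else 0)" for j
 have z: "a (Suc n) = 0" if "n \<notin> {..<m}" for n using that by (simp add: a_def)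
 have r: "0 < 1 / real m" using m by simp
 have "(\<Sum>n. a (Suc n)) = (\<Sum>n<m. a (Suc n))" by (rule suminf_finite) (use z in auto)
 also have "... = (\<Sum>j=1..m. a j)"
  by (rule sum.reindex_bij_witness[of _ "%j. j - 1" Suc]) auto
 also have "... = (\<Sum>j=1..m. bump e (x - u (real j / real m)))" by (intro sum.cong) (auto simp: a_def)
 finally have 1: "profile e m (%j. u (real j / real m)) x = (1 / real m) *\<^sub>R (\<Sum>n. a (Suc n))"
  unfolding profile_def by simp
 have "summable (%n. norm (a (Suc n)))" by (rule summable_finite[of "{..<m}"]) (use z in auto)
 from sum_eq_integral_ceiling(2)[OF r this]
 have "profile e m (%j. u (real j / real m)) x = (LBINT s:{0<..}. a (nat \<lceil>s / (1 / real m)\<rceil>))" unfolding 1 by simp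
 also have "... = (LBINT s:{0<..1}. bump e (x - u (real_of_int \<lceil>s * real m\<rceil> / real m)))"
  unfolding set_lebesgue_integral_def
 proof (intro integral_cong refl)
  fix s :: real
  show "indicator {0<..} s *\<^sub>R a (nat \<lceil>s / (1 / real m)\<rceil>) = indicator {0<..1} s *\<^sub>R bump e (x - u (real_of_int \<lceil>s * real m\<rceil> / real m))"
  proof (cases "0 < s")
   case True
   have c: "0 < \<lceil>s * real m\<rceil>" using True m by simp
   have "nat \<lceil>s * real m\<rceil> <= m \<longleftrightarrow> s * real m <= real m" using c by (simp add: nat_le_iff ceiling_le_iff)
   also have "... \<longleftrightarrow> s <= 1" using m by simp
   finally have i: "nat \<lceil>s * real m\<rceil> <= m \<longleftrightarrow> s <= 1" .
   have "1 <= nat \<lceil>s * real m\<rceil>" "real (nat \<lceil>s * real m\<rceil>) = real_of_int \<lceil>s * real m\<rceil>" using c by linarith+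
   then show ?thesis using True i by (simp add: a_def indicator_def)
  qed simp
 qed
 finally show ?thesis .
qed

text \<open>The window jumps at 0 and \<open>e\<close>, but the path spends zero time at the levels
  \<open>x\<close> and \<open>x - e\<close>, since its occupation measure has a density. At all
  other times the step path converges inside the window function, and 1 / e dominates.\<close>

lemma profile_LIMSEQ:
 assumes e: "0 < e"
 shows "(%m. profile e (Suc m) (%j. u (real j / real (Suc m))) x) ----> avg e x"
 unfolding profile_eq_integral[OF zero_less_Suc] occupation_integral[OF e, symmetric] set_lebesgue_integral_def
proof (rule integral_dominated_convergence[where w="%s. indicator {0<..1} s *\<^sub>R (1 / e)"])
 show "integrable lborel (%s::real. indicator {0<..1} s *\<^sub>R (1 / e))"
  by (intro integrable_scaleR_left integrable_real_indicator) auto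
 have "AE s in lborel. s \<notin> {s \<in> {0<..1}. u s \<in> {y}}" for y
 proof (rule AE_not_in)
  have z: "(\<integral>\<^sup>+z\<in>{y}. ennreal (l z) \<partial>lborel) = 0"
   by (subst nn_integral_0_iff_AE) (use AE_lborel_singleton[of y] in \<open>auto simp: indicator_def elim: eventually_mono\<close>)
  show "{s \<in> {0<..1}. u s \<in> {y}} \<in> null_sets lborel"
   by (rule null_setsI[OF trans[OF occ_measure(2) z] occ_measure(1)]) simp_all
 qed
 note * = this
 show "AE s in lborel. (%m. indicator {0<..1} s *\<^sub>R bump e (x - u (real_of_int \<lceil>s * real (Suc m)\<rceil> / real (Suc m)))) ----> indicator {0<..1} s *\<^sub>R bump e (x - u s)"
  using *[of x] *[of "x - e"]
 proof eventually_elim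
  case (elim s)
  show ?case
  proof (cases "s \<in> {0<..1}")
   case True
   then have ne: "u s ~= x" "u s ~= x - e" using elim by simp_all
   have ne2: "x - u s ~= e"
   proof
    assume "x - u s = e"
    then have "u s = x - e" by linarith
    then show False using ne(2) by simp
   qed
   have "(%m. bump e (x - u (real_of_int \<lceil>s * real (Suc m)\<rceil> / real (Suc m)))) ----> bump e (x - u s)"
    by (intro bump_tendsto[OF tendsto_diff[OF tendsto_const step_LIMSEQ]]) (use True in simp, use ne in simp, use ne2 in simp)
   then show ?thesis by (intro tendsto_scaleR tendsto_const)
  qed simp
 qed
 show "AE s in lborel. norm (indicat_real {0<..1} s *\<^sub>R bump e (x - u (real_of_int \<lceil>s * real (Suc m)\<rceil> / real (Suc m)))) <= indicator {0<..1} s *\<^sub>R (1 / e)" for m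
  using e bump_le[OF e] bump_nonneg[of e] by (intro AE_I2) (auto simp: indicator_def)
 have "(%s. indicator {0<..1} s *\<^sub>R bump e (x - u s)) = (%s. indicator {0<..1} s *\<^sub>R bump e (x - indicator {0<..1} s * u s))"
  by (auto simp: indicator_def)
 then show "(%s. indicator {0<..1} s *\<^sub>R bump e (x - u s)) \<in> borel_measurable lborel" by simp
qed (simp del: of_nat_Suc)

lemma avg_measurable[measurable]: "0 < e ==> avg e \<in> borel_measurable borel"
 by (rule borel_measurable_LIMSEQ_real[OF profile_LIMSEQ]) auto

lemma avg_bounds:
 assumes e: "0 < e" and b: "!!y. x - e < y ==> y <= x ==> a <= l y \<and> l y <= b"
 shows "a <= avg e x" "avg e x <= b"
proof -
 have c: "set_integrable lborel {x - e<..x} (%_. k)" "(LBINT y:{x - e<..x}. k) = e * k" for k :: real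
  using e by (auto simp: set_integrable_def set_lebesgue_integral_def)
 have "e * a <= (LBINT y:{x - e<..x}. l y)" unfolding c(2)[symmetric] by (intro set_integral_mono c l_integrable) (use b in auto)
 moreover have "(LBINT y:{x - e<..x}. l y) <= e * b" unfolding c(2)[symmetric] by (intro set_integral_mono c l_integrable) (use b in auto)
 ultimately show "a <= avg e x" "avg e x <= b" using e by (simp_all add: avg_def field_simps)
qed

lemma avg_tendsto: "((%e. avg e x) ---> l x) (at_right 0)"
proof (rule tendstoI)
 fix \<eta> :: real assume \<eta>: "0 < \<eta>"
 have "isCont l x" using cont by (simp add: continuous_on_eq_continuous_at)
 then obtain d where d: "0 < d" "!!y. \<bar>y - x\<bar> < d ==> \<bar>l y - l x\<bar> < \<eta> / 2"
  using \<eta> unfolding continuous_at_eps_delta dist_real_def by (meson half_gt_zero)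
 have "\<forall>\<^sub>F e in at_right 0. e \<in> {0<..<d}" using d(1) by (intro eventually_at_right_real) 
 then show "\<forall>\<^sub>F e in at_right 0. dist (avg e x) (l x) < \<eta>"
 proof eventually_elim
  case (elim e)
  have "l x - \<eta> / 2 <= l y \<and> l y <= l x + \<eta> / 2" if "x - e < y" "y <= x" for y
  proof -
   have "\<bar>y - x\<bar> < d" using that elim by auto
   from d(2)[OF this] show ?thesis by linarith
  qed
  then have "l x - \<eta> / 2 <= avg e x" "avg e x <= l x + \<eta> / 2" using elim by (auto intro!: avg_bounds)
  then show ?case using \<eta> by (simp add: dist_real_def abs_less_iff)
 qed
qed

lemma pow_int_profile_LIMSEQ:
 assumes "0 < \<beta>" and e: "0 < e"
 shows "(%m. pow_int \<beta> R (profile e (Suc m) (%j. u (real j / real (Suc m))))) ----> pow_int \<beta> R (avg e)"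
 using e by (intro pow_int_LIMSEQ[where B="1 / e"] assms profile_LIMSEQ profile_nonneg profile_le) auto

lemma pow_int_avg_tendsto:
 assumes \<beta>: "0 < \<beta>" and r: "r ----> 0" "!!k. 0 < r k"
 shows "(%k. pow_int \<beta> R (avg (r k))) ----> pow_int \<beta> R l"
proof -
 obtain B where "0 < B" and B: "!!x. l x <= B" and "!!x. B < \<bar>x\<bar> ==> l x = 0" using bounded by blast
 show ?thesis
 proof (rule pow_int_LIMSEQ[OF \<beta>])
  show "0 <= avg (r k) x" for k x by (rule avg_bounds(1)[where b=B, OF r(2)]) (intro conjI nonneg B)
  show "avg (r k) x <= B" for k x by (rule avg_bounds(2)[where a=0, OF r(2)]) (intro conjI nonneg B)
  show "(%k. avg (r k) x) ----> l x" for x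
   by (rule filterlim_compose[OF avg_tendsto]) (use r in \<open>auto intro: tendsto_imp_filterlim_at_right\<close>)
 qed (rule avg_measurable[OF r(2)], rule l_measurable)
qed

text \<open>Once \<open>R\<close> exceeds the radius of the support, the window cuts nothing off.
  Positivity holds because a density vanishing almost everywhere would contradict total occupation
  time 1.\<close>

lemma pow_int_total:
 assumes \<beta>: "0 < \<beta>"
 shows "\<forall>\<^sub>F R in at_top. pow_int \<beta> R l = (LBINT x. l x powr \<beta>)" and "0 < (LBINT x. l x powr \<beta>)"
proof -
 obtain B where B: "0 < B" "!!x. l x <= B" "!!x. B < \<bar>x\<bar> ==> l x = 0" using bounded by blast
 have e: "indicator {-R..R} x *\<^sub>R l x powr \<beta> = l x powr \<beta>" if "B <= R" for R x
 proof (cases "l x = 0")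
  case False
  then have "\<bar>x\<bar> <= B" using B(3)[of x] by force
  then show ?thesis using that by (auto simp: indicator_def)
 qed simp
 have "pow_int \<beta> R l = (LBINT x. l x powr \<beta>)" if "B <= R" for R
  unfolding pow_int_def set_lebesgue_integral_def e[OF that] ..
 then show "\<forall>\<^sub>F R in at_top. pow_int \<beta> R l = (LBINT x. l x powr \<beta>)" by (rule eventually_at_top_linorderI)
 have i: "integrable lborel (%x. l x powr \<beta>)"
 proof (rule integrable_bound)
  show "integrable lborel (%x. indicator {-B..B} x *\<^sub>R B powr \<beta>)"
   using borel_integrable_atLeastAtMost'[OF continuous_on_const, of "-B" B "B powr \<beta>"] unfolding set_integrable_def .
  show "AE x in lborel. norm (l x powr \<beta>) <= norm (indicat_real {- B..B} x *\<^sub>R B powr \<beta>)"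
  proof (rule AE_I2)
   fix x
   have "l x powr \<beta> <= B powr \<beta>" using \<beta> nonneg B(2) by (intro powr_mono2) auto
   then show "norm (l x powr \<beta>) <= norm (indicat_real {- B..B} x *\<^sub>R B powr \<beta>)"
    using B(3)[of x] by (auto simp: indicator_def abs_if split: if_splits)
  qed
 qed measurable
 have "(LBINT x. l x powr \<beta>) ~= 0"
 proof
  assume "(LBINT x. l x powr \<beta>) = 0"
  then have "AE x in lborel. l x powr \<beta> = 0" using i by (subst (asm) integral_nonneg_eq_0_iff_AE) auto
  then have "AE x in lborel. ennreal (l x) * indicator UNIV x = 0" by eventually_elim simp
  then have "(\<integral>\<^sup>+x\<in>UNIV. ennreal (l x) \<partial>lborel) = 0" by (subst nn_integral_0_iff_AE) auto
  then have "emeasure lborel {s \<in> {0<..1::real}. u s \<in> UNIV} = 0" using occ_measure(2)[of UNIV] by simp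
  moreover have "{s \<in> {0<..1::real}. u s \<in> UNIV} = {0<..1}" by auto
  ultimately show False by (simp only: emeasure_lborel_Ioc) simp
 qed
 moreover have "0 <= (LBINT x. l x powr \<beta>)" by (intro integral_nonneg) auto
 ultimately show "0 < (LBINT x. l x powr \<beta>)" by (simp add: less_le)
qed

end

section \<open>Convergence in law of the self-intersection functional\<close>

lemma (in prob_space) expectation_iid_PiM:
 fixes V :: "nat => 'a => real" and f :: "(nat => real) => complex"
 assumes ind: "indep_vars (%_. borel) V {..<m}" and law: "!!i. i < m ==> distr M borel (V i) = \<nu>" and m: "0 < m"
  and f: "f \<in> borel_measurable (PiM {..<m} (%_. borel))"
 shows "expectation (%w. f (\<lambda>i\<in>{..<m}. V i w)) = (\<integral>y. f y \<partial>PiM {..<m} (%_. \<nu>))"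
proof -
 have rv: "V i \<in> borel_measurable M" if "i \<in> {..<m}" for i using ind that unfolding indep_vars_def by auto
 have "distr M (PiM {..<m} (%_. borel)) (%w. \<lambda>i\<in>{..<m}. V i w) = PiM {..<m} (%i. distr M borel (V i))"
  using ind by (subst (asm) indep_vars_iff_distr_eq_PiM') (use m rv in auto)
 also have "... = PiM {..<m} (%_. \<nu>)" by (intro PiM_cong refl law) auto
 finally have d: "distr M (PiM {..<m} (%_. borel)) (%w. \<lambda>i\<in>{..<m}. V i w) = PiM {..<m} (%_. \<nu>)" .
 show ?thesis unfolding d[symmetric] by (rule integral_distr[symmetric, OF measurable_restrict[OF rv] f])
qed

lemma integral_PiM_distr:
 fixes f :: "(nat => real) => complex" and g :: "'a => real"
 assumes Q: "prob_space Q" and g: "g \<in> borel_measurable Q" and f: "f \<in> borel_measurable (PiM {..<m} (%_. borel))"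
 shows "(\<integral>y. f y \<partial>PiM {..<m} (%_. distr Q borel g)) = (\<integral>x. f (\<lambda>i\<in>{..<m}. g (x i)) \<partial>PiM {..<m} (%_. Q))"
proof -
 interpret prob_space Q by fact
 let ?D = "distr Q borel g"
 have D: "prob_space ?D" by (rule prob_space_distr[OF g])
 have gD: "g \<in> measurable Q ?D" using g by simp
 have d: "distr (PiM {..<m} (%_. Q)) (PiM {..<m} (%_. ?D)) (compose {..<m} g) = PiM {..<m} (%_. distr Q ?D g)"
  by (rule distr_PiM_finite_prob_space') (use Q D gD in auto)
 have "distr Q ?D g = ?D" by (rule distr_cong) auto
 then have d2: "PiM {..<m} (%_. ?D) = distr (PiM {..<m} (%_. Q)) (PiM {..<m} (%_. ?D)) (compose {..<m} g)" using d by simp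
 have s: "sets (PiM {..<m} (%_. ?D)) = sets (PiM {..<m} (%_. borel))" by (intro sets_PiM_cong) auto
 have f': "f \<in> borel_measurable (PiM {..<m} (%_. ?D))" using f by (simp only: measurable_cong_sets[OF s refl])
 have c: "compose {..<m} g \<in> measurable (PiM {..<m} (%_. Q)) (PiM {..<m} (%_. ?D))"
  unfolding compose_def
  by (rule measurable_restrict, rule measurable_compose[OF measurable_component_singleton], assumption, rule gD)
 show ?thesis by (subst d2) (simp add: integral_distr[OF c f'] compose_def)
qed

text \<open>The functional expressed through increments, with partial sums rebuilding the positions.
  Walk blocks and Levy increments can then be compared through product laws on the same
  finite-dimensional space.\<close>

definition path_fun :: "real => real => real => nat => (nat => real) => real" where
 "path_fun \<beta> R e m y = pow_int \<beta> R (profile e m (%j. \<Sum>i<j. y i))"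

lemma profile_cong: "(!!j. j \<in> {1..m} ==> u j = v j) ==> profile e m u = profile e m v"
 unfolding profile_def by (intro ext arg_cong2[of _ _ _ _ "(/)"] refl sum.cong) auto

lemma path_fun_restrict: "path_fun \<beta> R e m (\<lambda>i\<in>{..<m}. y i) = path_fun \<beta> R e m y"
 unfolding path_fun_def by (intro arg_cong[of _ _ "pow_int \<beta> R"] profile_cong sum.cong) auto

lemma path_fun_measurable[measurable]: "path_fun \<beta> R e m \<in> borel_measurable (PiM {..<m} (%_. borel))"
proof -
 have s[measurable]: "(%y. \<Sum>i\<in>{..<j} \<inter> {..<m}. y i) \<in> borel_measurable (PiM {..<m} (%_. borel :: real measure))" for j
  by (intro borel_measurable_sum measurable_component_singleton) auto
 have e: "path_fun \<beta> R e m y = pow_int \<beta> R (profile e m (%j. \<Sum>i\<in>{..<j} \<inter> {..<m}. y i))" for y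
  unfolding path_fun_def by (intro arg_cong[of _ _ "pow_int \<beta> R"] profile_cong sum.cong) auto
 show ?thesis unfolding e[abs_def] pow_int_def set_lebesgue_integral_def profile_def by measurable
qed

lemma profile_move_dist:
 assumes e: "0 < e" and m: "0 < m"
 shows "(LBINT x. \<bar>profile e m u x - profile e m v x\<bar>) <= (\<Sum>k=1..m. 2 / e * \<bar>u k - v k\<bar>) / real m"
proof -
 have "(LBINT x. \<bar>profile e m u x - profile e m v x\<bar>) <= (LBINT x. (\<Sum>k=1..m. \<bar>bump e (x - u k) - bump e (x - v k)\<bar>) / real m)"
 proof (rule integral_mono)
  show "integrable lborel (%x. \<bar>profile e m u x - profile e m v x\<bar>)"
   by (intro integrable_abs integrable_diff profile_integrable e)
  show "integrable lborel (%x. (\<Sum>k=1..m. \<bar>bump e (x - u k) - bump e (x - v k)\<bar>) / real m)"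
   by (intro integrable_divide integrable_sum bump_shift_diff e)
  show "\<bar>profile e m u x - profile e m v x\<bar> <= (\<Sum>k=1..m. \<bar>bump e (x - u k) - bump e (x - v k)\<bar>) / real m" for x
   unfolding profile_def diff_divide_distrib[symmetric] sum_subtractf[symmetric] abs_divide
   by (simp add: divide_right_mono sum_abs)
 qed
 also have "... = (\<Sum>k=1..m. \<integral>x. \<bar>bump e (x - u k) - bump e (x - v k)\<bar> \<partial>lborel) / real m"
  unfolding integral_divide_zero by (subst integral_sum) (auto intro: bump_shift_diff(1)[OF e])
 also have "... <= (\<Sum>k=1..m. 2 / e * \<bar>u k - v k\<bar>) / real m"
  using bump_shift_diff(2)[OF e] by (intro divide_right_mono sum_mono) auto
 finally show ?thesis .
qed

text \<open>A single window jumps, yet moving its base point changes it continuously in L1, and so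
  it is for the profile. \<open>pow_int_diff\<close> with a small threshold \<open>d\<close>
  converts this into convergence of the functional.\<close>

lemma path_fun_LIMSEQ:
 assumes \<beta>: "0 < \<beta>" "\<beta> < 1" and R: "0 <= R" and e: "0 < e" and m: "0 < m"
  and y: "!!i. i < m ==> (%n. y n i) ----> z i"
 shows "(%n. path_fun \<beta> R e m (y n)) ----> path_fun \<beta> R e m z"
proof (rule LIMSEQ_I)
 fix \<eta> :: real assume \<eta>: "0 < \<eta>"
 define d where "d = (\<eta> / (4 * (R + 1))) powr (1 / \<beta>)"
 have d0: "0 < d" using \<eta> R by (simp add: d_def)
 have "d powr \<beta> = \<eta> / (4 * (R + 1))" unfolding d_def powr_powr using \<beta> \<eta> R by simp
 then have "2 * R * d powr \<beta> = \<eta> / 2 * (R / (R + 1))" using R by (simp add: field_simps)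
 also have "... <= \<eta> / 2 * 1" using R \<eta> by (intro mult_left_mono) auto
 finally have d1: "2 * R * d powr \<beta> < \<eta>" using \<eta> by simp
 let ?b = "%n. 2 * R * d powr \<beta> + d powr (\<beta> - 1) * ((\<Sum>k=1..m. 2 / e * \<bar>(\<Sum>i<k. y n i) - (\<Sum>i<k. z i)\<bar>) / real m)"
 have "?b ----> 2 * R * d powr \<beta> + d powr (\<beta> - 1) * ((\<Sum>k=1..m. 2 / e * \<bar>(\<Sum>i<k. z i) - (\<Sum>i<k. z i)\<bar>) / real m)"
  using m by (intro tendsto_add tendsto_mult tendsto_divide tendsto_const tendsto_sum tendsto_rabs tendsto_diff y) auto
 then have "\<forall>\<^sub>F n in sequentially. ?b n < \<eta>" by (rule order_tendstoD(2)) (use d1 in simp)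
 then obtain n0 where n0: "!!n. n0 <= n ==> ?b n < \<eta>" by (auto simp: eventually_sequentially)
 have "norm (path_fun \<beta> R e m (y n) - path_fun \<beta> R e m z) <= ?b n" for n
 proof -
  let ?f = "profile e m (%j. \<Sum>i<j. y n i)" and ?g = "profile e m (%j. \<Sum>i<j. z i)"
  have "norm (path_fun \<beta> R e m (y n) - path_fun \<beta> R e m z) = \<bar>pow_int \<beta> R ?f - pow_int \<beta> R ?g\<bar>"
   by (simp add: path_fun_def)
  then have "norm (path_fun \<beta> R e m (y n) - path_fun \<beta> R e m z) <= 2 * R * d powr \<beta> + d powr (\<beta> - 1) * (LBINT x:{-R..R}. \<bar>?f x - ?g x\<bar>)"
   using pow_int_diff[OF \<beta> d0 R profile_measurable profile_measurable profile_nonneg[OF less_imp_le[OF e]] profile_nonneg[OF less_imp_le[OF e]] profile_set_integrable[OF e] profile_set_integrable[OF e]]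
   by simp
  also have "(LBINT x:{-R..R}. \<bar>?f x - ?g x\<bar>) <= (LBINT x. \<bar>?f x - ?g x\<bar>)"
   by (intro set_integral_le_integral integrable_abs integrable_diff profile_integrable e) auto
  also note profile_move_dist[OF e m, of "%j. \<Sum>i<j. y n i" "%j. \<Sum>i<j. z i"]
  finally show ?thesis by (simp add: mult_left_mono)
 qed
 then show "\<exists>no. \<forall>n\<ge>no. norm (path_fun \<beta> R e m (y n) - path_fun \<beta> R e m z) < \<eta>"
  using n0 by (intro exI[of _ n0]) (auto intro: le_less_trans)
qed

abbreviation "root_law \<mu> \<alpha> m \<equiv> distr \<mu> borel (%x. real m powr (- 1 / \<alpha>) * x)"

text \<open>By stability a zero at \<open>t\<close> forces zeros at t n^(- 1 / \<alpha>) for all n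
  >= 1, and continuity at 0 contradicts the value 1 there.\<close>

lemma strictly_stable_char_nonzero:
 assumes st: "strictly_stable \<alpha> \<mu>" and \<alpha>: "0 < \<alpha>"
 shows "char \<mu> t ~= 0"
proof
 assume z: "char \<mu> t = 0"
 have rd: "real_distribution \<mu>" using st by (simp add: strictly_stable_def)
 interpret real_distribution \<mu> by fact
 let ?s = "%n. real (Suc n) powr (- 1 / \<alpha>) * t"
 have "char \<mu> (?s n) = 0" for n
 proof -
  have e: "real (Suc n) powr (1 / \<alpha>) * ?s n = t" by (simp add: powr_minus)
  have "char \<mu> (?s n) ^ Suc n = char \<mu> t" using strictly_stable_char_power[OF st \<alpha> zero_less_Suc, of "?s n" n] unfolding e .
  then show ?thesis using z by (simp only: power_eq_0_iff)
 qed
 moreover have "?s ----> 0"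
 proof -
  have "((%x. x powr (- 1 / \<alpha>)) ---> 0) at_top" using \<alpha> by (intro tendsto_neg_powr filterlim_ident) auto
  then have "(%n. real (Suc n) powr (- 1 / \<alpha>)) ----> 0"
   by (rule filterlim_compose[OF _ filterlim_compose[OF filterlim_real_sequentially filterlim_Suc]])
  then show ?thesis by (rule tendsto_mult_left_zero)
 qed
 then have "(%n. char \<mu> (?s n)) ----> char \<mu> 0" by (rule isCont_tendsto_compose[OF isCont_char])
 ultimately have "(%n::nat. 0 :: complex) ----> 1" by (simp add: char_zero)
 then show False by (simp add: LIMSEQ_const_iff)
qed

text \<open>The continuous \<open>m\<close>-th root of a non-vanishing characteristic function is unique, so the law at time \<open>1/m\<close> is determined by the law at time \<open>1\<close>.\<close>

lemma levy_process_root: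
 assumes levy: "levy_process N U" and law: "distr N borel (U 1) = \<mu>" and st: "strictly_stable \<alpha> \<mu>" and \<alpha>: "0 < \<alpha>" and m: "0 < m"
 defines "V \<equiv> %i w. U (real (Suc i) / real m) w - U (real i / real m) w"
 shows "prob_space.indep_vars N (%_. borel) V {..<m}"
  and "distr N borel (V i) = root_law \<mu> \<alpha> m"
proof -
 interpret prob_space N using levy by (simp add: levy_process_def)
 have Um[measurable]: "0 <= t ==> U t \<in> borel_measurable N" for t using levy by (simp add: levy_process_def)
 have rd: "real_distribution \<mu>" using st by (simp add: strictly_stable_def)
 have Vm[measurable]: "V i \<in> borel_measurable N" for i unfolding V_def by (intro borel_measurable_diff Um) auto
 have "mono (%i. real i / real m)" by (auto intro!: monoI divide_right_mono)
 then show ind: "indep_vars (%_. borel) V {..<m}"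
  using levy unfolding levy_process_def V_def by (auto dest: spec[where x="%i. real i / real m"])
 define \<nu> where "\<nu> = distr N borel (U (1 / real m))"
 have rn: "real_distribution \<nu>" unfolding \<nu>_def by (rule real_distribution_distr) simp
 have lawV: "distr N borel (V i) = \<nu>" for i
 proof -
  have "real (Suc i) / real m = real i / real m + 1 / real m" by (simp add: add_divide_distrib)
  then show ?thesis unfolding V_def \<nu>_def using levy unfolding levy_process_def by simp
 qed
 let ?g = "%t. char \<mu> (real m powr (- 1 / \<alpha>) * t)"
 have fm: "char \<nu> t ^ m = char \<mu> t" for t
 proof -
  have "char (distr N borel (%w. \<Sum>i<m. V i w)) t = (\<Prod>i<m. char (distr N borel (V i)) t)"
   by (rule char_distr_sum[OF ind])
  also have "... = char \<nu> t ^ m" by (simp add: lawV)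
  also have "distr N borel (%w. \<Sum>i<m. V i w) = distr N borel (U 1)"
  proof (rule distr_cong_AE)
   have "AE w in N. U 0 w = 0" using levy by (simp add: levy_process_def)
   then show "AE w in N. (\<Sum>i<m. V i w) = U 1 w"
   proof eventually_elim
    case (elim w)
    then show ?case unfolding V_def using sum_lessThan_telescope[of "%i. U (real i / real m) w" m] m by simp
   qed
  qed auto
  finally show ?thesis unfolding law ..
 qed
 have gm: "?g t ^ m = char \<mu> t" for t
 proof -
  have e: "real m powr (1 / \<alpha>) * (real m powr (- 1 / \<alpha>) * t) = t" using m by (simp add: powr_minus)
  show ?thesis using strictly_stable_char_power[OF st \<alpha> m, of "real m powr (- 1 / \<alpha>) * t"] unfolding e .
 qed
 have g0: "?g t ~= 0" for t by (rule strictly_stable_char_nonzero[OF st \<alpha>])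
 let ?r = "%t. char \<nu> t / ?g t"
 \<comment> \<open>The m-th powers of numerator and denominator agree, so the ratio takes values
   among the finitely many m-th roots of unity; continuous on a connected set, it is constant, and
   its value at 0 is 1.\<close>
 have "continuous_on UNIV ?r"
  by (intro continuous_on_divide continuous_at_imp_continuous_on ballI real_distribution.isCont_char[OF rn]
    continuous_intros isCont_o2[OF _ real_distribution.isCont_char[OF rd]] g0)
 moreover have "finite (?r ` UNIV)"
 proof (rule finite_subset)
  show "?r ` UNIV \<subseteq> {z. z ^ m = 1}" using fm gm strictly_stable_char_nonzero[OF st \<alpha>] by (auto simp: power_divide)
  show "finite {z::complex. z ^ m = 1}" using m by (intro finite_roots_unity) auto
 qed
 ultimately have "?r constant_on UNIV" by (intro continuous_finite_range_constant) auto
 then obtain c where c: "!!t. ?r t = c" unfolding constant_on_def by auto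
 have "c = 1" using c[of 0] real_distribution.char_zero[OF rn] real_distribution.char_zero[OF rd] by simp
 then have "char \<nu> t = ?g t" for t using c[of t] g0[of t] by simp
 then have "char \<nu> = char (root_law \<mu> \<alpha> m)"
  by (intro ext) (simp add: char_scale[OF rd])
 moreover have "real_distribution (root_law \<mu> \<alpha> m)"
 proof -
  interpret D: real_distribution \<mu> by fact
  show ?thesis by (rule D.real_distribution_distr) simp
 qed
 ultimately show "distr N borel (V i) = root_law \<mu> \<alpha> m"
  unfolding lawV by (intro Levy_uniqueness rn)
qed

lemma levy_process_profile_measurable:
 assumes levy: "levy_process N U"
 shows "(%w. pow_int \<beta> R (profile e m (%j. U (real j / real m) w))) \<in> borel_measurable N"
proof -
 have Um: "0 <= t ==> U t \<in> borel_measurable N" for t using levy by (simp add: levy_process_def)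
 have [measurable]: "(%(w, x). profile e m (%j. U (real j / real m) w) x) \<in> borel_measurable (N \<Otimes>\<^sub>M lborel)"
  unfolding profile_def split_beta'
  by (intro borel_measurable_divide borel_measurable_sum measurable_compose[OF _ bump_measurable] borel_measurable_diff measurable_compose[OF measurable_fst Um]) auto
 show ?thesis unfolding pow_int_def set_lebesgue_integral_def by measurable
qed

lemma levy_process_path_fun:
 assumes levy: "levy_process N U" and law: "distr N borel (U 1) = \<mu>" and st: "strictly_stable \<alpha> \<mu>" and \<alpha>: "0 < \<alpha>" and m: "0 < m"
 shows "(LINT w|N. iexp (t * pow_int \<beta> R (profile e m (%j. U (real j / real m) w))))
  = (\<integral>y. iexp (t * path_fun \<beta> R e m y) \<partial>PiM {..<m} (%_. root_law \<mu> \<alpha> m))"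
proof -
 interpret prob_space N using levy by (simp add: levy_process_def)
 have Um[measurable]: "0 <= t ==> U t \<in> borel_measurable N" for t using levy by (simp add: levy_process_def)
 define V where "V = (%i w. U (real (Suc i) / real m) w - U (real i / real m) w)"
 have [measurable]: "V i \<in> borel_measurable N" for i unfolding V_def by (intro borel_measurable_diff Um) auto
 have pm: "(%w. path_fun \<beta> R e m (\<lambda>i\<in>{..<m}. V i w)) \<in> borel_measurable N"
  by (rule measurable_compose[OF _ path_fun_measurable]) measurable
 note [measurable] = levy_process_profile_measurable[OF levy]
 have "(LINT w|N. iexp (t * pow_int \<beta> R (profile e m (%j. U (real j / real m) w)))) = expectation (%w. iexp (t * path_fun \<beta> R e m (\<lambda>i\<in>{..<m}. V i w)))"
 proof (rule integral_cong_AE)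
  have "AE w in N. U 0 w = 0" using levy by (simp add: levy_process_def)
  then show "AE w in N. iexp (t * pow_int \<beta> R (profile e m (%j. U (real j / real m) w))) = iexp (t * path_fun \<beta> R e m (\<lambda>i\<in>{..<m}. V i w))"
  proof eventually_elim
   case (elim w)
   have "(\<Sum>i<j. V i w) = U (real j / real m) w" for j
    unfolding V_def using sum_lessThan_telescope[of "%i. U (real i / real m) w" j] elim by simp
   then show ?case by (simp only: path_fun_restrict) (simp add: path_fun_def)
  qed
  show "(%w. iexp (t * pow_int \<beta> R (profile e m (%j. U (real j / real m) w)))) \<in> borel_measurable N"
   by measurable
  show "(%w. iexp (t * path_fun \<beta> R e m (\<lambda>i\<in>{..<m}. V i w))) \<in> borel_measurable N"
   using pm by measurable
 qed
 also have "... = (\<integral>y. iexp (t * path_fun \<beta> R e m y) \<partial>PiM {..<m} (%_. root_law \<mu> \<alpha> m))"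
  by (rule expectation_iid_PiM) (use levy_process_root[OF levy law st \<alpha> m] m in \<open>auto simp: V_def\<close>)
 finally show ?thesis .
qed

lemma filterlim_div_nat: "0 < m ==> filterlim (%n. n div m) at_top (sequentially :: nat filter)" for m :: nat
proof (rule filterlim_at_top[THEN iffD2], intro allI)
 fix Z :: nat assume m: "0 < m"
 show "\<forall>\<^sub>F n in sequentially. Z <= n div m"
  using eventually_ge_at_top[of "Z * m"] by eventually_elim (use m in \<open>simp add: less_eq_div_iff_mult_less_eq\<close>)
qed

lemma div_nat_ratio_LIMSEQ:
 assumes m: "0 < m"
 shows "(%n. real (n div m) / real n) ----> 1 / real m"
proof (rule real_tendsto_sandwich[of "%n. 1 / real m - 1 / real n" _ _ "%_. 1 / real m"])
 have "(%n. 1 / real m - 1 / real n) ----> 1 / real m - 0" by (intro tendsto_diff tendsto_const lim_1_over_n)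
 then show "(%n. 1 / real m - 1 / real n) ----> 1 / real m" by simp
 have *: "1 / real m - 1 / real n <= real (n div m) / real n \<and> real (n div m) / real n <= 1 / real m" if n: "0 < n" for n
 proof -
  have "real n = real m * real (n div m) + real (n mod m)" by (metis div_mult_mod_eq mult.commute of_nat_add of_nat_mult)
  moreover have "real (n mod m) < real m" using m by simp
  ultimately have "real m * real (n div m) <= real n" "real n <= real m * real (n div m) + real m" by linarith+
  then have "1 / real m <= (real (n div m) + 1) / real n" "real (n div m) / real n <= 1 / real m"
   using m n by (simp_all add: field_simps)
  then show ?thesis by (simp add: add_divide_distrib)
 qed
 show "\<forall>\<^sub>F n in sequentially. 1 / real m - 1 / real n <= real (n div m) / real n"
  "\<forall>\<^sub>F n in sequentially. real (n div m) / real n <= 1 / real m"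
  using eventually_gt_at_top[of 0] by (eventually_elim, simp add: *)+
qed auto

section \<open>Joint limit of the block increments\<close>

context stable_walk
begin

lemma blk_eq_path_fun:
 defines "B n m \<equiv> %i w. real_of_int (\<Sum>k\<in>{i * (n div m) + 1..Suc i * (n div m)}. X k w) * wd n"
 shows "pow_int \<beta> R (blk e m n w) = path_fun \<beta> R e m (\<lambda>i\<in>{..<m}. B n m i w)"
proof -
 have "(\<Sum>i<j. B n m i w) = T (j * (n div m)) w * wd n" for j
 proof -
  have "B n m i w = T (Suc i * (n div m)) w * wd n - T (i * (n div m)) w * wd n" for i
   unfolding B_def using S_diff[of "i * (n div m)" "Suc i * (n div m)" w, symmetric] by (simp add: left_diff_distrib)
  then show ?thesis
   using sum_lessThan_telescope[of "%i. T (i * (n div m)) w * wd n" j] by (simp add: random_walk_def)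
 qed
 then show ?thesis by (simp only: path_fun_restrict) (simp add: path_fun_def)
qed

lemma blocks_iid:
 defines "B n m \<equiv> %i w. real_of_int (\<Sum>k\<in>{i * (n div m) + 1..Suc i * (n div m)}. X k w) * wd n"
 shows "indep_vars (%_. borel) (B n m) {..<m}"
  and "distr M borel (B n m i) = distr M borel (%w. T (n div m) w * wd n)"
proof -
 let ?q = "n div m"
 let ?K = "%i. {i * ?q + 1..Suc i * ?q}"
 have K: "?K i \<subseteq> {1..}" for i by auto
 have dis: "disjoint_family_on ?K {..<m}"
  unfolding disjoint_family_on_def
 proof (intro ballI impI)
  fix i j :: nat assume ij: "i ~= j"
  have d: "?K i \<inter> ?K j = {}" if "i < j" for i j :: nat
  proof -
   have "Suc i * ?q <= j * ?q" using that by (intro mult_right_mono) auto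
   then show ?thesis by auto
  qed
  show "?K i \<inter> ?K j = {}" using d[of i j] d[of j i] ij by (cases "i < j") auto
 qed
 have iv: "indep_vars (%i. PiM (?K i) (%_. count_space UNIV)) (%i w. restrict (%k. X k w) (?K i)) {..<m}"
  by (rule indep_vars_restrict[OF indep_X K dis])
 have "indep_vars (%_. borel) (%i w. (%x. real_of_int (\<Sum>k\<in>?K i. x k) * wd n) (restrict (%k. X k w) (?K i))) {..<m}"
 proof (rule indep_vars_compose2[OF iv])
  fix i
  have "(%x. \<Sum>k\<in>?K i. x k) \<in> measurable (PiM (?K i) (%_. count_space UNIV :: int measure)) (count_space UNIV)"
   by (rule sum_coordinates_measurable) auto
  then show "(%x. real_of_int (\<Sum>k\<in>?K i. x k) * wd n) \<in> borel_measurable (PiM (?K i) (%_. count_space UNIV))" by measurable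
 qed
 moreover have "(%i w. (%x. real_of_int (\<Sum>k\<in>?K i. x k) * wd n) (restrict (%k. X k w) (?K i))) = B n m"
  unfolding B_def by (intro ext) simp
 ultimately show "indep_vars (%_. borel) (B n m) {..<m}" by simp
 have dd: "distr M borel (%w. real_of_int (f w) * wd n) = distr (distr M borel (%w. real_of_int (f w))) borel (%x. x * wd n)"
  if "f \<in> measurable M (count_space UNIV)" for f :: "'a => int"
  using that by (subst distr_distr) (auto simp: o_def)
 have "distr M borel (B n m i) = distr (distr M borel (%w. real_of_int (\<Sum>k\<in>?K i. X k w))) borel (%x. x * wd n)"
  unfolding B_def by (rule dd[OF sum_X_measurable[OF K]])
 also have "distr M borel (%w. real_of_int (\<Sum>k\<in>?K i. X k w)) = distr M borel (%w. T (card (?K i)) w)"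
  by (rule distr_sum_X[OF finite_atLeastAtMost K])
 also have "card (?K i) = ?q" by simp
 also have "distr (distr M borel (%w. real_of_int (S ?q w))) borel (%x. x * wd n) = distr M borel (%w. real_of_int (S ?q w) * wd n)"
  by (rule dd[OF S_measurable, symmetric])
 finally show "distr M borel (B n m i) = distr M borel (%w. real_of_int (S ?q w) * wd n)" .
qed

text \<open>For fixed \<open>m\<close> the block increments are independent with a common law, so
  independent copies of the Skorohod coupling on a product space realise their joint convergence
  pointwise. The factor \<open>?c n\<close> converts the normalisation at the block length into that
  at \<open>n\<close>; its limit is m^(- 1 / \<alpha>).\<close>

lemma blk_char_LIMSEQ:
 assumes \<beta>: "0 < \<beta>" "\<beta> < 1" and R: "0 <= R" and e: "0 < e" and m: "0 < m"
 shows "(%n. expectation (%z. iexp (t * pow_int \<beta> R (blk e m n z))))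
  ----> (\<integral>y. iexp (t * path_fun \<beta> R e m y) \<partial>PiM {..<m} (%_. root_law \<mu> \<alpha> m))"
proof -
 obtain Q :: "real measure" and Y Y' where Y: "prob_space Q" "!!n. Y n \<in> borel_measurable Q"
  "!!n. distr Q borel (Y n) = distr M borel (%z. real n powr (- 1 / \<alpha>) * T n z)"
  "Y' \<in> borel_measurable Q" "distr Q borel Y' = \<mu>" "!!x. x \<in> space Q ==> (%n. Y n x) ----> Y' x"
  using skorohod by blast
 interpret O: prob_space Q by fact
 interpret P: prob_space "PiM {..<m} (%_. Q)" by (intro prob_space_PiM Y(1))
 note [measurable] = Y(2) Y(4)
 let ?c = "%n. real (n div m) powr (1 / \<alpha>) * wd n" and ?c' = "real m powr (- 1 / \<alpha>)"
 let ?F = "%y. iexp (t * path_fun \<beta> R e m y)" and ?P = "PiM {..<m} (%_. Q)"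
 have fm[measurable]: "?F \<in> borel_measurable (PiM {..<m} (%_. borel))" by measurable
 have eq: "expectation (%z. iexp (t * pow_int \<beta> R (blk e m n z)))
  = (\<integral>x. ?F (\<lambda>i\<in>{..<m}. ?c n * Y (n div m) (x i)) \<partial>?P)" if n: "m <= n" for n
 proof -
  have q: "0 < n div m" using n m by (simp add: div_greater_zero_iff)
  have "distr Q borel (%x. ?c n * Y (n div m) x) = distr (distr Q borel (Y (n div m))) borel (%x. ?c n * x)"
   by (subst distr_distr) (auto simp: o_def)
  also have "... = distr M borel (%z. ?c n * (real (n div m) powr (- 1 / \<alpha>) * T (n div m) z))"
   unfolding Y(3) by (subst distr_distr) (auto simp: o_def)
  also have "(%z. ?c n * (real (n div m) powr (- 1 / \<alpha>) * T (n div m) z)) = (%z. T (n div m) z * wd n)"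
  proof (rule ext)
   fix z
   have e: "real (n div m) powr (1 / \<alpha>) * real (n div m) powr (- 1 / \<alpha>) = 1" unfolding powr_add[symmetric] using q by simp
   have "?c n * (real (n div m) powr (- 1 / \<alpha>) * T (n div m) z)
    = (real (n div m) powr (1 / \<alpha>) * real (n div m) powr (- 1 / \<alpha>)) * (T (n div m) z * wd n)" by (simp only: mult_ac)
   then show "?c n * (real (n div m) powr (- 1 / \<alpha>) * T (n div m) z) = T (n div m) z * wd n"
    by (simp only: e mult_1_left)
  qed
  finally have law: "distr Q borel (%x. ?c n * Y (n div m) x) = distr M borel (%z. T (n div m) z * wd n)" .
  show ?thesis
   unfolding blk_eq_path_fun expectation_iid_PiM[OF blocks_iid(1) blocks_iid(2) m fm] unfolding law[symmetric]
   by (rule integral_PiM_distr[OF Y(1) _ fm]) measurable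
 qed
 have lim: "(%n. \<integral>x. ?F (\<lambda>i\<in>{..<m}. ?c n * Y (n div m) (x i)) \<partial>?P)
  ----> (\<integral>x. ?F (\<lambda>i\<in>{..<m}. ?c' * Y' (x i)) \<partial>?P)"
 proof (rule integral_dominated_convergence[where w="%_. 1"])
  have q: "filterlim (%n. n div m) at_top sequentially" using m by (rule filterlim_div_nat)
  have c: "?c ----> ?c'"
  proof -
   have "(%n. real (n div m) / real n) ----> 1 / real m" using m by (rule div_nat_ratio_LIMSEQ)
   then have "(%n. (real (n div m) / real n) powr (1 / \<alpha>)) ----> (1 / real m) powr (1 / \<alpha>)"
    using m by (intro tendsto_powr tendsto_const) auto
   moreover have "(real k / real n) powr (1 / \<alpha>) = real k powr (1 / \<alpha>) * wd n" for k n
    by (simp add: powr_divide powr_minus_divide)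
   moreover have "(1 / real m) powr (1 / \<alpha>) = ?c'" by (simp add: powr_divide powr_minus_divide)
   ultimately show ?thesis by simp
  qed
  have "(%n. path_fun \<beta> R e m (\<lambda>i\<in>{..<m}. ?c n * Y (n div m) (x i))) ----> path_fun \<beta> R e m (\<lambda>i\<in>{..<m}. ?c' * Y' (x i))"
   if x: "x \<in> space (?P)" for x
  proof (rule path_fun_LIMSEQ[OF \<beta> R e m])
   fix i assume i: "i < m"
   then have "x i \<in> space Q" using x by (auto simp: space_PiM)
   then have "(%n. ?c n * Y (n div m) (x i)) ----> ?c' * Y' (x i)"
    by (intro tendsto_mult c filterlim_compose[OF Y(6) q])
   then show "(%n. (\<lambda>i\<in>{..<m}. ?c n * Y (n div m) (x i)) i) ----> (\<lambda>i\<in>{..<m}. ?c' * Y' (x i)) i" using i by simp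
  qed
  then show "AE x in ?P. (%n. ?F (\<lambda>i\<in>{..<m}. ?c n * Y (n div m) (x i))) ----> ?F (\<lambda>i\<in>{..<m}. ?c' * Y' (x i))"
   by (intro AE_I2 tendsto_intros)
  have pm: "(%x. ?F (\<lambda>i\<in>{..<m}. g (x i))) \<in> borel_measurable (?P)"
   if [measurable]: "g \<in> borel_measurable Q" for g
   by (rule measurable_compose[OF _ fm]) measurable
  show "(%x. ?F (\<lambda>i\<in>{..<m}. ?c' * Y' (x i))) \<in> borel_measurable (?P)"
   by (rule pm[of "%x. ?c' * Y' x"]) measurable
  show "(%x. ?F (\<lambda>i\<in>{..<m}. ?c n * Y (n div m) (x i))) \<in> borel_measurable (?P)" for n
   by (rule pm[of "%x. ?c n * Y (n div m) x"]) measurable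
 qed auto
 have "(\<integral>x. ?F (\<lambda>i\<in>{..<m}. ?c' * Y' (x i)) \<partial>?P)
  = (\<integral>y. ?F y \<partial>PiM {..<m} (%_. distr Q borel (%x. ?c' * Y' x)))"
  by (rule integral_PiM_distr[symmetric, OF Y(1) _ fm]) measurable
 also have "distr Q borel (%x. ?c' * Y' x) = distr \<mu> borel (%x. ?c' * x)"
  unfolding Y(5)[symmetric] by (subst distr_distr) (auto simp: o_def)
 finally have lim_eq: "(\<integral>x. ?F (\<lambda>i\<in>{..<m}. ?c' * Y' (x i)) \<partial>?P)
  = (\<integral>y. ?F y \<partial>PiM {..<m} (%_. distr \<mu> borel (%x. ?c' * x)))" .
 show ?thesis
  by (rule Lim_transform_eventually[OF lim[unfolded lim_eq] eventually_mono[OF eventually_ge_at_top[of m] eq[symmetric]]])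
qed

end

lemma norm_iexp_diff: "norm (iexp x - iexp y) <= \<bar>x - y\<bar>"
proof -
 have "iexp x - iexp y = iexp y * (iexp (x - y) - 1)"
  by (simp add: right_diff_distrib exp_add[symmetric] algebra_simps flip: exp_add)
 then have "norm (iexp x - iexp y) = norm (iexp (x - y) - 1)" by (simp add: norm_mult)
 also have "... <= \<bar>x - y\<bar>" using iexp_approx1[of "x - y" 0] by simp
 finally show ?thesis .
qed

lemma pow_int_profile_bounds:
 assumes \<beta>: "0 < \<beta>" "\<beta> < 1" and R: "0 <= R" and e: "0 < e" and n: "1 <= n"
 shows "0 <= pow_int \<beta> R (profile e n u)" "pow_int \<beta> R (profile e n u) <= 2 * R + 1"
proof -
 note nn = profile_nonneg[OF less_imp_le[OF e]]
 have c: "set_integrable lborel {-R..R} (%x. 1 :: real)" "(LBINT x:{-R..R}. 1 :: real) = 2 * R"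
  using borel_integrable_atLeastAtMost'[OF continuous_on_const, of "-R" R "1::real"] R by (simp_all add: set_lebesgue_integral_def)
 show "0 <= pow_int \<beta> R (profile e n u)"
  unfolding pow_int_def set_lebesgue_integral_def by (intro integral_nonneg) auto
 have "pow_int \<beta> R (profile e n u) <= (LBINT x:{-R..R}. 1 + profile e n u x)"
  unfolding pow_int_def
 proof (intro set_integral_mono set_integral_add c profile_set_integrable e)
  show "set_integrable lborel {-R..R} (%x. profile e n u x powr \<beta>)"
   by (rule pow_int_integrable[OF \<beta> profile_measurable nn profile_set_integrable[OF e]])
  show "profile e n u x powr \<beta> <= 1 + profile e n u x" for x
   using powr_diff_le[of "profile e n u x" 0 \<beta> 1] nn[of n u x] \<beta> by simp
 qed
 also have "... = 2 * R + (LBINT x:{-R..R}. profile e n u x)"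
  by (simp add: set_integral_add[OF c(1) profile_set_integrable[OF e]] c(2))
 also have "(LBINT x:{-R..R}. profile e n u x) <= (LBINT x. profile e n u x)"
  by (intro set_integral_le_integral profile_integrable e nn)
 also have "... = 1" using e n by (rule profile_integral)
 finally show "pow_int \<beta> R (profile e n u) <= 2 * R + 1" by simp
qed

context prob_space
begin

lemma iexp_integrable: "f \<in> borel_measurable M ==> integrable M (%w. iexp (t * f w))"
 by (rule integrable_const_bound[where B=1]) auto

lemma norm_expectation_iexp_diff:
 assumes [measurable]: "f \<in> borel_measurable M" "g \<in> borel_measurable M"
 shows "norm (expectation (%w. iexp (t * f w)) - expectation (%w. iexp (t * g w))) <= 2 * \<P>(w in M. f w ~= g w)"
  and "integrable M (%w. \<bar>f w - g w\<bar>) ==>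
   norm (expectation (%w. iexp (t * f w)) - expectation (%w. iexp (t * g w))) <= \<bar>t\<bar> * expectation (%w. \<bar>f w - g w\<bar>)"
proof -
 let ?d = "expectation (%w. iexp (t * f w)) - expectation (%w. iexp (t * g w))"
 have eq: "?d = expectation (%w. iexp (t * f w) - iexp (t * g w))"
  by (intro integral_diff[symmetric] iexp_integrable) measurable
 have b: "norm ?d <= expectation h"
  if "integrable M h" "!!w. w \<in> space M ==> norm (iexp (t * f w) - iexp (t * g w)) <= h w" for h
  unfolding eq
 proof (rule order_trans[OF integral_norm_bound integral_mono[OF integrable_norm that]])
  show "integrable M (%w. iexp (t * f w) - iexp (t * g w))"
   by (intro integrable_diff iexp_integrable) measurable
 qed
 have "norm ?d <= expectation (%w. 2 * indicator {w \<in> space M. f w ~= g w} w)"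
 proof (rule b)
  fix w assume "w \<in> space M"
  have "norm (iexp (t * f w) - iexp (t * g w)) <= norm (iexp (t * f w)) + norm (iexp (t * g w))" by (rule norm_triangle_ineq4)
  also have "... = 2" by (simp only: norm_exp_i_times one_add_one)
  finally show "norm (iexp (t * f w) - iexp (t * g w)) <= 2 * indicator {w \<in> space M. f w ~= g w} w"
   using \<open>w \<in> space M\<close> by (cases "f w = g w") auto
 qed (intro integrable_mult_right integrable_real_indicator, auto simp: less_top[symmetric])
 then show "norm ?d <= 2 * \<P>(w in M. f w ~= g w)" by simp
 assume i: "integrable M (%w. \<bar>f w - g w\<bar>)"
 have "norm ?d <= expectation (%w. \<bar>t\<bar> * \<bar>f w - g w\<bar>)"
 proof (rule b)
  show "norm (iexp (t * f w) - iexp (t * g w)) <= \<bar>t\<bar> * \<bar>f w - g w\<bar>" for w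
   using norm_iexp_diff[of "t * f w" "t * g w"] by (simp add: right_diff_distrib[symmetric] abs_mult)
 qed (intro integrable_mult_right i)
 then show "norm ?d <= \<bar>t\<bar> * expectation (%w. \<bar>f w - g w\<bar>)" by simp
qed

lemma expectation_iexp_LIMSEQ:
 assumes [measurable]: "!!n. f n \<in> borel_measurable M" "g \<in> borel_measurable M"
  and lim: "AE x in M. (%n. f n x) ----> g x"
 shows "(%n. expectation (%x. iexp (t * f n x))) ----> expectation (%x. iexp (t * g x))"
proof (rule integral_dominated_convergence[where w="%_. 1"])
 show "AE x in M. (%n. iexp (t * f n x)) ----> iexp (t * g x)"
  using lim by eventually_elim (intro tendsto_intros)
qed auto

end

section \<open>The limit variable and its approximations\<close>

locale stable_walk_limit = stable_walk +
 fixes N :: "'b measure" and U :: "real => 'b => real" and L :: "real => real => 'b => real" and \<beta> :: real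
 assumes levy: "levy_process N U" and U1: "distr N borel (U 1) = \<mu>" and local_time: "continuous_local_time N U L"
  and \<beta>: "0 < \<beta>" "\<beta> < 1"
begin

text \<open>The \<beta>-th power of the norm of the local time: \<open>local_time_norm\<close> is
  W^(1 / \<beta>).\<close>

definition W :: "'b => real" where
 "W w = (LBINT x. L 1 x w powr \<beta>)"

sublocale limit: prob_space "completion N"
 using levy by (intro prob_space.prob_space_completion) (simp add: levy_process_def)

lemma occupation: "AE w in completion N. occupation_density (%t. U t w) (%x. L 1 x w)"
proof (rule AE_completion)
 have "AE w in N. cadlag (%t. U t w)" using levy by (simp add: levy_process_def)
 then show "AE w in N. occupation_density (%t. U t w) (%x. L 1 x w)"
  using local_time[unfolded continuous_local_time_def, THEN conjunct2]
 proof eventually_elim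
  case (elim w)
  show ?case
  proof
   show "((%t. U t w) ---> U s w) (at_right s)" if "0 <= s" for s using elim(1) that unfolding cadlag_def by blast
   have c: "continuous_on ({0..} \<times> UNIV) (%(t, x). L t x w)" using elim(2) by blast
   have "continuous_on UNIV (%x. (%(t, x). L t x w) (1 :: real, x :: real))"
    by (rule continuous_on_compose2[OF c]) (auto intro: continuous_intros)
   then show "continuous_on UNIV (%x. L 1 x w)" by simp
   show "0 <= L 1 x w" for x using elim(2) by simp
   show "compact (closure {x. L 1 x w ~= 0})" using elim(2) by simp
   show "emeasure lborel {s \<in> {0..1}. U s w \<in> A} = (\<integral>\<^sup>+x\<in>A. ennreal (L 1 x w) \<partial>lborel)" if "A \<in> sets borel" for A
    using elim(2) that by simp
  qed
 qed
qed

lemma W_pos: "AE w in completion N. 0 < W w"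
 using occupation by eventually_elim (simp add: W_def occupation_density.pow_int_total(2)[OF _ \<beta>(1)])

text \<open>Successive approximations of \<open>W\<close>: \<open>H\<close> samples the path at m
  times, \<open>A\<close> is its limit as m grows, \<open>I\<close> the limit as the width
  \<open>e\<close> shrinks, and \<open>W\<close> appears as the window grows. Measurability is
  inherited along this chain, starting from \<open>H\<close>, which involves finitely many values of
  \<open>U\<close>.\<close>

abbreviation "H R e m w \<equiv> pow_int \<beta> R (profile e m (%j. U (real j / real m) w))"
abbreviation "A R e w \<equiv> pow_int \<beta> R (occupation_density.avg (%x. L 1 x w) e)"
abbreviation "I R w \<equiv> pow_int \<beta> R (%x. L 1 x w)"

lemma H_measurable[measurable]: "H R e m \<in> borel_measurable (completion N)"
 using levy_process_profile_measurable[OF levy] by (rule measurable_completion)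

lemma H_LIMSEQ: "0 < e ==> AE w in completion N. (%m. H R e (Suc m) w) ----> A R e w"
 using occupation by eventually_elim (rule occupation_density.pow_int_profile_LIMSEQ[OF _ \<beta>(1)])

lemma A_measurable: "0 < e ==> A R e \<in> borel_measurable (completion N)"
 by (rule AE_LIMSEQ_completion_measurable[OF _ H_LIMSEQ]) measurable

lemma A_LIMSEQ: "AE w in completion N. (%k. A R (1 / real (Suc k)) w) ----> I R w"
 using occupation
proof eventually_elim
 case (elim w)
 show ?case by (rule occupation_density.pow_int_avg_tendsto[OF elim \<beta>(1) LIMSEQ_Suc[OF lim_1_over_n]]) simp
qed

lemma I_measurable: "I R \<in> borel_measurable (completion N)"
 by (rule AE_LIMSEQ_completion_measurable[OF _ A_LIMSEQ]) (rule A_measurable, simp)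

lemma I_LIMSEQ: "AE w in completion N. (%k. I (real k) w) ----> W w"
 using occupation
proof eventually_elim
 case (elim w)
 have "\<forall>\<^sub>F k in sequentially. I (real k) w = W w"
  using filterlim_iff[THEN iffD1, OF filterlim_real_sequentially, rule_format, OF occupation_density.pow_int_total(1)[OF elim \<beta>(1)]]
  by (simp add: W_def)
 then show ?case by (rule tendsto_eventually)
qed

lemma W_measurable[measurable]: "W \<in> borel_measurable (completion N)"
 by (rule AE_LIMSEQ_completion_measurable[OF _ I_LIMSEQ]) (rule I_measurable)

lemma blk_char_LIMSEQ_limit:
 assumes "0 <= R" "0 < e" "0 < m"
 shows "(%n. expectation (%w. iexp (t * pow_int \<beta> R (blk e m n w)))) ----> limit.expectation (%w. iexp (t * H R e m w))"
proof -
 have m: "(%w. iexp (t * H R e m w)) \<in> borel_measurable N"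
  using levy_process_profile_measurable[OF levy, of \<beta> R e m] by measurable
 show ?thesis
  unfolding integral_completion[OF m] levy_process_path_fun[OF levy U1 stable order.strict_trans[OF zero_less_one \<alpha>(1)] assms(3)]
  by (rule blk_char_LIMSEQ[OF \<beta> assms])
qed

text \<open>The walk side and the limit side meet at finite \<open>m\<close> in
  \<open>blk_char_LIMSEQ_limit\<close>. The parameters are chosen in the order \<open>R\<close>,
  \<open>e\<close>, \<open>m\<close>, each choice serving both sides at once, before n is sent to
  infinity.\<close>

lemma occ_sum_char_LIMSEQ:
 "(%n. expectation (%z. iexp (t * (scaled_occ_sum \<beta> n z))))
  ----> limit.expectation (%z. iexp (t * W z))" (is "?a ----> ?c")
proof (rule LIMSEQ_I)
 fix \<epsilon> :: real assume \<epsilon>: "0 < \<epsilon>"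
 \<comment> \<open>A tolerance for six comparisons: one costs 2 \<eta>, one |t| \<eta>, and four
   cost \<eta> each.\<close>
 define \<eta> where "\<eta> = \<epsilon> / (\<bar>t\<bar> + 6)"
 have \<eta>: "0 < \<eta>" using \<epsilon> by (simp add: \<eta>_def add_pos_nonneg)
 let ?E = "limit.expectation"
 let ?d = "%x y. norm (x - y :: complex) < \<eta>"
 have cI: "\<forall>\<^sub>F k in sequentially. ?d (?E (%z. iexp (t * I (real k) z))) ?c"
  using limit.expectation_iexp_LIMSEQ[OF I_measurable W_measurable I_LIMSEQ, of t] \<eta> by (simp add: tendsto_iff dist_norm)
 have "\<forall>\<^sub>F k in sequentially. \<forall>n\<ge>1. \<P>(z in M. scaled_occ_sum \<beta> n z ~= pow_int \<beta> (real k) (loc n z)) <= \<eta>"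
  by (rule filterlim_iff[THEN iffD1, OF filterlim_real_sequentially, rule_format, OF occ_sum_eq_pow_int[OF \<beta>(1) \<eta>]])
 from eventually_happens'[OF sequentially_bot eventually_conj[OF cI this]] obtain k0 where k0:
  "?d (?E (%z. iexp (t * I (real k0) z))) ?c \<and> (\<forall>n\<ge>1. \<P>(z in M. scaled_occ_sum \<beta> n z ~= pow_int \<beta> (real k0) (loc n z)) <= \<eta>)"
  by blast
 obtain R :: real where R: "0 <= R" and 1: "?d (?E (%z. iexp (t * I R z))) ?c"
  and 2: "!!n. 1 <= n ==> \<P>(z in M. scaled_occ_sum \<beta> n z ~= pow_int \<beta> R (loc n z)) <= \<eta>"
  by (rule that[of "real k0"]) (simp, rule k0[THEN conjunct1], rule k0[THEN conjunct2, rule_format])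
 have cA: "\<forall>\<^sub>F k in sequentially. ?d (?E (%z. iexp (t * A R (1 / real (Suc k)) z))) (?E (%z. iexp (t * I R z)))"
  using limit.expectation_iexp_LIMSEQ[OF A_measurable I_measurable A_LIMSEQ, of t R] \<eta> by (simp add: tendsto_iff dist_norm)
 have "\<forall>\<^sub>F k in sequentially. \<forall>\<^sub>F m in sequentially. \<forall>\<^sub>F n in sequentially.
  expectation (%z. \<bar>pow_int \<beta> R (loc n z) - pow_int \<beta> R (blk (1 / real (Suc k)) m n z)\<bar>) < \<eta>"
 proof (rule filterlim_iff[THEN iffD1, rule_format, OF _ pow_int_approx[OF \<beta> R \<eta>]])
  show "filterlim (%k. 1 / real (Suc k)) (at_right 0) sequentially"
   by (rule tendsto_imp_filterlim_at_right[OF LIMSEQ_Suc[OF lim_1_over_n]]) simp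
 qed
 from eventually_happens'[OF sequentially_bot eventually_conj[OF cA this]] obtain k1 where k1:
  "?d (?E (%z. iexp (t * A R (1 / real (Suc k1)) z))) (?E (%z. iexp (t * I R z))) \<and> (\<forall>\<^sub>F m in sequentially. \<forall>\<^sub>F n in sequentially.
   expectation (%z. \<bar>pow_int \<beta> R (loc n z) - pow_int \<beta> R (blk (1 / real (Suc k1)) m n z)\<bar>) < \<eta>)"
  by blast
 obtain e :: real where e: "0 < e" and 3: "?d (?E (%z. iexp (t * A R e z))) (?E (%z. iexp (t * I R z)))"
  and 4: "\<forall>\<^sub>F m in sequentially. \<forall>\<^sub>F n in sequentially. expectation (%z. \<bar>pow_int \<beta> R (loc n z) - pow_int \<beta> R (blk e m n z)\<bar>) < \<eta>"
  by (rule that[of "1 / real (Suc k1)"]) (simp, rule k1[THEN conjunct1], rule k1[THEN conjunct2])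
 have cH: "\<forall>\<^sub>F m in sequentially. ?d (?E (%z. iexp (t * H R e (Suc m) z))) (?E (%z. iexp (t * A R e z)))"
  using limit.expectation_iexp_LIMSEQ[OF H_measurable A_measurable[OF e] H_LIMSEQ[OF e], of t R] \<eta> by (simp add: tendsto_iff dist_norm)
 from 4 have "\<forall>\<^sub>F m in sequentially. \<forall>\<^sub>F n in sequentially. expectation (%z. \<bar>pow_int \<beta> R (loc n z) - pow_int \<beta> R (blk e (Suc m) n z)\<bar>) < \<eta>"
  by (rule eventually_sequentially_Suc[THEN iffD2])
 from eventually_happens'[OF sequentially_bot eventually_conj[OF cH this]]
 obtain m where m: "0 < m" and 5: "?d (?E (%z. iexp (t * H R e m z))) (?E (%z. iexp (t * A R e z)))"
  and 6: "\<forall>\<^sub>F n in sequentially. expectation (%z. \<bar>pow_int \<beta> R (loc n z) - pow_int \<beta> R (blk e m n z)\<bar>) < \<eta>"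
  by blast
 have "\<forall>\<^sub>F n in sequentially. ?d (expectation (%z. iexp (t * pow_int \<beta> R (blk e m n z)))) (?E (%z. iexp (t * H R e m z)))"
  using blk_char_LIMSEQ_limit[OF R e m, of t] \<eta> by (simp add: tendsto_iff dist_norm)
 with 6 eventually_ge_at_top[of 1] have "\<forall>\<^sub>F n in sequentially. norm (?a n - ?c) < \<epsilon>"
 proof eventually_elim
  case (elim n)
  let ?x = "expectation (%z. iexp (t * pow_int \<beta> R (loc n z)))" and ?y = "expectation (%z. iexp (t * pow_int \<beta> R (blk e m n z)))"
  have "norm (?a n - ?x) <= 2 * \<P>(z in M. scaled_occ_sum \<beta> n z ~= pow_int \<beta> R (loc n z))"
   by (rule norm_expectation_iexp_diff(1)) measurable
  then have d1: "norm (?a n - ?x) <= 2 * \<eta>" using 2[OF elim(2)] by linarith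
  have w: "0 < wd n" and m1: "1 <= m" using elim(2) m by auto
  have "norm (?x - ?y) <= \<bar>t\<bar> * expectation (%z. \<bar>pow_int \<beta> R (loc n z) - pow_int \<beta> R (blk e m n z)\<bar>)"
  proof (rule norm_expectation_iexp_diff(2))
   have b: "\<bar>pow_int \<beta> R (loc n z) - pow_int \<beta> R (blk e m n z)\<bar> <= 2 * R + 1" for z
    using pow_int_profile_bounds[OF \<beta> R w elim(2), of "%k. T k z * wd n"]
     pow_int_profile_bounds[OF \<beta> R e m1, of "%j. T (j * (n div m)) z * wd n"] by linarith
   show "integrable M (%z. \<bar>pow_int \<beta> R (loc n z) - pow_int \<beta> R (blk e m n z)\<bar>)"
    by (rule integrable_const_bound[where B="2 * R + 1"]) (use b in auto)
  qed measurable
  also have "... <= \<bar>t\<bar> * \<eta>" using elim(1) by (intro mult_left_mono) auto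
  finally have d2: "norm (?x - ?y) <= \<bar>t\<bar> * \<eta>" .
  have tri: "norm (p0 - p6) <= norm (p0 - p1) + norm (p1 - p2) + norm (p2 - p3) + norm (p3 - p4) + norm (p4 - p5) + norm (p5 - p6)" for p0 p1 p2 p3 p4 p5 p6 :: complex
   using norm_triangle_ineq[of "p0 - p1" "p1 - p6"] norm_triangle_ineq[of "p1 - p2" "p2 - p6"] norm_triangle_ineq[of "p2 - p3" "p3 - p6"]
    norm_triangle_ineq[of "p3 - p4" "p4 - p6"] norm_triangle_ineq[of "p4 - p5" "p5 - p6"] by simp
  have "norm (?a n - ?c) < 2 * \<eta> + \<bar>t\<bar> * \<eta> + \<eta> + \<eta> + \<eta> + \<eta>"
   by (rule le_less_trans[OF tri[of _ _ ?x ?y "?E (%z. iexp (t * H R e m z))" "?E (%z. iexp (t * A R e z))" "?E (%z. iexp (t * I R z))"]])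
    (intro add_le_less_mono[OF _ 1] add_mono d1 d2 less_imp_le[OF elim(3)] less_imp_le[OF 5] less_imp_le[OF 3])
  also have "... = (\<bar>t\<bar> + 6) * \<eta>" by (simp add: algebra_simps)
  also have "... = \<epsilon>" by (simp add: \<eta>_def add_nonneg_eq_0_iff)
  finally show ?case .
 qed
 then show "\<exists>no. \<forall>n\<ge>no. norm (?a n - ?c) < \<epsilon>" by (simp add: eventually_sequentially)
qed

lemma occ_sum_weak_conv:
 "weak_conv_m (%n. distr M borel (%w. scaled_occ_sum \<beta> n w)) (distr (completion N) borel W)"
proof (rule levy_continuity)
 show "real_distribution (distr M borel (%w. scaled_occ_sum \<beta> n w))" for n
  by (rule real_distribution_distr) measurable
 show "real_distribution (distr (completion N) borel W)" by (rule limit.real_distribution_distr) measurable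
 show "(%n. char (distr M borel (%w. scaled_occ_sum \<beta> n w)) t) ----> char (distr (completion N) borel W) t" for t
  using occ_sum_char_LIMSEQ[of t] unfolding char_def by (simp add: integral_distr)
qed

end

section \<open>Averaging over the scenery\<close>

lemma sum_path_eq_occ:
 fixes f :: "int => real"
 shows "(\<Sum>k=1..n. f (s k)) = (\<Sum>y\<in>s ` {1..n}. real (occ s n y) * f y)"
proof -
 have "(\<Sum>k=1..n. f (s k)) = (\<Sum>y\<in>s ` {1..n}. \<Sum>k\<in>{k \<in> {1..n}. s k = y}. f (s k))" by (rule sum.image_gen) simp
 also have "... = (\<Sum>y\<in>s ` {1..n}. real (occ s n y) * f y)"
  unfolding occ_def by (intro sum.cong refl) simp
 finally show ?thesis .
qed

lemma occ_sum_eq_sites: "occ_sum \<beta> s n = (\<Sum>y\<in>s ` {1..n}. real (occ s n y) powr \<beta>)"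
 unfolding occ_sum_def
proof (subst sum_path_eq_occ, intro sum.cong refl)
 fix y assume "y \<in> s ` {1..n}"
 then obtain k where "k \<in> {1..n}" "y = s k" by blast
 then have "0 < real (occ s n y)" using occ_pos[of k n s] by simp
 then show "real (occ s n y) * real (occ s n y) powr (\<beta> - 1) = real (occ s n y) powr \<beta>" by (simp add: powr_diff)
qed

context prob_space
begin

text \<open>Collecting times by sites gives a sum of independent terms, the scenery at y weighted by
  its number N of visits. The exponent is homogeneous: N^\<beta> factors out of |N t|^\<beta>, while
  N t has the sign of t.\<close>

lemma path_scenery_char:
 assumes iid: "iid_on M borel \<xi> UNIV" and char: "!!u. char (distr M borel (\<xi> 0)) u = scenery_char \<beta> A1 A2 u"
 shows "expectation (%w. iexp (t * (\<Sum>k=1..n. \<xi> (s k) w)))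
  = exp (- (complex_of_real (\<bar>t\<bar> powr \<beta>) * (complex_of_real A1 + \<i> * complex_of_real (A2 * sgn t)) * complex_of_real (occ_sum \<beta> s n)))"
proof -
 let ?Y = "s ` {1..n}" and ?c = "complex_of_real A1 + \<i> * complex_of_real (A2 * sgn t)"
 have ind: "indep_vars (%_. borel) \<xi> UNIV" and law: "distr M borel (\<xi> y) = distr M borel (\<xi> 0)" for y
  using iid unfolding iid_on_def by blast+
 have m[measurable]: "\<xi> y \<in> borel_measurable M" for y using ind unfolding indep_vars_def by auto
 have rd: "real_distribution (distr M borel (\<xi> y))" for y by (rule real_distribution_distr) measurable
 have "indep_vars (%_. borel) (%y w. real (occ s n y) * \<xi> y w) ?Y"
  by (rule indep_vars_compose2[OF indep_vars_subset[OF ind]]) auto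
 then have "char (distr M borel (%w. \<Sum>y\<in>?Y. real (occ s n y) * \<xi> y w)) t = (\<Prod>y\<in>?Y. char (distr M borel (%w. real (occ s n y) * \<xi> y w)) t)"
  by (rule char_distr_sum)
 also have "... = (\<Prod>y\<in>?Y. exp (- (complex_of_real (\<bar>t\<bar> powr \<beta>) * ?c * complex_of_real (real (occ s n y) powr \<beta>))))"
 proof (intro prod.cong refl)
  fix y assume "y \<in> ?Y"
  then obtain k where "k \<in> {1..n}" "y = s k" by blast
  then have o: "0 < real (occ s n y)" using occ_pos[of k n s] by simp
  have "distr M borel (%w. real (occ s n y) * \<xi> y w) = distr (distr M borel (\<xi> y)) borel (%x. real (occ s n y) * x)"
   by (subst distr_distr) (auto simp: o_def)
  then have "char (distr M borel (%w. real (occ s n y) * \<xi> y w)) t = scenery_char \<beta> A1 A2 (real (occ s n y) * t)"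
   by (simp only: char_scale[OF rd] law[of y] char)
  also have "... = exp (- (complex_of_real (\<bar>t\<bar> powr \<beta>) * ?c * complex_of_real (real (occ s n y) powr \<beta>)))"
  proof -
   have "\<bar>real (occ s n y) * t\<bar> powr \<beta> = \<bar>t\<bar> powr \<beta> * real (occ s n y) powr \<beta>" "sgn (real (occ s n y) * t) = sgn t"
    by (simp_all only: abs_mult abs_of_pos[OF o] powr_mult sgn_mult sgn_pos[OF o] mult_1_left mult.commute)
   then show ?thesis unfolding scenery_char_def by (simp only: of_real_mult mult_ac)
  qed
  finally show "char (distr M borel (%w. real (occ s n y) * \<xi> y w)) t = exp (- (complex_of_real (\<bar>t\<bar> powr \<beta>) * ?c * complex_of_real (real (occ s n y) powr \<beta>)))" .
 qed
 also have "... = exp (- (complex_of_real (\<bar>t\<bar> powr \<beta>) * ?c * complex_of_real (occ_sum \<beta> s n)))"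
  unfolding occ_sum_eq_sites by (simp add: exp_sum[symmetric] sum_negf sum_distrib_left)
 finally have f: "char (distr M borel (%w. \<Sum>y\<in>?Y. real (occ s n y) * \<xi> y w)) t
  = exp (- (complex_of_real (\<bar>t\<bar> powr \<beta>) * ?c * complex_of_real (occ_sum \<beta> s n)))" .
 have e: "(\<Sum>k=1..n. \<xi> (s k) w) = (\<Sum>y\<in>?Y. real (occ s n y) * \<xi> y w)" for w by (rule sum_path_eq_occ)
 show ?thesis unfolding e f[symmetric] char_def by (rule integral_distr[symmetric]) measurable
qed

lemma indep_set_expectation_mult:
 fixes f g :: "'a => complex"
 assumes ind: "indep_set (sigma_sets (space M) A) (sigma_sets (space M) B)"
  and AB: "A \<subseteq> Pow (space M)" "B \<subseteq> Pow (space M)"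
  and f: "f \<in> borel_measurable (sigma (space M) A)" and g: "g \<in> borel_measurable (sigma (space M) B)"
  and fi: "integrable M f" and gi: "integrable M g"
 shows "expectation (%w. f w * g w) = expectation f * expectation g"
proof (rule indep_var_lebesgue_integral[OF _ fi gi])
 have s: "sigma_sets (space M) {h -` C \<inter> space M |C. C \<in> sets borel} \<subseteq> sigma_sets (space M) D"
  if D: "D \<subseteq> Pow (space M)" and h: "h \<in> borel_measurable (sigma (space M) D)" for h :: "'a => complex" and D
 proof (rule sigma_sets_mono, safe)
  fix C :: "complex set" assume "C \<in> sets borel"
  from measurable_sets[OF h this] show "h -` C \<inter> space M \<in> sigma_sets (space M) D" using D by simp
 qed
 have "indep_set (sigma_sets (space M) {f -` C \<inter> space M |C. C \<in> sets borel}) (sigma_sets (space M) {g -` C \<inter> space M |C. C \<in> sets borel})"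
  using ind unfolding indep_set_def
  by (rule indep_sets_mono_sets) (use s[OF AB(1) f] s[OF AB(2) g] in \<open>auto split: bool.splits\<close>)
 then show "indep_var borel f borel g"
  unfolding indep_var_eq using borel_measurable_integrable[OF fi] borel_measurable_integrable[OF gi] by simp
qed

end

context stable_walk
begin

text \<open>Conditioning on the walk is carried out by summing over its first \<open>n\<close>
  positions: on the event that these follow a given path \<open>s\<close>, the scenery sum is the
  one of \<open>path_scenery_char\<close> and is independent of the event. Restricting to paths in a
  box makes the sum finite; then the box grows under dominated convergence.\<close>

lemma rwrs_char:
 assumes iid\<xi>: "iid_on M borel \<xi> UNIV" and ind: "walk_indep_of_scenery M X \<xi>"
  and char: "!!u. char (distr M borel (\<xi> 0)) u = scenery_char \<beta> A1 A2 u" and A1: "0 <= A1"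
 shows "char (distr M borel (rwrs X \<xi> n)) t = expectation (%v.
   exp (- (complex_of_real (\<bar>t\<bar> powr \<beta>) * (complex_of_real A1 + \<i> * complex_of_real (A2 * sgn t)) * complex_of_real (occ_sum \<beta> (%k. S k v) n))))"
  and "rwrs X \<xi> n \<in> borel_measurable M"
proof -
 let ?A = "{X k -` B \<inter> space M | k B. 1 <= k}" and ?B = "{\<xi> y -` B \<inter> space M | y B. B \<in> sets borel}"
 let ?SA = "sigma (space M) ?A" and ?SB = "sigma (space M) ?B"
 have AB: "?A \<subseteq> Pow (space M)" "?B \<subseteq> Pow (space M)" by auto
 have indep: "indep_set (sigma_sets (space M) ?A) (sigma_sets (space M) ?B)"
  using ind unfolding walk_indep_of_scenery_def .
 have mX: "X k \<in> measurable ?SA (count_space UNIV)" if "1 <= k" for k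
  by (rule measurableI) (use that AB(1) in \<open>auto intro!: sigma_sets.Basic\<close>)
 have mS[measurable]: "S k \<in> measurable ?SA (count_space UNIV)" for k
 proof (induction k)
  case (Suc k)
  have e: "S (Suc k) = (%v. S k v + X (Suc k) v)" by (auto simp: random_walk_def)
  show ?case unfolding e by (rule add_int_measurable[OF Suc mX]) simp
 qed (simp add: random_walk_def)
 have m\<xi>B[measurable]: "\<xi> y \<in> borel_measurable ?SB" for y
  by (rule measurableI) (use AB(2) in \<open>auto intro!: sigma_sets.Basic\<close>)
 have m\<xi>[measurable]: "\<xi> y \<in> borel_measurable M" for y
  using iid\<xi> unfolding iid_on_def indep_vars_def by auto
 have rw: "rwrs X \<xi> n v = (\<Sum>k=1..n. \<xi> (S k v) v)" for v by (simp add: rwrs_def)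
 show m[measurable]: "rwrs X \<xi> n \<in> borel_measurable M"
 proof -
  have "(%v. \<xi> (S k v) v) \<in> borel_measurable M" for k
   by (rule measurable_compose_countable[of \<xi> M borel "S k"]) (rule m\<xi>, rule S_measurable)
  then have "(%v. \<Sum>k=1..n. \<xi> (S k v) v) \<in> borel_measurable M" by (rule borel_measurable_sum)
  then show ?thesis by (simp only: rw[symmetric])
 qed
 let ?V = "%s. exp (- (complex_of_real (\<bar>t\<bar> powr \<beta>) * (complex_of_real A1 + \<i> * complex_of_real (A2 * sgn t)) * complex_of_real (occ_sum \<beta> s n)))"
 have nV: "norm (?V s) <= 1" for s
 proof -
  have "0 <= occ_sum \<beta> s n" unfolding occ_sum_def by (intro sum_nonneg) auto
  then show ?thesis using A1 by simp
 qed
 have mV[measurable]: "(%v. ?V (%k. S k v)) \<in> borel_measurable M" by measurable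
 \<comment> \<open>The difference of the two integrands. Its expectation over each path event is 0,
   which is what gets summed.\<close>
 let ?g = "%v. iexp (t * rwrs X \<xi> n v) - ?V (%k. S k v)"
 have gi: "integrable M ?g"
  by (intro integrable_diff iexp_integrable m integrable_const_bound[where B=1]) (use nV in auto)
 have ng: "norm (?g v) <= 2" for v
 proof -
  have "norm (?g v) <= norm (iexp (t * rwrs X \<xi> n v)) + norm (?V (%k. S k v))" by (rule norm_triangle_ineq4)
  also have "... <= 1 + 1" by (intro add_mono nV) (simp only: norm_exp_i_times)
  finally show ?thesis by simp
 qed
 let ?P = "%s v. of_bool (\<forall>k\<in>{1..n}. S k v = s k) :: complex"
 have tm: "integrable M (%v. ?P s v * ?g v)" "expectation (%v. ?P s v * ?g v) = 0" for s
 proof -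
  let ?Z = "%v. iexp (t * (\<Sum>k=1..n. \<xi> (s k) v))"
  have eq: "?P s v * ?g v = ?P s v * ?Z v - ?V s * ?P s v" for v
  proof (cases "\<forall>k\<in>{1..n}. S k v = s k")
   case True
   then have c: "S k v = s k" if "k \<in> {1..n}" for k using that by blast
   have "occ (%k. S k v) n y = occ s n y" for y unfolding occ_def using c by (intro arg_cong[of _ _ card]) auto
   then have "occ_sum \<beta> (%k. S k v) n = occ_sum \<beta> s n" unfolding occ_sum_def using c by (intro sum.cong) auto
   moreover have "rwrs X \<xi> n v = (\<Sum>k=1..n. \<xi> (s k) v)" unfolding rw using c by (intro sum.cong) auto
   moreover have "?P s v = 1" by (rule iffD2[OF of_bool_eq_1_iff True])
   ultimately show ?thesis by (simp only: mult_1_left mult_1_right)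
  next
   case False
   then have "?P s v = 0" by (simp only: of_bool_eq_0_iff not_False_eq_True)
   then show ?thesis by (simp only: mult_zero_left mult_zero_right diff_self)
  qed
  have Pm: "?P s \<in> borel_measurable ?SA" by measurable
  have PmM[measurable]: "?P s \<in> borel_measurable M" by measurable
  have Pi: "integrable M (?P s)" by (rule integrable_const_bound[where B=1]) auto
  have Zm: "?Z \<in> borel_measurable ?SB" by measurable
  have Zi: "integrable M ?Z" by (intro iexp_integrable) measurable
  have PZi: "integrable M (%v. ?P s v * ?Z v)"
   by (rule integrable_const_bound[where B=1]) (auto simp: norm_mult)
  show "integrable M (%v. ?P s v * ?g v)" unfolding eq
   by (intro integrable_diff PZi integrable_mult_right Pi)
  have "expectation (%v. ?P s v * ?g v) = expectation (%v. ?P s v * ?Z v) - expectation (%v. ?V s * ?P s v)"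
   unfolding eq by (intro integral_diff PZi integrable_mult_right Pi)
  also have "expectation (%v. ?P s v * ?Z v) = expectation (?P s) * expectation ?Z"
   by (rule indep_set_expectation_mult[OF indep AB Pm Zm Pi Zi])
  also have "expectation ?Z = ?V s" by (rule path_scenery_char[OF iid\<xi> char])
  also have "expectation (%v. ?V s * ?P s v) = ?V s * expectation (?P s)" by (rule integral_mult_right_zero)
  finally show "expectation (%v. ?P s v * ?g v) = 0" by (simp only: mult.commute diff_self)
 qed
 let ?Q = "%K. PiE {1..n} (%_. {- int K..int K})"
 let ?b = "%K v. of_bool (\<forall>k\<in>{1..n}. \<bar>S k v\<bar> <= int K) :: complex"
 have bs: "?b K v * ?g v = (\<Sum>s\<in>?Q K. ?P s v * ?g v)" for K v
 proof -
  let ?r = "restrict (%k. S k v) {1..n}"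
  have ob: "of_bool p * z = (if p then z else 0)" for p and z :: complex by simp
  have fin: "finite (?Q K)" by (intro finite_PiE) auto
  have P: "?P s v = of_bool (s = ?r)" if "s \<in> ?Q K" for s
  proof -
   have "(\<forall>k\<in>{1..n}. S k v = s k) \<longleftrightarrow> s = ?r"
   proof
    assume "\<forall>k\<in>{1..n}. S k v = s k"
    then show "s = ?r" using that by (intro extensionalityI[of s "{1..n}"]) (auto simp: PiE_iff)
   qed auto
   then show ?thesis by (simp only:)
  qed
  have r: "?r \<in> ?Q K \<longleftrightarrow> (\<forall>k\<in>{1..n}. \<bar>S k v\<bar> <= int K)" by (auto simp: PiE_iff abs_le_iff)
  have "(\<Sum>s\<in>?Q K. ?P s v * ?g v) = (\<Sum>s\<in>?Q K. if s = ?r then ?g v else 0)"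
  proof (intro sum.cong refl)
   fix s assume "s \<in> ?Q K"
   then show "?P s v * ?g v = (if s = ?r then ?g v else 0)" by (simp only: P ob)
  qed
  also have "... = (if ?r \<in> ?Q K then ?g v else 0)" using fin by (simp only: sum.delta)
  also have "... = ?b K v * ?g v" unfolding r by (simp only: ob)
  finally show ?thesis ..
 qed
 have zero: "expectation (%v. ?b K v * ?g v) = 0" for K
  unfolding bs by (simp only: integral_sum tm sum.neutral_const)
 have lim: "(%K. expectation (%v. ?b K v * ?g v)) ----> expectation ?g"
 proof (rule integral_dominated_convergence[where w="%_. 2"])
  show "AE v in M. (%K. ?b K v * ?g v) ----> ?g v"
  proof (rule AE_I2, rule tendsto_eventually)
   fix v
   have ev: "\<forall>\<^sub>F K in sequentially. \<forall>k\<in>{1..n}. \<bar>S k v\<bar> <= int K"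
   proof (rule eventually_ball_finite, simp, rule ballI)
    fix k
    show "\<forall>\<^sub>F K in sequentially. \<bar>S k v\<bar> <= int K"
     using eventually_ge_at_top[of "nat \<bar>S k v\<bar>"] by eventually_elim simp
   qed
   then show "\<forall>\<^sub>F K in sequentially. ?b K v * ?g v = ?g v"
   proof eventually_elim
    case (elim K)
    show ?case unfolding iffD2[OF of_bool_eq_1_iff elim] by (rule mult_1_left)
   qed
  qed
  show "AE v in M. norm (?b K v * ?g v) <= 2" for K
  proof (rule AE_I2)
   fix v
   have "norm (?b K v) <= 1" by (simp add: of_bool_def)
   then have "norm (?b K v) * norm (?g v) <= 1 * 2" by (intro mult_mono ng) auto
   then show "norm (?b K v * ?g v) <= 2" by (simp only: norm_mult mult_1_left)
  qed
  show "?g \<in> borel_measurable M" using gi by (rule borel_measurable_integrable)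
  moreover have "Measurable.pred M (%v. \<bar>S k v\<bar> <= int K)" for k K
   by (rule measurable_compose[OF S_measurable[of k], where g="%x. \<bar>x\<bar> <= int K"]) simp
  then have "(?b K :: 'a => complex) \<in> borel_measurable M" for K by measurable
  ultimately show "(%v. ?b K v * ?g v) \<in> borel_measurable M" for K by (intro borel_measurable_times)
 qed simp
 then have "expectation ?g = 0" unfolding zero by (simp add: LIMSEQ_const_iff)
 moreover have "expectation ?g = expectation (%v. iexp (t * rwrs X \<xi> n v)) - expectation (%v. ?V (%k. S k v))"
  by (intro integral_diff iexp_integrable m integrable_const_bound[where B=1]) (use nV in auto)
 moreover have "char (distr M borel (rwrs X \<xi> n)) t = expectation (%v. iexp (t * rwrs X \<xi> n v))"
  unfolding char_def by (subst integral_distr) auto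
 ultimately show "char (distr M borel (rwrs X \<xi> n)) t = expectation (%v. ?V (%k. S k v))" by simp
qed

end

section \<open>Negative moments and Riemann sums of the occupation functional\<close>

context stable_walk_limit
begin

text \<open>This is \<beta> \<delta>, so that \<beta> / \<eta> is 1 / \<delta>.\<close>

definition \<eta> :: real where "\<eta> = \<beta> - \<beta> / \<alpha> + 1 / \<alpha>"

abbreviation V :: "nat => 'a => real" where "V n w \<equiv> occ_sum \<beta> (%k. S k w) n"

lemma \<eta>_eq: "\<eta> = 1 - (1 - \<beta>) * (1 - 1 / \<alpha>)"
 using \<alpha> by (simp add: \<eta>_def field_simps)

text \<open>The last inequality is the decay exponent that makes the Riemann sums converge: \<alpha>
  <= 2 gives 1 - 1 / \<alpha> <= 1 / 2 and hence \<eta> > 1 / 2.\<close>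

lemma \<eta>_bounds: "0 < \<eta>" "\<beta> < \<eta>" "1 < \<eta> * (2 / (1 - \<beta>))"
proof -
 have "\<eta> - \<beta> = (1 - \<beta>) / \<alpha>" using \<alpha> by (simp add: \<eta>_def field_simps)
 moreover have "0 < (1 - \<beta>) / \<alpha>" using \<alpha> \<beta> by simp
 ultimately show 1: "\<beta> < \<eta>" by linarith
 then show "0 < \<eta>" using \<beta> by linarith
 have "1 / 2 <= 1 / \<alpha>" using \<alpha> by (simp add: field_simps)
 then have "(1 - \<beta>) * (1 - 1 / \<alpha>) <= (1 - \<beta>) * (1 / 2)" using \<beta> by (intro mult_left_mono) auto
 then have "1 / 2 < \<eta>" using \<beta> unfolding \<eta>_eq by (simp add: field_simps)
 then have "1 - \<beta> < \<eta> * 2" using \<beta> by linarith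
 then show "1 < \<eta> * (2 / (1 - \<beta>))" using \<beta> by (simp add: field_simps)
qed

lemma V_ge_1: "1 <= n ==> 1 <= V n w"
 using \<beta> by (intro occ_sum_ge_1) auto

lemma V_nonneg: "0 <= V n w"
 unfolding occ_sum_def by (intro sum_nonneg) auto

text \<open>With exponent b = 1 - \<beta>, \<open>sum_powr_neg_bound\<close> trades the moment for
  the sum of the squared occupation numbers along the walk. Its mean is at most 8 n times the
  squared Green function, which is of order n^(2 - 2 / \<alpha>), and the powers of n combine to -
  \<eta> 2 / (1 - \<beta>).\<close>

lemma V_negative_moment:
 obtains C where "1 <= C" "!!n. 1 <= n ==> expectation (%w. V n w powr (- (2 / (1 - \<beta>)))) <= C * real n powr (- (\<eta> * (2 / (1 - \<beta>))))"
proof -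
 obtain C where C: "0 < C" "!!n. 1 <= n ==> (\<Sum>j\<le>n. p j 0) <= C * real n powr (1 - 1 / \<alpha>)"
  using green_bound by blast
 let ?q = "2 / (1 - \<beta>)"
 have "expectation (%w. V n w powr (- ?q)) <= (1 + 8 * C^2) * real n powr (- (\<eta> * ?q))" if n: "1 <= n" for n
 proof -
  let ?Q = "%w. \<Sum>k=1..n. (real (occ (%j. S j w) n (S k w)))^2"
  have Qi: "integrable M ?Q"
  proof (intro integrable_sum integrable_const_bound[where B="(real n)^2"] AE_I2)
   fix k w
   have "real (occ (%j. S j w) n (S k w)) <= real n" using occ_le by simp
   then have "(real (occ (%j. S j w) n (S k w)))^2 <= (real n)^2" by (intro power_mono) auto
   then show "norm ((real (occ (%j. S j w) n (S k w)))^2) <= (real n)^2" by simp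
  qed (unfold occ_eq_sum, measurable)
  have pw: "V n w powr (- ?q) <= real n powr (- ?q - 1) * ?Q w" for w
   using sum_powr_neg_bound[of "{1..n}" "%k. real (occ (%j. S j w) n (S k w))" "1 - \<beta>"] n \<beta> occ_pos[of _ n "%j. S j w"]
   unfolding occ_sum_def by (force simp: Suc_le_eq)
  have "expectation (%w. V n w powr (- ?q)) <= expectation (%w. real n powr (- ?q - 1) * ?Q w)"
  proof (rule integral_mono_AE')
   show "AE w in M. 0 <= real n powr (- ?q - 1) * ?Q w" by (intro AE_I2 mult_nonneg_nonneg sum_nonneg) auto
  qed (intro integrable_mult_right Qi AE_I2 pw)+
  also have "... = real n powr (- ?q - 1) * expectation ?Q" by (rule integral_mult_right_zero)
  also have "... <= real n powr (- ?q - 1) * (8 * real n * (C * real n powr (1 - 1 / \<alpha>))^2)"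
  proof (rule mult_left_mono)
   have "(\<Sum>j\<le>n. p j 0)^2 <= (C * real n powr (1 - 1 / \<alpha>))^2" by (intro power_mono C n sum_nonneg) auto
   then have "8 * real n * (\<Sum>j\<le>n. p j 0)^2 <= 8 * real n * (C * real n powr (1 - 1 / \<alpha>))^2" by (intro mult_left_mono) auto
   then show "expectation ?Q <= 8 * real n * (C * real n powr (1 - 1 / \<alpha>))^2" using expectation_occ_square[of n] by linarith
  qed simp
  also have "... = 8 * C^2 * real n powr (- (\<eta> * ?q))"
  proof -
   have "(real n powr (1 - 1 / \<alpha>))^2 = real n powr (2 * (1 - 1 / \<alpha>))" using n by (simp add: power2_eq_square powr_add[symmetric])
   then have "real n powr (- ?q - 1) * (8 * real n * (C * real n powr (1 - 1 / \<alpha>))^2)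
    = 8 * C^2 * (real n powr (- ?q - 1) * real n powr 1 * real n powr (2 * (1 - 1 / \<alpha>)))"
    using n by (simp add: power_mult_distrib)
   also have "real n powr (- ?q - 1) * real n powr 1 * real n powr (2 * (1 - 1 / \<alpha>)) = real n powr ((- ?q - 1) + 1 + 2 * (1 - 1 / \<alpha>))"
    by (simp only: powr_add)
   also have "(- ?q - 1) + 1 + 2 * (1 - 1 / \<alpha>) = - (\<eta> * ?q)" unfolding \<eta>_eq using \<beta> \<alpha> by (simp add: field_simps)
   finally show ?thesis .
  qed
  also have "... <= (1 + 8 * C^2) * real n powr (- (\<eta> * ?q))" by (intro mult_right_mono) auto
  finally show ?thesis .
 qed
 then show ?thesis by (intro that[of "1 + 8 * C^2"]) auto
qed

text \<open>r^\<eta> times \<open>V n\<close> is (r n)^\<eta> times the normalised functional n^(-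
  \<eta>) \<open>V n\<close>, so a Skorohod coupling of the latter lets both factors converge
  together.\<close>

lemma V_scaled_LIMSEQ:
 fixes f :: "real => 'c::{banach, second_countable_topology}"
 assumes f: "continuous_on UNIV f" and B: "!!v. 0 < v ==> norm (f v) <= B"
  and x: "(%k. r k * real (n k)) ----> x" "0 < x" and r: "!!k. 0 < r k" and n: "filterlim n at_top sequentially"
 shows "(%k. expectation (%u. f (r k powr \<eta> * V (n k) u))) ----> limit.expectation (%u. f (x powr \<eta> * W u))"
proof -
 have fm[measurable]: "f \<in> borel_measurable borel" using f by (rule borel_measurable_continuous_onI)
 let ?X = "%n u. V n u * real n powr (- \<eta>)"
 have "real_distribution (distr M borel (?X n))" for n by (rule real_distribution_distr) measurable
 moreover have "real_distribution (distr (completion N) borel W)" by (rule limit.real_distribution_distr) measurable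
 ultimately obtain Q :: "real measure" and Y Y' where Y: "prob_space Q" "!!n. Y n \<in> borel_measurable Q"
  "!!n. distr Q borel (Y n) = distr M borel (?X n)"
  "Y' \<in> borel_measurable Q" "distr Q borel Y' = distr (completion N) borel W" "!!x. x \<in> space Q ==> (%n. Y n x) ----> Y' x"
  using Skorohod[OF _ _ occ_sum_weak_conv[folded \<eta>_def]] by (metis measurable_lborel1 measurable_lborel2)
 interpret O: prob_space Q by fact
 note [measurable] = Y(2) Y(4)
 have Ynn: "AE x in Q. 0 <= Y n x" for n
 proof -
  have "AE x in distr M borel (?X n). 0 <= x" by (subst AE_distr_iff) (auto simp: V_nonneg)
  then have "AE x in distr Q borel (Y n). 0 <= x" unfolding Y(3) .
  then show ?thesis by (subst (asm) AE_distr_iff) auto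
 qed
 let ?z = "%k. (r k * real (n k)) powr \<eta>"
 have e: "expectation (%u. f (r k powr \<eta> * V (n k) u)) = O.expectation (%y. f (?z k * Y (n k) y))" for k
 proof -
  have "r k powr \<eta> * V (n k) u = ?z k * ?X (n k) u" for u
  proof (cases "n k = 0")
   case False
   then have "real (n k) powr \<eta> * real (n k) powr (- \<eta>) = 1" by (simp add: powr_add[symmetric])
   moreover have "?z k * ?X (n k) u = r k powr \<eta> * V (n k) u * (real (n k) powr \<eta> * real (n k) powr (- \<eta>))"
    by (simp only: powr_mult mult_ac)
   ultimately show ?thesis by (simp only: mult_1_right)
  qed (simp add: occ_sum_def)
  then have "expectation (%u. f (r k powr \<eta> * V (n k) u)) = expectation (%u. f (?z k * ?X (n k) u))"
   by (simp only:)
  also have "... = (\<integral>y. f (?z k * y) \<partial>distr M borel (?X (n k)))"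
   by (rule integral_distr[symmetric]) measurable
  also have "... = O.expectation (%y. f (?z k * Y (n k) y))"
   unfolding Y(3)[symmetric] by (rule integral_distr) measurable
  finally show ?thesis .
 qed
 have e': "limit.expectation (%u. f (x powr \<eta> * W u)) = O.expectation (%y. f (x powr \<eta> * Y' y))"
 proof -
  have "limit.expectation (%u. f (x powr \<eta> * W u)) = (\<integral>y. f (x powr \<eta> * y) \<partial>distr (completion N) borel W)"
   by (rule integral_distr[symmetric]) measurable
  also have "... = O.expectation (%y. f (x powr \<eta> * Y' y))"
   unfolding Y(5)[symmetric] by (rule integral_distr) measurable
  finally show ?thesis .
 qed
 show ?thesis unfolding e e'
 \<comment> \<open>The argument of \<open>f\<close> can be 0, for instance when
   \<open>n k = 0\<close>, and \<open>B\<close> bounds \<open>f\<close> at positive arguments; hence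
   the maximum with the value at 0.\<close>
 proof (rule integral_dominated_convergence[where w="%_. max B (norm (f 0))"])
  show "AE y in Q. (%k. f (?z k * Y (n k) y)) ----> f (x powr \<eta> * Y' y)"
  proof (rule AE_I2)
   fix y assume y: "y \<in> space Q"
   have "(%k. ?z k * Y (n k) y) ----> x powr \<eta> * Y' y"
    by (intro tendsto_mult tendsto_powr x(1) tendsto_const filterlim_compose[OF Y(6)[OF y] n]) (use x(2) in simp)
   then show "(%k. f (?z k * Y (n k) y)) ----> f (x powr \<eta> * Y' y)"
    using f by (intro isCont_tendsto_compose[of _ f]) (auto simp: continuous_on_eq_continuous_at)
  qed
  show "AE y in Q. norm (f (?z k * Y (n k) y)) <= max B (norm (f 0))" for k
   using Ynn[of "n k"]
  proof eventually_elim
   case (elim y)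
   then have "0 <= ?z k * Y (n k) y" by simp
   then consider "0 < ?z k * Y (n k) y" | "?z k * Y (n k) y = 0" by linarith
   then show ?case
   proof cases
    case 1
    from B[OF this] show ?thesis by simp
   next
    case 2
    show ?thesis unfolding 2 by simp
   qed
  qed
 qed auto
qed

text \<open>At scale \<open>r\<close> the n-th term is close to a function of x = r n, so
  \<open>riemann_sum_limit\<close> applies: the negative moment supplies the domination and
  \<open>V_scaled_LIMSEQ\<close> the pointwise limit.\<close>

lemma V_riemann_sum:
 fixes f :: "real => 'c::{banach, second_countable_topology}"
 assumes f: "continuous_on UNIV f" and C: "!!v. 0 < v ==> norm (f v) <= C * min 1 (v powr (- (2 / (1 - \<beta>))))"
 obtains K where "!!r. 0 < r ==> summable (%n. norm (expectation (%w. f (r powr \<eta> * V (Suc n) w))))"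
  "!!r. 0 < r ==> r * (\<Sum>n. norm (expectation (%w. f (r powr \<eta> * V (Suc n) w)))) <= K"
  "set_integrable lborel {0<..} (%x. limit.expectation (%w. f (x powr \<eta> * W w)))"
  "((%r. r *\<^sub>R (\<Sum>n. expectation (%w. f (r powr \<eta> * V (Suc n) w)))) ---> (LBINT x:{0<..}. limit.expectation (%w. f (x powr \<eta> * W w)))) (at_right 0)"
proof -
 have fm[measurable]: "f \<in> borel_measurable borel" using f by (rule borel_measurable_continuous_onI)
 let ?q = "2 / (1 - \<beta>)"
 have C0: "0 <= C" using order_trans[OF norm_ge_zero C[of 1]] by simp
 obtain C' where C': "1 <= C'" "!!n. 1 <= n ==> expectation (%w. V n w powr (- ?q)) <= C' * real n powr (- (\<eta> * ?q))"
  using V_negative_moment by blast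
 have bound: "norm (expectation (%w. f (r powr \<eta> * V n w))) <= C * C' * min 1 ((r * real n) powr (- (\<eta> * ?q)))"
  if r: "0 < r" and n: "1 <= n" for n r
 proof -
  have V0: "0 < V n w" for w using V_ge_1[OF n, of w] by linarith
  let ?m = "%w. C * min 1 ((r powr \<eta> * V n w) powr (- ?q))"
  have le: "norm (f (r powr \<eta> * V n w)) <= ?m w" for w by (rule C) (use r V0 in simp)
  have m0: "0 <= ?m w" for w using C0 by simp
  have mi: "integrable M ?m"
   by (rule integrable_const_bound[where B=C]) (use C0 in \<open>auto simp: abs_mult mult_left_le\<close>)
  have "norm (expectation (%w. f (r powr \<eta> * V n w))) <= expectation (%w. norm (f (r powr \<eta> * V n w)))" by (rule integral_norm_bound)
  also have "... <= expectation ?m" by (rule integral_mono_AE'[OF mi]) (use le m0 in auto)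
  finally have 1: "norm (expectation (%w. f (r powr \<eta> * V n w))) <= expectation ?m" .
  have "expectation ?m <= expectation (%w. C)" by (rule integral_mono[OF mi]) (use C0 in \<open>auto simp: mult_left_le\<close>)
  then have 2: "expectation ?m <= C * 1" by (simp add: prob_space)
  have Vi: "integrable M (%w. V n w powr (- ?q))"
  proof (rule integrable_const_bound[where B=1])
   have "V n w powr (- ?q) <= V n w powr 0" for w using V_ge_1[OF n, of w] \<beta> by (intro powr_mono) auto
   then show "AE w in M. norm (V n w powr (- ?q)) <= 1" using V0 by (intro AE_I2) (simp add: less_imp_neq[symmetric])
  qed measurable
  have "expectation ?m <= expectation (%w. C * (r powr (- (\<eta> * ?q)) * V n w powr (- ?q)))"
  proof (rule integral_mono[OF mi])
   show "integrable M (%w. C * (r powr (- (\<eta> * ?q)) * V n w powr (- ?q)))" by (intro integrable_mult_right Vi)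
   show "?m w <= C * (r powr (- (\<eta> * ?q)) * V n w powr (- ?q))" for w
    using C0 by (intro mult_left_mono) (auto simp: powr_mult powr_powr)
  qed
  also have "... = C * (r powr (- (\<eta> * ?q)) * expectation (%w. V n w powr (- ?q)))" by simp
  also have "... <= C * (r powr (- (\<eta> * ?q)) * (C' * real n powr (- (\<eta> * ?q))))"
   using C0 by (intro mult_left_mono C' n) auto
  also have "... = C * C' * (r * real n) powr (- (\<eta> * ?q))" by (simp add: powr_mult mult_ac)
  finally have 3: "expectation ?m <= C * C' * (r * real n) powr (- (\<eta> * ?q))" .
  have "C * 1 <= C * C'" using C0 C'(1) by (rule mult_left_mono[rotated])
  then have "expectation ?m <= C * C' * 1" using 2 by simp
  with 1 3 show ?thesis by (simp add: min_def)
 qed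
 have lim: "(%k. expectation (%w. f (r k powr \<eta> * V (n k) w))) ----> limit.expectation (%w. f (x powr \<eta> * W w))"
  if "0 < x" "!!k. 0 < r k" "r ----> 0" "(%k. r k * real (n k)) ----> x" "filterlim n at_top sequentially" for n r x
 proof (rule V_scaled_LIMSEQ[OF f _ that(4,1,2,5)])
  show "norm (f v) <= C" if "0 < v" for v
   by (rule order_trans[OF C[OF that]]) (use C0 in \<open>simp add: mult_left_le\<close>)
 qed
 note R = riemann_sum_limit[where A="%n r. expectation (%w. f (r powr \<eta> * V n w))", OF \<eta>_bounds(3) bound lim]
 show ?thesis by (rule that[OF R(1) R(2) R(3) R(4)]) assumption+
qed

text \<open>For \<open>c = Complex A1 (- A2)\<close> and t > 0 this is the characteristic function
  of \<open>rwrs X \<xi> n\<close> at - t, and its conjugate is the value at t.\<close>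

definition psi :: "complex => nat => real => complex" where
 "psi c n t = expectation (%w. exp (- (c * of_real (t powr \<beta> * V n w))))"

lemma psi_measurable[measurable]: "psi c n \<in> borel_measurable borel"
 unfolding psi_def by measurable

text \<open>Put r = t^(\<beta> / \<eta>): then r^\<eta> = t^\<beta>, and the factor 1 / r of the
  Riemann sum becomes the order of the singularity at 0.\<close>

lemma psi_sum:
 assumes c: "0 < Re c"
 obtains K where "!!t. 0 < t ==> summable (%n. norm (psi c (Suc n) t))"
  "!!t. 0 < t ==> (\<Sum>n. norm (psi c (Suc n) t)) <= K * t powr (- (\<beta> / \<eta>))"
proof -
 have q: "0 < 2 / (1 - \<beta>)" using \<beta> by simp
 obtain C where C: "0 < C" "!!v. 0 < v ==> norm (exp (- (c * of_real v))) <= C * min 1 (v powr (- (2 / (1 - \<beta>))))"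
  by (rule norm_linear_exp_le[OF q c]) (rule that)
 have cont: "continuous_on UNIV (%v. exp (- (c * complex_of_real v)))" by (intro continuous_intros)
 obtain K where K: "!!r. 0 < r ==> summable (%n. norm (expectation (%w. exp (- (c * of_real (r powr \<eta> * V (Suc n) w))))))"
  "!!r. 0 < r ==> r * (\<Sum>n. norm (expectation (%w. exp (- (c * of_real (r powr \<eta> * V (Suc n) w)))))) <= K"
  by (rule V_riemann_sum[OF cont C(2)], assumption, rule that)
 have e: "(t powr (\<beta> / \<eta>)) powr \<eta> = t powr \<beta>" for t using \<eta>_bounds by (simp add: powr_powr)
 show ?thesis
 proof (rule that[of K])
  fix t :: real assume t: "0 < t"
  then have r: "0 < t powr (\<beta> / \<eta>)" by simp
  show "summable (%n. norm (psi c (Suc n) t))" using K(1)[OF r] unfolding e psi_def .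
  have "t powr (\<beta> / \<eta>) * (\<Sum>n. norm (psi c (Suc n) t)) <= K" using K(2)[OF r] unfolding e psi_def .
  then show "(\<Sum>n. norm (psi c (Suc n) t)) <= K * t powr (- (\<beta> / \<eta>))"
   using t by (simp add: powr_minus field_simps)
 qed
qed

text \<open>The Riemann sums for the norm show that the limiting function is integrable on the
  half-line, and this is what yields the finite negative moment of \<open>W\<close>.\<close>

lemma W_moment_integral:
 assumes c: "0 < Re c"
 shows "integrable (completion N) (%w. W w powr (- 1 / \<eta>))"
  and "(LBINT x:{0<..}. limit.expectation (%w. c * of_real (x powr \<eta> * W w) * exp (- (c * of_real (x powr \<eta> * W w)))))
   = of_real (limit.expectation (%w. W w powr (- 1 / \<eta>))) * (of_real (Gamma (1 + 1 / \<eta>) / \<eta>) * c powr (- of_real (1 / \<eta>)))"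
proof -
 have q: "0 < 2 / (1 - \<beta>)" using \<beta> by simp
 obtain C where C: "0 < C" "!!v. 0 < v ==> norm (c * of_real v * exp (- (c * of_real v))) <= C * min 1 (v powr (- (2 / (1 - \<beta>))))"
  using norm_linear_exp_le[OF q c] by metis
 have cont: "continuous_on UNIV (%v. norm (c * of_real v * exp (- (c * complex_of_real v))))" by (intro continuous_intros)
 have nn: "norm (norm (c * of_real v * exp (- (c * of_real v)))) <= C * min 1 (v powr (- (2 / (1 - \<beta>))))" if "0 < v" for v
  using C(2)[OF that] unfolding real_norm_def abs_norm_cancel .
 have int: "set_integrable lborel {0<..} (%x. limit.expectation (%w. norm (c * of_real (x powr \<eta> * W w) * exp (- (c * of_real (x powr \<eta> * W w))))))"
  using V_riemann_sum[OF cont nn] by blast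
 show "integrable (completion N) (%w. W w powr (- 1 / \<eta>))"
  by (rule expected_linear_exp_integral(1)[OF limit.prob_space_axioms W_measurable W_pos \<eta>_bounds(1) c int])
 show "(LBINT x:{0<..}. limit.expectation (%w. c * of_real (x powr \<eta> * W w) * exp (- (c * of_real (x powr \<eta> * W w)))))
   = of_real (limit.expectation (%w. W w powr (- 1 / \<eta>))) * (of_real (Gamma (1 + 1 / \<eta>) / \<eta>) * c powr (- of_real (1 / \<eta>)))"
  by (rule expected_linear_exp_integral(2)[OF limit.prob_space_axioms W_measurable W_pos \<eta>_bounds(1) c int])
qed

text \<open>As \<open>V n\<close> is at least 1, the decay in t holds uniformly in \<open>n\<close>;
  the order 2 / \<beta> turns t^\<beta> into t^(- 2). It makes every characteristic function
  integrable, as Fourier inversion requires.\<close>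

lemma psi_bound:
 assumes c: "0 < Re c"
 obtains C where "0 < C" "!!n t. 1 <= n ==> 0 < t ==> norm (psi c n t) <= C * min 1 (t powr (- 2))"
proof -
 have q: "0 < 2 / \<beta>" using \<beta> by simp
 obtain C where C: "0 < C" "!!v. 0 < v ==> norm (exp (- (c * of_real v))) <= C * min 1 (v powr (- (2 / \<beta>)))"
  by (rule norm_linear_exp_le[OF q c]) (rule that)
 have "norm (psi c n t) <= C * min 1 (t powr (- 2))" if n: "1 <= n" and t: "0 < t" for n t
 proof -
  have "norm (exp (- (c * of_real (t powr \<beta> * V n w)))) <= C * min 1 (t powr (- 2))" for w
  proof -
   have tv: "t powr \<beta> <= t powr \<beta> * V n w" using mult_left_mono[OF V_ge_1[OF n, of w], of "t powr \<beta>"] by simp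
   have t0: "0 < t powr \<beta>" using t by simp
   have "(t powr \<beta> * V n w) powr (- (2 / \<beta>)) <= (t powr \<beta>) powr (- (2 / \<beta>))"
    by (rule powr_mono2') (use \<beta> tv t0 in auto)
   also have "... = t powr (- 2)" using \<beta> by (simp add: powr_powr)
   finally have "C * min 1 ((t powr \<beta> * V n w) powr (- (2 / \<beta>))) <= C * min 1 (t powr (- 2))"
    using C(1) by (intro mult_left_mono min.mono) auto
   with C(2)[OF less_le_trans[OF t0 tv]] show ?thesis by (rule order_trans)
  qed
  then have "expectation (%w. norm (exp (- (c * of_real (t powr \<beta> * V n w))))) <= expectation (%w. C * min 1 (t powr (- 2)))"
   using C(1) by (intro integral_mono_AE') (auto intro!: AE_I2)
  then show ?thesis
   unfolding psi_def using integral_norm_bound[of M "%w. exp (- (c * of_real (t powr \<beta> * V n w)))"] by (simp add: prob_space)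
 qed
 with C(1) show ?thesis by (rule that)
qed

text \<open>The value of the half-line integral in \<open>W_moment_integral\<close>; the constant of
  the theorem is read off from it.\<close>

definition J :: "complex => complex" where
 "J c = of_real (limit.expectation (%w. W w powr (- 1 / \<eta>))) * (of_real (Gamma (1 + 1 / \<eta>) / \<eta>) * c powr (- of_real (1 / \<eta>)))"

text \<open>An instance of \<open>halfline_limit\<close> with p = \<beta> / \<eta>. Differentiating
  \<open>psi\<close> in t gives - \<beta> / t times the mean of f (t^\<beta> V) with f v = c v exp
  (- c v), so t^(1 + p) times the sum over n is \<beta> times a Riemann sum at scale t^p and tends
  to \<beta> J.\<close>

lemma walk_halfline_limit:
 fixes g g' :: "real => complex"
 assumes c: "0 < Re c"
  and der: "!!t. (g has_vector_derivative g' t) (at t)" and cont: "continuous_on UNIV g'"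
  and g: "integrable lborel g" and g': "integrable lborel g'" and B: "!!t. norm (g t) <= B"
 shows "((%a. complex_of_real (a powr (1 - \<beta> / \<eta>)) * (\<Sum>n. LBINT t:{0<..}. g t * iexp (a * t) * psi c (Suc n) t))
  ---> \<i> * g 0 * (of_real \<beta> * J c) * of_real (Gamma (1 - \<beta> / \<eta>) / (\<beta> / \<eta>)) * exp (- (\<i> * of_real (pi * (\<beta> / \<eta>) / 2)))) at_top"
  and "summable (%n. LBINT t:{0<..}. g t * iexp (a * t) * psi c (Suc n) t)"
  and "set_integrable lborel {0<..} (%t. g t * iexp (a * t) * psi c (Suc n) t)"
proof -
 let ?p = "\<beta> / \<eta>"
 have p: "0 < ?p" "?p < 1" using \<eta>_bounds \<beta> by auto
 have cg: "continuous_on UNIV g" using der by (intro continuous_at_imp_continuous_on) (auto intro: has_vector_derivative_continuous)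
 have gm[measurable]: "g \<in> borel_measurable borel" "g' \<in> borel_measurable borel"
  using cg cont by (auto intro: borel_measurable_continuous_onI)
 have sg: "set_integrable lborel {0<..} g" "set_integrable lborel {0<..} g'"
  using g g' unfolding set_integrable_def by (auto intro!: integrable_mult_indicator)
 have g0: "(g ---> g 0) (at_right 0)"
  using cg by (auto simp: continuous_on_eq_continuous_at isCont_def intro: filterlim_at_split[THEN iffD1, THEN conjunct2])
 obtain K1 where K1: "!!t. 0 < t ==> summable (%n. norm (psi c (Suc n) t))"
  "!!t. 0 < t ==> (\<Sum>n. norm (psi c (Suc n) t)) <= K1 * t powr (- ?p)"
  using psi_sum[OF c] by blast
 have K10: "0 <= K1" using order_trans[OF suminf_nonneg[OF K1(1)] K1(2), of 1] by simp
 have B0: "0 <= B" using order_trans[OF norm_ge_zero B] .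
 let ?F = "%n t. indicator {0<..} t *\<^sub>R (g t * iexp (a * t) * psi c (Suc n) t)"
 \<comment> \<open>The first term dominates for t > 1, where t^(- p) <= 1; the second takes over the
   integrable singularity on (0, 1], where \<open>g\<close> enters through its bound
   \<open>B\<close>.\<close>
 let ?w = "%t. K1 * norm (g t) + indicator {0<..} t *\<^sub>R (B * K1 * (t powr (- ?p) * indicator {0<..1} t))"
 have wi: "integrable lborel ?w"
 proof -
  have "set_integrable lborel {0<..} (%t. t powr (- ?p) * indicator {0<..1} t)"
  proof -
   have "set_integrable lborel {0<..} (%s. s powr (- (1 + ?p)) * min 1 (s powr 1))" using p by (intro set_integrable_powr_min) auto
   then show ?thesis
    unfolding set_integrable_def
   proof (rule integrable_bound)
    show "AE t in lborel. norm (indicat_real {0<..} t *\<^sub>R (t powr (- ?p) * indicator {0<..1} t)) <= norm (indicat_real {0<..} t *\<^sub>R (t powr (- (1 + ?p)) * min 1 (t powr 1)))"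
    proof (rule AE_I2)
     fix t :: real
     have "t powr (- ?p) = t powr (- (1 + ?p)) * t" if "0 < t" using that powr_add[of t "- (1 + ?p)" 1] by simp
     then show "norm (indicat_real {0<..} t *\<^sub>R (t powr (- ?p) * indicator {0<..1} t)) <= norm (indicat_real {0<..} t *\<^sub>R (t powr (- (1 + ?p)) * min 1 (t powr 1)))"
      by (auto simp: indicator_def)
    qed
   qed measurable
  qed
  then have "set_integrable lborel {0<..} (%t. B * K1 * (t powr (- ?p) * indicator {0<..1} t))" by (intro set_integrable_mult_right)
  then show ?thesis using g unfolding set_integrable_def by (intro integrable_add integrable_mult_right integrable_norm)
 qed
 have nF: "norm (?F n t) = indicator {0<..} t * (norm (g t) * norm (psi c (Suc n) t))" for n t
  by (simp add: norm_mult)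
 have sF: "summable (%n. norm (?F n t))" for t
  unfolding nF using K1(1)[of t] by (cases "0 < t") (auto intro: summable_mult)
 have leF: "(\<Sum>n. norm (?F n t)) <= ?w t" for t
 proof (cases "0 < t")
  case True
  have "(\<Sum>n. norm (?F n t)) = norm (g t) * (\<Sum>n. norm (psi c (Suc n) t))"
   unfolding nF using True K1(1)[OF True] by (simp add: suminf_mult)
  also have "... <= norm (g t) * (K1 * t powr (- ?p))" by (intro mult_left_mono K1 True) auto
  also have "... <= ?w t"
  proof (cases "t <= 1")
   case True
   have "norm (g t) * (K1 * t powr (- ?p)) <= B * (K1 * t powr (- ?p))" using K10 by (intro mult_right_mono B) auto
   then show ?thesis using True \<open>0 < t\<close> K10 by (simp add: add_increasing mult_ac)
  next
   case False
   then have "t powr (- ?p) <= t powr 0" using p by (intro powr_mono) auto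
   then have "norm (g t) * (K1 * t powr (- ?p)) <= norm (g t) * (K1 * 1)" using K10 False by (intro mult_left_mono) auto
   then show ?thesis using False by (simp add: mult.commute)
  qed
  finally show ?thesis .
 qed (use K10 in simp)
 have Fm: "?F n \<in> borel_measurable lborel" for n by measurable
 note ds = dominated_suminf[where f="?F", OF Fm wi sF leF]
 show "set_integrable lborel {0<..} (%t. g t * iexp (a * t) * psi c (Suc n) t)" unfolding set_integrable_def by (rule ds(1))
 show "summable (%n. LBINT t:{0<..}. g t * iexp (a * t) * psi c (Suc n) t)"
  unfolding set_lebesgue_integral_def by (rule summable_norm_cancel[OF ds(2)])
 let ?f = "%v. c * of_real v * exp (- (c * complex_of_real v))"
 let ?e = "%n t. expectation (%y. ?f ((t powr ?p) powr \<eta> * V (Suc n) y))"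
 have q: "0 < 2 / (1 - \<beta>)" using \<beta> by simp
 obtain C where C: "0 < C" "!!v. 0 < v ==> norm (?f v) <= C * min 1 (v powr (- (2 / (1 - \<beta>))))"
  using norm_linear_exp_le[OF q c] by metis
 have contf: "continuous_on UNIV ?f" by (intro continuous_intros)
 obtain K2 where K2: "!!r. 0 < r ==> summable (%n. norm (expectation (%y. ?f (r powr \<eta> * V (Suc n) y))))"
  "!!r. 0 < r ==> r * (\<Sum>n. norm (expectation (%y. ?f (r powr \<eta> * V (Suc n) y)))) <= K2"
  "((%r. r *\<^sub>R (\<Sum>n. expectation (%y. ?f (r powr \<eta> * V (Suc n) y)))) ---> (LBINT x:{0<..}. limit.expectation (%y. ?f (x powr \<eta> * W y)))) (at_right 0)"
  by (rule V_riemann_sum[OF contf C(2)], assumption, rule that)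
 define d where "d n t = expectation (%y. c * of_real (\<beta> * t powr (\<beta> - 1) * V (Suc n) y) * exp (- (c * of_real (t powr \<beta> * V (Suc n) y))))" for n t
 have dm[measurable]: "d n \<in> borel_measurable borel" for n unfolding d_def by measurable
 have e: "(t powr ?p) powr \<eta> = t powr \<beta>" for t using \<eta>_bounds by (simp add: powr_powr)
 have d_pw: "c * of_real (\<beta> * t powr (\<beta> - 1) * v) * z = of_real (\<beta> / t) * (c * of_real (t powr \<beta> * v) * z)" if "0 < t" for t v z
 proof -
  have e: "\<beta> * t powr (\<beta> - 1) * v = \<beta> / t * (t powr \<beta> * v)" using that by (simp add: powr_diff)
  show ?thesis by (subst e) (simp only: of_real_mult mult_ac)
 qed
 have d_eq: "d n t = of_real (\<beta> / t) * ?e n t" if t: "0 < t" for n t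
  unfolding d_def d_pw[OF t] e by (rule integral_mult_right_zero)
 have nd: "norm (d n t) = \<beta> / t * norm (?e n t)" if t: "0 < t" for n t
  unfolding d_eq[OF t] norm_mult norm_of_real using t \<beta> by simp
 have tp: "0 < t powr ?p" if "0 < t" for t using that by simp
 have sd: "summable (%n. norm (d n t))" if t: "0 < t" for t
  unfolding nd[OF t] by (intro summable_mult K2(1) tp t)
 define K where "K = max K1 (\<beta> * K2)"
 have led: "(\<Sum>n. norm (d n t)) <= K * t powr (- (1 + ?p))" if t: "0 < t" for t
 proof -
  let ?s = "\<Sum>n. norm (?e n t)"
  have "(\<Sum>n. norm (d n t)) = \<beta> / t * ?s" unfolding nd[OF t] by (intro suminf_mult K2(1) tp t)
  also have "?s <= K2 / t powr ?p" using K2(2)[OF tp[OF t]] t by (simp add: field_simps)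
  then have "\<beta> / t * ?s <= \<beta> / t * (K2 / t powr ?p)" using \<beta> t by (intro mult_left_mono) auto
  also have "... = \<beta> * K2 * t powr (- (1 + ?p))" unfolding powr_minus powr_add using t by (simp add: field_simps)
  also have "... <= K * t powr (- (1 + ?p))" by (intro mult_right_mono) (auto simp: K_def)
  finally show ?thesis .
 qed
 have le\<psi>: "(\<Sum>n. norm (psi c (Suc n) t)) <= K * t powr (- ?p)" if t: "0 < t" for t
  by (rule order_trans[OF K1(2)[OF t]]) (intro mult_right_mono, auto simp: K_def)
 have D: "((%t. t powr (1 + ?p) *\<^sub>R (\<Sum>n. d n t)) ---> of_real \<beta> * J c) (at_right 0)"
 proof -
  have "filterlim (%t. t powr ?p) (at_right 0) (at_right (0::real))"
  proof (rule tendsto_imp_filterlim_at_right)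
   show "((%t. t powr ?p) ---> 0) (at_right (0::real))"
    using p by (intro tendsto_eq_intros) (auto simp: eventually_at_filter)
   show "\<forall>\<^sub>F t in at_right 0. 0 < t powr ?p" by (simp add: eventually_at_filter)
  qed
  from filterlim_compose[OF K2(3) this]
  have "((%t. of_real \<beta> * (t powr ?p *\<^sub>R (\<Sum>n. ?e n t))) ---> of_real \<beta> * J c) (at_right 0)"
   unfolding W_moment_integral(2)[OF c] J_def[symmetric] by (rule tendsto_mult_left)
  moreover have "\<forall>\<^sub>F t in at_right 0. of_real \<beta> * (t powr ?p *\<^sub>R (\<Sum>n. ?e n t)) = t powr (1 + ?p) *\<^sub>R (\<Sum>n. d n t)"
   unfolding eventually_at_filter
  proof (intro always_eventually allI impI)
   fix t :: real assume "t \<in> {0<..}"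
   then have t: "0 < t" by simp
   have "(\<Sum>n. d n t) = of_real (\<beta> / t) * (\<Sum>n. ?e n t)"
    unfolding d_eq[OF t] by (intro suminf_mult summable_norm_cancel[OF K2(1)] tp t)
   then show "of_real \<beta> * (t powr ?p *\<^sub>R (\<Sum>n. ?e n t)) = t powr (1 + ?p) *\<^sub>R (\<Sum>n. d n t)"
    using t by (simp add: scaleR_conv_of_real powr_add)
  qed
  ultimately show ?thesis by (rule Lim_transform_eventually)
 qed
 show "((%a. complex_of_real (a powr (1 - ?p)) * (\<Sum>n. LBINT t:{0<..}. g t * iexp (a * t) * psi c (Suc n) t))
  ---> \<i> * g 0 * (of_real \<beta> * J c) * of_real (Gamma (1 - ?p) / ?p) * exp (- (\<i> * of_real (pi * ?p / 2)))) at_top"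
 proof (rule halfline_limit[OF p sg gm B g0 psi_measurable dm K1(1) le\<psi> sd led D])
  fix n and a :: real assume a: "0 < a"
  have Vpos: "0 < V (Suc n) y" for y using V_ge_1[of "Suc n" y] by simp
  have "integrable M (%y. c * of_real (\<beta> * t powr (\<beta> - 1) * V (Suc n) y) * exp (- (c * of_real (t powr \<beta> * V (Suc n) y))))" if t: "0 < t" for t
   unfolding d_pw[OF t]
  proof (intro integrable_mult_right integrable_const_bound[where B=C] AE_I2)
   fix y
   have "norm (?f (t powr \<beta> * V (Suc n) y)) <= C * min 1 ((t powr \<beta> * V (Suc n) y) powr (- (2 / (1 - \<beta>))))"
    by (rule C(2)) (use t Vpos in simp)
   also have "... <= C" using C(1) by (simp add: mult_left_le)
   finally show "norm (?f (t powr \<beta> * V (Suc n) y)) <= C" .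
  qed measurable
  then show "(LBINT t:{0<..}. g t * iexp (a * t) * psi c (Suc n) t)
   = \<i> / of_real a * (LBINT t:{0<..}. (g' t * psi c (Suc n) t - g t * d n t) * (iexp (a * t) - 1))"
   unfolding psi_def d_def
   by (intro expected_halfline_ibp[OF prob_space_axioms _ Vpos c \<beta>(1) a der _ sg gm B g0])
    (use cont in \<open>auto simp: continuous_on_eq_continuous_at\<close>)
 qed
qed

end

section \<open>The potential\<close>

lemma integral_split_half_lines:
 fixes f :: "real => complex"
 assumes f: "integrable lborel f"
 shows "(LBINT t. f t) = (LBINT t:{0<..}. f t) + (LBINT t:{0<..}. f (- t))"
proof -
 have fm[measurable]: "f \<in> borel_measurable borel" using borel_measurable_integrable[OF f] by simp
 have i1: "integrable lborel (%t. indicator {0<..} t *\<^sub>R f t)" and i2: "integrable lborel (%t. indicator {..<0} t *\<^sub>R f t)"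
  by (intro integrable_mult_indicator f, simp)+
 have "(LBINT t. f t) = (LBINT t. indicator {0<..} t *\<^sub>R f t + indicator {..<0} t *\<^sub>R f t)"
 proof (rule integral_cong_AE)
  show "AE t in lborel. f t = indicator {0<..} t *\<^sub>R f t + indicator {..<0} t *\<^sub>R f t"
   using AE_lborel_singleton[of 0] by eventually_elim (auto simp: indicator_def)
 qed auto
 also have "... = (LBINT t:{0<..}. f t) + (LBINT t. indicator {..<0} t *\<^sub>R f t)"
  unfolding set_lebesgue_integral_def by (rule integral_add[OF i1 i2])
 also have "(LBINT t. indicator {..<0} t *\<^sub>R f t) = (LBINT t. indicator {..<0} (0 + (-1) * t) *\<^sub>R f (0 + (-1) * t))"
  using lborel_integral_real_affine[of "-1" "%t. indicator {..<0} t *\<^sub>R f t" 0] by simp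
 also have "... = (LBINT t:{0<..}. f (- t))"
  unfolding set_lebesgue_integral_def by (intro integral_cong) (auto simp: indicator_def)
 finally show ?thesis .
qed

lemma norm_fourier_transform_le:
 assumes "integrable lebesgue h"
 shows "norm (fourier_transform h x) <= (LINT y|lebesgue. norm (h y))"
 unfolding fourier_transform_def
 by (rule order_trans[OF integral_norm_bound]) (simp add: norm_mult)

lemma H1_cases:
 assumes "h \<in> H1"
 obtains G' where "integrable lebesgue h" "!!t. (fourier_transform h has_vector_derivative G' t) (at t)" "continuous_on UNIV G'"
  "integrable lborel (fourier_transform h)" "integrable lborel G'" "!!t. norm (fourier_transform h t) <= (LINT y|lebesgue. norm (h y))"
proof -
 have h: "integrable lebesgue h" "fourier_transform h C1_differentiable_on UNIV" "integrable lebesgue (fourier_transform h)"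
  "integrable lebesgue (%x. vector_derivative (fourier_transform h) (at x))"
  using assms unfolding H1_def by auto
 obtain D where D: "!!t. (fourier_transform h has_vector_derivative D t) (at t)" "continuous_on UNIV D"
  using h(2) unfolding C1_differentiable_on_def by auto
 have vd: "vector_derivative (fourier_transform h) (at t) = D t" for t using D(1) by (rule vector_derivative_at)
 have "continuous_on UNIV (fourier_transform h)"
  using D(1) by (intro continuous_at_imp_continuous_on) (auto intro: has_vector_derivative_continuous)
 then have m: "fourier_transform h \<in> borel_measurable lborel" by (simp add: borel_measurable_continuous_onI)
 have m': "D \<in> borel_measurable lborel" using D(2) by (simp add: borel_measurable_continuous_onI)
 show ?thesis
  by (rule that[OF h(1) D]) (use h(3,4) integrable_completion[OF m] integrable_completion[OF m'] norm_fourier_transform_le[OF h(1)] in \<open>simp_all add: vd\<close>)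
qed

text \<open>\<open>A1 > 0\<close> keeps the rate in the right half-plane, where its argument is -
  arctan (A2 / A1). Together with the phase - pi p / 2 and the factor i this produces the sine, by
  Re (i exp (i y)) = - sin y. The Gamma recurrences and 1 - p = (\<eta> - \<beta>) / \<eta>
  rearrange the remaining factors.\<close>

lemma rwrs_constant:
 assumes A1: "0 < A1" and \<beta>: "0 < \<beta>" "\<beta> < \<eta>"
 defines "p \<equiv> \<beta> / \<eta>"
 shows "Re (\<i> * (of_real \<beta> * (of_real E * (of_real (Gamma (1 + 1 / \<eta>) / \<eta>) * Complex A1 (- A2) powr (- of_real (1 / \<eta>)))))
   * of_real (Gamma (1 - p) / p) * exp (- (\<i> * of_real (pi * p / 2)))) / pi
  = Gamma (1 / \<eta>) * Gamma (2 - p) * E / (pi * (\<eta> - \<beta>) * (A1^2 + A2^2) powr (1 / (2 * \<eta>))) * sin (p * (pi / 2 - 1 / \<beta> * arctan (A2 / A1)))"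
proof -
 let ?d = "arctan (A2 / A1)" and ?r = "sqrt (A1^2 + A2^2)"
 let ?z = "Complex A1 (- A2) powr (- of_real (1 / \<eta>))" and ?g = "Gamma (1 + 1 / \<eta>) / \<eta>" and ?x = "exp (- (\<i> * of_real (pi * p / 2)))" and ?y = "\<i> * of_real (?d / \<eta> - pi * p / 2)"
 let ?L = "\<i> * (of_real \<beta> * (of_real E * (of_real ?g * ?z))) * of_real (Gamma (1 - p) / p) * ?x" and ?B = "(A1^2 + A2^2) powr (1 / (2 * \<eta>))"
 have \<eta>: "0 < \<eta>" using \<beta> by simp
 have p: "0 < p" "p < 1" using \<beta> \<eta> by (auto simp: p_def)
 have c0: "Complex A1 (- A2) ~= 0" using A1 by (simp add: complex_eq_iff)
 have r: "0 < A1^2 + A2^2" using A1 by (simp add: add_pos_nonneg)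
 have Ln: "Ln (Complex A1 (- A2)) = of_real (ln ?r) - \<i> * of_real ?d"
 proof -
  have "Im (Ln (Complex A1 (- A2))) = - ?d"
   using Arg_eq_Im_Ln[OF c0] arg_conv_arctan[of "Complex A1 (- A2)"] A1 by (simp add: arctan_minus)
  moreover have "Re (Ln (Complex A1 (- A2))) = ln ?r" using c0 by (simp add: cmod_def)
  ultimately show ?thesis by (simp add: complex_eq_iff)
 qed
 have "?z * ?x
  = exp (of_real (- (1 / \<eta>) * ln ?r)) * exp (?y)"
  unfolding powr_def using c0 by (simp add: Ln exp_add[symmetric] algebra_simps flip: exp_add)
 also have "exp (of_real (- (1 / \<eta>) * ln ?r)) = complex_of_real (?r powr (- (1 / \<eta>)))"
  using A1 by (simp add: powr_def exp_of_real[symmetric] del: exp_of_real)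
 also have "?r powr (- (1 / \<eta>)) = inverse (?B)"
  using r by (simp add: powr_half_sqrt[symmetric] powr_powr powr_minus)
 finally have e: "?z * ?x
  = of_real (inverse (?B)) * exp (?y)" .
 have re: "Re (of_real k * z) = k * Re z" for k z by simp
 let ?k = "\<beta> * (E * ?g) * (Gamma (1 - p) / p) * inverse (?B)"
 have "?L
  = of_real (\<beta> * (E * ?g) * (Gamma (1 - p) / p)) * (\<i> * (?z * ?x))"
  by (simp only: of_real_mult mult_ac)
 also have "... = of_real ?k * (\<i> * exp (?y))"
  unfolding e by (simp only: of_real_mult mult_ac)
 finally have "Re (?L) = Re (of_real ?k * (\<i> * exp (?y)))"
  by (simp only:)
 also have "... = ?k * sin (pi * p / 2 - ?d / \<eta>)"
  unfolding re using sin_minus[of "?d / \<eta> - pi * p / 2"] by (simp add: Im_exp)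
 also have "pi * p / 2 - ?d / \<eta> = p * (pi / 2 - 1 / \<beta> * ?d)" using \<beta> \<eta> by (simp add: p_def field_simps)
 finally have 1: "Re (?L) = ?k * sin (p * (pi / 2 - 1 / \<beta> * ?d))" .
 have G1: "Gamma (1 + 1 / \<eta>) = 1 / \<eta> * Gamma (1 / \<eta>)"
 proof -
  have "1 / \<eta> \<notin> \<int>\<^sub>\<le>\<^sub>0" using \<eta> nonpos_Ints_nonpos[of "1 / \<eta>"] by force
  from Gamma_plus1[OF this] show ?thesis by (simp add: add.commute)
 qed
 have G2: "Gamma (2 - p) = (1 - p) * Gamma (1 - p)"
 proof -
  have "1 - p \<notin> \<int>\<^sub>\<le>\<^sub>0" using p nonpos_Ints_nonpos[of "1 - p"] by force
  from Gamma_plus1[OF this] show ?thesis by simp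
 qed
 have "?k / pi = Gamma (1 / \<eta>) * Gamma (2 - p) * E / (pi * (\<eta> - \<beta>) * ?B)"
 proof -
  have alg: "\<beta> * (E * (1 / \<eta> * x / \<eta>)) * (y / p) * inverse z / pi = (\<beta> / (\<eta> * \<eta> * p)) * (x * y * E / (pi * z))" for x y z :: real
   by (simp only: divide_inverse inverse_mult_distrib mult_1_left mult_ac)
  have q: "\<beta> / (\<eta> * \<eta> * p) = (1 - p) / (\<eta> - \<beta>)"
  proof -
   have "1 - p = (\<eta> - \<beta>) / \<eta>" using \<eta> by (simp add: p_def diff_divide_distrib)
   then show ?thesis using \<beta> \<eta> by (simp add: p_def)
  qed
  have "?k / pi = (\<beta> / (\<eta> * \<eta> * p)) * (Gamma (1 / \<eta>) * Gamma (1 - p) * E / (pi * ?B))"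
   unfolding G1 by (rule alg)
  also have "... = Gamma (1 / \<eta>) * Gamma (2 - p) * E / (pi * (\<eta> - \<beta>) * ?B)"
   unfolding q G2 by (simp add: mult_ac)
  finally show ?thesis .
 qed
 then have "?k * s / pi = Gamma (1 / \<eta>) * Gamma (2 - p) * E / (pi * (\<eta> - \<beta>) * ?B) * s" for s
  by (simp only: times_divide_eq_left[symmetric])
 then show ?thesis unfolding 1 .
qed

section \<open>Convergence of the potential and identification of its constant\<close>

context stable_walk_limit
begin

lemma \<delta>_eq: "rwrs_delta \<alpha> \<beta> = \<eta> / \<beta>"
 unfolding rwrs_delta_def \<eta>_def using \<alpha> \<beta> by (simp add: field_simps)

lemma local_time_norm_powr: "local_time_norm \<beta> L w powr (- 1 / rwrs_delta \<alpha> \<beta>) = W w powr (- 1 / \<eta>)"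
 unfolding \<delta>_eq local_time_norm_def W_def powr_powr using \<beta> by simp

lemma rwrs_C0_eq:
 assumes A1: "0 < A1"
 shows "rwrs_C0 \<alpha> \<beta> A1 A2 N L = Re (\<i> * (of_real \<beta> * J (Complex A1 (- A2))) * of_real (Gamma (1 - \<beta> / \<eta>) / (\<beta> / \<eta>)) * exp (- (\<i> * of_real (pi * (\<beta> / \<eta>) / 2)))) / pi"
proof -
 have e: "1 / (\<eta> / \<beta> * \<beta>) = 1 / \<eta>" "2 - 1 / (\<eta> / \<beta>) = 2 - \<beta> / \<eta>" "1 / (\<eta> / \<beta>) = \<beta> / \<eta>"
  "pi * \<beta> * (\<eta> / \<beta> - 1) = pi * (\<eta> - \<beta>)" "1 / (2 * (\<eta> / \<beta>) * \<beta>) = 1 / (2 * \<eta>)"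
  using \<beta> \<eta>_bounds by (simp_all add: field_simps)
 show ?thesis
  unfolding J_def rwrs_constant[OF A1 \<beta>(1) \<eta>_bounds(2)] rwrs_C0_def Let_def local_time_norm_powr unfolding \<delta>_eq e ..
qed

text \<open>In the inversion integral, negative frequencies give a half-line integral of
  \<open>psi\<close> against the transform of \<open>h\<close>; positive ones give the conjugate of
  such an integral against the reflected conjugate transform \<open>?g\<close>. Both limits carry
  the factor \<open>Q\<close>, multiplied by the transform at 0 or its conjugate. Adding leaves 2 Re
  Q times the transform at 0, and division by 2 pi gives the constant.\<close>

lemma rwrs_limit:
 assumes A1: "0 < A1" and iid\<xi>: "iid_on M borel \<xi> UNIV" and ind: "walk_indep_of_scenery M X \<xi>"
  and char\<xi>: "!!u. char (distr M borel (\<xi> 0)) u = scenery_char \<beta> A1 A2 u" and h: "h \<in> H1"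
 shows "1 <= n ==> integrable (completion M) (%w. h (rwrs X \<xi> n w - a))"
  and "summable (%n. expect M (%w. h (rwrs X \<xi> (Suc n) w - a)))"
  and "((%a. complex_of_real (a powr (1 - \<beta> / \<eta>)) * (\<Sum>n. expect M (%w. h (rwrs X \<xi> (Suc n) w - a))))
     ---> complex_of_real (rwrs_C0 \<alpha> \<beta> A1 A2 N L) * fourier_transform h 0) at_top"
proof -
 let ?G = "fourier_transform h" and ?c = "Complex A1 (- A2)"
 let ?Z = "rwrs X \<xi>" and ?\<chi> = "%n. char (distr M borel (rwrs X \<xi> n))"
 let ?a = "%a. complex_of_real (a powr (1 - \<beta> / \<eta>))"
 have c: "0 < Re ?c" using A1 by simp
 obtain G' where hi: "integrable lebesgue h" and der: "!!t. (?G has_vector_derivative G' t) (at t)" and cG': "continuous_on UNIV G'"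
  and Gi: "integrable lborel ?G" and G'i: "integrable lborel G'" and B: "!!t. norm (?G t) <= (LINT y|lebesgue. norm (h y))"
  by (rule H1_cases[OF h]) (rule that)
 have [measurable]: "?G \<in> borel_measurable borel" using borel_measurable_integrable[OF Gi] by simp
 have Zm[measurable]: "?Z n \<in> borel_measurable M" for n by (rule rwrs_char(2)[OF iid\<xi> ind char\<xi> less_imp_le[OF A1]])
 have \<chi>_neg: "?\<chi> n (- t) = psi ?c n t" if "0 < t" for n t
  unfolding rwrs_char(1)[OF iid\<xi> ind char\<xi> less_imp_le[OF A1]] psi_def using that
  by (simp add: Complex_eq mult_ac)
 have \<chi>_pos: "?\<chi> n t = cnj (psi ?c n t)" if "0 < t" for n t
 proof -
  have e: "exp (- (complex_of_real (\<bar>t\<bar> powr \<beta>) * (complex_of_real A1 + \<i> * complex_of_real (A2 * sgn t)) * complex_of_real v))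
   = cnj (exp (- (?c * of_real (t powr \<beta> * v))))" for v
   using that by (simp add: exp_cnj Complex_eq mult_ac)
  show ?thesis unfolding rwrs_char(1)[OF iid\<xi> ind char\<xi> less_imp_le[OF A1]] psi_def e by (rule integral_cnj)
 qed
 have real: "real_distribution (distr M borel (?Z n))" for n by (rule real_distribution_distr[OF Zm])
 have [measurable]: "?\<chi> n \<in> borel_measurable borel" for n by (rule real_distribution.char_measurable[OF real])
 have \<chi>_le: "norm (?\<chi> n t) <= 1" for n t by (rule real_distribution.cmod_char_le_1[OF real])
 obtain C where C: "0 < C" "!!n t. 1 <= n ==> 0 < t ==> norm (psi ?c n t) <= C * min 1 (t powr (- 2))"
  by (rule psi_bound[OF c]) (rule that)
 have \<chi>i: "integrable lborel (?\<chi> n)" if n: "1 <= n" for n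
 proof (rule integrable_bound)
  have "set_integrable lborel {0<..} (%s::real. s powr (- 2) * min 1 (s powr 2))" by (intro set_integrable_powr_min) auto
  then have "set_integrable lborel {0<..} (%s::real. min 1 (s powr (- 2)))"
   by (rule set_integrable_cong[THEN iffD1, rotated -1]) (auto simp: min_powr_eq)
  then have "set_integrable lborel {0<..} (%s::real. C * min 1 (s powr (- 2)))" by (rule set_integrable_mult_right)
  then show "integrable lborel (%t. C * min 1 (\<bar>t\<bar> powr (- 2)))" by (rule even_integral(1)) measurable
  show "AE t in lborel. norm (?\<chi> n t) <= norm (C * min 1 (\<bar>t\<bar> powr (- 2)))"
   using AE_lborel_singleton[of 0]
  proof eventually_elim
   case (elim t)
   have "norm (?\<chi> n t) = norm (psi ?c n \<bar>t\<bar>)"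
    using \<chi>_pos[of t n] \<chi>_neg[of "- t" n] elim by (cases "0 < t") auto
   also have "... <= C * min 1 (\<bar>t\<bar> powr (- 2))" by (rule C(2)[OF n]) (use elim in simp)
   also have "... <= norm (C * min 1 (\<bar>t\<bar> powr (- 2)))" unfolding real_norm_def by (rule abs_ge_self)
   finally show ?case .
  qed
 qed measurable
 show "integrable (completion M) (%w. h (?Z n w - a))" if "1 <= n" for n a
  by (rule integral_via_char(1)[OF Zm \<chi>i[OF that] hi])
 let ?g = "%t. cnj (?G (- t))" and ?g' = "%t. - cnj (G' (- t))"
 have der2: "(?g has_vector_derivative ?g' t) (at t)" for t
 proof -
  have "((%t. - t) has_vector_derivative (- 1)) (at t)" by (auto intro!: derivative_eq_intros)
  from vector_diff_chain_at[OF this der] have "((%t. ?G (- t)) has_vector_derivative - G' (- t)) (at t)" by (simp add: o_def)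
  from has_vector_derivative_cnj[OF this] show ?thesis by simp
 qed
 have cont2: "continuous_on UNIV ?g'"
  by (intro continuous_intros continuous_on_compose2[OF cG']) auto
 have refl_int: "integrable lborel (%t. f (- t))" if "integrable lborel f" for f :: "real => complex"
  using lborel_integrable_real_affine[OF that, of "-1" 0] by simp
 have gi2: "integrable lborel ?g" "integrable lborel ?g'"
  using refl_int[OF Gi] refl_int[OF G'i] by auto
 note L1 = walk_halfline_limit[OF c der cG' Gi G'i B]
 note L2 = walk_halfline_limit[OF c der2 cont2 gi2, of "LINT y|lebesgue. norm (h y)", unfolded complex_mod_cnj, OF B]
 let ?I1 = "%n a. LBINT t:{0<..}. ?G t * iexp (a * t) * psi ?c (Suc n) t" and ?I2 = "%n a. LBINT t:{0<..}. ?g t * iexp (a * t) * psi ?c (Suc n) t"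
 have E: "expect M (%w. h (?Z (Suc n) w - a)) = (cnj (?I2 n a) + ?I1 n a) / (2 * pi)" for n a
 proof -
  let ?\<Phi> = "%t. ?\<chi> (Suc n) t * iexp (- (t * a)) * ?G (- t)"
  have \<Phi>i: "integrable lborel ?\<Phi>"
  proof (rule integrable_bound[OF refl_int[OF Gi]])
   show "AE t in lborel. norm (?\<Phi> t) <= norm (?G (- t))"
    using \<chi>_le by (intro AE_I2) (simp add: norm_mult mult_left_le_one_le)
  qed measurable
  have "expect M (%w. h (?Z (Suc n) w - a)) = (LBINT t. ?\<Phi> t) / (2 * pi)"
   by (rule integral_via_char(2)[OF Zm \<chi>i hi]) simp
  also have "(LBINT t. ?\<Phi> t) = (LBINT t:{0<..}. ?\<Phi> t) + (LBINT t:{0<..}. ?\<Phi> (- t))"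
   by (rule integral_split_half_lines[OF \<Phi>i])
  also have "(LBINT t:{0<..}. ?\<Phi> t) = (LBINT t:{0<..}. cnj (?g t * iexp (a * t) * psi ?c (Suc n) t))"
   unfolding set_lebesgue_integral_def
   by (intro integral_cong refl) (auto simp: indicator_def \<chi>_pos exp_cnj mult_ac)
  also have "... = cnj (?I2 n a)"
   unfolding set_lebesgue_integral_def complex_cnj_scaleR[symmetric] by (rule integral_cnj)
  also have "(LBINT t:{0<..}. ?\<Phi> (- t)) = ?I1 n a"
   unfolding set_lebesgue_integral_def
   by (intro integral_cong refl) (auto simp: indicator_def \<chi>_neg mult_ac)
  finally show ?thesis .
 qed
 have s: "summable (%n. cnj (?I2 n a))" "(\<Sum>n. cnj (?I2 n a)) = cnj (\<Sum>n. ?I2 n a)" for a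
  using L2(2)[of a] sums_cnj[of "%n. ?I2 n a" "\<Sum>n. ?I2 n a"] by (auto simp: sums_iff)
 have sum: "(%n. expect M (%w. h (?Z (Suc n) w - a))) sums ((cnj (\<Sum>n. ?I2 n a) + (\<Sum>n. ?I1 n a)) / (2 * pi))" for a
  unfolding E s(2)[symmetric] by (intro sums_divide sums_add summable_sums s(1) L1(2))
 show "summable (%n. expect M (%w. h (?Z (Suc n) w - a)))" for a using sum by (rule sums_summable)
 define Q where "Q = \<i> * (of_real \<beta> * J ?c) * of_real (Gamma (1 - \<beta> / \<eta>) / (\<beta> / \<eta>)) * exp (- (\<i> * of_real (pi * (\<beta> / \<eta>) / 2)))"
 have q: "\<i> * z * (of_real \<beta> * J ?c) * of_real (Gamma (1 - \<beta> / \<eta>) / (\<beta> / \<eta>)) * exp (- (\<i> * of_real (pi * (\<beta> / \<eta>) / 2))) = z * Q" for z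
  unfolding Q_def by (simp only: mult_ac)
 have l1: "((%a. ?a a * (\<Sum>n. ?I1 n a)) ---> ?G 0 * Q) at_top"
  using L1(1) unfolding q .
 have "((%a. ?a a * (\<Sum>n. ?I2 n a)) ---> cnj (?G 0) * Q) at_top"
  using L2(1) unfolding q minus_zero .
 then have l2: "((%a. cnj (?a a * (\<Sum>n. ?I2 n a))) ---> cnj (cnj (?G 0) * Q)) at_top"
  by (rule tendsto_cnj)
 have "((%a. (cnj (?a a * (\<Sum>n. ?I2 n a)) + ?a a * (\<Sum>n. ?I1 n a)) / (2 * pi))
  ---> (cnj (cnj (?G 0) * Q) + ?G 0 * Q) / (2 * pi)) at_top"
  by (intro tendsto_divide tendsto_add l1 l2 tendsto_const) simp
 moreover have "(cnj (cnj (?G 0) * Q) + ?G 0 * Q) / (2 * pi) = complex_of_real (rwrs_C0 \<alpha> \<beta> A1 A2 N L) * ?G 0"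
 proof -
  have "cnj (cnj (?G 0) * Q) + ?G 0 * Q = ?G 0 * (Q + cnj Q)" by (simp add: algebra_simps)
  also have "... = ?G 0 * of_real (2 * Re Q)" by (simp only: complex_add_cnj)
  finally show ?thesis unfolding rwrs_C0_eq[OF A1] Q_def[symmetric] by simp
 qed
 moreover have "(cnj (?a a * (\<Sum>n. ?I2 n a)) + ?a a * (\<Sum>n. ?I1 n a)) / (2 * pi)
  = ?a a * (\<Sum>n. expect M (%w. h (?Z (Suc n) w - a)))" for a
  unfolding sums_unique[OF sum, symmetric] by (simp add: distrib_left)
 ultimately show "((%a. ?a a * (\<Sum>n. expect M (%w. h (?Z (Suc n) w - a))))
     ---> complex_of_real (rwrs_C0 \<alpha> \<beta> A1 A2 N L) * ?G 0) at_top" by simp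
qed

end

theorem theorem2:
  fixes M :: "'a measure" and N :: "'b measure"
    and X :: "nat \<Rightarrow> 'a \<Rightarrow> int" and \<xi> :: "int \<Rightarrow> 'a \<Rightarrow> real"
    and U :: "real \<Rightarrow> 'b \<Rightarrow> real" and L :: "real \<Rightarrow> real \<Rightarrow> 'b \<Rightarrow> real"
    and \<mu> :: "real measure" and \<alpha> \<beta> A1 A2 \<delta> :: real
  assumes "1 < \<alpha>" "\<alpha> \<le> 2" "0 < \<beta>" "\<beta> < 1"
    and "0 < A1" "\<bar>A2 / A1\<bar> \<le> \<bar>tan (pi * \<beta> / 2)\<bar>"
    and "prob_space M"
    and "iid_on M (count_space UNIV) X {1..}"
    and "iid_on M borel \<xi> UNIV"
    and "walk_indep_of_scenery M X \<xi>"
    and "support_generates_int M (X 1)"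
    and "strictly_stable \<alpha> \<mu>"
    and "weak_conv_m
           (\<lambda>n. distr M borel (\<lambda>\<omega>. real n powr (- 1 / \<alpha>) * real_of_int (random_walk X n \<omega>))) \<mu>"
    and "\<forall>u. char (distr M borel (\<xi> 0)) u = scenery_char \<beta> A1 A2 u"
    and "levy_process N U" "distr N borel (U 1) = \<mu>"
    and "continuous_local_time N U L"
    and "\<delta> = rwrs_delta \<alpha> \<beta>"
  shows "integrable (completion N) (\<lambda>\<omega>. local_time_norm \<beta> L \<omega> powr (- 1 / \<delta>)) \<and>
    (\<forall>h\<in>H1.
       (\<forall>n\<ge>1. \<forall>a. integrable (completion M) (\<lambda>\<omega>. h (rwrs X \<xi> n \<omega> - a))) \<and>
       (\<forall>a. summable (\<lambda>n. expect M (\<lambda>\<omega>. h (rwrs X \<xi> (Suc n) \<omega> - a)))) \<and>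
       ((\<lambda>a. complex_of_real (a powr (1 - 1 / \<delta>)) *
              (\<Sum>n. expect M (\<lambda>\<omega>. h (rwrs X \<xi> (Suc n) \<omega> - a))))
          \<longlongrightarrow> complex_of_real (rwrs_C0 \<alpha> \<beta> A1 A2 N L) * (\<integral>x. h x \<partial>lebesgue)) at_top)"
proof -
  interpret stable_walk_limit M X \<mu> \<alpha> N U L \<beta>
    using assms by (intro stable_walk_limit.intro stable_walk.intro stable_walk_axioms.intro stable_walk_limit_axioms.intro)
  have d: "1 / \<delta> = \<beta> / \<eta>" using assms(18) \<delta>_eq by simp
  have ft: "(\<integral>x. h x \<partial>lebesgue) = fourier_transform h 0" for h by (simp add: fourier_transform_def)
  \<comment> \<open>The moment does not involve the rate c, so \<open>W_moment_integral\<close> is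
    taken at c = 1.\<close>
  have "integrable (completion N) (\<lambda>\<omega>. local_time_norm \<beta> L \<omega> powr (- 1 / \<delta>))"
    unfolding assms(18) local_time_norm_powr by (rule W_moment_integral(1)[of 1]) simp
  moreover note rwrs_limit[OF assms(5,9,10) assms(14)[rule_format]]
  ultimately show ?thesis unfolding d ft by blast
qed

end
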